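(* Let $n$ be a positive integer and let $\sigma,\sigma'$ be $m$-component welded string links. Then $\sigma$ and $\sigma'$ are $(2n+\mathrm{sv})$-equivalent if and only if both of the following hold: (i) $\mu^{\mathrm w}_{\sigma}(I)\equiv\mu^{\mathrm w}_{\sigma'}(I)\pmod n$ for every non-repeated sequence $I$ of elements of $\{1,\dots,m\}$; (ii) $\mu^{\mathrm w}_{\sigma}(ij)-\mu^{\mathrm w}_{\sigma}(ji)=\mu^{\mathrm w}_{\sigma'}(ij)-\mu^{\mathrm w}_{\sigma'}(ji)$ for all $1\le i<j\le m$.
   Context: An $m$-component virtual string link diagram is an ordered, oriented string link diagram of $m$ strands in the plane whose transverse double points are either classical crossings (with over/under information) or virtual crossings. A welded string link is an equivalence class of such diagrams under welded Reidemeister moves: the classical Reidemeister moves R1–R3, the virtual moves V1–V4 (the virtual Reidemeister moves and the mixed move in which a strand with only virtual crossings passes a classical crossing), and the overcrossings commute move OC (two consecutive classical crossings in which a strand passes under two over-strands may be exchanged). A sequence of such moves is a welded isotopy. Welded Milnor invariants. Given a virtual diagram $D=D_1\cup\dots\cup D_m$ of $\sigma$, an arc is a piece of strand whose boundary points are strand endpoints or classical undercrossings and whose interior contains no classical undercrossing. Label the arcs of $D_i$ as $a_{i1},\dots,a_{ir(i)}$ in order along the orientation starting from the initial arc. The group $G(\sigma)$ has the Wirtinger presentation with generators $a_{ij}$ and relations $a_{i,j+1}^{-1}u_{ij}^{-1}a_{ij}u_{ij}$ ($1\le j\le r(i)-1$), where $u_{ij}$ is the generator of the over-arc at the crossing separating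 $a_{ij}$ and $a_{i,j+1}$, or its inverse, according to the sign of that crossing. Put $v_{ij}=u_{i1}\cdots u_{ij}$; the preferred $i$th longitude is $l_i=a_{i1}^{s}v_{i,r(i)-1}$ with $s\in\mathbb Z$ chosen so that the total exponent of generators of the $i$th component in $l_i$ is zero. Let $G(\sigma)_q$ be the $q$th lower central series term; $G(\sigma)/G(\sigma)_q$ is generated by the images $\alpha_1,\dots,\alpha_m$ of $a_{11},\dots,a_{m1}$, so the image of $l_i$ is represented by a word $\lambda_i$ in the free group $\langle\alpha_1,\dots,\alpha_m\rangle$. The Magnus expansion $E$ is the homomorphism into the ring of noncommutative formal power series $\mathbb Z\langle\langle X_1,\dots,X_m\rangle\rangle$ with $E(\alpha_i)=1+X_i$, $E(\alpha_i^{-1})=1-X_i+X_i^2-\cdots$. For a sequence $I=j_1\dots j_k i$ with $k<q$, $\mu^{\mathrm w}_\sigma(I)$ is the coefficient of $X_{j_1}\cdots X_{j_k}$ in $E(\lambda_i)$; this is an invariant of welded string links. A sequence is non-repeated if its entries are pairwise distinct. A $2n$-move is the local move replacing two parallel strands (without crossings) in a disk by two strands twisted around each other with $2n$ consecutive classical crossings (i.e. $2n$ half-twists), or the inverse. A self-crossing virtualization replaces a classical crossing whose two strands belong to the same component by a virtual crossing (or conversely). The $(2n+\mathrm{sv})$-equivalence is the equivalence relation on welded string links generated by $2n$-moves, self-crossing virtualizations and welded isotopy.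
   Formalization: The move OC is taken in its standard form, exchanging two consecutive over-passages of a strand (overcrossings commute); the gloss "a strand passes under two over-strands", read literally, gives a move that does not preserve the Milnor invariants. *)

theory Defs
  imports Main
begin

text \<open>A virtual string link diagram up to the virtual moves V1-V4 is the same as a
Gauss diagram on m ordered oriented intervals.  Strand c (0-based, c < m) is the list of
arrow endpoints met along its orientation.  An arrow goes from the over-passage (tail)
to the under-passage (head) of a classical crossing and carries the crossing sign
(True = positive).  Arrows are identified by natural-number labels.\<close>

datatype ep = EP (lab: nat) (is_tail: bool) (psgn: bool)

type_synonym gdiag = "ep list list"

definition gd_wf :: "nat \<Rightarrow> gdiag \<Rightarrow> bool" where
  "gd_wf m D \<longleftrightarrow> length D = m \<and>
     (\<forall>a. (\<exists>e\<in>set (concat D). lab e = a) \<longrightarrow>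
        (\<exists>s. count_list (concat D) (EP a True s) = 1 \<and> count_list (concat D) (EP a False s) = 1
             \<and> length (filter (\<lambda>e. lab e = a) (concat D)) = 2))"

text \<open>Local moves are described via contexts with numbered holes, each hole occurring
exactly once; filling the holes with words of endpoints gives diagrams.\<close>

datatype 'a slot = Lit 'a | Hole nat

definition fill :: "(nat \<Rightarrow> 'a list) \<Rightarrow> 'a slot list list \<Rightarrow> 'a list list" where
  "fill f C = map (\<lambda>xs. concat (map (\<lambda>x. case x of Lit e \<Rightarrow> [e] | Hole k \<Rightarrow> f k) xs)) C"

definition ctx :: "nat \<Rightarrow> 'a slot list list \<Rightarrow> bool" where
  "ctx K C \<longleftrightarrow> (\<forall>k<K. count_list (concat C) (Hole k) = 1) \<and>
               (\<forall>k. Hole k \<in> set (concat C) \<longrightarrow> k < K)"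

definition ord2 :: "bool \<Rightarrow> 'a \<Rightarrow> 'a \<Rightarrow> 'a list" where
  "ord2 b u v = (if b then [u, v] else [v, u])"

definition r1_move :: "gdiag \<Rightarrow> gdiag \<Rightarrow> bool" where
  "r1_move D D' \<longleftrightarrow> (\<exists>C a s t. ctx 1 C \<and> D = fill (\<lambda>_. []) C \<and>
       D' = fill (\<lambda>_. [EP a t s, EP a (\<not> t) s]) C)"

definition r2_move :: "gdiag \<Rightarrow> gdiag \<Rightarrow> bool" where
  "r2_move D D' \<longleftrightarrow> (\<exists>C a b s h. ctx 2 C \<and> D = fill (\<lambda>_. []) C \<and>
       D' = fill (\<lambda>k. if k = 0 then [EP a True s, EP b True (\<not> s)]
                       else ord2 h (EP a False s) (EP b False (\<not> s))) C)"

text \<open>R3: strands T (top), M (middle), B (bottom); arrows x: T\<rightarrow>M, y: T\<rightarrow>B, z: M\<rightarrow>B.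
The boolean oT says that on T the crossing with M comes first, oM that on M the
crossing with T comes first, oB that on B the crossing with T comes first.
The sign/order conditions are exactly those realizable by three oriented lines in
the plane; the move reverses the order on all three strands.\<close>
definition r3_blocks :: "nat \<Rightarrow> nat \<Rightarrow> nat \<Rightarrow> bool \<Rightarrow> bool \<Rightarrow> bool \<Rightarrow> bool \<Rightarrow> bool \<Rightarrow> bool \<Rightarrow> nat \<Rightarrow> ep list" where
  "r3_blocks x y z sx sy sz oT oM oB k =
     (if k = 0 then ord2 oT (EP x True sx) (EP y True sy)
      else if k = 1 then ord2 oM (EP x False sx) (EP z True sz)
      else ord2 oB (EP y False sy) (EP z False sz))"

definition r3_move :: "gdiag \<Rightarrow> gdiag \<Rightarrow> bool" where
  "r3_move D D' \<longleftrightarrow> (\<exists>C x y z sx sy sz oT oM oB. ctx 3 C \<and>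
       ((oM = oT) \<longleftrightarrow> (sy = sz)) \<and> ((oB = oT) \<longleftrightarrow> (sx = sz)) \<and>
       D = fill (r3_blocks x y z sx sy sz oT oM oB) C \<and>
       D' = fill (r3_blocks x y z sx sy sz (\<not> oT) (\<not> oM) (\<not> oB)) C)"

definition oc_move :: "gdiag \<Rightarrow> gdiag \<Rightarrow> bool" where
  "oc_move D D' \<longleftrightarrow> (\<exists>C a b s t. ctx 1 C \<and>
       D = fill (\<lambda>_. [EP a True s, EP b True t]) C \<and>
       D' = fill (\<lambda>_. [EP b True t, EP a True s]) C)"

definition relabel :: "gdiag \<Rightarrow> gdiag \<Rightarrow> bool" where
  "relabel D D' \<longleftrightarrow> (\<exists>\<pi>. inj \<pi> \<and> D' = map (map (\<lambda>e. EP (\<pi> (lab e)) (is_tail e) (psgn e))) D)"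

definition welded_move :: "gdiag \<Rightarrow> gdiag \<Rightarrow> bool" where
  "welded_move D D' \<longleftrightarrow> r1_move D D' \<or> r2_move D D' \<or> r3_move D D' \<or> oc_move D D' \<or> relabel D D'"

definition welded_isotopic :: "nat \<Rightarrow> gdiag \<Rightarrow> gdiag \<Rightarrow> bool" where
  "welded_isotopic m = equivclp (\<lambda>D D'. gd_wf m D \<and> gd_wf m D' \<and> welded_move D D')"

text \<open>2n-move: insert 2n half-twists between two crossingless strand pieces A (hole 0)
and B (hole 1).  All crossings have the same sign s; the over-strand alternates,
fo says that A is over at the first crossing; par says A and B are parallel.\<close>
definition twist_move :: "nat \<Rightarrow> gdiag \<Rightarrow> gdiag \<Rightarrow> bool" where
  "twist_move n D D' \<longleftrightarrow> (\<exists>C (a :: nat \<Rightarrow> nat) s fo par. ctx 2 C \<and> D = fill (\<lambda>_. []) C \<and>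
       D' = fill (\<lambda>k. if k = 0 then map (\<lambda>i. EP (a i) (fo = even i) s) [0..<2*n]
                       else (if par then id else rev)
                              (map (\<lambda>i. EP (a i) (fo \<noteq> even i) s) [0..<2*n])) C)"

text \<open>Self-crossing virtualization: add/delete an arrow whose endpoints lie on the
same component (virtual crossings are invisible in Gauss diagrams).\<close>
definition sv_move :: "gdiag \<Rightarrow> gdiag \<Rightarrow> bool" where
  "sv_move D D' \<longleftrightarrow> (\<exists>C a s. ctx 2 C \<and>
       (\<exists>c<length C. Hole 0 \<in> set (C ! c) \<and> Hole 1 \<in> set (C ! c)) \<and>
       D = fill (\<lambda>_. []) C \<and>
       D' = fill (\<lambda>k. if k = 0 then [EP a True s] else [EP a False s]) C)"

definition twon_sv_equiv :: "nat \<Rightarrow> nat \<Rightarrow> gdiag \<Rightarrow> gdiag \<Rightarrow> bool" where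
  "twon_sv_equiv n m = equivclp (\<lambda>D D'. gd_wf m D \<and> gd_wf m D' \<and>
       (welded_move D D' \<or> twist_move n D D' \<or> sv_move D D'))"

text \<open>Generators (c, j): j-th arc (1-based) of component c (0-based).
A letter is a generator with exponent (True = +1, False = -1).\<close>
type_synonym letter = "(nat \<times> nat) \<times> bool"

definition narcs :: "gdiag \<Rightarrow> nat \<Rightarrow> nat" where
  "narcs D c = Suc (length (filter (\<lambda>e. \<not> is_tail e) (D ! c)))"

definition arc_at :: "gdiag \<Rightarrow> nat \<Rightarrow> nat \<Rightarrow> nat" where
  "arc_at D c p = Suc (length (filter (\<lambda>e. \<not> is_tail e) (take p (D ! c))))"

definition tail_loc :: "gdiag \<Rightarrow> nat \<Rightarrow> nat \<times> nat" where
  "tail_loc D a = (SOME (c, p). c < length D \<and> p < length (D ! c) \<and>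
                      lab (D ! c ! p) = a \<and> is_tail (D ! c ! p))"

text \<open>u D c j: over-arc generator (to the power of the crossing sign) at the j-th
undercrossing of component c, which separates arcs j and j+1.\<close>
definition u_letter :: "gdiag \<Rightarrow> nat \<Rightarrow> nat \<Rightarrow> letter" where
  "u_letter D c j = (let e = filter (\<lambda>e. \<not> is_tail e) (D ! c) ! (j - 1);
                         (c', p') = tail_loc D (lab e)
                     in ((c', arc_at D c' p'), psgn e))"

definition inv_letter :: "letter \<Rightarrow> letter" where
  "inv_letter l = (fst l, \<not> snd l)"

definition invw :: "letter list \<Rightarrow> letter list" where
  "invw w = rev (map inv_letter w)"

definition v_word :: "gdiag \<Rightarrow> nat \<Rightarrow> nat \<Rightarrow> letter list" where
  "v_word D c j = map (u_letter D c) [1..<Suc j]"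

definition relator :: "gdiag \<Rightarrow> nat \<Rightarrow> nat \<Rightarrow> letter list" where
  "relator D c j = [((c, Suc j), False)] @ invw [u_letter D c j] @ [((c, j), True)] @ [u_letter D c j]"

definition expsum :: "nat \<Rightarrow> letter list \<Rightarrow> int" where
  "expsum c w = sum_list (map (\<lambda>l. if fst (fst l) = c then (if snd l then 1 else -1) else 0) w)"

definition longitude :: "gdiag \<Rightarrow> nat \<Rightarrow> letter list" where
  "longitude D c = (let w = v_word D c (narcs D c - 1); s = - expsum c w
                    in replicate (nat \<bar>s\<bar>) ((c, 1), s \<ge> 0) @ w)"

definition gen_ok :: "gdiag \<Rightarrow> letter \<Rightarrow> bool" where
  "gen_ok D l \<longleftrightarrow> fst (fst l) < length D \<and> 1 \<le> snd (fst l) \<and> snd (fst l) \<le> narcs D (fst (fst l))"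

definition comm :: "letter list \<Rightarrow> letter list \<Rightarrow> letter list" where
  "comm x y = invw x @ invw y @ x @ y"

definition lcomm :: "letter list \<Rightarrow> letter list list \<Rightarrow> letter list" where
  "lcomm g gs = foldl comm g gs"

text \<open>Words that are trivial in G/G_q: free cancellation pairs, Wirtinger relators,
and weight-q commutators (which generate the q-th lower central series term).\<close>
definition killer :: "gdiag \<Rightarrow> nat \<Rightarrow> letter list \<Rightarrow> bool" where
  "killer D q x \<longleftrightarrow>
     (\<exists>g. x = [g, inv_letter g]) \<or>
     (\<exists>c j. c < length D \<and> 1 \<le> j \<and> j < narcs D c \<and> x = relator D c j) \<or>
     (\<exists>g gs. Suc (length gs) = q \<and> (\<forall>l\<in>set (concat (g # gs)). gen_ok D l) \<and> x = lcomm g gs)"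

definition gstep :: "gdiag \<Rightarrow> nat \<Rightarrow> letter list \<Rightarrow> letter list \<Rightarrow> bool" where
  "gstep D q w w' \<longleftrightarrow> (\<exists>u x v. killer D q x \<and> w = u @ x @ v \<and> w' = u @ v)"

text \<open>Equality of the images of two words in G(D)/G(D)_q.\<close>
definition geq :: "gdiag \<Rightarrow> nat \<Rightarrow> letter list \<Rightarrow> letter list \<Rightarrow> bool" where
  "geq D q = equivclp (gstep D q)"

text \<open>Magnus expansion: coefficient of the monomial X_{j1}...X_{jk} in E(w),
for a word w in letters (i, exponent), with E(i,+) = 1 + X_i, E(i,-) = (1+X_i)^{-1}.\<close>
definition lcoef :: "nat \<Rightarrow> bool \<Rightarrow> nat list \<Rightarrow> int" where
  "lcoef i b p = (if b then (if p = [] \<or> p = [i] then 1 else 0)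
                  else (if set p \<subseteq> {i} then (-1) ^ length p else 0))"

fun mcoef :: "(nat \<times> bool) list \<Rightarrow> nat list \<Rightarrow> int" where
  "mcoef [] js = (if js = [] then 1 else 0)"
| "mcoef ((i, b) # w) js = (\<Sum>t\<le>length js. lcoef i b (take t js) * mcoef w (drop t js))"

text \<open>Welded Milnor invariant mu(I) for a nonempty sequence I = j1...jk i of
component indices in 1..m; computed with q = k + 1.\<close>
definition mu :: "gdiag \<Rightarrow> nat list \<Rightarrow> int" where
  "mu D I = (let i = last I; q = length I;
                 lam = (SOME w. set w \<subseteq> {((c, 1), b) | c b. c < length D} \<and>
                                geq D q w (longitude D (i - 1)))
             in mcoef (map (\<lambda>((c, j), b). (Suc c, b)) lam) (butlast I))"

end

theory Submission
  imports Defs "HOL-Library.Multiset"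
begin

text \<open>
Necessity: work in the ring of power series in which monomials with a repeated variable vanish. There a
conjugate of 1 + X c has square-zero logarithm, so colouring the arcs of strand c by conjugates of 1 + X c
solves the Wirtinger relations, and a non-repeated Milnor number is a coefficient of the product of
the colours met along a strand. These products, away from the variable of the strand, do not see
self-crossings, and a 2n-move changes them only by n-th powers 1 + n Y; moreover such a move changes both linking
numbers of two strands by the same amount.

Sufficiency: sliding tails over heads, at the cost of new arrows, and deleting self-arrows brings every diagram
to a form in which each strand first carries its tails and then its heads, that is, to a tuple of
words. On strand l the words may be changed by the relations that each generator commutes with its
conjugates and that n-th powers of generators are central. In a group with these relations a word is
determined by the first-order coefficients of its Magnus expansion and by the
non-repeated ones modulo n. Finally 2n-moves adjust the linking numbers of two strands simultaneously by n,
which accounts for the hypothesis on their differences.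
\<close>

section \<open>Power series without repeated variables\<close>

text \<open>\<open>mu\<close> is a coefficient of a word picked by \<open>SOME\<close> in a
  nilpotent quotient, so it is never followed through a move. Instead the colouring defines a
  homomorphism that is trivial on all \<open>killer\<close> words up to the relevant degree, and
  this turns \<open>mu\<close> into a coefficient attached to the diagram. Strand products are
  compared only on monomials without the variable of the strand. This is enough, since in a
  conjugate \<open>f * (X c * g)\<close> a surviving monomial has \<open>c\<close> exactly once, so
  \<open>f\<close> and \<open>g\<close> are tested only on monomials without \<open>c\<close>; it
  also makes the conjugations inside a twist region invisible. In the other direction a 2n-move does
  not kill an n-th power: it inserts one on two strands at once. What it does give is centrality: a
  tail is swept through the n new heads, and then the 2n-move is undone. Hence commutators of
  generators have exponent n, while the exponents of the generators themselves, the linking numbers,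
  are exact integers; this is the origin of condition (ii). That a generator commutes with its
  conjugates comes from inserting a self-arrow, sliding over it and deleting it.\<close>

fun conv :: "(nat list \<Rightarrow> int) \<Rightarrow> (nat list \<Rightarrow> int) \<Rightarrow> nat list \<Rightarrow> int" where
  "conv f g [] = f [] * g []"
| "conv f g (x # p) = f [] * g (x # p) + conv (\<lambda>q. f (x # q)) g p"

lemma conv_add_left: "conv (\<lambda>q. f q + f' q) g p = conv f g p + conv f' g p"
  by (induction p arbitrary: f f') (auto simp: algebra_simps)

lemma conv_add_right: "conv f (\<lambda>q. g q + g' q) p = conv f g p + conv f g' p"
  by (induction p arbitrary: f) (auto simp: algebra_simps)

lemma conv_scale_left: "conv (\<lambda>q. a * f q) g p = a * conv f g p"
  by (induction p arbitrary: f) (auto simp: algebra_simps)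

lemma conv_zero_left: "conv (\<lambda>q. 0) g p = 0"
  by (induction p) auto

text \<open>The recursion of \<open>conv\<close> is the Leibniz rule for peeling the first letter x:
  the derivative of the product is f [] times the derivative of g, plus the product of the
  derivative of f with g. The right factor h never changes, so only f and g are generalised.\<close>

lemma conv_assoc: "conv (conv f g) h p = conv f (conv g h) p"
proof (induction p arbitrary: f g)
  case (Cons x p)
  have "conv (conv f g) h (x # p) = f [] * g [] * h (x # p) + conv (\<lambda>q. f [] * g (x # q) + conv (\<lambda>q. f (x # q)) g q) h p"
    by simp
  also have "\<dots> = f [] * g [] * h (x # p) + (f [] * conv (\<lambda>q. g (x # q)) h p + conv (\<lambda>q. f (x # q)) (conv g h) p)"
    by (simp only: conv_add_left conv_scale_left Cons.IH)
  also have "\<dots> = conv f (conv g h) (x # p)" by (simp add: algebra_simps)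
  finally show ?case .
qed simp

text \<open>\<open>conv f g p\<close> is the sum of f u * g v over all splittings p = u @ v, so only
  prefixes and suffixes of p matter. With N = 0 divisibility is equality; exact and modular
  comparisons thus share one lemma.\<close>

lemma conv_dvd_cong:
  assumes "\<And>u v. p = u @ v \<Longrightarrow> N dvd f u - f' u"
    and "\<And>u v. p = u @ v \<Longrightarrow> N dvd g v - g' v"
  shows "N dvd conv f g p - conv f' g' p"
  using assms
proof (induction p arbitrary: f f')
  case Nil
  have "f [] * g [] - f' [] * g' [] = (f [] - f' []) * g [] + f' [] * (g [] - g' [])"
    by (simp add: algebra_simps)
  then show ?case using Nil by simp
next
  case (Cons x p)
  have 1: "N dvd conv (\<lambda>q. f (x # q)) g p - conv (\<lambda>q. f' (x # q)) g' p"
  proof (rule Cons.IH)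
    show "N dvd f (x # u) - f' (x # u)" if "p = u @ v" for u v
      using Cons.prems(1)[of "x # u" v] that by simp
    show "N dvd g v - g' v" if "p = u @ v" for u v
      using Cons.prems(2)[of "x # u" v] that by simp
  qed
  have e: "f [] * g (x # p) - f' [] * g' (x # p) = (f [] - f' []) * g (x # p) + f' [] * (g (x # p) - g' (x # p))"
    by (simp add: algebra_simps)
  have 2: "N dvd f [] * g (x # p) - f' [] * g' (x # p)"
    unfolding e using Cons.prems(1)[of "[]"] Cons.prems(2)[of "[]"] by simp
  from dvd_add[OF 2 1] show ?case by (simp add: algebra_simps)
qed

lemma conv_cong:
  assumes "\<And>u v. p = u @ v \<Longrightarrow> f u = f' u" and "\<And>u v. p = u @ v \<Longrightarrow> g v = g' v"
  shows "conv f g p = conv f' g' p"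
  using conv_dvd_cong[of p 0 f f' g g'] assms by simp

lemma conv_one_left: "conv (\<lambda>p. if p = [] then 1 else 0) g p = g p"
  by (cases p) (auto simp: conv_zero_left)

lemma conv_one_right: "conv f (\<lambda>p. if p = [] then 1 else 0) p = f p"
  by (induction p arbitrary: f) auto

text \<open>The quotient of the noncommutative power series by the ideal of monomials with a
  repeated variable; a class is represented by its coefficients, set to zero on that ideal.\<close>

typedef nrs = "{f :: nat list \<Rightarrow> int. \<forall>p. \<not> distinct p \<longrightarrow> f p = 0}"
  morphisms coef Abs_nrs
  by (rule exI[of _ "\<lambda>_. 0"]) simp

definition mk_nrs :: "(nat list \<Rightarrow> int) \<Rightarrow> nrs" where
  "mk_nrs f = Abs_nrs (\<lambda>p. if distinct p then f p else 0)"

lemma coef_mk_nrs [simp]: "coef (mk_nrs f) p = (if distinct p then f p else 0)"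
  unfolding mk_nrs_def by (subst Abs_nrs_inverse) auto

lemma coef_not_distinct: "\<not> distinct p \<Longrightarrow> coef f p = 0"
  using coef[of f] by auto

lemma nrs_eqI: "(\<And>p. distinct p \<Longrightarrow> coef f p = coef g p) \<Longrightarrow> f = g"
  by (metis coef_inject coef_not_distinct ext)

instantiation nrs :: ring_1
begin

definition "0 = mk_nrs (\<lambda>_. 0)"
definition "1 = mk_nrs (\<lambda>p. if p = [] then 1 else 0)"
definition "f + g = mk_nrs (\<lambda>p. coef f p + coef g p)"
definition "f - g = mk_nrs (\<lambda>p. coef f p - coef g p)"
definition "- f = mk_nrs (\<lambda>p. - coef f p)"
definition "f * g = mk_nrs (conv (coef f) (coef g))"

instance
proof
  fix a b c :: nrs
  have add: "coef (f + g) p = coef f p + coef g p" for f g p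
    by (simp add: plus_nrs_def coef_not_distinct)
  show "a + b + c = a + (b + c)" "a + b = b + a" "0 + a = a" "- a + a = 0" "a - b = a + - b"
    by (auto intro!: nrs_eqI simp: plus_nrs_def zero_nrs_def uminus_nrs_def minus_nrs_def)
  show "a * b * c = a * (b * c)"
  proof (rule nrs_eqI)
    fix p :: "nat list" assume p: "distinct p"
    \<comment> \<open>Truncated coefficients may be replaced by untruncated ones, because prefixes
      and suffixes of a distinct word are distinct.\<close>
    have "conv (coef (a * b)) (coef c) p = conv (conv (coef a) (coef b)) (coef c) p"
      by (rule conv_cong) (use p in \<open>auto simp: times_nrs_def\<close>)
    moreover have "conv (coef a) (coef (b * c)) p = conv (coef a) (conv (coef b) (coef c)) p"
      by (rule conv_cong) (use p in \<open>auto simp: times_nrs_def\<close>)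
    ultimately show "coef (a * b * c) p = coef (a * (b * c)) p"
      using p by (simp add: times_nrs_def[of "a * b"] times_nrs_def[of a "b * c"] conv_assoc)
  qed
  show "1 * a = a"
  proof (rule nrs_eqI)
    fix p :: "nat list" assume p: "distinct p"
    have "conv (coef 1) (coef a) p = conv (\<lambda>p. if p = [] then 1 else 0) (coef a) p"
      by (rule conv_cong) (use p in \<open>auto simp: one_nrs_def\<close>)
    then show "coef (1 * a) p = coef a p" using p by (simp add: times_nrs_def conv_one_left)
  qed
  show "a * 1 = a"
  proof (rule nrs_eqI)
    fix p :: "nat list" assume p: "distinct p"
    have "conv (coef a) (coef 1) p = conv (coef a) (\<lambda>p. if p = [] then 1 else 0) p"
      by (rule conv_cong) (use p in \<open>auto simp: one_nrs_def\<close>)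
    then show "coef (a * 1) p = coef a p" using p by (simp add: times_nrs_def conv_one_right)
  qed
  show "(a + b) * c = a * c + b * c"
  proof (rule nrs_eqI)
    fix p :: "nat list" assume p: "distinct p"
    have "conv (coef (a + b)) (coef c) p = conv (\<lambda>p. coef a p + coef b p) (coef c) p"
      by (rule conv_cong) (simp_all add: add)
    then show "coef ((a + b) * c) p = coef (a * c + b * c) p"
      using p by (simp add: times_nrs_def add conv_add_left)
  qed
  show "a * (b + c) = a * b + a * c"
  proof (rule nrs_eqI)
    fix p :: "nat list" assume p: "distinct p"
    have "conv (coef a) (coef (b + c)) p = conv (coef a) (\<lambda>p. coef b p + coef c p) p"
      by (rule conv_cong) (simp_all add: add)
    then show "coef (a * (b + c)) p = coef (a * b + a * c) p"
      using p by (simp add: times_nrs_def add conv_add_right)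
  qed
  have "coef 0 [] \<noteq> coef 1 []" by (simp add: zero_nrs_def one_nrs_def)
  then show "(0::nrs) \<noteq> 1" by auto
qed

end

lemma coef_zero [simp]: "coef 0 p = 0"
  and coef_one: "coef 1 p = (if p = [] then 1 else 0)"
  and coef_add [simp]: "coef (f + g) p = coef f p + coef g p"
  and coef_minus [simp]: "coef (- f) p = - coef f p"
  and coef_diff [simp]: "coef (f - g) p = coef f p - coef g p"
  and coef_mult: "distinct p \<Longrightarrow> coef (f * g) p = conv (coef f) (coef g) p"
  by (auto simp: zero_nrs_def one_nrs_def plus_nrs_def uminus_nrs_def minus_nrs_def times_nrs_def
      coef_not_distinct)

lemma coef_mult_Nil [simp]: "coef (f * g) [] = coef f [] * coef g []"
  by (simp add: coef_mult)

lemma coef_one_Nil [simp]: "coef 1 [] = 1"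
  by (simp add: coef_one)

definition X :: "nat \<Rightarrow> nrs" where
  "X i = mk_nrs (\<lambda>p. if p = [i] then 1 else 0)"

lemma coef_X: "coef (X i) p = (if p = [i] then 1 else 0)"
  by (simp add: X_def)

lemma coef_X_Nil [simp]: "coef (X i) [] = 0"
  by (simp add: coef_X)

text \<open>N = 0 gives equality on the monomials in P. The predicates used bound the length,
  exclude one variable, or hold always; all are closed under factors (\<open>infixcl\<close>), which
  makes \<open>cg\<close> compatible with products.\<close>

definition cg :: "int \<Rightarrow> (nat list \<Rightarrow> bool) \<Rightarrow> nrs \<Rightarrow> nrs \<Rightarrow> bool" where
  "cg N P f g \<longleftrightarrow> (\<forall>p. distinct p \<and> P p \<longrightarrow> N dvd coef f p - coef g p)"

definition infixcl :: "(nat list \<Rightarrow> bool) \<Rightarrow> bool" where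
  "infixcl P \<longleftrightarrow> (\<forall>u v. P (u @ v) \<longrightarrow> P u \<and> P v)"

lemma infixcl_avoid: "infixcl (\<lambda>p. c \<notin> set p)"
  and infixcl_length: "infixcl (\<lambda>p. length p \<le> d)"
  and infixcl_True: "infixcl (\<lambda>p. True)"
  by (auto simp: infixcl_def)

lemma cg_refl [simp]: "cg N P f f"
  by (simp add: cg_def)

lemma cg_sym: "cg N P f g \<Longrightarrow> cg N P g f"
  unfolding cg_def by (metis dvd_diff_commute)

lemma cg_trans [trans]: "cg N P f g \<Longrightarrow> cg N P g h \<Longrightarrow> cg N P f h"
proof (unfold cg_def, intro allI impI)
  fix p assume a: "\<forall>p. distinct p \<and> P p \<longrightarrow> N dvd coef f p - coef g p"
    "\<forall>p. distinct p \<and> P p \<longrightarrow> N dvd coef g p - coef h p" and p: "distinct p \<and> P p"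
  then have "N dvd (coef f p - coef g p) + (coef g p - coef h p)"
    by (intro dvd_add) auto
  then show "N dvd coef f p - coef h p" by simp
qed

lemma cg_mono: "cg N P f g \<Longrightarrow> (\<And>p. Q p \<Longrightarrow> P p) \<Longrightarrow> N' dvd N \<Longrightarrow> cg N' Q f g"
  unfolding cg_def by (meson dvd_trans)

lemma cg_add: "cg N P f f' \<Longrightarrow> cg N P g g' \<Longrightarrow> cg N P (f + g) (f' + g')"
proof (unfold cg_def, intro allI impI)
  fix p assume a: "\<forall>p. distinct p \<and> P p \<longrightarrow> N dvd coef f p - coef f' p"
    "\<forall>p. distinct p \<and> P p \<longrightarrow> N dvd coef g p - coef g' p" and p: "distinct p \<and> P p"
  then have "N dvd (coef f p - coef f' p) + (coef g p - coef g' p)"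
    by (intro dvd_add) auto
  then show "N dvd coef (f + g) p - coef (f' + g') p" by (simp add: algebra_simps)
qed

lemma cg_minus: "cg N P f f' \<Longrightarrow> cg N P (- f) (- f')"
  unfolding cg_def by (simp add: dvd_diff_commute)

lemma cg_diff: "cg N P f f' \<Longrightarrow> cg N P g g' \<Longrightarrow> cg N P (f - g) (f' - g')"
  using cg_add[OF _ cg_minus] by (simp only: diff_conv_add_uminus)

lemma cg_mult: "infixcl P \<Longrightarrow> cg N P f f' \<Longrightarrow> cg N P g g' \<Longrightarrow> cg N P (f * g) (f' * g')"
proof (unfold cg_def, intro allI impI)
  fix p assume cl: "infixcl P" and a: "\<forall>p. distinct p \<and> P p \<longrightarrow> N dvd coef f p - coef f' p"
    "\<forall>p. distinct p \<and> P p \<longrightarrow> N dvd coef g p - coef g' p" and p: "distinct p \<and> P p"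
  have "N dvd conv (coef f) (coef g) p - conv (coef f') (coef g') p"
  proof (rule conv_dvd_cong)
    show "N dvd coef f u - coef f' u" if "p = u @ v" for u v
      using a(1)[rule_format, of u] p cl[unfolded infixcl_def, rule_format, of u v] that by simp
    show "N dvd coef g v - coef g' v" if "p = u @ v" for u v
      using a(2)[rule_format, of v] p cl[unfolded infixcl_def, rule_format, of u v] that by simp
  qed
  then show "N dvd coef (f * g) p - coef (f' * g') p" using p by (simp add: coef_mult)
qed

lemma cg_0_iff: "cg 0 (\<lambda>p. True) f g \<longleftrightarrow> f = g"
proof
  assume "cg 0 (\<lambda>p. True) f g"
  then show "f = g" by (intro nrs_eqI) (simp add: cg_def)
qed simp

lemma coef_X_mult: "distinct (x # p) \<Longrightarrow> coef (X c * f) (x # p) = (if x = c then coef f p else 0)"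
proof -
  assume d: "distinct (x # p)"
  have "conv (\<lambda>q. coef (X c) (x # q)) (coef f) p = (if x = c then coef f p else 0)"
  proof (cases "x = c")
    case True
    then have "(\<lambda>q. coef (X c) (x # q)) = (\<lambda>q. if q = [] then 1 else 0)"
      by (auto simp: coef_X)
    then show ?thesis using True by (simp add: conv_one_left)
  next
    case False
    then have "(\<lambda>q. coef (X c) (x # q)) = (\<lambda>q. 0)"
      by (auto simp: coef_X)
    then show ?thesis using False by (simp add: conv_zero_left)
  qed
  then show ?thesis using d by (simp add: coef_mult)
qed

lemma coef_mult_X: "distinct (p @ [x]) \<Longrightarrow> coef (f * X c) (p @ [x]) = (if x = c then coef f p else 0)"
proof -
  assume d: "distinct (p @ [x])"
  have "conv F (coef (X c)) (p @ [x]) = (if x = c then F p else 0)" for F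
    by (induction p arbitrary: F) (auto simp: coef_X)
  then show ?thesis using d by (simp add: coef_mult)
qed

text \<open>A distinct word contains c at most once, so at most one of its splittings contributes,
  the one at that letter.\<close>

lemma coef_X_mid:
  assumes "distinct p"
  shows "coef (f * (X c * g)) p = (if c \<in> set p then coef f (takeWhile (\<lambda>x. x \<noteq> c) p) * coef g (tl (dropWhile (\<lambda>x. x \<noteq> c) p)) else 0)"
proof -
  have "conv F (coef (X c * g)) p = (if c \<in> set p then F (takeWhile (\<lambda>x. x \<noteq> c) p) * coef g (tl (dropWhile (\<lambda>x. x \<noteq> c) p)) else 0)" for F
    using assms
  proof (induction p arbitrary: F)
    case (Cons x p)
    show ?case
    proof (cases "x = c")
      case True
      then have c: "c \<notin> set p" using Cons.prems by auto
      have "conv (\<lambda>q. F (x # q)) (coef (X c * g)) p = 0"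
        using Cons c by auto
      then show ?thesis using True Cons.prems by (simp add: coef_X_mult)
    next
      case False
      then show ?thesis using Cons by (simp add: coef_X_mult)
    qed
  qed simp
  then show ?thesis using assms by (simp add: coef_mult)
qed

text \<open>Every monomial of this product contains c twice.\<close>

lemma X_mult_X: "X c * (f * X c) = 0"
proof (rule nrs_eqI)
  fix p :: "nat list" assume d: "distinct p"
  show "coef (X c * (f * X c)) p = coef 0 p"
  proof (cases p)
    case (Cons x q)
    then show ?thesis using d
      by (cases q rule: rev_cases) (auto simp: coef_X_mult coef_mult_X coef_X)
  qed simp
qed

text \<open>For a conjugate z of X c this makes 1 + z and 1 - z mutually inverse, and the k-th power
  of 1 + z equal to 1 + k z.\<close>

lemma conjugate_X_square: "(f * (X c * g)) * (f' * (X c * g')) = 0"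
proof -
  have "(f * (X c * g)) * (f' * (X c * g')) = f * (X c * ((g * f') * X c) * g')"
    by (simp add: mult.assoc)
  then show ?thesis by (simp add: X_mult_X)
qed

text \<open>The two sides of the single c in a surviving monomial avoid c. So control of the flanks
  away from c gives full control of the conjugate; this is why the strand products need only be
  known away from the variable of the strand.\<close>

lemma cg_mid_avoid:
  assumes "cg N (\<lambda>p. c \<notin> set p) f f'" "cg N (\<lambda>p. c \<notin> set p) g g'"
  shows "cg N (\<lambda>p. True) (f * (X c * g)) (f' * (X c * g'))"
proof (unfold cg_def, intro allI impI)
  fix p :: "nat list" assume "distinct p \<and> True"
  then have p: "distinct p" by simp
  let ?u = "takeWhile (\<lambda>x. x \<noteq> c) p" and ?v = "tl (dropWhile (\<lambda>x. x \<noteq> c) p)"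
  show "N dvd coef (f * (X c * g)) p - coef (f' * (X c * g')) p"
  proof (cases "c \<in> set p")
    case True
    then obtain w where w: "dropWhile (\<lambda>x. x \<noteq> c) p = c # w"
      by (metis (mono_tags, lifting) dropWhile_eq_Nil_conv hd_dropWhile list.collapse)
    have pp: "p = ?u @ c # ?v" using w takeWhile_dropWhile_id[of "\<lambda>x. x \<noteq> c" p] by simp
    have "distinct ?u" "distinct ?v" "c \<notin> set ?u" "c \<notin> set ?v"
      using arg_cong[OF pp, of distinct] p by auto
    then have 1: "N dvd coef f ?u - coef f' ?u" and 2: "N dvd coef g ?v - coef g' ?v"
      using assms by (auto simp: cg_def)
    have "coef f ?u * coef g ?v - coef f' ?u * coef g' ?v
        = (coef f ?u - coef f' ?u) * coef g ?v + coef f' ?u * (coef g ?v - coef g' ?v)"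
      by (simp add: algebra_simps)
    then have "N dvd coef f ?u * coef g ?v - coef f' ?u * coef g' ?v" using 1 2 by simp
    then show ?thesis using True p by (simp add: coef_X_mid)
  qed (use p in \<open>simp add: coef_X_mid\<close>)
qed

text \<open>The letter c uses up one degree, so forming a conjugate of X c gains one degree of
  precision. This contraction property yields existence and uniqueness of colourings.\<close>

lemma cg_mid_length:
  assumes "cg N (\<lambda>p. length p \<le> d) f f'" "cg N (\<lambda>p. length p \<le> d) g g'"
  shows "cg N (\<lambda>p. length p \<le> Suc d) (f * (X c * g)) (f' * (X c * g'))"
proof (unfold cg_def, intro allI impI)
  fix p :: "nat list" assume "distinct p \<and> length p \<le> Suc d"
  then have p: "distinct p" and l: "length p \<le> Suc d" by auto
  let ?u = "takeWhile (\<lambda>x. x \<noteq> c) p" and ?v = "tl (dropWhile (\<lambda>x. x \<noteq> c) p)"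
  show "N dvd coef (f * (X c * g)) p - coef (f' * (X c * g')) p"
  proof (cases "c \<in> set p")
    case True
    then obtain w where w: "dropWhile (\<lambda>x. x \<noteq> c) p = c # w"
      by (metis (mono_tags, lifting) dropWhile_eq_Nil_conv hd_dropWhile list.collapse)
    have pp: "p = ?u @ c # ?v" using w takeWhile_dropWhile_id[of "\<lambda>x. x \<noteq> c" p] by simp
    have "distinct ?u" "distinct ?v" "length ?u \<le> d" "length ?v \<le> d"
      using arg_cong[OF pp, of distinct] p l arg_cong[OF pp, of length] by auto
    then have 1: "N dvd coef f ?u - coef f' ?u" and 2: "N dvd coef g ?v - coef g' ?v"
      using assms by (auto simp: cg_def)
    have "coef f ?u * coef g ?v - coef f' ?u * coef g' ?v
        = (coef f ?u - coef f' ?u) * coef g ?v + coef f' ?u * (coef g ?v - coef g' ?v)"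
      by (simp add: algebra_simps)
    then have "N dvd coef f ?u * coef g ?v - coef f' ?u * coef g' ?v" using 1 2 by simp
    then show ?thesis using True p by (simp add: coef_X_mid)
  qed (use p in \<open>simp add: coef_X_mid\<close>)
qed

section \<open>Groups whose generators commute with their conjugates\<close>

text \<open>Groups are written additively because \<open>group_add\<close> does not assume
  commutativity. Conjugation is a right action, see \<open>conjg_conjg\<close>.\<close>

definition conjg :: "'g::group_add \<Rightarrow> 'g \<Rightarrow> 'g" where
  "conjg a g = - g + (a + g)"

definition cm :: "'g::group_add \<Rightarrow> 'g \<Rightarrow> bool" where
  "cm a b \<longleftrightarrow> a + b = b + a"

primrec nmul :: "nat \<Rightarrow> 'g::group_add \<Rightarrow> 'g" where
  "nmul 0 a = 0"
| "nmul (Suc k) a = a + nmul k a"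

definition zmul :: "int \<Rightarrow> 'g::group_add \<Rightarrow> 'g" where
  "zmul k a = (if 0 \<le> k then nmul (nat k) a else - nmul (nat (- k)) a)"

lemma conjg_conjg: "conjg (conjg a g) h = conjg a (g + h)"
  by (simp add: conjg_def add.assoc minus_add del: add_uminus_conv_diff)

lemma conjg_add: "conjg (a + b) g = conjg a g + conjg b g"
  by (simp add: conjg_def add.assoc del: add_uminus_conv_diff)

lemma conjg_zero [simp]: "conjg 0 g = 0" "conjg a 0 = a"
  by (simp_all add: conjg_def)

lemma conjg_uminus: "conjg (- a) g = - conjg a g"
  by (simp add: conjg_def add.assoc minus_add del: add_uminus_conv_diff)

lemma conjg_eq_self_iff: "conjg a g = a \<longleftrightarrow> cm a g"
  unfolding conjg_def cm_def
  by (metis add.assoc add.left_neutral add.right_inverse left_minus)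

lemma add_conjg: "g + conjg a g = a + g"
  by (simp add: conjg_def add.assoc[symmetric])

lemma cm_sym: "cm a b \<Longrightarrow> cm b a"
  by (simp add: cm_def)

lemma cm_zero [simp]: "cm 0 b" "cm b 0"
  by (simp_all add: cm_def)

lemma cm_refl [simp]: "cm a a"
  by (simp add: cm_def)

lemma cm_add: "cm a c \<Longrightarrow> cm b c \<Longrightarrow> cm (a + b) c"
  unfolding cm_def by (metis add.assoc)

lemma cm_uminus: "cm a b \<Longrightarrow> cm (- a) b"
  unfolding cm_def by (metis add.assoc add.left_neutral add.right_neutral add.right_inverse left_minus)

lemma cm_conjg: "cm (conjg a g) (conjg b g) \<longleftrightarrow> cm a b"
  unfolding cm_def conjg_add[symmetric]
  by (simp add: conjg_def)

lemma cm_nmul: "cm a b \<Longrightarrow> cm (nmul k a) b"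
  by (induction k) (auto intro: cm_add)

lemma cm_zmul: "cm a b \<Longrightarrow> cm (zmul k a) b"
  by (auto simp: zmul_def intro: cm_nmul cm_uminus)

lemma nmul_add: "nmul (j + k) a = nmul j a + nmul k a"
  by (induction j) (auto simp: add.assoc)

lemma zmul_0 [simp]: "zmul 0 a = 0" and zmul_1 [simp]: "zmul 1 a = a"
  by (simp_all add: zmul_def)

lemma zmul_of_nat: "zmul (int k) a = nmul k a"
  by (simp add: zmul_def)

lemma zmul_Suc: "zmul (k + 1) a = zmul k a + a"
proof (cases "0 \<le> k")
  case True
  then have "nat (k + 1) = nat k + 1" by simp
  then have "nmul (nat (k + 1)) a = nmul (nat k) a + nmul 1 a" by (simp only: nmul_add)
  then show ?thesis using True by (simp add: zmul_def)
next
  case False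
  then have "nat (- k) = Suc (nat (- (k + 1)))" by simp
  then have "- nmul (nat (- k)) a + a = - nmul (nat (- (k + 1))) a"
    by (simp add: minus_add add.assoc del: add_uminus_conv_diff)
  then show ?thesis using False by (auto simp: zmul_def)
qed

lemma zmul_add: "zmul (j + k) a = zmul j a + zmul k a"
proof (induction k rule: int_induct[where k = 0])
  case (step1 i)
  then show ?case using zmul_Suc[of "j + i" a] zmul_Suc[of i a] by (simp add: add.assoc)
next
  case (step2 i)
  have "zmul (j + (i - 1)) a + a = zmul j a + zmul (i - 1) a + a"
    using step2 zmul_Suc[of "j + (i - 1)" a] zmul_Suc[of "i - 1" a] by (simp add: add.assoc)
  then show ?case by simp
qed simp

lemma zmul_uminus: "zmul (- k) a = - zmul k a"
  using zmul_add[of k "- k" a] by (simp add: minus_unique)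

lemma zmul_uminus_right: "zmul k (- a) = - zmul k a"
proof (induction k rule: int_induct[where k = 0])
  case (step1 i)
  have "a + zmul i a = zmul i a + a"
    using zmul_add[of 1 i a] zmul_add[of i 1 a] by (simp add: add.commute)
  then show ?case using step1 by (simp add: zmul_Suc) (metis minus_add add_uminus_conv_diff)
next
  case (step2 i)
  have c: "a + zmul (i - 1) a = zmul (i - 1) a + a"
    using zmul_add[of 1 "i - 1" a] zmul_add[of "i - 1" 1 a] by (simp add: add.commute)
  have "zmul (i - 1) (- a) + (- a) = zmul i (- a)" "zmul i a = zmul (i - 1) a + a"
    using zmul_Suc[of "i - 1" "- a"] zmul_Suc[of "i - 1" a] by simp_all
  then have "zmul (i - 1) (- a) + (- a) = - zmul (i - 1) a + (- a)"
    using step2 c by (metis minus_add)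
  then show ?case by (simp only: add_right_cancel)
qed simp

lemma zmul_plus_commuting: "cm a b \<Longrightarrow> zmul k (a + b) = zmul k a + zmul k b"
proof (induction k rule: int_induct[where k = 0])
  case (step1 i)
  have "cm (zmul i b) a" using step1.prems by (simp add: cm_zmul cm_sym)
  then show ?case using step1 by (simp add: zmul_Suc) (metis add.assoc cm_def)
next
  case (step2 i)
  have c: "cm (zmul (i - 1) b) a" using step2.prems by (simp add: cm_zmul cm_sym)
  have "zmul (i - 1) (a + b) + (a + b) = zmul i a + zmul i b"
    using step2 zmul_Suc[of "i - 1" "a + b"] by simp
  also have "\<dots> = zmul (i - 1) a + a + (zmul (i - 1) b + b)"
    using zmul_Suc[of "i - 1" a] zmul_Suc[of "i - 1" b] by simp
  also have "\<dots> = zmul (i - 1) a + zmul (i - 1) b + (a + b)"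
    using c unfolding cm_def by (metis add.assoc)
  finally show ?case by (simp only: add_right_cancel)
qed simp

lemma conjg_zmul: "conjg (zmul k a) g = zmul k (conjg a g)"
proof (induction k rule: int_induct[where k = 0])
  case (step1 i)
  then show ?case by (simp add: zmul_Suc conjg_add)
next
  case (step2 i)
  have "conjg (zmul (i - 1) a) g + conjg a g = zmul (i - 1) (conjg a g) + conjg a g"
    using step2 zmul_Suc[of "i - 1" a] zmul_Suc[of "i - 1" "conjg a g"] conjg_add[of "zmul (i - 1) a" a g]
    by simp
  then show ?case by (simp only: add_right_cancel)
qed simp

lemma zmul_torsion:
  assumes "nmul n a = 0" "int n dvd j - k"
  shows "zmul j a = zmul k a"
proof -
  obtain t where t: "j - k = int n * t" using assms(2) by blast
  have "zmul (int n * t) a = 0"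
  proof (induction t rule: int_induct[where k = 0])
    case (step1 i)
    then show ?case using assms(1) by (simp add: distrib_left zmul_add zmul_of_nat)
  next
    case (step2 i)
    have "zmul (int n * (i - 1)) a + zmul (int n) a = zmul (int n * i) a"
      by (simp flip: zmul_add add: algebra_simps)
    then show ?case using step2 assms(1) by (simp add: zmul_of_nat)
  qed simp
  then have "zmul (j - k) a = 0" by (simp only: t)
  then show ?thesis using zmul_add[of "j - k" k a] by simp
qed

lemma sum_list_cm: "(\<And>a. a \<in> set as \<Longrightarrow> cm a b) \<Longrightarrow> cm (sum_list as) b"
  by (induction as) (auto intro: cm_add)

section \<open>Words, their values in a group and their Magnus expansions\<close>

type_synonym gword = "(nat \<times> bool) list"

definition gval :: "(nat \<Rightarrow> 'g::group_add) \<Rightarrow> nat \<times> bool \<Rightarrow> 'g" where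
  "gval x l = (if snd l then x (fst l) else - x (fst l))"

definition ev :: "(nat \<Rightarrow> 'g::group_add) \<Rightarrow> gword \<Rightarrow> 'g" where
  "ev x w = sum_list (map (gval x) w)"

definition winv :: "gword \<Rightarrow> gword" where
  "winv w = rev (map (\<lambda>l. (fst l, \<not> snd l)) w)"

lemma winv_simps [simp]: "winv [] = []" "winv (l # w) = winv w @ [(fst l, \<not> snd l)]"
  "winv (u @ v) = winv v @ winv u"
  by (simp_all add: winv_def)

lemma winv_winv [simp]: "winv (winv w) = w"
  by (simp add: winv_def rev_map o_def)

lemma fst_set_winv [simp]: "fst ` set (winv w) = fst ` set w"
  by (auto simp: winv_def image_image)

lemma ev_simps [simp]: "ev x [] = 0" "ev x (l # w) = gval x l + ev x w" "ev x (u @ v) = ev x u + ev x v"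
  by (simp_all add: ev_def)

lemma ev_winv: "ev x (winv w) = - ev x w"
  by (induction w) (auto simp: gval_def minus_add simp del: add_uminus_conv_diff)

text \<open>Since X i has square zero in \<open>nrs\<close>, the inverse series of 1 + X i is just 1
  - X i.\<close>

definition lval :: "nat \<times> bool \<Rightarrow> nrs" where
  "lval l = 1 + (if snd l then X (fst l) else - X (fst l))"

definition magnus :: "gword \<Rightarrow> nrs" where
  "magnus w = prod_list (map lval w)"

lemma magnus_simps [simp]: "magnus [] = 1" "magnus (l # w) = lval l * magnus w"
  "magnus (u @ v) = magnus u * magnus v"
  by (simp_all add: magnus_def)

lemma coef_mult_X': "distinct p \<Longrightarrow> coef (f * X c) p = (if p \<noteq> [] \<and> last p = c then coef f (butlast p) else 0)"
  by (cases p rule: rev_cases) (auto simp: coef_mult_X)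

lemma coef_mult_lval:
  "distinct p \<Longrightarrow> coef (f * lval l) p
    = coef f p + (if p \<noteq> [] \<and> last p = fst l then (if snd l then 1 else - 1) * coef f (butlast p) else 0)"
  by (auto simp: lval_def distrib_left coef_mult_X')

lemma coef_magnus_Nil [simp]: "coef (magnus w) [] = 1"
  by (induction w) (auto simp: lval_def)

text \<open>Deleting the generators outside S amounts to setting their variables to zero.\<close>

lemma coef_magnus_filter:
  "distinct p \<Longrightarrow> set p \<subseteq> S \<Longrightarrow> coef (magnus (filter (\<lambda>l. fst l \<in> S) w)) p = coef (magnus w) p"
proof (induction w arbitrary: p rule: rev_induct)
  case (snoc l w)
  have "set (butlast p) \<subseteq> S" "distinct (butlast p)" using snoc.prems
    by (auto dest: in_set_butlastD simp: distinct_butlast)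
  moreover have "p \<noteq> [] \<Longrightarrow> last p = fst l \<Longrightarrow> fst l \<in> S" using snoc.prems last_in_set[of p] by auto
  ultimately show ?case using snoc.prems snoc.IH[of p] snoc.IH[of "butlast p"]
    by (auto simp: coef_mult_lval)
qed simp

lemma coef_magnus_support:
  "distinct p \<Longrightarrow> \<not> set p \<subseteq> fst ` set w \<Longrightarrow> coef (magnus w) p = 0"
proof (induction w arbitrary: p rule: rev_induct)
  case Nil
  then show ?case by (auto simp: coef_one)
next
  case (snoc l w)
  have "coef (magnus w) p = 0" using snoc by auto
  moreover have "coef (magnus w) (butlast p) = 0" if "p \<noteq> []" "last p = fst l"
  proof (rule snoc.IH)
    show "distinct (butlast p)" using snoc.prems by (simp add: distinct_butlast)
    have "set p = insert (last p) (set (butlast p))"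
      using that(1) by (metis append_butlast_last_id list.simps(15) rotate1.simps(2) set_rotate1)
    then show "\<not> set (butlast p) \<subseteq> fst ` set w" using snoc.prems that(2) by auto
  qed
  ultimately show ?case using snoc.prems by (auto simp: coef_mult_lval)
qed

text \<open>Milnor's reduced group with central n-th powers. Commuting is demanded only for
  conjugators free of the generator itself, which is the form that the diagram moves deliver;
  \<open>conjg_drop\<close> lifts the restriction. Conjugators are words over S, so nothing is asked
  of the rest of the ambient group.\<close>

locale reduced_group =
  fixes x :: "nat \<Rightarrow> 'g::group_add" and S :: "nat set" and n :: nat
  assumes commutes_conjugates:
      "i \<in> S \<Longrightarrow> fst ` set g \<subseteq> S - {i} \<Longrightarrow> cm (x i) (conjg (x i) (ev x g))"
    and central_power: "i \<in> S \<Longrightarrow> k \<in> S \<Longrightarrow> cm (nmul n (x i)) (x k)"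
begin

abbreviation over :: "gword \<Rightarrow> bool" where
  "over g \<equiv> fst ` set g \<subseteq> S"

text \<open>Reading g from the left, the conjugate reached so far commutes with x i by the axiom, so
  a letter i acts trivially on it and can be skipped.\<close>

lemma conjg_drop:
  "i \<in> S \<Longrightarrow> over g \<Longrightarrow> conjg (x i) (ev x g) = conjg (x i) (ev x (filter (\<lambda>l. fst l \<noteq> i) g))"
proof (induction g rule: rev_induct)
  case (snoc l g)
  let ?g = "filter (\<lambda>l. fst l \<noteq> i) g"
  have IH: "conjg (x i) (ev x g) = conjg (x i) (ev x ?g)" using snoc by auto
  have c: "cm (conjg (x i) (ev x ?g)) (x i)"
    by (rule cm_sym, rule commutes_conjugates) (use snoc.prems in auto)
  have "conjg (x i) (ev x (g @ [l])) = conjg (conjg (x i) (ev x ?g)) (gval x l)"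
    using IH by (simp add: conjg_conjg[symmetric])
  also have "\<dots> = conjg (x i) (ev x (filter (\<lambda>l. fst l \<noteq> i) (g @ [l])))"
  proof (cases "fst l = i")
    case True
    then have "cm (conjg (x i) (ev x ?g)) (gval x l)"
      using c cm_sym[OF cm_uminus[OF cm_sym[OF c]]] by (auto simp: gval_def)
    then have "conjg (conjg (x i) (ev x ?g)) (gval x l) = conjg (x i) (ev x ?g)"
      by (simp only: conjg_eq_self_iff)
    then show ?thesis using True by simp
  qed (simp add: conjg_conjg)
  finally show ?case .
qed simp

lemma commutes_all_conjugates: "i \<in> S \<Longrightarrow> over g \<Longrightarrow> cm (x i) (conjg (x i) (ev x g))"
  by (subst conjg_drop) (force intro!: commutes_conjugates)+

text \<open>The normal closure of x i in the subgroup generated by S. That it is abelian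
  (\<open>ncl_cm\<close>) is what makes the word problem linear.\<close>

inductive_set ncl :: "nat \<Rightarrow> 'g set" for i where
  ncl_gen: "over g \<Longrightarrow> conjg (x i) (ev x g) \<in> ncl i"
| ncl_zero: "0 \<in> ncl i"
| ncl_add: "a \<in> ncl i \<Longrightarrow> b \<in> ncl i \<Longrightarrow> a + b \<in> ncl i"
| ncl_uminus: "a \<in> ncl i \<Longrightarrow> - a \<in> ncl i"

lemma ncl_base: "x i \<in> ncl i"
  using ncl_gen[of "[]" i] by simp

text \<open>Undoing the conjugation by g turns the first element into x i itself.\<close>

lemma ncl_cm_gen:
  assumes "i \<in> S" "over g" "over h"
  shows "cm (conjg (x i) (ev x g)) (conjg (x i) (ev x h))"
proof -
  have "cm (x i) (conjg (x i) (ev x (h @ winv g)))"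
    using assms by (intro commutes_all_conjugates) (simp_all add: image_Un)
  then have "cm (conjg (x i) (ev x g)) (conjg (conjg (x i) (ev x (h @ winv g))) (ev x g))"
    by (simp only: cm_conjg)
  then show ?thesis by (simp add: conjg_conjg ev_winv add.assoc del: add_uminus_conv_diff)
qed

lemma ncl_cm:
  assumes "i \<in> S" "a \<in> ncl i" "b \<in> ncl i"
  shows "cm a b"
proof -
  have 1: "cm c (conjg (x i) (ev x h))" if "c \<in> ncl i" "over h" for c h
    using that(1)
  proof induction
    case (ncl_gen g)
    then show ?case by (rule ncl_cm_gen[OF assms(1) _ that(2)])
  qed (auto intro: cm_add cm_uminus)
  show ?thesis using assms(3)
    by induction (auto intro: cm_sym[OF cm_add] cm_sym[OF cm_uminus] cm_sym 1 assms(2))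
qed

lemma ncl_conjg: "a \<in> ncl i \<Longrightarrow> over h \<Longrightarrow> conjg a (ev x h) \<in> ncl i"
proof (induction rule: ncl.induct)
  case (ncl_gen g)
  then have "conjg (x i) (ev x (g @ h)) \<in> ncl i" by (intro ncl.ncl_gen) auto
  then show ?case by (simp add: conjg_conjg)
qed (auto simp: conjg_add conjg_uminus intro: ncl.intros)

lemma ncl_word: "i \<in> S \<Longrightarrow> a \<in> ncl i \<Longrightarrow> \<exists>w. over w \<and> a = ev x w"
proof (rotate_tac, induction rule: ncl.induct)
  case (ncl_gen g)
  have "conjg (x i) (ev x g) = ev x (winv g @ [(i, True)] @ g)"
    by (simp add: conjg_def ev_winv gval_def)
  moreover have "over (winv g @ [(i, True)] @ g)" using ncl_gen by (auto simp: winv_def)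
  ultimately show ?case by blast
next
  case ncl_zero
  then show ?case by (intro exI[of _ "[]"]) simp
next
  case (ncl_add a b)
  then obtain u v where "over u" "a = ev x u" "over v" "b = ev x v" by blast
  then show ?case by (intro exI[of _ "u @ v"]) auto
next
  case (ncl_uminus a)
  then obtain u where "over u" "a = ev x u" by blast
  then show ?case by (intro exI[of _ "winv u"]) (simp add: ev_winv)
qed

text \<open>\<open>- a + conjg a (x i)\<close> is the commutator of a and x i, so
  \<open>cmono k [i1, ..., ir]\<close> is the left-normed commutator [..[x k, x i1], .., x ir]. Its
  exponent in a word will be the Magnus coefficient of the monomial k, i1, ..., ir.\<close>

definition cmono :: "nat \<Rightarrow> nat list \<Rightarrow> 'g" where
  "cmono k q = foldl (\<lambda>a i. - a + conjg a (x i)) (x k) q"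

lemma cmono_Nil [simp]: "cmono k [] = x k"
  and cmono_snoc: "cmono k (q @ [i]) = - cmono k q + conjg (cmono k q) (x i)"
  by (simp_all add: cmono_def)

lemma conjg_letter: "conjg a (x i) = conjg a (ev x [(i, True)])"
  by (simp add: gval_def)

lemma cmono_ncl: "k \<in> S \<Longrightarrow> set q \<subseteq> S \<Longrightarrow> cmono k q \<in> ncl k"
proof (induction q rule: rev_induct)
  case (snoc i q)
  then have "cmono k q \<in> ncl k" by simp
  then show ?case using snoc.prems unfolding cmono_snoc conjg_letter
    by (intro ncl_add ncl_uminus ncl_conjg) auto
qed (simp add: ncl_base)

text \<open>A commutator of a with x i is also a conjugate of - x i followed by x i, hence it
  belongs to the normal closure of x i; further commutators stay there.\<close>

lemma cmono_ncl_var: "k \<in> S \<Longrightarrow> set q \<subseteq> S \<Longrightarrow> j \<in> set q \<Longrightarrow> cmono k q \<in> ncl j"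
proof (induction q rule: rev_induct)
  case (snoc i q)
  show ?case
  proof (cases "j \<in> set q")
    case True
    then have "cmono k q \<in> ncl j" using snoc by simp
    then show ?thesis using snoc.prems unfolding cmono_snoc conjg_letter
      by (intro ncl_add ncl_uminus ncl_conjg) auto
  next
    case False
    then have j: "j = i" using snoc.prems by auto
    have "cmono k q \<in> ncl k" using snoc.prems by (auto intro: cmono_ncl)
    then obtain w where w: "over w" "cmono k q = ev x w" using ncl_word snoc.prems by blast
    have "cmono k (q @ [i]) = conjg (- x i) (ev x w) + x i"
      unfolding cmono_snoc w(2)[symmetric] conjg_def
      by (simp add: add.assoc del: add_uminus_conv_diff)
    moreover have "conjg (- x i) (ev x w) + x i \<in> ncl i"
      unfolding conjg_uminus by (intro ncl_add ncl_uminus ncl_base ncl_gen w)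
    ultimately show ?thesis using j by simp
  qed
qed simp

text \<open>The group counterpart of discarding monomials with a repeated variable:
  \<open>cmono k q\<close> already lies in the abelian normal closure of x i and so commutes with x
  i.\<close>

lemma cmono_repeat:
  assumes "k \<in> S" "set q \<subseteq> S" "i \<in> set q"
  shows "cmono k (q @ [i]) = 0"
proof -
  have "cm (cmono k q) (x i)"
    using assms by (intro ncl_cm[of i] cmono_ncl_var ncl_base) auto
  then have "conjg (cmono k q) (x i) = cmono k q" by (simp only: conjg_eq_self_iff)
  then show ?thesis by (simp add: cmono_snoc)
qed

text \<open>The commutator of \<open>cmono k q\<close> with x i commutes with x i, so conjugation by
  x i adds it and conjugation by the inverse subtracts it. This mirrors right multiplication by
  \<open>lval l\<close>.\<close>

lemma conjg_cmono:
  assumes "k \<in> S" "set q \<subseteq> S" "fst l \<in> S"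
  shows "conjg (cmono k q) (gval x l) = cmono k q + zmul (if snd l then 1 else - 1) (cmono k (q @ [fst l]))"
proof -
  define i where "i = fst l"
  have i: "i \<in> S" using assms i_def by simp
  have pos: "conjg (cmono k q) (x i) = cmono k q + cmono k (q @ [i])"
    by (simp add: cmono_snoc add.assoc[symmetric])
  have "cm (cmono k (q @ [i])) (x i)"
    by (rule ncl_cm[OF i]) (use assms i in \<open>auto intro!: cmono_ncl_var ncl_base\<close>)
  then have "cm (cmono k (q @ [i])) (- x i)"
    by (intro cm_sym[OF cm_uminus[OF cm_sym]])
  then have fixd: "conjg (cmono k (q @ [i])) (- x i) = cmono k (q @ [i])"
    by (simp only: conjg_eq_self_iff)
  have "conjg (conjg (cmono k q) (x i)) (- x i) = cmono k q"
    by (simp add: conjg_conjg)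
  then have "conjg (cmono k q) (- x i) + cmono k (q @ [i]) = cmono k q"
    unfolding pos conjg_add fixd .
  then have neg: "conjg (cmono k q) (- x i) = cmono k q - cmono k (q @ [i])"
    by (metis add_diff_cancel)
  show ?thesis
  proof (cases "snd l")
    case True
    then show ?thesis using pos by (simp add: gval_def i_def)
  next
    case False
    then show ?thesis using neg by (simp add: gval_def i_def zmul_uminus)
  qed
qed

text \<open>Weight two is where centrality of n-th powers enters; beyond that, forming a commutator
  with x i is additive on the abelian normal closure of x k, so exponent n is inherited. The
  generator x k itself need not be torsion, whence q \<noteq> [].\<close>

lemma cmono_torsion:
  assumes "k \<in> S" "set q \<subseteq> S" "q \<noteq> []"
  shows "nmul n (cmono k q) = 0"
  using assms(2,3)
proof (induction q rule: rev_induct)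
  case (snoc i q)
  then have i: "i \<in> S" by simp
  show ?case
  proof (cases "q = []")
    case True
    have c: "cm (cmono k [i]) (x i)"
      by (rule ncl_cm[OF i]) (use assms(1) i in \<open>auto intro: cmono_ncl_var ncl_base\<close>)
    \<comment> \<open>The commutator is fixed by x i, so each further conjugation adds one more copy
      of it. For j = n the left side is x k by centrality, which forces n copies to vanish.\<close>
    have "conjg (x k) (nmul j (x i)) = x k + nmul j (cmono k [i])" for j
    proof (induction j)
      case (Suc j)
      have cc: "conjg (nmul j (cmono k [i])) (x i) = nmul j (cmono k [i])"
        using cm_nmul[OF c] by (simp only: conjg_eq_self_iff)
      have "nmul (Suc j) (x i) = nmul j (x i) + x i"
        using nmul_add[of j 1 "x i"] by simp
      then have "conjg (x k) (nmul (Suc j) (x i)) = conjg (x k + nmul j (cmono k [i])) (x i)"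
        using Suc by (simp only: conjg_conjg[symmetric])
      also have "\<dots> = x k + (cmono k [i] + nmul j (cmono k [i]))"
        using cmono_snoc[of k "[]" i] cc by (simp add: conjg_add add.assoc[symmetric])
      finally show ?case by simp
    qed simp
    then have "conjg (x k) (nmul n (x i)) = x k + nmul n (cmono k [i])" .
    moreover have "conjg (x k) (nmul n (x i)) = x k"
      unfolding conjg_eq_self_iff using central_power[OF i assms(1)] by (rule cm_sym)
    ultimately have "x k + nmul n (cmono k [i]) = x k + 0" by simp
    then show ?thesis using True by (simp only: add_left_cancel append_Nil)
  next
    case False
    let ?a = "cmono k q"
    have a: "?a \<in> ncl k" using snoc.prems assms(1) by (intro cmono_ncl) auto
    have "conjg ?a (x i) \<in> ncl k" unfolding conjg_letter using i by (intro ncl_conjg a) auto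
    then have "cm (- ?a) (conjg ?a (x i))" using assms(1) a by (intro ncl_cm[of k] ncl_uminus) auto
    then have "nmul n (cmono k (q @ [i])) = - zmul (int n) ?a + conjg (zmul (int n) ?a) (x i)"
      by (simp add: cmono_snoc zmul_of_nat[symmetric] zmul_plus_commuting zmul_uminus_right conjg_zmul)
    then show ?thesis using snoc False by (simp add: zmul_of_nat)
  qed
qed simp

text \<open>The list Qs merely fixes an order of summation: all summands lie in the abelian normal
  closure of x k.\<close>

definition nform :: "nat \<Rightarrow> nat list list \<Rightarrow> (nat list \<Rightarrow> int) \<Rightarrow> 'g" where
  "nform k Qs e = sum_list (map (\<lambda>q. zmul (e q) (cmono k q)) Qs)"

lemma nform_Cons: "nform k (q # Qs) e = zmul (e q) (cmono k q) + nform k Qs e"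
  by (simp add: nform_def)

lemma nform_cm:
  assumes "k \<in> S" "\<And>q. q \<in> set Qs \<Longrightarrow> set q \<subseteq> S" "set r \<subseteq> S"
  shows "cm (nform k Qs e) (zmul c (cmono k r))"
  unfolding nform_def
  by (rule sum_list_cm)
    (use assms in \<open>auto intro!: cm_zmul cm_sym[OF cm_zmul] ncl_cm[of k] cmono_ncl\<close>)

lemma nform_add:
  assumes "k \<in> S" "\<And>q. q \<in> set Qs \<Longrightarrow> set q \<subseteq> S"
  shows "nform k Qs (\<lambda>q. e q + e' q) = nform k Qs e + nform k Qs e'"
  using assms(2)
proof (induction Qs)
  case (Cons q Qs)
  have "cm (nform k Qs e) (zmul (e' q) (cmono k q))"
    by (rule nform_cm[OF assms(1)]) (use Cons.prems in auto)
  then have "zmul (e' q) (cmono k q) + (nform k Qs e + nform k Qs e')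
      = nform k Qs e + (zmul (e' q) (cmono k q) + nform k Qs e')"
    unfolding cm_def by (metis add.assoc)
  then show ?case using Cons by (simp add: nform_Cons zmul_add add.assoc)
qed (simp add: nform_def)

lemma nform_zero: "(\<And>q. q \<in> set Qs \<Longrightarrow> e q = 0) \<Longrightarrow> nform k Qs e = 0"
  by (induction Qs) (auto simp: nform_def)

lemma nform_single:
  "distinct Qs \<Longrightarrow> r \<in> set Qs \<Longrightarrow> nform k Qs (\<lambda>q. if q = r then c else 0) = zmul c (cmono k r)"
proof (induction Qs)
  case (Cons q Qs)
  show ?case
  proof (cases "q = r")
    case True
    then have "nform k Qs (\<lambda>q. if q = r then c else 0) = 0"
      using Cons.prems by (intro nform_zero) auto
    then show ?thesis using True by (simp add: nform_Cons)
  qed (use Cons in \<open>simp add: nform_Cons\<close>)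
qed simp

lemma nform_cong: "(\<And>q. q \<in> set Qs \<Longrightarrow> e q = e' q) \<Longrightarrow> nform k Qs e = nform k Qs e'"
  by (induction Qs) (auto simp: nform_def)

text \<open>Conjugation by a letter changes the exponents by the recursion that
  \<open>coef_mult_lval\<close> gives for Magnus coefficients. The sum runs over a sublist ys so
  that the induction can consume it while the result is always expressed over the full list
  Qs.\<close>

lemma conjg_nform_sub:
  assumes k: "k \<in> S" and T: "T \<subseteq> S" "fst l \<in> T"
    and Qs: "distinct Qs" "set Qs = {q. distinct q \<and> set q \<subseteq> T}"
    and ys: "distinct ys" "set ys \<subseteq> set Qs"
  shows "conjg (nform k ys e) (gval x l)
    = nform k Qs (\<lambda>r. (if r \<in> set ys then e r else 0) +
        (if r \<noteq> [] \<and> last r = fst l \<and> butlast r \<in> set ys then (if snd l then 1 else - 1) * e (butlast r) else 0))"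
  using ys
proof (induction ys)
  case Nil
  then show ?case by (simp add: nform_def[of k "[]"] nform_zero)
next
  case (Cons q ys)
  let ?s = "if snd l then 1 else - 1 :: int" and ?i = "fst l"
  let ?f = "\<lambda>r. (if r \<in> set ys then e r else 0) +
        (if r \<noteq> [] \<and> last r = fst l \<and> butlast r \<in> set ys then ?s * e (butlast r) else 0)"
  have q: "distinct q" "set q \<subseteq> T" "q \<in> set Qs" using Cons.prems Qs by auto
  have sub: "\<And>q. q \<in> set Qs \<Longrightarrow> set q \<subseteq> S" using Qs(2) T by auto
  have qS: "set q \<subseteq> S" "?i \<in> S" using q T by auto
  have m: "cmono k q \<in> ncl k" "cmono k (q @ [?i]) \<in> ncl k" using qS k by (auto intro!: cmono_ncl)
  have "conjg (zmul (e q) (cmono k q)) (gval x l) = zmul (e q) (cmono k q + zmul ?s (cmono k (q @ [?i])))"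
    using q(2) T k by (subst conjg_zmul, subst conjg_cmono) blast+
  also have "\<dots> = zmul (e q) (cmono k q) + zmul (e q) (zmul ?s (cmono k (q @ [?i])))"
    using m k by (intro zmul_plus_commuting cm_sym[OF cm_zmul] ncl_cm[of k]) auto
  also have "zmul (e q) (zmul ?s (cmono k (q @ [?i]))) = zmul (?s * e q) (cmono k (q @ [?i]))"
    by (auto simp: zmul_uminus zmul_uminus_right)
  also have "zmul (?s * e q) (cmono k (q @ [?i])) = nform k Qs (\<lambda>r. if r = q @ [?i] then ?s * e q else 0)"
  proof (cases "?i \<in> set q")
    case True
    then have "cmono k (q @ [?i]) = 0" using cmono_repeat k q T by blast
    moreover have "nform k Qs (\<lambda>r. if r = q @ [?i] then ?s * e q else 0) = 0"
      using True Qs(2) by (intro nform_zero) auto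
    moreover have "zmul j 0 = (0 :: 'g)" for j
      using zmul_torsion[of 1 "0 :: 'g" j 0] by simp
    ultimately show ?thesis by simp
  next
    case False
    then show ?thesis using Qs q T by (subst nform_single) auto
  qed
  finally have 1: "conjg (zmul (e q) (cmono k q)) (gval x l)
    = nform k Qs (\<lambda>r. if r = q then e q else 0) + nform k Qs (\<lambda>r. if r = q @ [?i] then ?s * e q else 0)"
    using Qs q by (simp add: nform_single)
  have "conjg (nform k (q # ys) e) (gval x l) = nform k Qs (\<lambda>r. if r = q then e q else 0)
     + nform k Qs (\<lambda>r. if r = q @ [?i] then ?s * e q else 0) + nform k Qs ?f"
    using Cons by (simp add: nform_Cons conjg_add 1)
  also have "\<dots> = nform k Qs (\<lambda>r. (if r = q then e q else 0) + (if r = q @ [?i] then ?s * e q else 0) + ?f r)"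
    by (simp only: nform_add[OF k sub])
  also have "\<dots> = nform k Qs (\<lambda>r. (if r \<in> set (q # ys) then e r else 0) +
        (if r \<noteq> [] \<and> last r = fst l \<and> butlast r \<in> set (q # ys) then ?s * e (butlast r) else 0))"
  proof (rule nform_cong)
    fix r
    have "r = q @ [?i] \<longleftrightarrow> r \<noteq> [] \<and> last r = ?i \<and> butlast r = q"
      by (cases r rule: rev_cases) auto
    then show "(if r = q then e q else 0) + (if r = q @ [?i] then ?s * e q else 0) + ?f r
      = (if r \<in> set (q # ys) then e r else 0) +
        (if r \<noteq> [] \<and> last r = fst l \<and> butlast r \<in> set (q # ys) then ?s * e (butlast r) else 0)"
      using Cons.prems by auto
  qed
  finally show ?case .
qed

text \<open>The word is split as a word without k times an element of the normal closure of x k.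
  Appending a letter from T conjugates the second factor, appending x k adds to it; in both cases
  its exponents follow the Magnus coefficients of the monomials that begin with k.\<close>

lemma ev_decompose:
  assumes k: "k \<in> S" "k \<notin> T" and T: "T \<subseteq> S"
    and Qs: "distinct Qs" "set Qs = {q. distinct q \<and> set q \<subseteq> T}"
  shows "fst ` set w \<subseteq> insert k T \<Longrightarrow>
    ev x w = ev x (filter (\<lambda>l. fst l \<in> T) w) + nform k Qs (\<lambda>q. coef (magnus w) (k # q))"
proof (induction w rule: rev_induct)
  case Nil
  show ?case by (simp add: nform_zero coef_one)
next
  case (snoc l w)
  let ?s = "if snd l then 1 else - 1 :: int"
  let ?e = "\<lambda>q. coef (magnus w) (k # q)" and ?e' = "\<lambda>q. coef (magnus (w @ [l])) (k # q)"
  have sub: "\<And>q. q \<in> set Qs \<Longrightarrow> set q \<subseteq> S" using Qs(2) T by auto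
  have IH: "ev x w = ev x (filter (\<lambda>l. fst l \<in> T) w) + nform k Qs ?e" using snoc by auto
  have e': "?e' q = ?e q + (if last (k # q) = fst l then ?s * coef (magnus w) (butlast (k # q)) else 0)"
    if "q \<in> set Qs" for q
  proof -
    have "distinct (k # q)" using that Qs k by auto
    then show ?thesis by (simp only: magnus_simps mult_1_right coef_mult_lval) simp
  qed
  show ?case
  proof (cases "fst l = k")
    case True
    \<comment> \<open>Appending a letter k affects only monomials ending in k. Words over T do not
      contain k, so among k # q this is only the monomial k itself.\<close>
    have "nform k Qs ?e' = nform k Qs (\<lambda>q. ?e q + (if q = [] then ?s else 0))"
    proof (rule nform_cong)
      fix q assume q: "q \<in> set Qs"
      then have "k \<notin> set q" using Qs k by auto
      then have "q \<noteq> [] \<Longrightarrow> last q \<noteq> k" by (metis last_in_set)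
      then show "?e' q = ?e q + (if q = [] then ?s else 0)"
        unfolding e'[OF q] using True by auto
    qed
    also have "\<dots> = nform k Qs ?e + nform k Qs (\<lambda>q. if q = [] then ?s else 0)"
      by (rule nform_add[OF k(1) sub])
    also have "nform k Qs (\<lambda>q. if q = [] then ?s else 0) = zmul ?s (x k)"
      using nform_single[of Qs "[]" k ?s] Qs by simp
    also have "zmul ?s (x k) = gval x l"
      using True by (auto simp: gval_def zmul_uminus)
    finally show ?thesis using IH True k by (simp add: add.assoc)
  next
    case False
    then have lT: "fst l \<in> T" using snoc.prems by auto
    have "conjg (nform k Qs ?e) (gval x l) = nform k Qs ?e'"
      unfolding conjg_nform_sub[OF k(1) T lT Qs Qs(1) subset_refl]
    proof (rule nform_cong)
      fix q assume q: "q \<in> set Qs"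
      \<comment> \<open>Qs is closed under removing the last letter, so the conjugation formula
        applies without boundary terms.\<close>
      have "butlast q \<in> set Qs" using q Qs by (auto simp: distinct_butlast dest: in_set_butlastD)
      then show "(if q \<in> set Qs then ?e q else 0) +
         (if q \<noteq> [] \<and> last q = fst l \<and> butlast q \<in> set Qs then ?s * ?e (butlast q) else 0) = ?e' q"
        unfolding e'[OF q] using q False by auto
    qed
    then have "nform k Qs ?e + gval x l = gval x l + nform k Qs ?e'"
      by (metis add_conjg)
    then show ?thesis using IH lT by (simp add: add.assoc)
  qed
qed

text \<open>One generator is split off at a time. Exponents of generators must agree exactly, while
  exponents of proper commutators matter only modulo n because of
  \<open>cmono_torsion\<close>.\<close>

theorem ev_eqI:
  assumes "finite T" "T \<subseteq> S" "fst ` set w \<subseteq> T" "fst ` set w' \<subseteq> T"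
    and "\<And>i. coef (magnus w) [i] = coef (magnus w') [i]"
    and "\<And>p. distinct p \<Longrightarrow> int n dvd coef (magnus w) p - coef (magnus w') p"
  shows "ev x w = ev x w'"
  using assms
proof (induction T arbitrary: w w' rule: finite_induct)
  case empty
  then show ?case by simp
next
  case (insert k T)
  let ?r = "filter (\<lambda>l. fst l \<in> T)"
  have r: "coef (magnus (?r v)) p = (if set p \<subseteq> T then coef (magnus v) p else 0)" if "distinct p" for v p
    using that coef_magnus_filter[of p T v] coef_magnus_support[of p "?r v"] by auto
  have ri: "ev x (?r w) = ev x (?r w')"
  proof (rule insert.IH)
    show "T \<subseteq> S" "fst ` set (?r w) \<subseteq> T" "fst ` set (?r w') \<subseteq> T" using insert.prems by auto
    show "coef (magnus (?r w)) [i] = coef (magnus (?r w')) [i]" for i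
      using insert.prems(4)[of i] by (simp add: r)
    show "int n dvd coef (magnus (?r w)) p - coef (magnus (?r w')) p" if "distinct p" for p
      using insert.prems(5)[OF that] that by (simp add: r)
  qed
  have "finite {q. set q \<subseteq> T \<and> distinct q}" using insert.hyps(1) by (rule finite_subset_distinct)
  then have "finite {q. distinct q \<and> set q \<subseteq> T}" by (simp add: conj_commute)
  then obtain Qs where Qs: "set Qs = {q. distinct q \<and> set q \<subseteq> T}" "distinct Qs"
    using finite_distinct_list by metis
  have "zmul (coef (magnus w) (k # q)) (cmono k q) = zmul (coef (magnus w') (k # q)) (cmono k q)"
    if "q \<in> set Qs" for q
  proof (cases "q = []")
    case True
    then show ?thesis using insert.prems(4)[of k] by simp
  next
    case False
    have q: "distinct (k # q)" "set q \<subseteq> S" using that Qs insert.hyps insert.prems(1) by auto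
    show ?thesis
      using cmono_torsion[of k q] insert.prems(1) False insert.prems(5)[OF q(1)] q by (intro zmul_torsion) auto
  qed
  then have "nform k Qs (\<lambda>q. coef (magnus w) (k # q)) = nform k Qs (\<lambda>q. coef (magnus w') (k # q))"
    unfolding nform_def by (metis (mono_tags, lifting) map_cong)
  then show ?case
    using ev_decompose[OF _ _ _ Qs(2,1), of k w] ev_decompose[OF _ _ _ Qs(2,1), of k w'] insert.hyps insert.prems ri
    by simp
qed

end

section \<open>Gauss diagrams and contexts\<close>

text \<open>Well-formedness depends only on the multiset of endpoints, so every move that merely
  permutes endpoints preserves it at once.\<close>

definition wfm :: "ep multiset \<Rightarrow> bool" where
  "wfm M \<longleftrightarrow> (\<forall>a. (\<exists>e. e \<in># M \<and> lab e = a) \<longrightarrow>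
      (\<exists>s. filter_mset (\<lambda>e. lab e = a) M = {#EP a True s, EP a False s#}))"

lemma gd_wf_iff: "gd_wf m D \<longleftrightarrow> length D = m \<and> wfm (mset (concat D))"
proof -
  have "(count_list xs (EP a True s) = 1 \<and> count_list xs (EP a False s) = 1 \<and> length (filter (\<lambda>e. lab e = a) xs) = 2)
      \<longleftrightarrow> filter_mset (\<lambda>e. lab e = a) (mset xs) = {#EP a True s, EP a False s#}" (is "?L \<longleftrightarrow> ?R") for xs a s
  proof
    assume L: ?L
    let ?F = "filter_mset (\<lambda>e. lab e = a) (mset xs)"
    have c: "count ?F (EP a True s) = 1" "count ?F (EP a False s) = 1" using L by (simp_all add: count_mset)
    have "{#EP a True s, EP a False s#} \<subseteq># ?F"
    proof (rule mset_subset_eqI)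
      fix e show "count {#EP a True s, EP a False s#} e \<le> count ?F e"
        using c by (cases "e = EP a True s"; cases "e = EP a False s") simp_all
    qed
    moreover have "size ?F = size {#EP a True s, EP a False s#}" using L
      by (simp flip: mset_filter)
    ultimately show ?R
      by (metis mset_subset_size nat_neq_iff subset_mset.le_imp_less_or_eq)
  next
    assume R: ?R
    have "count (mset xs) (EP a b s) = count (filter_mset (\<lambda>e. lab e = a) (mset xs)) (EP a b s)" for b by simp
    then have "count (mset xs) (EP a b s) = 1" for b unfolding R by (cases b) auto
    moreover have "length (filter (\<lambda>e. lab e = a) xs) = 2"
      using arg_cong[OF R, of size] by (simp flip: mset_filter)
    ultimately show ?L by (simp add: count_mset[symmetric])
  qed
  then have "gd_wf m D \<longleftrightarrow> length D = m \<and> (\<forall>a. (\<exists>e\<in>set (concat D). lab e = a) \<longrightarrow>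
      (\<exists>s. filter_mset (\<lambda>e. lab e = a) (mset (concat D)) = {#EP a True s, EP a False s#}))"
    unfolding gd_wf_def by presburger
  then show ?thesis unfolding wfm_def by (simp only: set_mset_mset Bex_def)
qed

lemma wfm_count: "wfm M \<Longrightarrow> count M e \<le> 1"
proof (cases "e \<in># M")
  case True
  assume "wfm M"
  then obtain s where "filter_mset (\<lambda>e'. lab e' = lab e) M = {#EP (lab e) True s, EP (lab e) False s#}"
    using True unfolding wfm_def by blast
  then have "count (filter_mset (\<lambda>e'. lab e' = lab e) M) e \<le> 1"
    by (cases e) simp
  then show ?thesis by simp
next
  case False
  then show ?thesis by (simp add: not_in_iff)
qed

lemma wf_distinct: "gd_wf m D \<Longrightarrow> distinct (concat D)"
  unfolding gd_wf_iff distinct_count_atmost_1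
proof
  assume "length D = m \<and> wfm (mset (concat D))"
  then have "count (mset (concat D)) e \<le> 1" for e using wfm_count by blast
  moreover have "count (mset (concat D)) e \<noteq> 0 \<longleftrightarrow> e \<in> set (concat D)" for e
    by (simp only: count_mset_0_iff) simp
  ultimately show "count (mset (concat D)) e = (if e \<in> set (concat D) then 1 else 0)" for e
    by (metis One_nat_def le_SucE le_zero_eq)
qed

lemma wf_partner:
  assumes "gd_wf m D" "EP a b s \<in> set (concat D)"
  shows "EP a (\<not> b) s \<in> set (concat D)" and "EP a b' s' \<in> set (concat D) \<Longrightarrow> s' = s"
proof -
  obtain s0 where f: "filter_mset (\<lambda>e. lab e = a) (mset (concat D)) = {#EP a True s0, EP a False s0#}"
    using assms unfolding gd_wf_iff wfm_def by (metis ep.sel(1) in_multiset_in_set)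
  have mem: "EP a b'' s'' \<in> set (concat D) \<longleftrightarrow> s'' = s0" for b'' s''
  proof -
    have "EP a b'' s'' \<in> set (concat D) \<longleftrightarrow> EP a b'' s'' \<in># filter_mset (\<lambda>e. lab e = a) (mset (concat D))"
      by simp
    then show ?thesis unfolding f by auto
  qed
  show "EP a (\<not> b) s \<in> set (concat D)" using assms(2) by (simp only: mem)
  show "s' = s" if "EP a b' s' \<in> set (concat D)" using that assms(2) by (simp only: mem)
qed

lemma in_concat_nth: "e \<in> set (concat D) \<longleftrightarrow> (\<exists>c<length D. e \<in> set (D ! c))"
proof -
  have "e \<in> set (concat D) \<longleftrightarrow> (\<exists>r\<in>set D. e \<in> set r)" by simp
  also have "\<dots> \<longleftrightarrow> (\<exists>c<length D. e \<in> set (D ! c))" by (metis in_set_conv_nth)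
  finally show ?thesis .
qed

lemma distinct_rows:
  assumes "distinct (concat D)" "c < length D" "c' < length D" "e \<in> set (D ! c)" "e \<in> set (D ! c')"
  shows "c = c'"
proof -
  have *: False if "c < c'" "c' < length D" "e \<in> set (D ! c)" "e \<in> set (D ! c')" for c c'
  proof -
    have "distinct (concat (take c' D) @ concat (drop c' D))"
      using assms(1) by (metis append_take_drop_id concat_append)
    moreover have "e \<in> set (concat (take c' D))"
      unfolding in_concat_nth using that by (intro exI[of _ c]) simp
    moreover have "e \<in> set (concat (drop c' D))"
      unfolding in_concat_nth using that by (intro exI[of _ 0]) simp
    ultimately show False by auto
  qed
  show ?thesis using *[of c c'] *[of c' c] assms by (metis linorder_neqE_nat)
qed

lemma distinct_row: "distinct (concat D) \<Longrightarrow> c < length D \<Longrightarrow> distinct (D ! c)"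
  by (simp add: distinct_concat_iff)

lemma split_unique: "distinct (xs @ e # ys) \<Longrightarrow> xs @ e # ys = xs' @ e # ys' \<Longrightarrow> xs = xs' \<and> ys = ys'"
proof (induction xs arbitrary: xs')
  case Nil
  then show ?case by (cases xs') auto
next
  case (Cons x xs)
  show ?case
  proof (cases xs')
    case Nil
    then show ?thesis using Cons.prems by auto
  next
    case (Cons y zs)
    then have "x = y" "xs @ e # ys = zs @ e # ys'" using Cons.prems by auto
    moreover have "distinct (xs @ e # ys)" using Cons.prems by (metis append_Cons distinct.simps(2))
    ultimately show ?thesis using Cons.IH[of zs] Cons by blast
  qed
qed

lemma occurrence_unique:
  assumes "distinct (concat D)" "c < length D" "c' < length D"
    and "D ! c = xs @ e # ys" "D ! c' = xs' @ e # ys'"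
  shows "c = c'" "xs = xs'" "ys = ys'"
proof -
  show c: "c = c'" using assms by (intro distinct_rows[of D c c' e]) auto
  show "xs = xs'" "ys = ys'"
    using split_unique[of xs e ys xs' ys'] distinct_row[OF assms(1,2)] assms(4,5) c by auto
qed

definition slotf :: "(nat \<Rightarrow> 'a list) \<Rightarrow> 'a slot \<Rightarrow> 'a list" where
  "slotf f x = (case x of Lit e \<Rightarrow> [e] | Hole k \<Rightarrow> f k)"

definition fillrow :: "(nat \<Rightarrow> 'a list) \<Rightarrow> 'a slot list \<Rightarrow> 'a list" where
  "fillrow f xs = concat (map (slotf f) xs)"

lemma slotf_simps [simp]: "slotf f (Lit e) = [e]" "slotf f (Hole k) = f k"
  by (simp_all add: slotf_def)

lemma fillrow_simps [simp]: "fillrow f [] = []" "fillrow f (x # xs) = slotf f x @ fillrow f xs"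
  "fillrow f (xs @ ys) = fillrow f xs @ fillrow f ys"
  by (simp_all add: fillrow_def)

lemma fill_eq: "fill f C = map (fillrow f) C"
  unfolding fill_def fillrow_def slotf_def ..

lemma length_fill [simp]: "length (fill f C) = length C"
  by (simp add: fill_eq)

lemma fill_nth [simp]: "c < length C \<Longrightarrow> fill f C ! c = fillrow f (C ! c)"
  by (simp add: fill_eq)

lemma fillrow_split:
  assumes "fillrow f cs = xs @ e # ys"
  obtains (lit) cs1 cs2 where "cs = cs1 @ Lit e # cs2" "xs = fillrow f cs1" "ys = fillrow f cs2"
  | (hole) cs1 k cs2 us vs where "cs = cs1 @ Hole k # cs2" "f k = us @ e # vs" "xs = fillrow f cs1 @ us"
      "ys = vs @ fillrow f cs2"
  using assms
proof (induction cs arbitrary: xs thesis)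
  case (Cons z cs)
  have "(\<exists>w. xs = slotf f z @ w \<and> fillrow f cs = w @ e # ys) \<or>
        (\<exists>v. slotf f z = xs @ e # v \<and> ys = v @ fillrow f cs)"
    using Cons.prems(3) by (auto simp: append_eq_append_conv2 append_eq_Cons_conv Cons_eq_append_conv)
  then show ?case
  proof
    assume "\<exists>w. xs = slotf f z @ w \<and> fillrow f cs = w @ e # ys"
    then obtain w where w: "xs = slotf f z @ w" "fillrow f cs = w @ e # ys" by blast
    show ?case
    proof (rule Cons.IH[OF _ _ w(2)])
      fix cs1 cs2 assume "cs = cs1 @ Lit e # cs2" "w = fillrow f cs1" "ys = fillrow f cs2"
      then show thesis using Cons.prems(1)[of "z # cs1" cs2] w by simp
    next
      fix cs1 k cs2 us vs assume "cs = cs1 @ Hole k # cs2" "f k = us @ e # vs" "w = fillrow f cs1 @ us" "ys = vs @ fillrow f cs2"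
      then show thesis using Cons.prems(2)[of "z # cs1" k cs2 us vs] w by simp
    qed
  next
    assume "\<exists>v. slotf f z = xs @ e # v \<and> ys = v @ fillrow f cs"
    then obtain v where v: "slotf f z = xs @ e # v" "ys = v @ fillrow f cs" by blast
    show ?case
    proof (cases z)
      case (Lit e')
      then show ?thesis using v Cons.prems(1)[of "[]" cs] by (auto simp: Cons_eq_append_conv)
    next
      case (Hole k)
      then show ?thesis using v Cons.prems(2)[of "[]" k cs xs v] by auto
    qed
  qed
qed simp

section \<open>Colourings by power series\<close>

definition sgz :: "bool \<Rightarrow> nrs \<Rightarrow> nrs" where
  "sgz s z = (if s then z else - z)"

definition hfac :: "(nat \<Rightarrow> nrs) \<Rightarrow> ep \<Rightarrow> nrs" where
  "hfac T e = (if is_tail e then 1 else 1 + sgz (psgn e) (T (lab e)))"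

text \<open>Colours minus one have square zero in a solution, so this is the inverse of
  \<open>hfac\<close>. Keeping it as a separate factor allows \<open>col\<close> to be formed for
  arbitrary T, as the iteration in \<open>sol_exists\<close> requires.\<close>

definition hifac :: "(nat \<Rightarrow> nrs) \<Rightarrow> ep \<Rightarrow> nrs" where
  "hifac T e = (if is_tail e then 1 else 1 - sgz (psgn e) (T (lab e)))"

definition hol :: "(nat \<Rightarrow> nrs) \<Rightarrow> ep list \<Rightarrow> nrs" where
  "hol T es = prod_list (map (hfac T) es)"

definition ihol :: "(nat \<Rightarrow> nrs) \<Rightarrow> ep list \<Rightarrow> nrs" where
  "ihol T es = prod_list (map (hifac T) (rev es))"

definition col :: "(nat \<Rightarrow> nrs) \<Rightarrow> nat \<Rightarrow> ep list \<Rightarrow> nrs" where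
  "col T c es = ihol T es * (X c * hol T es)"

text \<open>T assigns to each arrow the colour of the arc carrying its tail, minus one. Colours are conjugates
of 1 + X c, where c is the strand of the arc.\<close>

definition sol :: "int \<Rightarrow> gdiag \<Rightarrow> (nat \<Rightarrow> nrs) \<Rightarrow> bool" where
  "sol N D T \<longleftrightarrow> (\<forall>c<length D. \<forall>xs a s ys. D ! c = xs @ EP a True s # ys \<longrightarrow>
      cg N (\<lambda>p. True) (T a) (col T c xs))"

lemma hol_simps [simp]: "hol T [] = 1" "hol T (e # es) = hfac T e * hol T es" "hol T (us @ vs) = hol T us * hol T vs"
  by (simp_all add: hol_def)

lemma ihol_simps [simp]: "ihol T [] = 1" "ihol T (e # es) = ihol T es * hifac T e" "ihol T (us @ vs) = ihol T vs * ihol T us"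
  by (simp_all add: ihol_def)

lemma sgz_cg: "cg N P z z' \<Longrightarrow> cg N P (sgz s z) (sgz s z')"
  by (simp add: sgz_def cg_minus)

lemma hol_cg:
  assumes "infixcl P" "\<And>e. e \<in> set es \<Longrightarrow> \<not> is_tail e \<Longrightarrow> cg N P (T (lab e)) (T' (lab e))"
  shows "cg N P (hol T es) (hol T' es)" "cg N P (ihol T es) (ihol T' es)"
proof -
  have "cg N P (hfac T e) (hfac T' e)" "cg N P (hifac T e) (hifac T' e)" if "e \<in> set es" for e
    using assms(2)[OF that] by (auto simp: hfac_def hifac_def intro!: cg_add cg_diff sgz_cg)
  then show "cg N P (hol T es) (hol T' es)" "cg N P (ihol T es) (ihol T' es)"
    by (induction es) (auto intro!: cg_mult assms(1))
qed

lemma coef_hol_Nil [simp]: "(\<And>e. e \<in> set es \<Longrightarrow> coef (T (lab e)) [] = 0) \<Longrightarrow> coef (hol T es) [] = 1"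
  by (induction es) (auto simp: hfac_def sgz_def)

lemma coef_col_Nil [simp]: "coef (col T c es) [] = 0"
  by (simp add: col_def)

text \<open>All monomials of a conjugate of X c contain c; hence an undercrossing below the own
  strand c is invisible away from c.\<close>

lemma col_avoid: "cg N (\<lambda>p. c \<notin> set p) (col T c es) 0"
  unfolding cg_def col_def by (auto simp: coef_X_mid)

lemma col_square: "col T c es * col T' c es' = 0"
  unfolding col_def by (rule conjugate_X_square)

lemma sol_0: "sol 0 D T \<longleftrightarrow> (\<forall>c<length D. \<forall>xs a s ys. D ! c = xs @ EP a True s # ys \<longrightarrow> T a = col T c xs)"
  unfolding sol_def cg_0_iff ..

lemma sol_0_D: "sol 0 D T \<Longrightarrow> c < length D \<Longrightarrow> D ! c = xs @ EP a True s # ys \<Longrightarrow> T a = col T c xs"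
  unfolding sol_0 by blast

lemma sol_mono: "sol 0 D T \<Longrightarrow> sol N D T"
  unfolding sol_def by (meson cg_mono dvd_0_right)

lemma tail_occurs:
  assumes "gd_wf m D" "e \<in> set (concat D)"
  obtains c xs ys where "c < length D" "D ! c = xs @ EP (lab e) True (psgn e) # ys"
proof -
  have "EP (lab e) True (psgn e) \<in> set (concat D)"
  proof (cases e)
    case (EP a b s)
    then show ?thesis using assms wf_partner(1)[OF assms(1), of a b s] by (cases b) auto
  qed
  then show ?thesis using that by (metis in_concat_nth split_list)
qed

text \<open>By \<open>cg_mid_length\<close>, agreement of all colours up to degree d forces
  agreement up to degree d + 1. The conclusion holds modulo N because the comparison solution in
  \<open>inv_eqI\<close> is only a solution modulo N.\<close>

lemma sol_unique:
  assumes wf: "gd_wf m D" and s1: "sol N D T1" and s2: "sol N D T2" and e: "e \<in> set (concat D)"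
  shows "cg N (\<lambda>p. True) (T1 (lab e)) (T2 (lab e))"
proof -
  have "\<forall>e\<in>set (concat D). cg N (\<lambda>p. length p \<le> d) (T1 (lab e)) (T2 (lab e))" for d
  proof (induction d)
    case 0
    show ?case
    proof
      fix e assume "e \<in> set (concat D)"
      then obtain c xs ys where c: "c < length D" "D ! c = xs @ EP (lab e) True (psgn e) # ys"
        using tail_occurs[OF wf] by blast
      have "cg N (\<lambda>p. length p \<le> 0) (T1 (lab e)) 0" "cg N (\<lambda>p. length p \<le> 0) (T2 (lab e)) 0"
        using s1 s2 c unfolding sol_def cg_def by (metis coef_col_Nil coef_zero le_zero_eq length_0_conv)+
      then show "cg N (\<lambda>p. length p \<le> 0) (T1 (lab e)) (T2 (lab e))" by (metis cg_sym cg_trans)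
    qed
  next
    case (Suc d)
    show ?case
    proof
      fix e assume "e \<in> set (concat D)"
      then obtain c xs ys where c: "c < length D" "D ! c = xs @ EP (lab e) True (psgn e) # ys"
        using tail_occurs[OF wf] by blast
      have xs: "set xs \<subseteq> set (concat D)"
        unfolding in_concat_nth subset_iff using c by (metis UnCI set_append)
      have "cg N (\<lambda>p. length p \<le> Suc d) (col T1 c xs) (col T2 c xs)"
        unfolding col_def
        by (intro cg_mid_length hol_cg infixcl_length) (use Suc xs in auto)
      moreover have "cg N (\<lambda>p. length p \<le> Suc d) (T1 (lab e)) (col T1 c xs)"
        "cg N (\<lambda>p. length p \<le> Suc d) (T2 (lab e)) (col T2 c xs)"
        using s1 s2 c unfolding sol_def by (metis cg_mono dvd_refl)+
      ultimately show "cg N (\<lambda>p. length p \<le> Suc d) (T1 (lab e)) (T2 (lab e))"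
        by (metis cg_sym cg_trans)
    qed
  qed
  then have "cg N (\<lambda>q. length q \<le> length p) (T1 (lab e)) (T2 (lab e))" for p :: "nat list" using e by blast
  then show ?thesis unfolding cg_def by blast
qed

text \<open>A solution is a fixed point of a map that gains one degree of precision at each
  application. The equations may be cyclic along the diagram; the grading replaces any order in
  which to colour the arcs.\<close>

lemma sol_exists:
  assumes wf: "gd_wf m D"
  obtains T where "sol 0 D T"
proof -
  define P where "P = (\<lambda>a cx. \<exists>s ys. fst cx < length D \<and> D ! fst cx = snd cx @ EP a True s # ys)"
  \<comment> \<open>A label has one tail, so the equations indexed by tail positions become a single
    equation \<open>T = F T\<close> indexed by labels.\<close>
  define loc where "loc a = (SOME cx. P a cx)" for a
  have loc: "loc a = (c, xs)" if "c < length D" "D ! c = xs @ EP a True s # ys" for a c xs s ys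
  proof -
    have "P a (c, xs)" using that by (auto simp: P_def)
    then have "P a (loc a)" unfolding loc_def by (rule someI)
    then obtain s' ys' where l: "fst (loc a) < length D" "D ! fst (loc a) = snd (loc a) @ EP a True s' # ys'"
      by (auto simp: P_def)
    have "EP a True s \<in> set (concat D)" "EP a True s' \<in> set (concat D)"
      unfolding in_concat_nth using that l by (metis in_set_conv_decomp)+
    then have "s' = s" using wf_partner(2)[OF wf] by blast
    then show ?thesis using occurrence_unique[OF wf_distinct[OF wf] that(1) l(1) that(2)] l(2)
      by (metis prod.collapse)
  qed
  define F where "F T a = col T (fst (loc a)) (snd (loc a))" for T a
  \<comment> \<open>The iterates of F starting at zero; U k is stable up to length k.\<close>
  define U where "U k = (F ^^ k) (\<lambda>_. 0)" for k
  have U0: "U 0 a = 0" for a by (simp add: U_def)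
  have US: "U (Suc k) = F (U k)" for k by (simp add: U_def)
  have Fcg: "cg 0 (\<lambda>p. length p \<le> Suc d) (F T a) (F T' a)"
    if "\<And>a. cg 0 (\<lambda>p. length p \<le> d) (T a) (T' a)" for d T T' a
    unfolding F_def col_def by (intro cg_mid_length hol_cg infixcl_length that)
  have step: "cg 0 (\<lambda>p. length p \<le> k) (U k a) (U (Suc k) a)" for k a
  proof (induction k arbitrary: a)
    case 0
    show ?case unfolding US F_def by (simp add: cg_def U0)
  next
    case (Suc k)
    show ?case using Fcg[of k "U k" "U (Suc k)" a] Suc by (simp add: US)
  qed
  have agree: "cg 0 (\<lambda>p. length p \<le> k) (U k a) (U (k + j) a)" for k j a
  proof (induction j)
    case (Suc j)
    have "cg 0 (\<lambda>p. length p \<le> k) (U (k + j) a) (U (k + Suc j) a)"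
      using cg_mono[OF step[of "k + j" a], of "\<lambda>p. length p \<le> k" 0] by simp
    then show ?case using Suc cg_trans by blast
  qed simp
  \<comment> \<open>The limit: the coefficient at p is read off the first iterate that is guaranteed
    to have settled at the length of p.\<close>
  define T where "T a = mk_nrs (\<lambda>p. coef (U (length p) a) p)" for a
  have TU: "cg 0 (\<lambda>p. length p \<le> d) (T a) (U d a)" for d a
    unfolding cg_def
  proof (intro allI impI)
    fix p :: "nat list" assume p: "distinct p \<and> length p \<le> d"
    have "cg 0 (\<lambda>q. length q \<le> length p) (U (length p) a) (U (length p + (d - length p)) a)"
      by (rule agree)
    then show "0 dvd coef (T a) p - coef (U d a) p" using p by (simp add: T_def cg_def)
  qed
  have fixp: "T a = F T a" for a
  proof -
    have "cg 0 (\<lambda>p. length p \<le> Suc d) (T a) (F T a)" for d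
    proof -
      have "cg 0 (\<lambda>p. length p \<le> Suc d) (U (Suc d) a) (F T a)"
        unfolding US by (intro Fcg cg_sym[OF TU])
      then show ?thesis using TU[of "Suc d" a] cg_trans by blast
    qed
    then have "cg 0 (\<lambda>q. length q \<le> Suc (length p)) (T a) (F T a)" for p :: "nat list" by blast
    then have "cg 0 (\<lambda>p. True) (T a) (F T a)"
      unfolding cg_def by (meson le_SucI order_refl)
    then show ?thesis by (simp add: cg_0_iff)
  qed
  have "sol 0 D T" unfolding sol_0
  proof (intro allI impI)
    fix c xs a s ys assume "c < length D" "D ! c = xs @ EP a True s # ys"
    then have "loc a = (c, xs)" by (rule loc)
    then show "T a = col T c xs" using fixp[of a] by (simp add: F_def)
  qed
  then show thesis by (rule that)
qed

text \<open>Carries a solution T' across a local change of the hole contents. On literals the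
  colours are unchanged, and by \<open>cg_mid_avoid\<close> their equations survive if each hole
  contributes, away from the variable of its row, the same product as before. Only tails inside the
  holes have to be checked by hand. The modulus N serves the 2n-move.\<close>

lemma hole_sol:
  assumes s': "sol 0 (fill f' C) T'"
    and lits: "\<And>c e. c < length C \<Longrightarrow> Lit e \<in> set (C ! c) \<Longrightarrow> T (lab e) = T' (lab e)"
    and holes: "\<And>c k. c < length C \<Longrightarrow> Hole k \<in> set (C ! c) \<Longrightarrow>
       cg N (\<lambda>p. c \<notin> set p) (hol T (f k)) (hol T' (f' k)) \<and> cg N (\<lambda>p. c \<notin> set p) (ihol T (f k)) (ihol T' (f' k))"
    and tails: "\<And>c k cs1 cs2 us a s vs. c < length C \<Longrightarrow> C ! c = cs1 @ Hole k # cs2 \<Longrightarrow>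
       f k = us @ EP a True s # vs \<Longrightarrow> cg N (\<lambda>p. True) (T a) (col T c (fillrow f cs1 @ us))"
  shows "sol N (fill f C) T"
    and "c < length C \<Longrightarrow> cg N (\<lambda>p. c \<notin> set p) (hol T (fill f C ! c)) (hol T' (fill f' C ! c))"
proof -
  have row: "cg N (\<lambda>p. c \<notin> set p) (hol T (fillrow f cs)) (hol T' (fillrow f' cs)) \<and>
      cg N (\<lambda>p. c \<notin> set p) (ihol T (fillrow f cs)) (ihol T' (fillrow f' cs))"
    if "c < length C" "set cs \<subseteq> set (C ! c)" for c cs
    using that(2)
  proof (induction cs)
    case (Cons z cs)
    have "cg N (\<lambda>p. c \<notin> set p) (hol T (slotf f z)) (hol T' (slotf f' z)) \<and>
        cg N (\<lambda>p. c \<notin> set p) (ihol T (slotf f z)) (ihol T' (slotf f' z))"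
    proof (cases z)
      case (Lit e)
      then have "T (lab e) = T' (lab e)" using lits[OF that(1)] Cons.prems by auto
      then show ?thesis using Lit by (simp add: hfac_def hifac_def)
    next
      case (Hole k)
      then show ?thesis using holes[OF that(1)] Cons.prems by auto
    qed
    then show ?case using Cons by (auto intro!: cg_mult infixcl_avoid)
  qed simp
  show "c < length C \<Longrightarrow> cg N (\<lambda>p. c \<notin> set p) (hol T (fill f C ! c)) (hol T' (fill f' C ! c))"
    using row[of c "C ! c"] by simp
  show "sol N (fill f C) T" unfolding sol_def
  proof (intro allI impI)
    fix c xs a s ys assume c: "c < length (fill f C)" and eq: "fill f C ! c = xs @ EP a True s # ys"
    have c': "c < length C" using c by simp
    have "fillrow f (C ! c) = xs @ EP a True s # ys" using eq c' by simp
    then show "cg N (\<lambda>p. True) (T a) (col T c xs)"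
    proof (cases rule: fillrow_split)
      case (lit cs1 cs2)
      have "fill f' C ! c = fillrow f' cs1 @ EP a True s # fillrow f' cs2" using lit c' by simp
      then have "T' a = col T' c (fillrow f' cs1)" using s' c' by (intro sol_0_D) auto
      moreover have "T a = T' a" using lits[OF c', of "EP a True s"] lit by simp
      moreover have "cg N (\<lambda>p. True) (col T c xs) (col T' c (fillrow f' cs1))"
        unfolding col_def lit(2) using row[OF c', of cs1] lit(1) by (intro cg_mid_avoid) auto
      ultimately show ?thesis by (simp add: cg_sym)
    next
      case (hole cs1 k cs2 us vs)
      then show ?thesis using tails[OF c'] by simp
    qed
  qed
qed

text \<open>Since solutions are unique on the labels present, quantifying over all of them is
  harmless and avoids choosing one; \<open>inv_eqI\<close> reduces the claim to exhibiting a single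
  solution modulo N.\<close>

definition inv_eq :: "int \<Rightarrow> gdiag \<Rightarrow> gdiag \<Rightarrow> bool" where
  "inv_eq N D D' \<longleftrightarrow> (\<forall>T T'. sol 0 D T \<longrightarrow> sol 0 D' T' \<longrightarrow>
     (\<forall>c<length D. cg N (\<lambda>p. c \<notin> set p) (hol T (D ! c)) (hol T' (D' ! c))))"

lemma inv_eqI:
  assumes wf: "gd_wf m D"
    and "\<And>T'. sol 0 D' T' \<Longrightarrow> \<exists>T. sol N D T \<and> (\<forall>c<length D. cg N (\<lambda>p. c \<notin> set p) (hol T (D ! c)) (hol T' (D' ! c)))"
  shows "inv_eq N D D'"
  unfolding inv_eq_def
proof (intro allI impI)
  fix T T' c assume T: "sol 0 D T" "sol 0 D' T'" and c: "c < length D"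
  obtain U where U: "sol N D U" "cg N (\<lambda>p. c \<notin> set p) (hol U (D ! c)) (hol T' (D' ! c))"
    using assms(2)[OF T(2)] c by blast
  have "cg N (\<lambda>p. c \<notin> set p) (hol T (D ! c)) (hol U (D ! c))"
  proof (rule hol_cg(1)[OF infixcl_avoid])
    fix e assume "e \<in> set (D ! c)"
    then have "e \<in> set (concat D)" unfolding in_concat_nth using c by blast
    then have "cg N (\<lambda>p. True) (T (lab e)) (U (lab e))"
      by (rule sol_unique[OF wf sol_mono[OF T(1)] U(1)])
    then show "cg N (\<lambda>p. c \<notin> set p) (T (lab e)) (U (lab e))" by (rule cg_mono) auto
  qed
  then show "cg N (\<lambda>p. c \<notin> set p) (hol T (D ! c)) (hol T' (D' ! c))" using U(2) cg_trans by blast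
qed

lemma inv_eq_hole:
  assumes wf: "gd_wf m (fill f C)"
    and "\<And>T'. sol 0 (fill f' C) T' \<Longrightarrow> \<exists>T.
      (\<forall>c e. c < length C \<longrightarrow> Lit e \<in> set (C ! c) \<longrightarrow> T (lab e) = T' (lab e)) \<and>
      (\<forall>c k. c < length C \<longrightarrow> Hole k \<in> set (C ! c) \<longrightarrow>
       cg N (\<lambda>p. c \<notin> set p) (hol T (f k)) (hol T' (f' k)) \<and> cg N (\<lambda>p. c \<notin> set p) (ihol T (f k)) (ihol T' (f' k))) \<and>
      (\<forall>c k cs1 cs2 us a s vs. c < length C \<longrightarrow> C ! c = cs1 @ Hole k # cs2 \<longrightarrow>
       f k = us @ EP a True s # vs \<longrightarrow> cg N (\<lambda>p. True) (T a) (col T c (fillrow f cs1 @ us)))"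
  shows "inv_eq N (fill f C) (fill f' C)"
proof (rule inv_eqI[OF wf])
  fix T' assume s': "sol 0 (fill f' C) T'"
  obtain T where T: "\<And>c e. c < length C \<Longrightarrow> Lit e \<in> set (C ! c) \<Longrightarrow> T (lab e) = T' (lab e)"
    "\<And>c k. c < length C \<Longrightarrow> Hole k \<in> set (C ! c) \<Longrightarrow>
       cg N (\<lambda>p. c \<notin> set p) (hol T (f k)) (hol T' (f' k)) \<and> cg N (\<lambda>p. c \<notin> set p) (ihol T (f k)) (ihol T' (f' k))"
    "\<And>c k cs1 cs2 us a s vs. c < length C \<Longrightarrow> C ! c = cs1 @ Hole k # cs2 \<Longrightarrow>
       f k = us @ EP a True s # vs \<Longrightarrow> cg N (\<lambda>p. True) (T a) (col T c (fillrow f cs1 @ us))"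
    using assms(2)[OF s'] by blast
  show "\<exists>T. sol N (fill f C) T \<and> (\<forall>c<length (fill f C). cg N (\<lambda>p. c \<notin> set p) (hol T (fill f C ! c)) (hol T' (fill f' C ! c)))"
  proof (intro exI[of _ T] conjI allI impI)
    show "sol N (fill f C) T" by (rule hole_sol(1)[OF s']) (use T in blast)+
    show "cg N (\<lambda>p. c \<notin> set p) (hol T (fill f C ! c)) (hol T' (fill f' C ! c))" if "c < length (fill f C)" for c
      by (rule hole_sol(2)[OF s']) (use T that in \<open>auto\<close>)
  qed
qed

lemma inv_eqD:
  "inv_eq N D D' \<Longrightarrow> sol 0 D T \<Longrightarrow> sol 0 D' T' \<Longrightarrow> c < length D \<Longrightarrow>
     cg N (\<lambda>p. c \<notin> set p) (hol T (D ! c)) (hol T' (D' ! c))"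
  unfolding inv_eq_def by blast

lemma inv_eq_sym:
  assumes "length D = length D'" "inv_eq N D D'"
  shows "inv_eq N D' D"
  unfolding inv_eq_def
proof (intro allI impI)
  fix T T' c assume "sol 0 D' T" "sol 0 D T'" "c < length D'"
  then show "cg N (\<lambda>p. c \<notin> set p) (hol T (D' ! c)) (hol T' (D ! c))"
    using cg_sym[OF inv_eqD[OF assms(2), of T' T c]] assms(1) by metis
qed

text \<open>The middle diagram must have a solution, or the two hypotheses would be empty; this is
  what its well-formedness provides.\<close>

lemma inv_eq_trans:
  assumes "gd_wf m D2" "length D1 = m" "inv_eq N D1 D2" "inv_eq N D2 D3"
  shows "inv_eq N D1 D3"
proof -
  obtain T2 where T2: "sol 0 D2 T2" using sol_exists[OF assms(1)] .
  have "length D2 = length D1" using assms by (simp add: gd_wf_def)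
  show ?thesis unfolding inv_eq_def
  proof (intro allI impI)
    fix T T' c assume a: "sol 0 D1 T" "sol 0 D3 T'" "c < length D1"
    then have c: "c < length D2" using \<open>length D2 = length D1\<close> by metis
    show "cg N (\<lambda>p. c \<notin> set p) (hol T (D1 ! c)) (hol T' (D3 ! c))"
      by (rule cg_trans[OF inv_eqD[OF assms(3) a(1) T2 a(3)] inv_eqD[OF assms(4) T2 a(2) c]])
  qed
qed

lemma inv_eq_refl: "gd_wf m D \<Longrightarrow> inv_eq N D D"
proof (rule inv_eqI)
  fix T' assume "sol 0 D T'"
  then show "\<exists>T. sol N D T \<and> (\<forall>c<length D. cg N (\<lambda>p. c \<notin> set p) (hol T (D ! c)) (hol T' (D ! c)))"
    using sol_mono cg_refl by (intro exI[of _ T']) blast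
qed

lemma inv_eq_mono: "inv_eq 0 D D' \<Longrightarrow> inv_eq N D D'"
  unfolding inv_eq_def
proof (intro allI impI)
  fix T T' c assume "\<forall>T T'. sol 0 D T \<longrightarrow> sol 0 D' T' \<longrightarrow> (\<forall>c<length D. cg 0 (\<lambda>p. c \<notin> set p) (hol T (D ! c)) (hol T' (D' ! c)))"
    "sol 0 D T" "sol 0 D' T'" "c < length D"
  then have "cg 0 (\<lambda>p. c \<notin> set p) (hol T (D ! c)) (hol T' (D' ! c))" by blast
  then show "cg N (\<lambda>p. c \<notin> set p) (hol T (D ! c)) (hol T' (D' ! c))" by (rule cg_mono) simp_all
qed

lemma tail_in_hole:
  assumes "sol 0 (fill f C) T" "c < length C" "C ! c = cs1 @ Hole k # cs2" "f k = us @ EP a True s # vs"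
  shows "T a = col T c (fillrow f cs1 @ us)"
  by (rule sol_0_D[OF assms(1), of c _ a s "vs @ fillrow f cs2"]) (use assms in simp_all)

lemma hole_exists:
  assumes "ctx K C" "k < K"
  obtains c cs1 cs2 where "c < length C" "C ! c = cs1 @ Hole k # cs2"
proof -
  have "count_list (concat C) (Hole k) \<noteq> 0" using assms by (simp add: ctx_def)
  then have "Hole k \<in> set (concat C)" by (metis count_list_0_iff)
  then show ?thesis using that by (metis in_concat_nth split_list)
qed

lemma hole_row_unique:
  assumes "ctx K C" "c < length C" "c' < length C" "Hole k \<in> set (C ! c)" "Hole k \<in> set (C ! c')"
  shows "c = c'"
proof -
  let ?F = "map (filter ((=) (Hole k))) C"
  have "k < K" using assms unfolding ctx_def in_concat_nth by blast
  then have "length (filter ((=) (Hole k)) (concat C)) = 1"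
    using assms(1) by (simp add: ctx_def count_list_eq_length_filter)
  then have "distinct (filter ((=) (Hole k)) (concat C))"
    by (cases "filter ((=) (Hole k)) (concat C)") auto
  then have "distinct (concat ?F)" by (simp add: filter_concat)
  then show ?thesis using assms by (intro distinct_rows[of ?F c c' "Hole k"]) auto
qed

lemma concat_fill: "concat (fill f C) = fillrow f (concat C)"
  by (induction C) (auto simp: fill_eq)

lemma mset_fillrow:
  assumes "\<And>k. Hole k \<in> set xs \<Longrightarrow> k < K"
  shows "mset (fillrow f xs) = mset (fillrow (\<lambda>_. []) xs) + (\<Sum>k<K. repeat_mset (count_list xs (Hole k)) (mset (f k)))"
  using assms
proof (induction xs)
  case (Cons z xs)
  show ?case
  proof (cases z)
    case (Lit e)
    then show ?thesis using Cons by simp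
  next
    case (Hole j)
    then have j: "j < K" using Cons.prems by auto
    have "(\<Sum>k<K. repeat_mset (count_list (z # xs) (Hole k)) (mset (f k)))
        = (\<Sum>k<K. (if k = j then mset (f k) else {#}) + repeat_mset (count_list xs (Hole k)) (mset (f k)))"
      using Hole by (intro sum.cong) auto
    also have "\<dots> = mset (f j) + (\<Sum>k<K. repeat_mset (count_list xs (Hole k)) (mset (f k)))"
      using j by (simp add: sum.distrib sum.delta')
    finally show ?thesis using Cons Hole by (simp add: ac_simps)
  qed
qed simp

lemma mset_fill:
  assumes "ctx K C"
  shows "mset (concat (fill f C)) = mset (fillrow (\<lambda>_. []) (concat C)) + (\<Sum>k<K. mset (f k))"
proof -
  have "(\<Sum>k<K. repeat_mset (count_list (concat C) (Hole k)) (mset (f k))) = (\<Sum>k<K. mset (f k))"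
    using assms by (intro sum.cong) (auto simp: ctx_def)
  then show ?thesis using mset_fillrow[of "concat C" K f] assms
    unfolding concat_fill ctx_def by presburger
qed

lemma lit_in_fill: "c < length C \<Longrightarrow> Lit e \<in> set (C ! c) \<Longrightarrow> e \<in># mset (fillrow (\<lambda>_. []) (concat C))"
  by (force simp: fillrow_def in_set_conv_nth[of _ C])

lemma fillrow_hol:
  assumes "\<And>e. Lit e \<in> set cs \<Longrightarrow> T (lab e) = T' (lab e)"
    and "\<And>k. Hole k \<in> set cs \<Longrightarrow> hol T (f k) = hol T' (f' k) \<and> ihol T (f k) = ihol T' (f' k)"
  shows "hol T (fillrow f cs) = hol T' (fillrow f' cs) \<and> ihol T (fillrow f cs) = ihol T' (fillrow f' cs)"
  using assms
proof (induction cs)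
  case (Cons z cs)
  show ?case
  proof (cases z)
    case (Lit e)
    then have "T (lab e) = T' (lab e)" using Cons.prems(1)[of e] by simp
    then show ?thesis using Cons Lit by (simp add: hfac_def hifac_def)
  next
    case (Hole k)
    then show ?thesis using Cons by simp
  qed
qed simp

section \<open>Invariance of the strand products under the individual moves\<close>

lemma cg_one_head: "cg N P z 0 \<Longrightarrow> cg N P 1 (1 + sgz s z) \<and> cg N P 1 (1 - sgz s z)"
proof -
  assume "cg N P z 0"
  then have "cg N P (sgz s z) (sgz s 0)" by (rule sgz_cg)
  moreover have "sgz s 0 = 0" by (simp add: sgz_def)
  ultimately have "cg N P 0 (sgz s z)" using cg_sym by metis
  then show ?thesis using cg_add[OF cg_refl[of N P 1], of 0 "sgz s z"] cg_diff[OF cg_refl[of N P 1], of 0 "sgz s z"] by simp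
qed

text \<open>The arrow of a kink is a self-arrow, so the factor at its head is 1 away from the
  variable of the strand. As D has fewer arrows than D', the solution of D' serves for D unchanged;
  the same holds for the R2, self-arrow and twist moves.\<close>

lemma inv_eq_r1:
  assumes wf: "gd_wf m D" and "r1_move D D'"
  shows "inv_eq 0 D D'"
proof -
  obtain C a s t where C: "ctx 1 C" and D: "D = fill (\<lambda>_. []) C"
    "D' = fill (\<lambda>_. [EP a t s, EP a (\<not> t) s]) C"
    using assms(2) unfolding r1_move_def by blast
  let ?f = "\<lambda>_. [EP a t s, EP a (\<not> t) s]"
  show ?thesis unfolding D
  proof (rule inv_eq_hole[OF wf[unfolded D]], rule exI, intro conjI allI impI)
    fix T' c k assume s: "sol 0 (fill ?f C) T'" and c: "c < length C" and "Hole k \<in> set (C ! c)"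
    then obtain cs1 cs2 where cs: "C ! c = cs1 @ Hole k # cs2" by (meson split_list)
    have "\<exists>us. T' a = col T' c (fillrow ?f cs1 @ us)"
    proof (cases t)
      case True
      then show ?thesis using tail_in_hole[OF s c cs, of "[]" a] by (intro exI[of _ "[]"]) simp
    next
      case False
      then show ?thesis using tail_in_hole[OF s c cs, of "[EP a False s]" a]
        by (intro exI[of _ "[EP a False s]"]) simp
    qed
    then have "cg 0 (\<lambda>p. c \<notin> set p) (T' a) 0" using col_avoid by metis
    from cg_one_head[OF this, of s]
    show "cg 0 (\<lambda>p. c \<notin> set p) (hol T' []) (hol T' [EP a t s, EP a (\<not> t) s])"
      "cg 0 (\<lambda>p. c \<notin> set p) (ihol T' []) (ihol T' [EP a t s, EP a (\<not> t) s])"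
      by (cases t; simp add: hfac_def hifac_def)+
  qed simp_all
qed

text \<open>As for a kink: the head has the colour of an arc of its own strand. The condition that
  both holes lie in one row is used through \<open>hole_row_unique\<close>.\<close>

lemma inv_eq_sv:
  assumes wf: "gd_wf m D" and "sv_move D D'"
  shows "inv_eq 0 D D'"
proof -
  obtain C a s c0 where C: "ctx 2 C" and c0: "c0 < length C" "Hole 0 \<in> set (C ! c0)" "Hole 1 \<in> set (C ! c0)"
    and D: "D = fill (\<lambda>_. []) C" "D' = fill (\<lambda>k. if k = 0 then [EP a True s] else [EP a False s]) C"
    using assms(2) unfolding sv_move_def by blast
  let ?f = "\<lambda>k::nat. if k = 0 then [EP a True s] else [EP a False s]"
  show ?thesis unfolding D
  proof (rule inv_eq_hole[OF wf[unfolded D]], rule exI, intro conjI allI impI)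
    fix T' c and k :: nat assume s: "sol 0 (fill ?f C) T'" and c: "c < length C" and k: "Hole k \<in> set (C ! c)"
    have "k < 2" using C k c unfolding ctx_def in_concat_nth by blast
    obtain cs1 cs2 where cs: "C ! c0 = cs1 @ Hole 0 # cs2" using c0 by (meson split_list)
    have T: "T' a = col T' c0 (fillrow ?f cs1)" using tail_in_hole[OF s c0(1) cs, of "[]" a s "[]"] by simp
    have "cg 0 (\<lambda>p. c \<notin> set p) (T' a) 0" if "k = 1"
    proof -
      have "c = c0" using hole_row_unique[OF C c c0(1), of 1] k c0 that by simp
      then show ?thesis using T col_avoid by metis
    qed
    from cg_one_head[OF this, of s] \<open>k < 2\<close>
    show "cg 0 (\<lambda>p. c \<notin> set p) (hol T' []) (hol T' (if k = 0 then [EP a True s] else [EP a False s]))"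
      "cg 0 (\<lambda>p. c \<notin> set p) (ihol T' []) (ihol T' (if k = 0 then [EP a True s] else [EP a False s]))"
      by (cases "k = 0"; simp add: hfac_def hifac_def)+
  qed simp_all
qed

lemma sgz_square: "z * z = 0 \<Longrightarrow> (1 + sgz s z) * (1 - sgz s z) = 1 \<and> (1 - sgz s z) * (1 + sgz s z) = 1"
  by (simp add: sgz_def algebra_simps)

lemma sgz_not: "sgz (\<not> s) z = - sgz s z"
  by (simp add: sgz_def)

lemma sgz_swap:
  assumes "A * Z = Z' * A"
  shows "A * (1 + sgz s Z) = (1 + sgz s Z') * A" "A * (1 - sgz s Z) = (1 - sgz s Z') * A"
  using assms by (simp_all add: sgz_def distrib_left distrib_right left_diff_distrib right_diff_distrib)

lemma hol_tails: "(\<And>e. e \<in> set es \<Longrightarrow> is_tail e) \<Longrightarrow> hol T es = 1 \<and> ihol T es = 1"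
  by (induction es) (auto simp: hfac_def hifac_def)

lemma col_append_tails: "(\<And>e. e \<in> set us \<Longrightarrow> is_tail e) \<Longrightarrow> col T c (xs @ us) = col T c xs"
  using hol_tails[of us T] by (simp add: col_def)

text \<open>No undercrossing separates the two tails, so they carry the same colour, and the
  opposite signs make the two head factors inverse in either order.\<close>

lemma inv_eq_r2:
  assumes wf: "gd_wf m D" and "r2_move D D'"
  shows "inv_eq 0 D D'"
proof -
  obtain C a b s h where C: "ctx 2 C" and D: "D = fill (\<lambda>_. []) C"
    "D' = fill (\<lambda>k. if k = 0 then [EP a True s, EP b True (\<not> s)]
                       else ord2 h (EP a False s) (EP b False (\<not> s))) C"
    using assms(2) unfolding r2_move_def by blast
  let ?f = "\<lambda>k::nat. if k = 0 then [EP a True s, EP b True (\<not> s)] else ord2 h (EP a False s) (EP b False (\<not> s))"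
  show ?thesis unfolding D
  proof (rule inv_eq_hole[OF wf[unfolded D]], rule exI, intro conjI allI impI)
    fix T' c and k :: nat assume s: "sol 0 (fill ?f C) T'"
    obtain c0 cs1 cs2 where c0: "c0 < length C" and cs: "C ! c0 = cs1 @ Hole 0 # cs2" using hole_exists[OF C, of 0] by auto
    have a: "T' a = col T' c0 (fillrow ?f cs1)"
      using tail_in_hole[OF s c0(1) cs, of "[]" a s "[EP b True (\<not> s)]"] by simp
    have b: "T' b = col T' c0 (fillrow ?f cs1)"
      using tail_in_hole[OF s c0(1) cs, of "[EP a True s]" b "\<not> s" "[]"]
        col_append_tails[of "[EP a True s]" T' c0 "fillrow ?f cs1"] by simp
    have "T' b = T' a" "T' a * T' a = 0" using a b by (simp_all add: col_square)
    then have "hol T' (?f k) = 1 \<and> ihol T' (?f k) = 1"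
      using sgz_square[of "T' a" s] by (auto simp: ord2_def hfac_def hifac_def sgz_not)
    then show "cg 0 (\<lambda>p. c \<notin> set p) (hol T' []) (hol T' (?f k))"
      "cg 0 (\<lambda>p. c \<notin> set p) (ihol T' []) (ihol T' (?f k))" by (simp_all only: hol_simps ihol_simps cg_refl)
  qed simp_all
qed

text \<open>Passing over a crossing does not change the colour of an arc.\<close>

lemma inv_eq_oc:
  assumes wf: "gd_wf m D" and "oc_move D D'"
  shows "inv_eq 0 D D'"
proof -
  obtain C a b s t where C: "ctx 1 C" and D: "D = fill (\<lambda>_. [EP a True s, EP b True t]) C"
    "D' = fill (\<lambda>_. [EP b True t, EP a True s]) C"
    using assms(2) unfolding oc_move_def by blast
  let ?f = "\<lambda>_::nat. [EP a True s, EP b True t]" and ?f' = "\<lambda>_::nat. [EP b True t, EP a True s]"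
  show ?thesis unfolding D
  proof (rule inv_eq_hole[OF wf[unfolded D]], rule exI, intro conjI allI impI)
    fix T' c k cs1 cs2 us x sx vs
    assume s: "sol 0 (fill ?f' C) T'" and c: "c < length C" and cs: "C ! c = cs1 @ Hole k # cs2"
      and us: "?f k = us @ EP x True sx # vs"
    have usx: "(us = [] \<and> x = a) \<or> (us = [EP a True s] \<and> x = b)"
      using us by (auto simp: Cons_eq_append_conv)
    have 1: "T' b = col T' c (fillrow ?f' cs1)"
      using tail_in_hole[OF s c cs, of "[]" b] by simp
    have 2: "T' a = col T' c (fillrow ?f' cs1)"
      using tail_in_hole[OF s c cs, of "[EP b True t]" a]
        col_append_tails[of "[EP b True t]" T' c "fillrow ?f' cs1"] by simp
    have 3: "hol T' (fillrow ?f cs1) = hol T' (fillrow ?f' cs1) \<and> ihol T' (fillrow ?f cs1) = ihol T' (fillrow ?f' cs1)"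
      by (rule fillrow_hol) (simp_all add: hfac_def hifac_def)
    then have "T' x = col T' c (fillrow ?f cs1)" using 1 2 usx unfolding col_def by auto
    moreover have "col T' c (fillrow ?f cs1 @ us) = col T' c (fillrow ?f cs1)"
      using usx by (intro col_append_tails) auto
    ultimately show "cg 0 (\<lambda>p. True) (T' x) (col T' c (fillrow ?f cs1 @ us))" by simp
  qed (simp_all add: hfac_def hifac_def)
qed

lemma inv_eq_relabel:
  assumes wf: "gd_wf m D" and "relabel D D'"
  shows "inv_eq 0 D D'"
proof -
  obtain \<pi> where "inj \<pi>" and D': "D' = map (map (\<lambda>e. EP (\<pi> (lab e)) (is_tail e) (psgn e))) D"
    using assms(2) unfolding relabel_def by blast
  let ?r = "\<lambda>e. EP (\<pi> (lab e)) (is_tail e) (psgn e)"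
  have h: "hol T' (map ?r xs) = hol (T' \<circ> \<pi>) xs \<and> ihol T' (map ?r xs) = ihol (T' \<circ> \<pi>) xs" for T' xs
    by (induction xs) (auto simp: hfac_def hifac_def)
  show ?thesis
  proof (rule inv_eqI[OF wf])
    fix T' assume s: "sol 0 D' T'"
    have "sol 0 D (T' \<circ> \<pi>)" unfolding sol_0
    proof (intro allI impI)
      fix c xs a s' ys assume c: "c < length D" "D ! c = xs @ EP a True s' # ys"
      have "T' (\<pi> a) = col T' c (map ?r xs)"
        by (rule sol_0_D[OF s, of c _ _ s' "map ?r ys"]) (use c D' in simp_all)
      then show "(T' \<circ> \<pi>) a = col (T' \<circ> \<pi>) c xs" using h by (simp add: col_def)
    qed
    then show "\<exists>T. sol 0 D T \<and> (\<forall>c<length D. cg 0 (\<lambda>p. c \<notin> set p) (hol T (D ! c)) (hol T' (D' ! c)))"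
      using h D' by (intro exI[of _ "T' \<circ> \<pi>"]) simp
  qed
qed

lemma wfm_tail_label:
  assumes "wfm M" "{#EP z b s, EP z b' s', e#} \<subseteq># M" 
  shows "lab e \<noteq> z"
proof
  assume e: "lab e = z"
  have "EP z b s \<in># M" using assms(2) by (meson mset_subset_eqD union_single_eq_member)
  then obtain s0 where "filter_mset (\<lambda>e. lab e = z) M = {#EP z True s0, EP z False s0#}"
    using assms(1) unfolding wfm_def by (metis ep.sel(1))
  moreover have "filter_mset (\<lambda>e. lab e = z) {#EP z b s, EP z b' s', e#} \<subseteq># filter_mset (\<lambda>e. lab e = z) M"
    using assms(2) by (rule multiset_filter_mono)
  ultimately have "size {#EP z b s, EP z b' s', e#} \<le> size {#EP z True s0, EP z False s0#}"
    using e size_mset_mono by fastforce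
  then show False by simp
qed

text \<open>The arrows x and y start on the same arc of the top strand. The move changes on which
  side of x the middle strand emits z, so the colour of z is conjugated by that of x; on the bottom
  strand this is compensated by exchanging y and z.\<close>

lemma inv_eq_r3:
  assumes wf: "gd_wf m D" and "r3_move D D'"
  shows "inv_eq 0 D D'"
proof -
  obtain C x y z sx sy sz oT oM oB where C: "ctx 3 C"
    and cond: "(oM = oT) \<longleftrightarrow> (sy = sz)" "(oB = oT) \<longleftrightarrow> (sx = sz)"
    and D: "D = fill (r3_blocks x y z sx sy sz oT oM oB) C"
      "D' = fill (r3_blocks x y z sx sy sz (\<not> oT) (\<not> oM) (\<not> oB)) C"
    using assms(2) unfolding r3_move_def by (elim exE conjE) (rule that)
  let ?f = "r3_blocks x y z sx sy sz oT oM oB" and ?f' = "r3_blocks x y z sx sy sz (\<not> oT) (\<not> oM) (\<not> oB)"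
  let ?M = "mset (concat D)" and ?L = "mset (fillrow (\<lambda>_. []) (concat C))"
  have M: "?M = ?L + {#EP x True sx, EP y True sy, EP x False sx, EP z True sz, EP y False sy, EP z False sz#}"
    using mset_fill[OF C, of ?f] unfolding D
    by (simp add: numeral_3_eq_3 r3_blocks_def ord2_def)
  have wfM: "wfm ?M" using wf by (simp add: gd_wf_iff)
  have "{#EP z True sz, EP z False sz, EP x True sx#} \<subseteq># ?M" "{#EP z True sz, EP z False sz, EP y True sy#} \<subseteq># ?M"
    unfolding M by (rule subset_mset.add_increasing; simp)+
  from this[THEN wfm_tail_label[OF wfM]] have xz: "x \<noteq> z" and yz: "y \<noteq> z" by simp_all
  have Lz: "lab e \<noteq> z" if "c < length C" "Lit e \<in> set (C ! c)" for c e
  proof -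
    have "{#e#} \<subseteq># ?L" using lit_in_fill[OF that] by simp
    then have "{#e#} + {#EP z True sz, EP z False sz#} \<subseteq># ?L + {#EP x True sx, EP y True sy, EP x False sx, EP z True sz, EP y False sy, EP z False sz#}"
      by (intro subset_mset.add_mono) simp_all
    then show ?thesis using wfm_tail_label[OF wfM, of z True sz False sz e] unfolding M by (simp add: add_mset_commute)
  qed
  show ?thesis unfolding D
  proof (rule inv_eq_hole[OF wf[unfolded D]])
    fix T' assume s: "sol 0 (fill ?f' C) T'"
    define t where "t = T' x"
    have xy: "T' x = col T' c (fillrow ?f' cs1)" "T' y = col T' c (fillrow ?f' cs1)"
      if "c < length C" "C ! c = cs1 @ Hole 0 # cs2" for c cs1 cs2
    proof -
      let ?ux = "if oT then [EP y True sy] else []" and ?uy = "if oT then [] else [EP x True sx]"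
      have "?f' 0 = ?ux @ EP x True sx # (if oT then [] else [EP y True sy])"
        "?f' 0 = ?uy @ EP y True sy # (if oT then [EP x True sx] else [])"
        by (simp_all add: r3_blocks_def ord2_def)
      from this[THEN tail_in_hole[OF s that]]
      have "T' x = col T' c (fillrow ?f' cs1 @ ?ux)" "T' y = col T' c (fillrow ?f' cs1 @ ?uy)" .
      moreover have "col T' c (fillrow ?f' cs1 @ ?ux) = col T' c (fillrow ?f' cs1)"
        "col T' c (fillrow ?f' cs1 @ ?uy) = col T' c (fillrow ?f' cs1)"
        by (intro col_append_tails; auto split: if_splits)+
      ultimately show "T' x = col T' c (fillrow ?f' cs1)" "T' y = col T' c (fillrow ?f' cs1)" by simp_all
    qed
    obtain c0 as bs where c0: "c0 < length C" "C ! c0 = as @ Hole 0 # bs" using hole_exists[OF C, of 0] by auto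
    have ty: "T' y = t" and tt: "t * t = 0" using xy[OF c0] by (simp_all add: t_def col_square)
    \<comment> \<open>In the diagram D the tail of z comes after the head of x exactly when
      \<open>oM\<close>; in D' it is the other way round. Hence the colour of z in D is that in D'
      conjugated by the factor at x, or by its inverse.\<close>
    define \<tau> where "\<tau> = (if oM then sx else \<not> sx)"
    define Z where "Z = (1 - sgz \<tau> t) * (T' z * (1 + sgz \<tau> t))"
    \<comment> \<open>The label z differs from x, y and all labels outside the disk, so recolouring
      it disturbs nothing else.\<close>
    define T where "T = T'(z := Z)"
    have T: "T x = t" "T y = t" "T z = Z" using xz yz ty by (simp_all add: T_def t_def)
    have inv: "(1 + sgz \<sigma> t) * (1 - sgz \<sigma> t) = 1" "(1 - sgz \<sigma> t) * (1 + sgz \<sigma> t) = 1" for \<sigma>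
      using sgz_square[OF tt] by auto
    have inv': "(1 + sgz \<sigma> t) * ((1 - sgz \<sigma> t) * w) = w" "(1 - sgz \<sigma> t) * ((1 + sgz \<sigma> t) * w) = w" for \<sigma> w
      using inv[of \<sigma>] by (simp_all add: mult.assoc[symmetric])
    \<comment> \<open>The two planarity conditions on signs and orders say precisely that the
      conjugation needed on the middle strand is the one that the exchange on the bottom strand
      undoes.\<close>
    have tau: "\<tau> = (if oB then sy else \<not> sy)" using cond by (auto simp: \<tau>_def)
    have swap: "oB \<Longrightarrow> (1 + sgz sy t) * Z = T' z * (1 + sgz sy t) \<and> Z * (1 - sgz sy t) = (1 - sgz sy t) * T' z"
      "\<not> oB \<Longrightarrow> Z * (1 + sgz sy t) = (1 + sgz sy t) * T' z \<and> (1 - sgz sy t) * Z = T' z * (1 - sgz sy t)"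
      unfolding Z_def tau by (simp_all only: if_True if_False sgz_not mult.assoc inv inv' diff_minus_eq_add
          add_uminus_conv_diff mult_1_right simp_thms)
    have f2: "hol T (?f 2) = hol T' (?f' 2) \<and> ihol T (?f 2) = ihol T' (?f' 2)"
    proof (cases oB)
      case True
      have "hol T (?f 2) = (1 + sgz sy t) * (1 + sgz sz Z)" "hol T' (?f' 2) = (1 + sgz sz (T' z)) * (1 + sgz sy t)"
        "ihol T (?f 2) = (1 - sgz sz Z) * (1 - sgz sy t)" "ihol T' (?f' 2) = (1 - sgz sy t) * (1 - sgz sz (T' z))"
        using True T ty by (simp_all add: r3_blocks_def ord2_def hfac_def hifac_def)
      moreover have "(1 + sgz sy t) * (1 + sgz sz Z) = (1 + sgz sz (T' z)) * (1 + sgz sy t)"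
        using swap(1)[OF True] by (intro sgz_swap) simp
      moreover have "(1 - sgz sy t) * (1 - sgz sz (T' z)) = (1 - sgz sz Z) * (1 - sgz sy t)"
        using swap(1)[OF True] by (intro sgz_swap) simp
      ultimately show ?thesis by simp
    next
      case False
      have "hol T (?f 2) = (1 + sgz sz Z) * (1 + sgz sy t)" "hol T' (?f' 2) = (1 + sgz sy t) * (1 + sgz sz (T' z))"
        "ihol T (?f 2) = (1 - sgz sy t) * (1 - sgz sz Z)" "ihol T' (?f' 2) = (1 - sgz sz (T' z)) * (1 - sgz sy t)"
        using False T ty by (simp_all add: r3_blocks_def ord2_def hfac_def hifac_def)
      moreover have "(1 + sgz sy t) * (1 + sgz sz (T' z)) = (1 + sgz sz Z) * (1 + sgz sy t)"
        using swap(2)[OF False] by (intro sgz_swap) simp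
      moreover have "(1 - sgz sy t) * (1 - sgz sz Z) = (1 - sgz sz (T' z)) * (1 - sgz sy t)"
        using swap(2)[OF False] by (intro sgz_swap) simp
      ultimately show ?thesis by simp
    qed
    have fk: "hol T (?f k) = hol T' (?f' k) \<and> ihol T (?f k) = ihol T' (?f' k)" for k
    proof (cases "k = 0 \<or> k = 1")
      case True
      then show ?thesis using T by (elim disjE) (simp_all add: r3_blocks_def ord2_def hfac_def hifac_def t_def)
    next
      case False
      then have "?f k = ?f 2" "?f' k = ?f' 2" by (simp_all add: r3_blocks_def)
      then show ?thesis using f2 by simp
    qed
    have lits: "T (lab e) = T' (lab e)" if "c < length C" "Lit e \<in> set (C ! c)" for c e
      using Lz[OF that] by (simp add: T_def)
    show "\<exists>T.
      (\<forall>c e. c < length C \<longrightarrow> Lit e \<in> set (C ! c) \<longrightarrow> T (lab e) = T' (lab e)) \<and>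
      (\<forall>c k. c < length C \<longrightarrow> Hole k \<in> set (C ! c) \<longrightarrow>
       cg 0 (\<lambda>p. c \<notin> set p) (hol T (?f k)) (hol T' (?f' k)) \<and> cg 0 (\<lambda>p. c \<notin> set p) (ihol T (?f k)) (ihol T' (?f' k))) \<and>
      (\<forall>c k cs1 cs2 us a s vs. c < length C \<longrightarrow> C ! c = cs1 @ Hole k # cs2 \<longrightarrow>
       ?f k = us @ EP a True s # vs \<longrightarrow> cg 0 (\<lambda>p. True) (T a) (col T c (fillrow ?f cs1 @ us)))"
    proof (rule exI[of _ T], intro conjI allI impI)
      fix c k cs1 cs2 us a s' vs
      assume c: "c < length C" and cs: "C ! c = cs1 @ Hole k # cs2" and us: "?f k = us @ EP a True s' # vs"
      have row: "hol T (fillrow ?f cs1) = hol T' (fillrow ?f' cs1) \<and> ihol T (fillrow ?f cs1) = ihol T' (fillrow ?f' cs1)"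
        by (rule fillrow_hol) (use lits[OF c] fk cs in auto)
      have "T a = col T c (fillrow ?f cs1 @ us)"
      proof (cases "k = 0")
        case True
        then have usx: "(a = x \<or> a = y) \<and> (\<forall>e\<in>set us. is_tail e)"
          using us by (cases oT) (auto simp: r3_blocks_def ord2_def Cons_eq_append_conv)
        have "T a = col T' c (fillrow ?f' cs1)" using xy(1)[OF c cs[unfolded True]] usx T t_def by auto
        also have "\<dots> = col T c (fillrow ?f cs1)" using row by (simp add: col_def)
        also have "\<dots> = col T c (fillrow ?f cs1 @ us)" using usx by (intro col_append_tails[symmetric]) blast
        finally show ?thesis .
      next
        case False
        show ?thesis
        proof (cases "k = 1")
          case True
          have a: "a = z" and usx: "us = (if oM then [EP x False sx] else [])"
            using us True by (cases oM; auto simp: r3_blocks_def ord2_def Cons_eq_append_conv)+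
          let ?m = "col T' c (fillrow ?f' cs1)"
          have m: "col T c (fillrow ?f cs1 @ us) = (if oM then (1 - sgz sx t) * (?m * (1 + sgz sx t)) else ?m)"
            using row T by (simp add: usx col_def hfac_def hifac_def mult.assoc)
          have "T' z = (if oM then ?m else (1 - sgz sx t) * (?m * (1 + sgz sx t)))"
          proof (cases oM)
            case o: True
            then show ?thesis using tail_in_hole[OF s c cs, of "[]" z sz "[EP x False sx]"] True
              by (simp add: r3_blocks_def ord2_def)
          next
            case o: False
            then show ?thesis using tail_in_hole[OF s c cs, of "[EP x False sx]" z sz "[]"] True
              by (simp add: r3_blocks_def ord2_def col_def hfac_def hifac_def mult.assoc t_def)
          qed
          then show ?thesis unfolding m a T Z_def \<tau>_def
            using inv'[of sx] inv[of sx] by (simp add: sgz_not mult.assoc)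
        next
          case f: False
          then show ?thesis using us False by (cases oB) (auto simp: r3_blocks_def ord2_def Cons_eq_append_conv)
        qed
      qed
      then show "cg 0 (\<lambda>p. True) (T a) (col T c (fillrow ?f cs1 @ us))" by simp
    next
      fix c e assume "c < length C" "Lit e \<in> set (C ! c)"
      then show "T (lab e) = T' (lab e)" by (rule lits)
    next
      fix c k
      show "cg 0 (\<lambda>p. c \<notin> set p) (hol T (?f k)) (hol T' (?f' k))" "cg 0 (\<lambda>p. c \<notin> set p) (ihol T (?f k)) (ihol T' (?f' k))"
        using fk[of k] by (metis cg_refl)+
    qed
  qed
qed

lemma inv_eq_welded: "gd_wf m D \<Longrightarrow> welded_move D D' \<Longrightarrow> inv_eq 0 D D'"
  unfolding welded_move_def
  using inv_eq_r1 inv_eq_r2 inv_eq_r3 inv_eq_oc inv_eq_relabel by blast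

lemma coef_of_nat_mult: "coef (of_nat k * W) p = int k * coef W p"
  by (induction k) (auto simp: distrib_right)

text \<open>A product of equal square-zero perturbations of 1 is additive. The colours need only
  agree with Z on the monomials in P.\<close>

lemma block_hol:
  assumes "infixcl P" "Z * Z = 0"
    and "\<And>e. e \<in> set es \<Longrightarrow> \<not> is_tail e \<Longrightarrow> psgn e = s \<and> cg N P (T (lab e)) Z"
  shows "cg N P (hol T es) (1 + of_nat (length (filter (\<lambda>e. \<not> is_tail e) es)) * sgz s Z)"
    and "cg N P (ihol T es) (1 - of_nat (length (filter (\<lambda>e. \<not> is_tail e) es)) * sgz s Z)"
proof -
  let ?W = "sgz s Z"
  have WW: "?W * (of_nat k * ?W) = 0" "of_nat k * ?W * ?W = 0" for k
    using assms(2) by (simp_all add: sgz_def mult.assoc mult_of_nat_commute[symmetric] flip: mult.assoc)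
      (simp_all add: sgz_def mult.assoc)
  have "cg N P (hol T es) (1 + of_nat (length (filter (\<lambda>e. \<not> is_tail e) es)) * ?W) \<and>
    cg N P (ihol T es) (1 - of_nat (length (filter (\<lambda>e. \<not> is_tail e) es)) * ?W)"
    using assms(3)
  proof (induction es)
    case (Cons e es)
    let ?k = "length (filter (\<lambda>e. \<not> is_tail e) es)"
    have IH: "cg N P (hol T es) (1 + of_nat ?k * ?W)" "cg N P (ihol T es) (1 - of_nat ?k * ?W)"
      using Cons by auto
    show ?case
    proof (cases "is_tail e")
      case True
      then show ?thesis using IH by (simp add: hfac_def hifac_def)
    next
      case False
      then have e: "psgn e = s" "cg N P (sgz s (T (lab e))) ?W" using Cons.prems[of e] by (auto intro: sgz_cg)
      have "cg N P (hfac T e) (1 + ?W)" "cg N P (hifac T e) (1 - ?W)"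
        using False e by (auto simp: hfac_def hifac_def intro!: cg_add cg_diff)
      then have "cg N P (hfac T e * hol T es) ((1 + ?W) * (1 + of_nat ?k * ?W))"
        "cg N P (ihol T es * hifac T e) ((1 - of_nat ?k * ?W) * (1 - ?W))"
        using IH by (auto intro!: cg_mult assms(1))
      moreover have "(1 + ?W) * (1 + of_nat ?k * ?W) = 1 + of_nat (Suc ?k) * ?W"
        "(1 - of_nat ?k * ?W) * (1 - ?W) = 1 - of_nat (Suc ?k) * ?W"
        using WW by (simp_all add: algebra_simps)
      ultimately show ?thesis using False by simp
    qed
  qed simp
  then show "cg N P (hol T es) (1 + of_nat (length (filter (\<lambda>e. \<not> is_tail e) es)) * sgz s Z)"
    "cg N P (ihol T es) (1 - of_nat (length (filter (\<lambda>e. \<not> is_tail e) es)) * sgz s Z)" by auto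
qed

definition twist_fill :: "nat \<Rightarrow> (nat \<Rightarrow> nat) \<Rightarrow> bool \<Rightarrow> bool \<Rightarrow> bool \<Rightarrow> nat \<Rightarrow> ep list" where
  "twist_fill n a s fo par k = (if k = 0 then map (\<lambda>i. EP (a i) (fo = even i) s) [0..<2*n]
                       else (if par then id else rev)
                              (map (\<lambda>i. EP (a i) (fo \<noteq> even i) s) [0..<2*n]))"

lemma twist_move_iff: "twist_move n D D' \<longleftrightarrow>
  (\<exists>C a s fo par. ctx 2 C \<and> D = fill (\<lambda>_. []) C \<and> D' = fill (twist_fill n a s fo par) C)"
  unfolding twist_move_def twist_fill_def ..

lemma twist_fill_set: "set (twist_fill n a s fo par k) =
   (\<lambda>i. EP (a i) (if k = 0 then fo = even i else fo \<noteq> even i) s) ` {0..<2*n}"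
  by (auto simp: twist_fill_def)

lemma twist_fill_partner:
  assumes "e \<in> set (twist_fill n a s fo par k)" "\<not> is_tail e" "k < 2"
  shows "psgn e = s" "EP (lab e) True s \<in> set (twist_fill n a s fo par (1 - k))"
  using assms by (auto simp: twist_fill_set less_2_cases_iff)

text \<open>The over-strand alternates along the 2n half-twists, so each strand passes under n
  times, whichever strand starts.\<close>

lemma twist_fill_heads: "length (filter (\<lambda>e. \<not> is_tail e) (twist_fill n a s fo par k)) = n"
proof -
  have "length (filter (\<lambda>e. \<not> is_tail e) (map (\<lambda>i. EP (a i) (b = even i) s) [0..<2*n])) = n" for b
    by (induction n) auto
  moreover have "(fo \<noteq> even i) = ((\<not> fo) = even i)" for i :: nat by auto
  ultimately show ?thesis
    by (simp only: twist_fill_def id_apply length_rev rev_filter[symmetric] split: if_split) simp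
qed

text \<open>Inside the twist region the arc of the partner strand is conjugated only by colours of
  strand c, which are trivial away from c. So every head on c sees the colour with which the partner
  enters the region; if both pieces lie on one strand, that colour too is trivial, whence Z =
  0.\<close>

lemma twist_colour:
  assumes C: "ctx 2 C" and s: "sol 0 (fill (twist_fill n a sg fo par) C) T" and k: "k < 2"
    and c: "c < length C" "Hole k \<in> set (C ! c)"
    and c': "c' < length C" "C ! c' = cs1 @ Hole (1 - k) # cs2"
  defines "Z \<equiv> (if c = c' then 0 else col T c' (fillrow (twist_fill n a sg fo par) cs1))"
  assumes e: "e \<in> set (twist_fill n a sg fo par k)" "\<not> is_tail e"
  shows "psgn e = sg \<and> cg 0 (\<lambda>p. c \<notin> set p) (T (lab e)) Z"
proof -
  let ?f = "twist_fill n a sg fo par"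
  obtain us vs where us: "?f (1 - k) = us @ EP (lab e) True sg # vs"
    using twist_fill_partner(2)[OF e k] by (meson split_list)
  have T: "T (lab e) = col T c' (fillrow ?f cs1 @ us)" by (rule tail_in_hole[OF s c' us])
  have "cg 0 (\<lambda>p. c \<notin> set p) (T (lab e)) Z"
  proof (cases "c = c'")
    case True
    then show ?thesis using T col_avoid by (simp add: Z_def)
  next
    case False
    obtain ds1 ds2 where ds: "C ! c = ds1 @ Hole k # ds2" using c(2) by (meson split_list)
    have sgz0: "sgz sg 0 = 0" by (simp add: sgz_def)
    have "psgn d = sg \<and> cg 0 (\<lambda>p. c \<notin> set p) (T (lab d)) 0" if d: "d \<in> set us" "\<not> is_tail d" for d
    proof -
      have "d \<in> set (?f (1 - k))" using us d(1) by simp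
      then have "psgn d = sg" and "EP (lab d) True sg \<in> set (?f k)"
        using twist_fill_partner[of d n a sg fo par "1 - k"] d(2) k by (auto simp: less_2_cases_iff)
      then obtain us' vs' where "?f k = us' @ EP (lab d) True sg # vs'" by (meson split_list)
      then have "T (lab d) = col T c (fillrow ?f ds1 @ us')" using tail_in_hole[OF s c(1) ds] by blast
      then show ?thesis using col_avoid \<open>psgn d = sg\<close> by simp
    qed
    then have "cg 0 (\<lambda>p. c \<notin> set p) (hol T us) 1" "cg 0 (\<lambda>p. c \<notin> set p) (ihol T us) 1"
      using block_hol[OF infixcl_avoid, of 0 us sg 0 c T] sgz0 by simp_all
    then have "cg 0 (\<lambda>p. c \<notin> set p) (ihol T us * (ihol T (fillrow ?f cs1) * (X c' * (hol T (fillrow ?f cs1) * hol T us))))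
       (1 * (ihol T (fillrow ?f cs1) * (X c' * (hol T (fillrow ?f cs1) * 1))))"
      by (intro cg_mult infixcl_avoid cg_refl)
    then show ?thesis using T False by (simp add: Z_def col_def mult.assoc)
  qed
  then show ?thesis using twist_fill_partner(1)[OF e k] by simp
qed

text \<open>The n heads on a strand multiply to 1 + n Z up to sign, which is 1 modulo n.\<close>

lemma inv_eq_twist:
  assumes wf: "gd_wf m D" and "twist_move n D D'"
  shows "inv_eq (int n) D D'"
proof -
  obtain C a s fo par where C: "ctx 2 C" and D: "D = fill (\<lambda>_. []) C" "D' = fill (twist_fill n a s fo par) C"
    using assms(2) unfolding twist_move_iff by blast
  let ?f = "twist_fill n a s fo par"
  show ?thesis unfolding D
  proof (rule inv_eq_hole[OF wf[unfolded D]], rule exI, intro conjI allI impI)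
    fix T' c and k :: nat assume sl: "sol 0 (fill ?f C) T'" and c: "c < length C" and k: "Hole k \<in> set (C ! c)"
    have k2: "k < 2" using C k c unfolding ctx_def in_concat_nth by blast
    then have "1 - k < 2" by simp
    then obtain c' cs1 cs2 where c': "c' < length C" "C ! c' = cs1 @ Hole (1 - k) # cs2" using hole_exists[OF C] by blast
    define Z where "Z = (if c = c' then 0 else col T' c' (fillrow ?f cs1))"
    have Z: "Z * Z = 0" by (simp add: Z_def col_square)
    note tc = twist_colour[OF C sl k2 c k c', folded Z_def]
    have 0: "cg 0 (\<lambda>p. c \<notin> set p) (hol T' (?f k)) (1 + of_nat n * sgz s Z)"
      "cg 0 (\<lambda>p. c \<notin> set p) (ihol T' (?f k)) (1 - of_nat n * sgz s Z)"
      using block_hol[OF infixcl_avoid Z, of "?f k" s 0 c T'] tc by (simp_all add: twist_fill_heads)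
    have 1: "cg (int n) (\<lambda>p. c \<notin> set p) (hol T' (?f k)) (1 + of_nat n * sgz s Z)"
      "cg (int n) (\<lambda>p. c \<notin> set p) (ihol T' (?f k)) (1 - of_nat n * sgz s Z)"
      by (rule cg_mono[OF 0(1)]; simp) (rule cg_mono[OF 0(2)]; simp)
    have 2: "cg (int n) (\<lambda>p. c \<notin> set p) (1 + of_nat n * sgz s Z) 1" "cg (int n) (\<lambda>p. c \<notin> set p) (1 - of_nat n * sgz s Z) 1"
      by (simp_all add: cg_def coef_of_nat_mult)
    show "cg (int n) (\<lambda>p. c \<notin> set p) (hol T' []) (hol T' (?f k))"
      using cg_sym[OF cg_trans[OF 1(1) 2(1)]] by simp
    show "cg (int n) (\<lambda>p. c \<notin> set p) (ihol T' []) (ihol T' (?f k))"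
      using cg_sym[OF cg_trans[OF 1(2) 2(2)]] by simp
  qed simp_all
qed

section \<open>Linking numbers\<close>

definition lkw :: "(nat \<Rightarrow> nrs) \<Rightarrow> nat \<Rightarrow> ep \<Rightarrow> int" where
  "lkw T j e = (if is_tail e then 0 else (if psgn e then 1 else - 1) * coef (T (lab e)) [j])"

lemma coef_ihol_Nil [simp]: "(\<And>e. e \<in> set es \<Longrightarrow> coef (T (lab e)) [] = 0) \<Longrightarrow> coef (ihol T es) [] = 1"
  by (induction es) (auto simp: hifac_def sgz_def)

lemma coef_hol_single:
  assumes "\<And>e. e \<in> set es \<Longrightarrow> coef (T (lab e)) [] = 0"
  shows "coef (hol T es) [j] = sum_list (map (lkw T j) es)"
  using assms
proof (induction es)
  case (Cons e es)
  have "coef (hol T es) [] = 1" "coef (hfac T e) [] = 1" using Cons.prems by (auto simp: hfac_def sgz_def)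
  moreover have "coef (hfac T e) [j] = lkw T j e" by (auto simp: hfac_def lkw_def sgz_def coef_one)
  ultimately show ?case using Cons by (simp add: coef_mult)
qed (simp add: coef_one)

lemma sol_const:
  assumes "gd_wf m D" "sol 0 D T" "e \<in> set (concat D)"
  shows "coef (T (lab e)) [] = 0"
  using tail_occurs[OF assms(1,3)] sol_0_D[OF assms(2)] by (metis coef_col_Nil)

lemma row_subset: "c < length D \<Longrightarrow> e \<in> set (D ! c) \<Longrightarrow> e \<in> set (concat D)"
  unfolding in_concat_nth by blast

text \<open>Conjugation does not affect the linear part, so in degree one an arrow remembers only
  the strand of its tail.\<close>

lemma sol_single:
  assumes wf: "gd_wf m D" and s: "sol 0 D T" and c: "c < length D" "EP a True t \<in> set (D ! c)"
  shows "coef (T a) [j] = (if j = c then 1 else 0)"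
proof -
  obtain xs ys where xs: "D ! c = xs @ EP a True t # ys" using c(2) by (meson split_list)
  have "coef (T (lab e)) [] = 0" if "e \<in> set xs" for e
    using sol_const[OF wf s] row_subset[OF c(1)] that xs by simp
  then have "coef (col T c xs) [j] = (if j = c then 1 else 0)"
    unfolding col_def by (auto simp: coef_X_mid)
  then show ?thesis using sol_0_D[OF s c(1) xs] by simp
qed

definition lkd :: "(nat \<Rightarrow> nrs) \<Rightarrow> gdiag \<Rightarrow> nat \<Rightarrow> nat \<Rightarrow> int" where
  "lkd T D c j = coef (hol T (D ! c)) [j] - coef (hol T (D ! j)) [c]"

definition lk_eq :: "gdiag \<Rightarrow> gdiag \<Rightarrow> bool" where
  "lk_eq D D' \<longleftrightarrow> (\<forall>T T' c j. sol 0 D T \<longrightarrow> sol 0 D' T' \<longrightarrow> c < length D \<longrightarrow> j < length D \<longrightarrow> c \<noteq> j \<longrightarrow>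
     lkd T D c j = lkd T' D' c j)"

lemma inv_eq_lk_eq:
  assumes "inv_eq 0 D D'"
  shows "lk_eq D D'"
  unfolding lk_eq_def
proof (intro allI impI)
  fix T T' c j assume a: "sol 0 D T" "sol 0 D' T'" "c < length D" "j < length D" "c \<noteq> j"
  have "coef (hol T (D ! c)) [j] = coef (hol T' (D' ! c)) [j]"
    using inv_eqD[OF assms a(1,2,3)] a(5) by (auto simp: cg_def)
  moreover have "coef (hol T (D ! j)) [c] = coef (hol T' (D' ! j)) [c]"
    using inv_eqD[OF assms a(1,2,4)] a(5) by (auto simp: cg_def)
  ultimately show "lkd T D c j = lkd T' D' c j" by (simp add: lkd_def)
qed

lemma count_list_row: "c < length C \<Longrightarrow> count_list (C ! c) x \<le> count_list (concat C) x"
proof (induction C arbitrary: c)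
  case (Cons r C)
  then show ?case by (cases c) (auto intro: le_add2 order_trans)
qed simp

lemma if_product_sum:
  "int (if P then 1 else 0) * (x * (if Q then 1 else 0)) + int (if R then 1 else 0) * (x * (if S then 1 else 0))
    = x * ((if P \<and> Q then 1 else 0) + (if R \<and> S then 1 else 0))"
  by (cases P; cases Q; cases R; cases S; simp)

text \<open>Each of the two strands passes under the other n times, always with sign s, so both
  linking numbers change by the same amount and their difference is unaffected.\<close>

lemma lk_eq_twist:
  assumes wf: "gd_wf m D" "gd_wf m D'" and "twist_move n D D'"
  shows "lk_eq D D'"
proof -
  obtain C a s fo par where C: "ctx 2 C" and D: "D = fill (\<lambda>_. []) C" "D' = fill (twist_fill n a s fo par) C"
    using assms(3) unfolding twist_move_iff by blast
  let ?f = "twist_fill n a s fo par"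
  obtain A as1 as2 where A: "A < length C" "C ! A = as1 @ Hole 0 # as2" using hole_exists[OF C, of 0] by auto
  obtain B bs1 bs2 where B: "B < length C" "C ! B = bs1 @ Hole 1 # bs2" using hole_exists[OF C, of 1] by auto
  have cnt: "count_list (C ! c) (Hole k) = (if c = R then 1 else 0)"
    if "R < length C" "Hole k \<in> set (C ! R)" "k < 2" "c < length C" for c k R
  proof (cases "c = R")
    case True
    have "count_list (C ! R) (Hole k) \<le> 1"
      using count_list_row[of R C "Hole k"] that C by (simp add: ctx_def)
    moreover have "count_list (C ! R) (Hole k) \<noteq> 0" using that(2) by (metis count_list_0_iff)
    ultimately show ?thesis using True by simp
  next
    case False
    then have "Hole k \<notin> set (C ! c)" using hole_row_unique[OF C that(4,1)] that(2) by blast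
    then show ?thesis using False by (simp add: count_list_0_iff)
  qed
  show ?thesis unfolding lk_eq_def
  proof (intro allI impI)
    fix T T' c j assume T: "sol 0 D T" "sol 0 D' T'" and cj: "c < length D" "j < length D" "c \<noteq> j"
    define \<sigma> where "\<sigma> = (if s then 1 else - 1 :: int)"
    \<comment> \<open>Degree-one coefficients are signed counts. The heads in hole 0 belong to
      arrows from row B, those in hole 1 to arrows from row A, n of each.\<close>
    have rowsum: "sum_list (map (lkw T' j) (fillrow ?f cs)) = sum_list (map (lkw T j) (fillrow (\<lambda>_. []) cs))
        + (int (count_list cs (Hole 0)) * (int n * \<sigma> * (if j = B then 1 else 0))
        + int (count_list cs (Hole 1)) * (int n * \<sigma> * (if j = A then 1 else 0)))"
      if "c < length C" "set cs \<subseteq> set (C ! c)" for c j cs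
      using that(2)
    proof (induction cs)
      case (Cons z cs)
      show ?case
      proof (cases z)
        case (Lit e)
        have e: "e \<in> set (D ! c)" using Cons.prems Lit that(1) unfolding D
          by (force simp: fillrow_def)
        have cD: "c < length D" using that(1) D(1) by simp
        obtain r xs ys where r: "r < length D" "D ! r = xs @ EP (lab e) True (psgn e) # ys"
          by (rule tail_occurs[OF wf(1) row_subset[OF cD e]])
        have "Lit (EP (lab e) True (psgn e)) \<in> set (C ! r)"
        proof -
          have "fillrow (\<lambda>_. []) (C ! r) = xs @ EP (lab e) True (psgn e) # ys" using r D by simp
          then show ?thesis by (cases rule: fillrow_split) auto
        qed
        then have "EP (lab e) True (psgn e) \<in> set (D' ! r)" using r(1) unfolding D by (force simp: fillrow_def)
        then have "coef (T' (lab e)) [j] = coef (T (lab e)) [j]"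
          using sol_single[OF wf(2) T(2), of r "lab e" "psgn e" j] sol_single[OF wf(1) T(1), of r "lab e" "psgn e" j] r
          by (simp add: D)
        then have "lkw T' j e = lkw T j e" by (simp add: lkw_def)
        then show ?thesis using Cons Lit by simp
      next
        case (Hole k)
        then have k: "k < 2" using C Cons.prems that(1) unfolding ctx_def in_concat_nth by auto
        define R where "R = (if k = 0 then B else A)"
        have R: "R < length C" "Hole (1 - k) \<in> set (C ! R)" using A B k by (auto simp: R_def less_2_cases_iff)
        have blk: "sum_list (map (lkw T' j) es) = int (length (filter (\<lambda>e. \<not> is_tail e) es)) * (\<sigma> * (if j = R then 1 else 0))"
          if "set es \<subseteq> set (?f k)" for es
          using that
        proof (induction es)
          case (Cons e es)
          have "lkw T' j e = \<sigma> * (if j = R then 1 else 0)" if h: "\<not> is_tail e"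
          proof -
            have "e \<in> set (?f k)" using Cons.prems by simp
            note p = twist_fill_partner[OF this h k]
            have "EP (lab e) True s \<in> set (D' ! R)" using p(2) R unfolding D by (force simp: fillrow_def)
            then have "coef (T' (lab e)) [j] = (if j = R then 1 else 0)"
              using sol_single[OF wf(2) T(2), of R "lab e" s j] R D by simp
            then show ?thesis using h p(1) by (simp add: lkw_def \<sigma>_def)
          qed
          moreover have "lkw T' j e = 0" if "is_tail e" using that by (simp add: lkw_def)
          moreover have "sum_list (map (lkw T' j) es) = int (length (filter (\<lambda>e. \<not> is_tail e) es)) * (\<sigma> * (if j = R then 1 else 0))"
            using Cons.IH Cons.prems by simp
          ultimately show ?case by (cases "is_tail e") (simp_all only: list.map sum_list.Cons filter.simps if_True if_False
              simp_thms length_Cons of_nat_Suc distrib_right mult_1 add_0)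
        qed simp
        have "sum_list (map (lkw T' j) (?f k)) = int n * \<sigma> * (if j = R then 1 else 0)"
          using blk[of "?f k"] by (simp add: twist_fill_heads)
        then show ?thesis using Cons Hole k by (auto simp: R_def less_2_cases_iff algebra_simps)
      qed
    qed simp
    have chg: "coef (hol T' (D' ! c)) [j] = coef (hol T (D ! c)) [j]
        + int n * \<sigma> * ((if c = A \<and> j = B then 1 else 0) + (if c = B \<and> j = A then 1 else 0))"
      if c: "c < length D" for c j
    proof -
      have cC: "c < length C" using c D by simp
      have r: "D' ! c = fillrow ?f (C ! c)" "D ! c = fillrow (\<lambda>_. []) (C ! c)" using cC by (simp_all add: D)
      have c0: "count_list (C ! c) (Hole 0) = (if c = A then 1 else 0)"
        by (rule cnt) (use A cC in simp_all)
      have c1: "count_list (C ! c) (Hole 1) = (if c = B then 1 else 0)"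
        by (rule cnt) (use B cC in simp_all)
      have cD: "c < length D'" using cC by (simp add: D)
      have "coef (hol T' (D' ! c)) [j] = sum_list (map (lkw T' j) (D' ! c))"
        by (rule coef_hol_single, rule sol_const[OF wf(2) T(2)], rule row_subset[OF cD])
      also have "\<dots> = sum_list (map (lkw T j) (D ! c))
        + (int (if c = A then 1 else 0) * (int n * \<sigma> * (if j = B then 1 else 0))
        + int (if c = B then 1 else 0) * (int n * \<sigma> * (if j = A then 1 else 0)))"
        unfolding r rowsum[OF cC subset_refl] c0 c1 ..
      also have "sum_list (map (lkw T j) (D ! c)) = coef (hol T (D ! c)) [j]"
        by (rule coef_hol_single[symmetric], rule sol_const[OF wf(1) T(1)], rule row_subset[OF c])
      also have "int (if c = A then 1 else 0) * (int n * \<sigma> * (if j = B then 1 else 0))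
        + int (if c = B then 1 else 0) * (int n * \<sigma> * (if j = A then 1 else 0))
        = int n * \<sigma> * ((if c = A \<and> j = B then 1 else 0) + (if c = B \<and> j = A then 1 else 0))"
        by (rule if_product_sum)
      finally show ?thesis .
    qed
    \<comment> \<open>The change is symmetric under exchanging c and j, so it cancels in
      \<open>lkd\<close>.\<close>
    have "(if c = A \<and> j = B then 1 else 0) + (if c = B \<and> j = A then 1 else 0)
      = (if j = A \<and> c = B then 1 else 0) + (if j = B \<and> c = A then 1 else 0 :: int)"
      by (simp only: conj_commute add.commute)
    then show "lkd T D c j = lkd T' D' c j"
      unfolding lkd_def chg[OF cj(1)] chg[OF cj(2)] by (simp only: add_diff_cancel_right)
  qed
qed

lemma lk_eq_trans:
  assumes "gd_wf m D2" "length D1 = m" "lk_eq D1 D2" "lk_eq D2 D3"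
  shows "lk_eq D1 D3"
proof -
  obtain T2 where T2: "sol 0 D2 T2" using sol_exists[OF assms(1)] .
  have l: "length D2 = length D1" using assms by (simp add: gd_wf_def)
  show ?thesis unfolding lk_eq_def
  proof (intro allI impI)
    fix T T' c j assume a: "sol 0 D1 T" "sol 0 D3 T'" "c < length D1" "j < length D1" "c \<noteq> j"
    have "lkd T D1 c j = lkd T2 D2 c j" using assms(3) a T2 unfolding lk_eq_def by blast
    also have "\<dots> = lkd T' D3 c j" using assms(4) a T2 l unfolding lk_eq_def by metis
    finally show "lkd T D1 c j = lkd T' D3 c j" .
  qed
qed

lemma lk_eq_sym: "length D = length D' \<Longrightarrow> lk_eq D D' \<Longrightarrow> lk_eq D' D"
  unfolding lk_eq_def by metis

definition gstep_sv :: "nat \<Rightarrow> nat \<Rightarrow> gdiag \<Rightarrow> gdiag \<Rightarrow> bool" where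
  "gstep_sv n m D D' \<longleftrightarrow> gd_wf m D \<and> gd_wf m D' \<and> (welded_move D D' \<or> twist_move n D D' \<or> sv_move D D')"

lemma twon_sv_equiv_eq: "twon_sv_equiv n m = equivclp (gstep_sv n m)"
  unfolding twon_sv_equiv_def gstep_sv_def ..

lemma gstep_inv: "gstep_sv n m D D' \<Longrightarrow> inv_eq (int n) D D' \<and> lk_eq D D'"
  unfolding gstep_sv_def
  using inv_eq_welded inv_eq_sv inv_eq_twist lk_eq_twist inv_eq_lk_eq inv_eq_mono by metis

lemma equiv_inv:
  assumes "twon_sv_equiv n m D D'" "gd_wf m D"
  shows "gd_wf m D' \<and> inv_eq (int n) D D' \<and> lk_eq D D'"
  using assms(1) unfolding twon_sv_equiv_eq
proof (induction rule: equivclp_induct)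
  case base
  show ?case using assms(2) inv_eq_refl inv_eq_lk_eq by blast
next
  case (step y z)
  have w: "gd_wf m y" "gd_wf m z" using step(2) by (auto simp: gstep_sv_def)
  have l: "length y = length z" "length D = m" using w assms(2) by (auto simp: gd_wf_def)
  have "inv_eq (int n) y z \<and> lk_eq y z"
    using step(2) gstep_inv inv_eq_sym[OF l(1)[symmetric]] lk_eq_sym[OF l(1)[symmetric]] by blast
  then show ?case using step(3) w inv_eq_trans[OF w(1) l(2)] lk_eq_trans[OF w(1) l(2)] by blast
qed

section \<open>Milnor invariants as coefficients of the coloured longitudes\<close>

lemma conv_eq_0: "(\<And>u v. p = u @ v \<Longrightarrow> f u * g v = 0) \<Longrightarrow> conv f g p = 0"
proof (induction p arbitrary: f)
  case (Cons x p)
  have "conv (\<lambda>q. f (x # q)) g p = 0"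
  proof (rule Cons.IH)
    show "f (x # u) * g v = 0" if "p = u @ v" for u v using Cons.prems[of "x # u" v] that by simp
  qed
  moreover have "f [] * g (x # p) = 0" using Cons.prems[of "[]" "x # p"] by simp
  ultimately show ?case by simp
qed simp

lemma conv_sum: "(\<Sum>t\<le>length p. f (take t p) * g (drop t p)) = conv f g p"
proof (induction p arbitrary: f)
  case (Cons x p)
  have "(\<Sum>t\<le>length (x # p). f (take t (x # p)) * g (drop t (x # p)))
      = f [] * g (x # p) + (\<Sum>t\<le>length p. f (x # take t p) * g (drop t p))"
    by (simp only: length_Cons sum.atMost_Suc_shift) simp
  then show ?case using Cons[of "\<lambda>q. f (x # q)"] by simp
qed simp

text \<open>Components are numbered from 1 in \<open>lcoef\<close> and from 0 in \<open>nrs\<close>,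
  hence the shift by \<open>Suc\<close>. On distinct words the higher powers in the inverse of 1 + X
  i leave no trace.\<close>

lemma coef_lval_lcoef:
  assumes "distinct q"
  shows "lcoef (Suc i) b (map Suc q) = coef (lval (i, b)) q"
proof (cases q)
  case Nil
  then show ?thesis by (simp add: lcoef_def lval_def coef_X)
next
  case (Cons x r)
  then show ?thesis using assms by (cases r) (auto simp: lcoef_def lval_def coef_X coef_one)
qed

lemma mcoef_magnus:
  "distinct p \<Longrightarrow> mcoef (map (\<lambda>(c, b). (Suc c, b)) w) (map Suc p) = coef (magnus w) p"
proof (induction w arbitrary: p)
  case Nil
  then show ?case by (simp add: coef_one)
next
  case (Cons l w)
  obtain i b where l: "l = (i, b)" by (cases l)
  have "mcoef (map (\<lambda>(c, b). (Suc c, b)) (l # w)) (map Suc p)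
      = (\<Sum>t\<le>length p. lcoef (Suc i) b (map Suc (take t p)) * mcoef (map (\<lambda>(c, b). (Suc c, b)) w) (map Suc (drop t p)))"
    by (simp add: l take_map drop_map)
  also have "\<dots> = (\<Sum>t\<le>length p. coef (lval l) (take t p) * coef (magnus w) (drop t p))"
    using Cons by (intro sum.cong) (auto simp: coef_lval_lcoef l)
  also have "\<dots> = coef (magnus (l # w)) p" using Cons.prems by (simp add: conv_sum coef_mult)
  finally show ?case .
qed

section \<open>Evaluation of Wirtinger words through a colouring\<close>

abbreviation heads :: "ep list \<Rightarrow> ep list" where
  "heads \<equiv> filter (\<lambda>e. \<not> is_tail e)"

lemma hol_heads: "hol T (heads es) = hol T es" "ihol T (heads es) = ihol T es"
  by (induction es) (auto simp: hfac_def hifac_def)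

lemma col_heads: "col T c (heads es) = col T c es"
  by (simp add: col_def hol_heads)

text \<open>The j-th arc lies behind j - 1 undercrossings, which conjugate X c. Letters that are not
  generators get the value 1, since the free cancellations in \<open>killer\<close> allow arbitrary
  letters.\<close>

definition lcol :: "gdiag \<Rightarrow> (nat \<Rightarrow> nrs) \<Rightarrow> letter \<Rightarrow> nrs" where
  "lcol D T l = (if gen_ok D l then 1 + sgz (snd l) (col T (fst (fst l)) (take (snd (fst l) - 1) (heads (D ! fst (fst l))))) else 1)"

definition wval :: "gdiag \<Rightarrow> (nat \<Rightarrow> nrs) \<Rightarrow> letter list \<Rightarrow> nrs" where
  "wval D T w = prod_list (map (lcol D T) w)"

lemma wval_simps [simp]: "wval D T [] = 1" "wval D T (l # w) = lcol D T l * wval D T w"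
  "wval D T (u @ v) = wval D T u * wval D T v"
  by (simp_all add: wval_def)

lemma inv_letter_simps [simp]: "fst (inv_letter l) = fst l" "snd (inv_letter l) = (\<not> snd l)"
  by (simp_all add: inv_letter_def)

lemma inv_inv_letter [simp]: "inv_letter (inv_letter l) = l"
  by (simp add: inv_letter_def)

lemma gen_ok_inv [simp]: "gen_ok D (inv_letter l) = gen_ok D l"
  by (simp add: gen_ok_def)

lemma lcol_inv: "lcol D T l * lcol D T (inv_letter l) = 1"
  using sgz_square[OF col_square] by (auto simp: lcol_def sgz_not)

lemma invw_simps [simp]: "invw [] = []" "invw (l # w) = invw w @ [inv_letter l]" "invw (u @ v) = invw v @ invw u"
  by (simp_all add: invw_def)

lemma invw_invw [simp]: "invw (invw w) = w"
  by (induction w) auto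

lemma wval_invw: "wval D T w * wval D T (invw w) = 1"
proof (induction w)
  case (Cons l w)
  have "wval D T (l # w) * wval D T (invw (l # w))
      = lcol D T l * (wval D T w * wval D T (invw w)) * lcol D T (inv_letter l)"
    by (simp add: mult.assoc)
  then show ?case using Cons lcol_inv by simp
qed simp

lemma wval_invw': "wval D T (invw w) * wval D T w = 1"
  using wval_invw[of D T "invw w"] by simp

lemma wval_Nil_coef: "coef (wval D T w) [] = 1"
  by (induction w) (auto simp: lcol_def sgz_def)

lemma lcomm_snoc: "lcomm g (gs @ [h]) = comm (lcomm g gs) h"
  by (simp add: lcomm_def)

text \<open>Magnus' estimate: a commutator of weight q differs from 1 only in degrees at least
  q.\<close>

lemma wval_lcomm: "cg 0 (\<lambda>p. length p \<le> length gs) (wval D T (lcomm g gs)) 1"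
proof (induction gs rule: rev_induct)
  case Nil
  then show ?case by (simp add: cg_def wval_Nil_coef)
next
  case (snoc h gs)
  let ?x = "lcomm g gs" and ?k = "length gs"
  let ?a = "wval D T ?x" and ?b = "wval D T h" and ?a' = "wval D T (invw ?x)" and ?b' = "wval D T (invw h)"
  let ?d = "(?a - 1) * (?b - 1) - (?b - 1) * (?a - 1)"
  have a0: "coef (?a - 1) p = 0" if "distinct p" "length p \<le> ?k" for p
    using snoc that by (simp add: cg_def)
  have b0: "coef (?b - 1) [] = 0" by (simp add: wval_Nil_coef)
  have d0: "coef ?d p = 0" if p: "distinct p" "length p \<le> Suc ?k" for p
  proof -
    have "conv (coef (?a - 1)) (coef (?b - 1)) p = 0"
    proof (rule conv_eq_0)
      fix u v assume "p = u @ v"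
      then show "coef (?a - 1) u * coef (?b - 1) v = 0"
        using a0[of u] b0 p by (cases v) (auto simp: le_Suc_eq)
    qed
    moreover have "conv (coef (?b - 1)) (coef (?a - 1)) p = 0"
    proof (rule conv_eq_0)
      fix u v assume "p = u @ v"
      then show "coef (?b - 1) u * coef (?a - 1) v = 0"
        using a0[of v] b0 p by (cases u) (auto simp: le_Suc_eq)
    qed
    ultimately show ?thesis using p by (simp only: coef_diff coef_mult)
  qed
  \<comment> \<open>The group commutator minus 1 is a unit times the ring commutator of a - 1 and b
    - 1, which starts at least one degree above a - 1.\<close>
  have "?a * ?b = ?b * ?a + ?d" by (simp add: algebra_simps)
  then have "wval D T (comm ?x h) = ?a' * (?b' * (?b * ?a + ?d))"
    by (simp add: comm_def mult.assoc)
  also have "\<dots> = ?a' * ((?b' * ?b) * ?a) + (?a' * ?b') * ?d" by (simp add: distrib_left mult.assoc)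
  also have "\<dots> = 1 + (?a' * ?b') * ?d" by (simp add: wval_invw')
  finally have eq: "wval D T (comm ?x h) = 1 + (?a' * ?b') * ?d" .
  have "coef ((?a' * ?b') * ?d) p = 0" if p: "distinct p" "length p \<le> Suc ?k" for p
  proof -
    have "conv (coef (?a' * ?b')) (coef ?d) p = 0"
    proof (rule conv_eq_0)
      fix u v assume "p = u @ v"
      then have "coef ?d v = 0" using p by (intro d0) auto
      then show "coef (?a' * ?b') u * coef ?d v = 0" by (simp only: mult_zero_right)
    qed
    then show ?thesis using p by (simp only: coef_mult)
  qed
  then show ?case unfolding lcomm_snoc eq by (simp only: cg_def coef_add) simp
qed

text \<open>\<open>tail_loc\<close> is an arbitrary choice made without regard to the sign, but each
  admissible position is one at which the solution equation for this label holds.\<close>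

lemma u_letter_props:
  assumes wf: "gd_wf m D" and s: "sol 0 D T" and c: "c < length D" and j: "1 \<le> j" "j < narcs D c"
  shows "gen_ok D (u_letter D c j)" "lcol D T (u_letter D c j) = hfac T (heads (D ! c) ! (j - 1))"
proof -
  define e where "e = heads (D ! c) ! (j - 1)"
  have eh: "e \<in> set (heads (D ! c))" unfolding e_def using j by (intro nth_mem) (simp add: narcs_def)
  then have e: "e \<in> set (concat D)" "\<not> is_tail e" using row_subset[OF c] by auto
  let ?P = "\<lambda>cp. fst cp < length D \<and> snd cp < length (D ! fst cp) \<and>
      lab (D ! fst cp ! snd cp) = lab e \<and> is_tail (D ! fst cp ! snd cp)"
  obtain c1 xs ys where o: "c1 < length D" "D ! c1 = xs @ EP (lab e) True (psgn e) # ys"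
    using tail_occurs[OF wf e(1)] .
  have "?P (c1, length xs)" using o by simp
  moreover have tl: "tail_loc D (lab e) = (SOME cp. ?P cp)" by (simp add: tail_loc_def case_prod_unfold)
  ultimately have P: "?P (tail_loc D (lab e))" using someI[of ?P "(c1, length xs)"] by simp
  obtain c' p' where t: "tail_loc D (lab e) = (c', p')" by (cases "tail_loc D (lab e)")
  have P': "c' < length D" "p' < length (D ! c')" "lab (D ! c' ! p') = lab e" "is_tail (D ! c' ! p')"
    using P t by auto
  have u: "u_letter D c j = ((c', arc_at D c' p'), psgn e)"
    unfolding u_letter_def Let_def e_def[symmetric] t by simp
  have len: "length (heads (take p' (D ! c'))) \<le> length (heads (D ! c'))"
    by (metis append_take_drop_id filter_append le_add1 length_append)
  show ok: "gen_ok D (u_letter D c j)"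
    using len P' by (simp add: u gen_ok_def arc_at_def narcs_def)
  have "take (arc_at D c' p' - 1) (heads (D ! c')) = heads (take p' (D ! c'))"
    by (simp add: arc_at_def) (metis append_eq_conv_conj append_take_drop_id filter_append)
  then have "col T c' (take (arc_at D c' p' - 1) (heads (D ! c'))) = col T c' (take p' (D ! c'))"
    by (simp add: col_heads)
  also have "\<dots> = T (lab e)"
  proof -
    have "D ! c' = take p' (D ! c') @ EP (lab e) True (psgn (D ! c' ! p')) # drop (Suc p') (D ! c')"
      using P' id_take_nth_drop[OF P'(2)] by (metis ep.collapse)
    then show ?thesis using sol_0_D[OF s P'(1)] by metis
  qed
  finally show "lcol D T (u_letter D c j) = hfac T (heads (D ! c) ! (j - 1))"
    unfolding e_def[symmetric] using ok e(2) by (simp add: lcol_def u hfac_def)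
qed

text \<open>The next arc has by construction the colour of the previous one conjugated by the factor
  at the undercrossing, and 1 - z inverts 1 + z for a conjugate z of X c.\<close>

lemma wval_relator:
  assumes wf: "gd_wf m D" and s: "sol 0 D T" and c: "c < length D" and j: "1 \<le> j" "j < narcs D c"
  shows "wval D T (relator D c j) = 1"
proof -
  define e where "e = heads (D ! c) ! (j - 1)"
  define w where "w = col T c (take (j - 1) (heads (D ! c)))"
  have jl: "j - 1 < length (heads (D ! c))" using j by (simp add: narcs_def)
  then have ne: "\<not> is_tail e" using nth_mem[OF jl] by (auto simp: e_def)
  have u: "lcol D T (u_letter D c j) = hfac T e" using u_letter_props(2)[OF assms] by (simp add: e_def)
  have iu: "lcol D T (inv_letter (u_letter D c j)) = hifac T e"
  proof -
    have "lcol D T (inv_letter (u_letter D c j)) = 2 - lcol D T (u_letter D c j)"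
      using u_letter_props(1)[OF assms] by (simp add: lcol_def sgz_not)
    then show ?thesis using ne unfolding u by (simp add: hfac_def hifac_def)
  qed
  have "take j (heads (D ! c)) = take (j - 1) (heads (D ! c)) @ [e]"
    using take_Suc_conv_app_nth[OF jl] j by (simp add: e_def)
  then have cj: "col T c (take j (heads (D ! c))) = hifac T e * (w * hfac T e)"
    by (simp add: col_def w_def mult.assoc)
  have l1: "lcol D T ((c, Suc j), False) = 1 - hifac T e * (w * hfac T e)"
    using j c by (simp add: lcol_def gen_ok_def cj[symmetric] sgz_def)
  have l2: "lcol D T ((c, j), True) = 1 + w" using j c by (simp add: lcol_def gen_ok_def w_def sgz_def)
  have ie: "hifac T e * hfac T e = 1"
    using lcol_inv[of D T "inv_letter (u_letter D c j)"] by (simp add: u iu)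
  have "wval D T (relator D c j) = (1 - hifac T e * (w * hfac T e)) * (hifac T e * ((1 + w) * hfac T e))"
    by (simp add: relator_def l1 l2 u iu mult.assoc)
  also have "hifac T e * ((1 + w) * hfac T e) = 1 + hifac T e * (w * hfac T e)"
    by (simp add: distrib_left distrib_right ie)
  also have "(1 - hifac T e * (w * hfac T e)) * (1 + hifac T e * (w * hfac T e)) = 1"
    unfolding cj[symmetric] using col_square[of T c] by (simp add: algebra_simps)
  finally show ?thesis .
qed

lemma geq_wval:
  assumes wf: "gd_wf m D" and s: "sol 0 D T" and "geq D q w w'"
  shows "cg 0 (\<lambda>p. length p < q) (wval D T w) (wval D T w')"
proof -
  have cl: "infixcl (\<lambda>p. length p < q)" by (auto simp: infixcl_def)
  have k: "cg 0 (\<lambda>p. length p < q) (wval D T x) 1" if "killer D q x" for x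
    using that unfolding killer_def
  proof (elim disjE exE conjE)
    fix g assume "x = [g, inv_letter g]"
    then show ?thesis using lcol_inv by simp
  next
    fix c j assume "c < length D" "1 \<le> j" "j < narcs D c" "x = relator D c j"
    then show ?thesis using wval_relator[OF wf s] by simp
  next
    fix g gs assume "Suc (length gs) = q" "x = lcomm g gs"
    then show ?thesis using wval_lcomm[of gs D T g] by (auto simp: cg_def)
  qed
  have st: "cg 0 (\<lambda>p. length p < q) (wval D T u) (wval D T v)" if "gstep D q u v" for u v
  proof -
    obtain a x b where "killer D q x" "u = a @ x @ b" "v = a @ b" using \<open>gstep D q u v\<close> unfolding gstep_def by blast
    moreover have "cg 0 (\<lambda>p. length p < q) (wval D T a * (wval D T x * wval D T b)) (wval D T a * (1 * wval D T b))"
      using k \<open>killer D q x\<close> by (intro cg_mult cl cg_refl)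
    ultimately show ?thesis by simp
  qed
  show ?thesis using assms(3) unfolding geq_def
  proof (induction rule: equivclp_induct)
    case (step y z)
    have "cg 0 (\<lambda>p. length p < q) (wval D T y) (wval D T z)" using step(2) st[of y z] cg_sym[OF st[of z y]] by blast
    then show ?case using step(3) cg_trans by blast
  qed simp
qed

section \<open>Generation of the nilpotent quotients by the initial arcs\<close>

definition gok :: "gdiag \<Rightarrow> letter list \<Rightarrow> bool" where
  "gok D w \<longleftrightarrow> (\<forall>l\<in>set w. gen_ok D l)"

lemma gok_simps [simp]: "gok D []" "gok D (l # w) \<longleftrightarrow> gen_ok D l \<and> gok D w" "gok D (u @ v) \<longleftrightarrow> gok D u \<and> gok D v"
  by (auto simp: gok_def)

lemma gok_concat: "(\<forall>l\<in>set (concat gs). gen_ok D l) \<longleftrightarrow> (\<forall>g\<in>set gs. gok D g)"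
  by (auto simp: gok_def)

text \<open>The relation geq restricted to words in the generators; the cancellations in geq may use
arbitrary letters, for which weight q commutators are not available.\<close>

definition ggq :: "gdiag \<Rightarrow> nat \<Rightarrow> letter list \<Rightarrow> letter list \<Rightarrow> bool" where
  "ggq D q = equivclp (\<lambda>w w'. gok D w \<and> gok D w' \<and> gstep D q w w')"

lemma ggq_refl [simp]: "ggq D q w w"
  by (simp add: ggq_def)

lemma ggq_sym: "ggq D q w w' \<Longrightarrow> ggq D q w' w"
  unfolding ggq_def by (rule equivclp_sym)

lemma ggq_trans [trans]: "ggq D q u v \<Longrightarrow> ggq D q v w \<Longrightarrow> ggq D q u w"
  unfolding ggq_def by (rule equivclp_trans)

lemma ggq_geq: "ggq D q w w' \<Longrightarrow> geq D q w w'"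
  unfolding ggq_def
proof (induction rule: equivclp_induct)
  case base
  show ?case by (simp add: geq_def)
next
  case (step y z)
  have "geq D q y z" unfolding geq_def
    using step(2) r_into_equivclp[of "gstep D q" y z] equivclp_sym[OF r_into_equivclp[of "gstep D q" z y]] by blast
  then show ?case using step(3) equivclp_trans[of "gstep D q" w y z] unfolding geq_def by blast
qed

lemma ggq_killer: "killer D q x \<Longrightarrow> gok D x \<Longrightarrow> ggq D q x []"
  unfolding ggq_def
  by (rule r_into_equivclp) (auto simp: gstep_def intro!: exI[of _ "[]"])

lemma ggq_ctx:
  assumes "ggq D q w w'" "gok D a" "gok D b"
  shows "ggq D q (a @ w @ b) (a @ w' @ b)"
  using assms(1) unfolding ggq_def
proof (induction rule: equivclp_induct)
  case (step y z)
  have "gok D (a @ u @ b) \<and> gok D (a @ v @ b) \<and> gstep D q (a @ u @ b) (a @ v @ b)"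
    if "gok D u \<and> gok D v \<and> gstep D q u v" for u v
  proof -
    obtain p x r where "killer D q x" "u = p @ x @ r" "v = p @ r" using \<open>gok D u \<and> gok D v \<and> gstep D q u v\<close> unfolding gstep_def by blast
    then have "gstep D q (a @ u @ b) (a @ v @ b)" unfolding gstep_def
      by (intro exI[of _ "a @ p"] exI[of _ x] exI[of _ "r @ b"]) simp
    then show ?thesis using that assms(2,3) by auto
  qed
  then have "equivclp (\<lambda>w w'. gok D w \<and> gok D w' \<and> gstep D q w w') (a @ y @ b) (a @ z @ b)"
    using step(2) r_into_equivclp[of "\<lambda>w w'. gok D w \<and> gok D w' \<and> gstep D q w w'" "a @ y @ b" "a @ z @ b"]
      equivclp_sym[OF r_into_equivclp[of "\<lambda>w w'. gok D w \<and> gok D w' \<and> gstep D q w w'" "a @ z @ b" "a @ y @ b"]]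
    by blast
  then show ?case by (rule equivclp_trans[OF step(3)])
qed simp

lemma ggq_append: "ggq D q u u' \<Longrightarrow> ggq D q v v' \<Longrightarrow> gok D u' \<Longrightarrow> gok D v \<Longrightarrow> ggq D q (u @ v) (u' @ v')"
  using ggq_ctx[of D q u u' "[]" v] ggq_ctx[of D q v v' u' "[]"] ggq_trans by fastforce

lemma gok_invw [simp]: "gok D (invw w) = gok D w"
  by (induction w) auto

lemma ggq_cancel: "gok D w \<Longrightarrow> ggq D q (w @ invw w) []"
proof (induction w)
  case (Cons l w)
  have "ggq D q (l # (w @ invw w) @ [inv_letter l]) ([l] @ [] @ [inv_letter l])"
    using ggq_ctx[of D q "w @ invw w" "[]" "[l]" "[inv_letter l]"] Cons by simp
  also have "ggq D q ([l] @ [] @ [inv_letter l]) []"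
    using Cons.prems by (intro ggq_killer) (auto simp: killer_def)
  finally show ?case by simp
qed simp

lemma ggq_cancel': "gok D w \<Longrightarrow> ggq D q (invw w @ w) []"
  using ggq_cancel[of D "invw w" q] by simp

lemma ggq_left_cancel: "gok D a \<Longrightarrow> gok D u \<Longrightarrow> ggq D q (a @ u) v \<Longrightarrow> gok D v \<Longrightarrow> ggq D q u (invw a @ v)"
proof -
  assume a: "gok D a" "gok D u" "ggq D q (a @ u) v" "gok D v"
  have "ggq D q ((invw a @ a) @ u) ([] @ u)" using ggq_ctx[OF ggq_cancel'[OF a(1)], of "[]" u] a by simp
  moreover have "ggq D q (invw a @ (a @ u)) (invw a @ v)" using ggq_ctx[OF a(3), of "invw a" "[]"] a by simp
  ultimately have "ggq D q u ((invw a @ a) @ u)" "ggq D q ((invw a @ a) @ u) (invw a @ v)"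
    using ggq_sym[of D q "(invw a @ a) @ u" "[] @ u"] by simp_all
  then show ?thesis by (rule ggq_trans)
qed

lemma ggq_invw:
  assumes "ggq D q w w'" "gok D w" "gok D w'"
  shows "ggq D q (invw w) (invw w')"
proof -
  have "ggq D q (w @ invw w') (w' @ invw w')" using ggq_ctx[OF assms(1), of "[]" "invw w'"] assms by simp
  also have "ggq D q (w' @ invw w') []" using assms ggq_cancel by blast
  finally have "ggq D q (invw w') (invw w @ [])" using assms by (intro ggq_left_cancel) auto
  then show ?thesis by (simp add: ggq_sym)
qed

text \<open>If x and y agree modulo the q-th lower central term, conjugating by them agrees modulo
  the next one, since commuting an element of that term with a raises the weight. This is what
  drives the induction in \<open>milnor_generation\<close>.\<close>

lemma ggq_conj:
  assumes "ggq D q x y" "gok D x" "gok D a"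
  shows "gok D y \<and> ggq D (Suc q) (invw x @ a @ x) (invw y @ a @ y)"
  using assms(1) unfolding ggq_def[of D q]
proof (induction rule: equivclp_induct)
  case base
  then show ?case using assms(2) by simp
next
  case (step y z)
  have *: "ggq D (Suc q) (invw u @ a @ u) (invw v @ a @ v)" if g: "gok D u" "gok D v" "gstep D q u v" for u v
  proof -
    obtain p x r where k: "killer D q x" and u: "u = p @ x @ r" "v = p @ r" using g unfolding gstep_def by blast
    have gp: "gok D p" "gok D x" "gok D r" using g u by auto
    let ?b = "invw p @ a @ p"
    have gb: "gok D ?b" using gp assms(3) by auto
    \<comment> \<open>Cancellations and relators are killers at every weight. The remaining killers
      are commutators of weight q, and bracketing one with ?b gives a killer of weight q +
      1.\<close>
    have "ggq D (Suc q) (invw x @ ?b @ x) ?b"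
    proof (cases "killer D (Suc q) x")
      case True
      then have x: "ggq D (Suc q) x []" using gp by (intro ggq_killer)
      then have ix: "ggq D (Suc q) (invw x) []" using ggq_invw[OF x] gp by simp
      have "ggq D (Suc q) (?b @ x) (?b @ [])" using ggq_ctx[OF x gb, of "[]"] by simp
      then show ?thesis using ggq_append[OF ix, of "?b @ x" "?b @ []"] gp gb by auto
    next
      case False
      then obtain g0 gs where gs: "Suc (length gs) = q" "\<forall>g\<in>set (g0 # gs). gok D g" "x = lcomm g0 gs"
        using k unfolding killer_def gok_concat by blast
      have "killer D (Suc q) (comm x ?b)"
        unfolding killer_def gok_concat using gs gb
        by (intro disjI2 exI[of _ g0] exI[of _ "gs @ [?b]"]) (simp add: lcomm_snoc)
      then have "ggq D (Suc q) (comm x ?b) []" using gp gb by (intro ggq_killer) (auto simp: comm_def)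
      then have c1: "ggq D (Suc q) (invw x @ (invw ?b @ x @ ?b)) []" by (simp add: comm_def)
      have "ggq D (Suc q) (invw ?b @ (x @ ?b)) x"
        using ggq_left_cancel[OF _ _ c1] gp gb by auto
      then have "ggq D (Suc q) (x @ ?b) (?b @ x)"
        using ggq_left_cancel[of D "invw ?b" "x @ ?b"] gp gb by auto
      then have "ggq D (Suc q) ?b (invw x @ ?b @ x)"
        using ggq_left_cancel[of D x ?b "Suc q" "?b @ x"] gp gb by auto
      then show ?thesis by (rule ggq_sym)
    qed
    from ggq_ctx[OF this, of "invw r" r] show ?thesis using gp u by simp
  qed
  have "gok D z" "ggq D (Suc q) (invw y @ a @ y) (invw z @ a @ z)"
    using step(2) * ggq_sym by blast+
  then show ?case using step(3) ggq_trans by blast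
qed

lemma gok_u:
  assumes "gd_wf m D" "c < length D" "1 \<le> j" "j < narcs D c"
  shows "gen_ok D (u_letter D c j)"
proof -
  obtain T where "sol 0 D T" using sol_exists[OF assms(1)] .
  then show ?thesis using u_letter_props(1) assms by blast
qed

lemma gok_v:
  assumes "gd_wf m D" "c < length D" "j < narcs D c"
  shows "gok D (v_word D c j)"
  using assms gok_u[OF assms(1,2)] by (auto simp: v_word_def gok_def)

lemma arc_conj:
  assumes wf: "gd_wf m D" and c: "c < length D" and "j < narcs D c"
  shows "ggq D q [((c, Suc j), True)] (invw (v_word D c j) @ [((c, 1), True)] @ v_word D c j)"
  using assms(3)
proof (induction j)
  case 0
  then show ?case by (simp add: v_word_def)
next
  case (Suc j)
  let ?u = "u_letter D c (Suc j)" and ?v = "v_word D c j"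
  have gu: "gen_ok D ?u" using gok_u[OF wf c, of "Suc j"] Suc by simp
  have gl: "gen_ok D ((c, Suc j), b)" "gen_ok D ((c, Suc (Suc j)), b)" "gen_ok D ((c, 1), b)" for b
    using Suc.prems c by (auto simp: gen_ok_def)
  have gv: "gok D ?v" using Suc.prems by (intro gok_v[OF wf c]) simp
  have "killer D q (relator D c (Suc j))" using c Suc by (auto simp: killer_def)
  then have "ggq D q (relator D c (Suc j)) []"
    using gl gu by (intro ggq_killer) (auto simp: relator_def)
  then have "ggq D q ([((c, Suc (Suc j)), False)] @ ([inv_letter ?u] @ [((c, Suc j), True)] @ [?u])) []"
    by (simp add: relator_def)
  then have "ggq D q ([inv_letter ?u] @ [((c, Suc j), True)] @ [?u]) (invw [((c, Suc (Suc j)), False)] @ [])"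
    using gl gu by (intro ggq_left_cancel) auto
  then have 1: "ggq D q [((c, Suc (Suc j)), True)] ([inv_letter ?u] @ [((c, Suc j), True)] @ [?u])"
    using ggq_sym by (simp add: inv_letter_def)
  have "ggq D q [((c, Suc j), True)] (invw ?v @ [((c, 1), True)] @ ?v)" using Suc by simp
  from ggq_ctx[OF this, of "[inv_letter ?u]" "[?u]"]
  have "ggq D q ([inv_letter ?u] @ [((c, Suc j), True)] @ [?u]) ([inv_letter ?u] @ (invw ?v @ [((c, 1), True)] @ ?v) @ [?u])"
    using gu by simp
  moreover have "v_word D c (Suc j) = ?v @ [?u]" by (simp add: v_word_def)
  ultimately show ?case using ggq_trans[OF 1] by simp
qed

definition alpha :: "gdiag \<Rightarrow> letter list \<Rightarrow> bool" where
  "alpha D w \<longleftrightarrow> set w \<subseteq> {((c, 1), b) | c b. c < length D}"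

lemma alpha_simps: "alpha D []" "alpha D (u @ v) \<longleftrightarrow> alpha D u \<and> alpha D v" "alpha D (invw u) \<longleftrightarrow> alpha D u"
  "c < length D \<Longrightarrow> alpha D [((c, 1), b)]"
  by (fastforce simp: alpha_def invw_def inv_letter_def)+

lemma alpha_gok: "alpha D w \<Longrightarrow> gok D w"
  by (fastforce simp: alpha_def gok_def gen_ok_def narcs_def)

text \<open>Every arc is the initial arc of its strand conjugated by a partial longitude. Replacing
  that longitude by a word in initial arcs is correct modulo weight q by induction, hence correct
  modulo weight q + 1 after conjugation. At weight one all words are killers.\<close>

lemma milnor_generation:
  assumes wf: "gd_wf m D"
  shows "gok D w \<Longrightarrow> \<exists>w'. alpha D w' \<and> ggq D (Suc q) w' w"
proof (induction q arbitrary: w)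
  case 0
  have "killer D 1 w" using 0 unfolding killer_def gok_concat
    by (intro disjI2 exI[of _ w] exI[of _ "[]"]) (auto simp: lcomm_def)
  then have "ggq D 1 w []" using 0 by (intro ggq_killer)
  then show ?case using ggq_sym alpha_simps(1) by (intro exI[of _ "[]"]) auto
next
  case (Suc q)
  have pos: "\<exists>w'. alpha D w' \<and> ggq D (Suc (Suc q)) w' [((c, Suc j), True)]" if "gen_ok D ((c, Suc j), True)" for c j
  proof -
    have c: "c < length D" "j < narcs D c" using that by (auto simp: gen_ok_def)
    let ?v = "v_word D c j"
    have gv: "gok D ?v" using gok_v[OF wf c] .
    then obtain v' where v': "alpha D v'" "ggq D (Suc q) v' ?v" using Suc.IH by blast
    have "ggq D (Suc (Suc q)) (invw v' @ [((c, 1), True)] @ v') (invw ?v @ [((c, 1), True)] @ ?v)"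
      using ggq_conj[OF v'(2) alpha_gok[OF v'(1)]] alpha_gok[OF alpha_simps(4)[OF c(1)]] by blast
    also have "ggq D (Suc (Suc q)) (invw ?v @ [((c, 1), True)] @ ?v) [((c, Suc j), True)]"
      by (rule ggq_sym[OF arc_conj[OF wf c]])
    finally show ?thesis using v'(1) c(1) by (intro exI[of _ "invw v' @ [((c, 1), True)] @ v'"]) (simp only: alpha_simps simp_thms)
  qed
  have let1: "\<exists>w'. alpha D w' \<and> ggq D (Suc (Suc q)) w' [l]" if l: "gen_ok D l" for l
  proof -
    obtain c j b where lc: "l = ((c, Suc j), b)" using l
      by (cases l) (metis gen_ok_def fst_conv snd_conv Suc_le_D One_nat_def prod.collapse)
    have "gen_ok D ((c, Suc j), True)" using l lc by (simp add: gen_ok_def)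
    then obtain w' where w': "alpha D w'" "ggq D (Suc (Suc q)) w' [((c, Suc j), True)]" using pos by blast
    show ?thesis
    proof (cases b)
      case True
      then show ?thesis using w' lc by auto
    next
      case False
      have "ggq D (Suc (Suc q)) (invw w') (invw [((c, Suc j), True)])"
        using ggq_invw[OF w'(2) alpha_gok[OF w'(1)]] \<open>gen_ok D ((c, Suc j), True)\<close> by simp
      then show ?thesis using w' lc False by (intro exI[of _ "invw w'"]) (simp add: alpha_simps inv_letter_def)
    qed
  qed
  show ?case using Suc.prems
  proof (induction w)
    case Nil
    show ?case using alpha_simps(1) ggq_refl by blast
  next
    case (Cons l w)
    then obtain u v where "alpha D u" "ggq D (Suc (Suc q)) u [l]" "alpha D v" "ggq D (Suc (Suc q)) v w"
      using let1[of l] by auto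
    then show ?case using ggq_append[of D "Suc (Suc q)" u "[l]" v w] Cons.prems alpha_gok
      by (intro exI[of _ "u @ v"]) (simp add: alpha_simps)
  qed
qed

lemma wval_alpha: "alpha D w \<Longrightarrow> wval D T w = magnus (map (\<lambda>((c, j), b). (c, b)) w)"
proof (induction w)
  case (Cons l w)
  then obtain c b where l: "l = ((c, 1), b)" "c < length D" and w: "alpha D w" by (auto simp: alpha_def)
  have "lcol D T l = lval (c, b)" using l by (simp add: lcol_def gen_ok_def narcs_def lval_def sgz_def col_def)
  then show ?case using Cons w l by simp
qed simp

lemma wval_v_word:
  assumes "gd_wf m D" "sol 0 D T" "c < length D"
  shows "j < narcs D c \<Longrightarrow> wval D T (v_word D c j) = hol T (take j (heads (D ! c)))"
proof (induction j)
  case (Suc j)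
  have "j < length (heads (D ! c))" using Suc.prems by (simp add: narcs_def)
  moreover have "lcol D T (u_letter D c (Suc j)) = hfac T (heads (D ! c) ! j)"
    using u_letter_props(2)[OF assms, of "Suc j"] Suc.prems by simp
  ultimately show ?case using Suc by (simp add: v_word_def take_Suc_conv_app_nth)
qed (simp add: v_word_def)

text \<open>All words that \<open>SOME\<close> may select in \<open>mu\<close> have the same
  coefficients below degree q, by \<open>geq_wval\<close>; with q the length of J, the monomial
  \<open>butlast J\<close> has degree q - 1.\<close>

theorem mu_eq_coef:
  assumes wf: "gd_wf m D" and s: "sol 0 D T" and J: "distinct J" "J \<noteq> []" "set J \<subseteq> {..<m}"
  shows "mu D (map Suc J) = coef (hol T (D ! last J)) (butlast J)"
proof -
  define c where "c = last J"
  have cm: "c < length D" using J wf last_in_set[OF J(2)] by (simp add: c_def gd_wf_def subset_iff)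
  have cn: "c \<notin> set (butlast J)" using J
    by (metis append_butlast_last_id c_def distinct_append disjoint_iff list.set_intros(1))
  have dj: "distinct (butlast J)" using J by (simp add: distinct_butlast)
  let ?w = "v_word D c (narcs D c - 1)"
  have nc: "narcs D c - 1 < narcs D c" by (simp add: narcs_def)
  have gl: "gok D (longitude D c)"
    using gok_v[OF wf cm nc] cm by (auto simp: longitude_def Let_def gok_def gen_ok_def narcs_def)
  let ?Q = "\<lambda>w. set w \<subseteq> {((c, 1), b) | c b. c < length D} \<and> geq D (length J) w (longitude D c)"
  \<comment> \<open>Without this the value of \<open>SOME\<close> would carry no
    information.\<close>
  have "\<exists>w. ?Q w"
    using milnor_generation[OF wf gl, of "length J - 1"] J ggq_geq by (auto simp: alpha_def)
  then have Q: "?Q (SOME w. ?Q w)" by (rule someI_ex)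
  define lam where "lam = (SOME w. ?Q w)"
  have lam: "alpha D lam" "geq D (length J) lam (longitude D c)" using Q by (auto simp: lam_def alpha_def)
  have "mu D (map Suc J) = mcoef (map (\<lambda>((c, j), b). (Suc c, b)) lam) (map Suc (butlast J))"
    using J by (simp add: mu_def Let_def last_map map_butlast c_def[symmetric] lam_def)
  also have "map (\<lambda>((c, j), b). (Suc c, b)) lam = map (\<lambda>(c, b). (Suc c, b)) (map (\<lambda>((c, j), b). (c, b)) lam)"
    by (simp add: case_prod_unfold)
  also have "mcoef \<dots> (map Suc (butlast J)) = coef (wval D T lam) (butlast J)"
    using dj lam(1) by (simp only: mcoef_magnus wval_alpha)
  also have "\<dots> = coef (wval D T (longitude D c)) (butlast J)"
    using geq_wval[OF wf s lam(2)] dj J by (simp add: cg_def)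
  also have "\<dots> = coef (hol T (D ! c)) (butlast J)"
  proof -
    \<comment> \<open>The framing power of the initial arc is trivial away from c, and c does not
      occur in \<open>butlast J\<close>.\<close>
    have "cg 0 (\<lambda>p. c \<notin> set p) (lcol D T ((c, 1), b)) 1" for b
    proof -
      have "cg 0 (\<lambda>p. c \<notin> set p) (X c) 0" by (auto simp: cg_def coef_X)
      from cg_one_head[OF this, of b] show ?thesis
        using cm cg_sym by (auto simp: lcol_def gen_ok_def narcs_def col_def)
    qed
    then have "cg 0 (\<lambda>p. c \<notin> set p) (wval D T (replicate k ((c, 1), b))) 1" for k b
    proof (induction k)
      case (Suc k)
      then show ?case using cg_mult[OF infixcl_avoid, of 0 c "lcol D T ((c, 1), b)" 1 "wval D T (replicate k ((c, 1), b))" 1] by simp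
    qed simp
    then have "cg 0 (\<lambda>p. c \<notin> set p) (wval D T (longitude D c)) (1 * wval D T ?w)"
      unfolding longitude_def Let_def wval_simps by (intro cg_mult infixcl_avoid cg_refl)
    moreover have "wval D T ?w = hol T (D ! c)"
      using wval_v_word[OF wf s cm nc] by (simp add: narcs_def hol_heads)
    ultimately show ?thesis using cn dj by (simp add: cg_def)
  qed
  finally show ?thesis by (simp add: c_def)
qed

section \<open>Derived moves on Gauss diagrams\<close>

text \<open>The equivalence closure relates every list to itself, even an ill-formed one; recording
  well-formedness of both ends lets it be recovered from any derived step.\<close>

definition DE :: "nat \<Rightarrow> nat \<Rightarrow> gdiag \<Rightarrow> gdiag \<Rightarrow> bool" where
  "DE n m D D' \<longleftrightarrow> gd_wf m D \<and> gd_wf m D' \<and> twon_sv_equiv n m D D'"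

lemma DE_refl: "gd_wf m D \<Longrightarrow> DE n m D D"
  by (simp add: DE_def twon_sv_equiv_eq)

lemma DE_sym: "DE n m D D' \<Longrightarrow> DE n m D' D"
  unfolding DE_def twon_sv_equiv_eq using equivclp_sym by metis

lemma DE_trans [trans]: "DE n m D D' \<Longrightarrow> DE n m D' D'' \<Longrightarrow> DE n m D D''"
  unfolding DE_def twon_sv_equiv_eq by (meson equivclp_trans)

lemma DE_step: "gd_wf m D \<Longrightarrow> gd_wf m D' \<Longrightarrow> welded_move D D' \<or> twist_move n D D' \<or> sv_move D D' \<Longrightarrow> DE n m D D'"
  unfolding DE_def twon_sv_equiv_eq by (simp add: gstep_sv_def r_into_equivclp)

lemma DE_wf: "DE n m D D' \<Longrightarrow> gd_wf m D \<and> gd_wf m D'"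
  by (simp add: DE_def)

section \<open>Contexts substituted into contexts\<close>

definition liftL :: "'a slot \<Rightarrow> 'a slot slot" where
  "liftL x = (case x of Lit e \<Rightarrow> Lit (Lit e) | Hole k \<Rightarrow> Hole k)"

text \<open>Substitutes slot words for the holes, which allows a move to be applied inside the
  contents of a hole. Literals are lifted once more so that \<open>fill\<close>, now acting on
  slots, leaves them alone and produces slots again.\<close>

definition cbind :: "(nat \<Rightarrow> 'a slot list) \<Rightarrow> 'a slot list list \<Rightarrow> 'a slot list list" where
  "cbind g C = fill g (map (map liftL) C)"

lemma fillrow_bind: "fillrow f (fillrow g (map liftL xs)) = fillrow (\<lambda>k. fillrow f (g k)) xs"
  by (induction xs) (auto simp: liftL_def split: slot.split)

lemma fill_cbind: "fill f (cbind g C) = fill (\<lambda>k. fillrow f (g k)) C"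
  by (simp add: cbind_def fill_eq fillrow_bind)

lemma count_liftL: "count_list (map liftL xs) (Hole k) = count_list xs (Hole k)"
  by (induction xs) (auto simp: liftL_def split: slot.splits)

lemma ctx_liftL: "ctx K C \<Longrightarrow> ctx K (map (map liftL) C)"
proof -
  assume C: "ctx K C"
  have c: "concat (map (map liftL) C) = map liftL (concat C)" by (simp add: map_concat)
  have "Hole k \<in> set (concat C)" if "Hole k \<in> liftL ` set (concat C)" for k
    using that by (auto simp: liftL_def split: slot.splits)
  then show ?thesis using C unfolding ctx_def c count_liftL by auto
qed

lemma ctx_cbind:
  assumes C: "ctx K C" and g: "\<And>j. j < K' \<Longrightarrow> (\<Sum>k<K. count_list (g k) (Hole j)) = 1"
    and h: "\<And>k j. k < K \<Longrightarrow> Hole j \<in> set (g k) \<Longrightarrow> j < K'"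
  shows "ctx K' (cbind g C)"
proof -
  let ?L = "fillrow (\<lambda>_. []) (concat (map (map liftL) C))"
  have m: "mset (concat (cbind g C)) = mset ?L + (\<Sum>k<K. mset (g k))"
    unfolding cbind_def by (rule mset_fill[OF ctx_liftL[OF C]])
  have nl: "Hole j \<notin> set ?L" for j
    by (auto simp: fillrow_def slotf_def liftL_def split: slot.splits)
  have "count_list (concat (cbind g C)) (Hole j) = (\<Sum>k<K. count_list (g k) (Hole j))" for j
  proof -
    have "count (mset (concat (cbind g C))) (Hole j) = (\<Sum>k<K. count (mset (g k)) (Hole j))"
      unfolding m using nl[of j] by (simp add: count_sum not_in_iff)
    then show ?thesis by (simp only: count_mset)
  qed
  moreover have "j < K'" if j: "Hole j \<in> set (concat (cbind g C))" for j
  proof -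
    have "Hole j \<in># mset (concat (cbind g C))" using j by (simp only: set_mset_mset)
    then have "Hole j \<in># (\<Sum>k<K. mset (g k))" unfolding m using nl[of j] by (simp only: set_mset_union set_mset_mset Un_iff) blast
    then obtain k where "k < K" "Hole j \<in> set (g k)" by (auto simp: set_mset_sum)
    then show ?thesis by (rule h)
  qed
  ultimately show ?thesis using g unfolding ctx_def by simp
qed

lemma fill_cong: "ctx K C \<Longrightarrow> (\<And>k. k < K \<Longrightarrow> f k = f' k) \<Longrightarrow> fill f C = fill f' C"
proof -
  assume C: "ctx K C" and f: "\<And>k. k < K \<Longrightarrow> f k = f' k"
  have "fillrow f r = fillrow f' r" if r: "r \<in> set C" for r
  proof -
    have "slotf f x = slotf f' x" if "x \<in> set r" for x
    proof (cases x)
      case (Hole k)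
      then have "k < K" using C r that unfolding ctx_def by auto
      then show ?thesis using f Hole by simp
    qed simp
    then show ?thesis unfolding fillrow_def by (metis map_cong)
  qed
  then show ?thesis by (simp add: fill_eq)
qed

lemma fillrow_Lit [simp]: "fillrow f (map Lit xs) = xs"
  by (induction xs) auto

lemma count_list_Lit [simp]: "count_list (map Lit xs) (Hole j) = 0"
  by (induction xs) auto

lemma gd_wf_mset: "gd_wf m D \<Longrightarrow> length D' = length D \<Longrightarrow> mset (concat D') = mset (concat D) \<Longrightarrow> gd_wf m D'"
  by (simp add: gd_wf_iff)

lemma wfm_add:
  assumes "wfm M" "\<And>e. e \<in># M \<Longrightarrow> lab e \<noteq> a"
  shows "wfm (M + {#EP a True s, EP a False s#})"
  unfolding wfm_def
proof (intro allI impI)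
  fix b assume "\<exists>e. e \<in># M + {#EP a True s, EP a False s#} \<and> lab e = b"
  show "\<exists>s'. filter_mset (\<lambda>e. lab e = b) (M + {#EP a True s, EP a False s#}) = {#EP b True s', EP b False s'#}"
  proof (cases "b = a")
    case True
    have "filter_mset (\<lambda>e. lab e = a) M = {#}"
      by (rule multiset_eqI) (auto simp: count_eq_zero_iff dest: assms(2))
    then show ?thesis unfolding True by (intro exI[of _ s]) simp
  next
    case False
    then have "\<exists>e. e \<in># M \<and> lab e = b"
      using \<open>\<exists>e. e \<in># M + {#EP a True s, EP a False s#} \<and> lab e = b\<close> by auto
    then obtain s' where "filter_mset (\<lambda>e. lab e = b) M = {#EP b True s', EP b False s'#}"
      using assms(1) unfolding wfm_def by blast
    then show ?thesis using False by auto
  qed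
qed

abbreviation labs :: "gdiag \<Rightarrow> nat set" where
  "labs D \<equiv> lab ` set (concat D)"

lemma gd_wf_add:
  assumes "gd_wf m D" "length D' = length D" "a \<notin> labs D"
    and "mset (concat D') = mset (concat D) + {#EP a True s, EP a False s#}"
  shows "gd_wf m D'"
proof -
  have "wfm (mset (concat D) + {#EP a True s, EP a False s#})"
    by (rule wfm_add) (use assms in \<open>auto simp: gd_wf_iff image_iff simp del: set_concat\<close>)
  then show ?thesis using assms by (simp add: gd_wf_iff)
qed

lemma fresh_nat: "finite (A :: nat set) \<Longrightarrow> \<exists>p. p \<notin> A"
  by (rule ex_new_if_finite) auto

lemma fresh2:
  obtains p q where "p \<notin> labs D" "q \<notin> labs D" "p \<noteq> (q::nat)"
proof -
  obtain p where "p \<notin> labs D" using fresh_nat[of "labs D"] by auto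
  moreover obtain q where "q \<notin> insert p (labs D)" using fresh_nat[of "insert p (labs D)"] by auto
  ultimately show ?thesis using that[of p q] by blast
qed

lemma welded_oc: "oc_move D D' \<Longrightarrow> welded_move D D'"
  and welded_r2: "r2_move D D' \<Longrightarrow> welded_move D D'"
  and welded_r3: "r3_move D D' \<Longrightarrow> welded_move D D'"
  and welded_rl: "relabel D D' \<Longrightarrow> welded_move D D'"
  by (simp_all add: welded_move_def)

lemma ctx_single_hole:
  assumes "ctx K C" "k < K"
  shows "ctx 1 (cbind (\<lambda>j. if j = k then map Lit us @ [Hole 0] @ map Lit vs else map Lit (f j)) C)"
proof (rule ctx_cbind[OF assms(1)])
  fix j :: nat assume "j < 1"
  then have "(\<Sum>i<K. count_list (if i = k then map Lit us @ [Hole 0] @ map Lit vs else map Lit (f i)) (Hole j))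
      = (\<Sum>i<K. if i = k then 1 else 0)" by (intro sum.cong) auto
  then show "(\<Sum>i<K. count_list (if i = k then map Lit us @ [Hole 0] @ map Lit vs else map Lit (f i)) (Hole j)) = 1"
    using assms(2) by simp
qed (auto split: if_splits)

lemma oc_ctx:
  assumes C: "ctx K C" "k < K" and wf: "gd_wf m (fill f C)" and f: "f k = us @ [EP a True s, EP b True t] @ vs"
  shows "DE n m (fill f C) (fill (f(k := us @ [EP b True t, EP a True s] @ vs)) C)"
proof -
  let ?g = "\<lambda>j. if j = k then map Lit us @ [Hole 0] @ map Lit vs else map Lit (f j)"
  let ?f' = "f(k := us @ [EP b True t, EP a True s] @ vs)"
  have 1: "fill f C = fill (\<lambda>_. [EP a True s, EP b True t]) (cbind ?g C)"
    unfolding fill_cbind by (rule fill_cong[OF C(1)]) (simp add: f)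
  have 2: "fill ?f' C = fill (\<lambda>_. [EP b True t, EP a True s]) (cbind ?g C)"
    unfolding fill_cbind by (rule fill_cong[OF C(1)]) simp
  have "oc_move (fill f C) (fill ?f' C)"
    unfolding 1 2 oc_move_def using ctx_single_hole[OF C] by blast
  moreover have "gd_wf m (fill ?f' C)"
  proof (rule gd_wf_mset[OF wf])
    have "mset (f i) = mset (?f' i)" for i using f by (auto simp: ac_simps)
    then show "mset (concat (fill ?f' C)) = mset (concat (fill f C))" unfolding mset_fill[OF C(1)] by simp
  qed simp
  ultimately show ?thesis using wf by (intro DE_step) (auto intro: welded_oc)
qed

lemma oc_move_front:
  assumes C: "ctx K C" "k < K" and t: "is_tail t" "\<And>e. e \<in> set as \<Longrightarrow> is_tail e"
    and wf: "gd_wf m (fill f C)" and f: "f k = us @ as @ t # vs"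
  shows "DE n m (fill f C) (fill (f(k := us @ t # as @ vs)) C)"
  using t(2) wf f
proof (induction as arbitrary: f vs rule: rev_induct)
  case Nil
  then show ?case using DE_refl[OF Nil(2)] by (simp add: fun_upd_idem)
next
  case (snoc e as)
  have "is_tail e" using snoc.prems(1) by simp
  then obtain a s b t' where e: "e = EP a True s" "t = EP b True t'" using t(1) by (cases e; cases t) auto
  let ?f1 = "f(k := (us @ as) @ [EP b True t', EP a True s] @ vs)"
  have 1: "DE n m (fill f C) (fill ?f1 C)"
    by (rule oc_ctx[OF C snoc.prems(2)]) (use snoc.prems(3) e in simp)
  have 2: "DE n m (fill ?f1 C) (fill (?f1(k := us @ t # as @ e # vs)) C)"
    by (rule snoc.IH[OF _ conjunct2[OF DE_wf[OF 1]]]) (use snoc.prems(1,3) e in auto)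
  show ?case using DE_trans[OF 1 2] unfolding fun_upd_upd by (simp add: fun_upd_def)
qed

text \<open>Adjacent tails may be permuted arbitrarily, by bringing the letters of the target to the
  front one after another.\<close>

lemma oc_perm:
  assumes C: "ctx K C" "k < K" and t: "\<And>e. e \<in> set ts \<Longrightarrow> is_tail e"
    and wf: "gd_wf m (fill f C)" and f: "f k = us @ ts @ vs" and p: "mset ts' = mset ts"
  shows "DE n m (fill f C) (fill (f(k := us @ ts' @ vs)) C)"
  using t wf f p
proof (induction ts' arbitrary: ts f us)
  case Nil
  then show ?case using DE_refl[OF Nil(2)] by (simp add: fun_upd_idem)
next
  case (Cons x ts')
  have "x \<in> set ts" using Cons.prems(4) by (metis list.set_intros(1) set_mset_mset)
  then obtain as bs where ts: "ts = as @ x # bs" by (meson split_list)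
  let ?f1 = "f(k := us @ x # as @ (bs @ vs))"
  have 1: "DE n m (fill f C) (fill ?f1 C)"
    by (rule oc_move_front[OF C _ _ Cons.prems(2)]) (use Cons.prems(1,3) ts in auto)
  have w1: "gd_wf m (fill ?f1 C)" using DE_wf[OF 1] by blast
  have "DE n m (fill ?f1 C) (fill (?f1(k := (us @ [x]) @ ts' @ vs)) C)"
    by (rule Cons.IH[of "as @ bs", OF _ w1]) (use Cons.prems(1,3,4) ts in auto)
  from DE_trans[OF 1 this] show ?case unfolding fun_upd_upd by (simp add: fun_upd_def)
qed

text \<open>The tail of z is to pass the head of x. An R3 move would do this but needs a third
  arrow, from the over-strand of x to the under-strand of z. An R2 move creates a cancelling pair p,
  q of such arrows; q is used up as the third arrow, so that p and q end up on both sides of the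
  head of z: the arrow z is conjugated by x.\<close>

lemma slide_ctx:
  assumes C: "ctx 3 C" and wf: "gd_wf m (fill f C)"
    and f: "f 0 = [EP x True sx]" "f 1 = [EP x False sx, EP z True sz]" "f 2 = [EP z False sz]"
    and f': "f' 0 = [EP x True sx, EP p True (\<not> sx), EP q True sx]" "f' 1 = [EP z True sz, EP x False sx]"
      "f' 2 = [EP p False (\<not> sx), EP z False sz, EP q False sx]"
    and fresh: "p \<notin> labs (fill f C)" "q \<notin> labs (fill f C)" "p \<noteq> q"
  shows "DE n m (fill f C) (fill f' C)"
proof -
  \<comment> \<open>In the R3 move with arrows x, q, z the orders on the middle and bottom strands
    are fixed and q has the sign of x. The planarity conditions then leave this one order for the
    top strand, which commuting tails can produce.\<close>
  define oT where "oT = (sx = sz)"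
  \<comment> \<open>The stages are: f1 after R2, f2 after reordering the tails, f3 after R3. A last
    permutation of tails leads to f'.\<close>
  define f1 where "f1 = f(0 := [EP x True sx, EP p True (\<not> sx), EP q True sx], 2 := [EP p False (\<not> sx), EP q False sx, EP z False sz])"
  define f2 where "f2 = f1(0 := EP p True (\<not> sx) # ord2 oT (EP x True sx) (EP q True sx))"
  define f3 where "f3 = f2(0 := EP p True (\<not> sx) # ord2 (\<not> oT) (EP x True sx) (EP q True sx), 1 := [EP z True sz, EP x False sx],
     2 := [EP p False (\<not> sx), EP z False sz, EP q False sx])"
  have S3: "(\<Sum>k<3. h k) = h 0 + h 1 + h 2" for h :: "nat \<Rightarrow> 'b::comm_monoid_add"
    by (simp add: numeral_3_eq_3 numeral_2_eq_2)
  have lt3: "(k::nat) < 3 \<longleftrightarrow> k = 0 \<or> k = 1 \<or> k = 2" for k by auto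
  have wf1: "gd_wf m (fill f1 C)"
  proof -
    let ?fp = "f(0 := [EP x True sx, EP p True (\<not> sx)], 2 := [EP p False (\<not> sx), EP z False sz])"
    have "mset (concat (fill ?fp C)) = mset (concat (fill f C)) + {#EP p True (\<not> sx), EP p False (\<not> sx)#}"
      unfolding mset_fill[OF C] S3 using f by simp
    then have w: "gd_wf m (fill ?fp C)" by (intro gd_wf_add[OF wf _ fresh(1)]) auto
    have l: "q \<notin> labs (fill ?fp C)"
    proof -
      have "set (concat (fill ?fp C)) = set_mset (mset (concat (fill ?fp C)))" by (simp only: set_mset_mset)
      also have "\<dots> = set (concat (fill f C)) \<union> {EP p True (\<not> sx), EP p False (\<not> sx)}"
        unfolding \<open>mset (concat (fill ?fp C)) = _\<close> by (simp only: set_mset_union set_mset_mset) auto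
      finally show ?thesis using fresh by (auto simp del: set_concat)
    qed
    have "mset (concat (fill f1 C)) = mset (concat (fill ?fp C)) + {#EP q True sx, EP q False sx#}"
      unfolding mset_fill[OF C] S3 using f by (simp add: f1_def)
    then show ?thesis by (intro gd_wf_add[OF w _ l]) auto
  qed
  have "r2_move (fill f C) (fill f1 C)"
  proof -
    let ?g = "\<lambda>k::nat. if k = 0 then [Lit (EP x True sx), Hole 0] else if k = 1 then map Lit (f 1) else [Hole 1, Lit (EP z False sz)]"
    have "ctx 2 (cbind ?g C)"
      by (rule ctx_cbind[OF C]) (auto simp: S3 f less_2_cases_iff split: if_splits)
    moreover have "fill f C = fill (\<lambda>_. []) (cbind ?g C)"
      unfolding fill_cbind by (rule fill_cong[OF C]) (auto simp: lt3 f)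
    moreover have "fill f1 C = fill (\<lambda>k. if k = 0 then [EP p True (\<not> sx), EP q True (\<not> \<not> sx)]
                       else ord2 True (EP p False (\<not> sx)) (EP q False (\<not> \<not> sx))) (cbind ?g C)"
      unfolding fill_cbind by (rule fill_cong[OF C]) (auto simp: lt3 f f1_def ord2_def)
    ultimately show ?thesis unfolding r2_move_def by blast
  qed
  then have 1: "DE n m (fill f C) (fill f1 C)" using wf wf1 by (intro DE_step) (auto intro: welded_r2)
  have 2: "DE n m (fill f1 C) (fill f2 C)"
  proof -
    have "DE n m (fill f1 C) (fill (f1(0 := [] @ (EP p True (\<not> sx) # ord2 oT (EP x True sx) (EP q True sx)) @ [])) C)"
      by (rule oc_perm[OF C _ _ wf1]) (auto simp: f1_def ord2_def)
    then show ?thesis by (simp add: f2_def)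
  qed
  have wf2: "gd_wf m (fill f2 C)" using DE_wf[OF 2] by simp
  have wf3: "gd_wf m (fill f3 C)"
  proof (rule gd_wf_mset[OF wf2])
    show "mset (concat (fill f3 C)) = mset (concat (fill f2 C))"
      unfolding mset_fill[OF C] S3 by (simp add: f3_def f2_def f1_def f f(2)[unfolded One_nat_def] ord2_def)
  qed simp
  have "r3_move (fill f2 C) (fill f3 C)"
  proof -
    let ?g = "\<lambda>k::nat. if k = 0 then [Lit (EP p True (\<not> sx)), Hole 0] else if k = 1 then [Hole 1] else [Lit (EP p False (\<not> sx)), Hole 2]"
    have "ctx 3 (cbind ?g C)"
      by (rule ctx_cbind[OF C]) (auto simp: S3 lt3 split: if_splits)
    moreover have "fill f2 C = fill (r3_blocks x q z sx sx sz oT True True) (cbind ?g C)"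
      unfolding fill_cbind by (rule fill_cong[OF C]) (auto simp: lt3 f f(2)[unfolded One_nat_def] f1_def f2_def ord2_def r3_blocks_def)
    moreover have "fill f3 C = fill (r3_blocks x q z sx sx sz (\<not> oT) (\<not> True) (\<not> True)) (cbind ?g C)"
      unfolding fill_cbind by (rule fill_cong[OF C]) (auto simp: lt3 f f1_def f2_def f3_def ord2_def r3_blocks_def)
    moreover have "(True = oT) \<longleftrightarrow> (sx = sz)" by (simp add: oT_def)
    ultimately show ?thesis unfolding r3_move_def by (intro exI conjI)
  qed
  then have 3: "DE n m (fill f2 C) (fill f3 C)" using wf2 wf3 by (intro DE_step) (auto intro: welded_r3)
  have 4: "DE n m (fill f3 C) (fill (f3(0 := [] @ [EP x True sx, EP p True (\<not> sx), EP q True sx] @ [])) C)"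
    by (rule oc_perm[OF C _ _ wf3, of 0 "EP p True (\<not> sx) # ord2 (\<not> oT) (EP x True sx) (EP q True sx)"])
      (auto simp: f3_def ord2_def split: if_splits)
  have "fill (f3(0 := [] @ [EP x True sx, EP p True (\<not> sx), EP q True sx] @ [])) C = fill f' C"
    by (rule fill_cong[OF C]) (auto simp: lt3 f' f'(2)[unfolded One_nat_def] f3_def)
  then show ?thesis using 1 2 3 4 DE_trans by metis
qed

lemma fillrow_map: "fillrow f (map \<phi> xs) = concat (map (\<lambda>e. slotf f (\<phi> e)) xs)"
  by (simp add: fillrow_def o_def)

lemma concat_singletons: "(\<And>e. e \<in> set xs \<Longrightarrow> g e = [e]) \<Longrightarrow> concat (map g xs) = xs"
  by (induction xs) auto

lemma wf_count: "gd_wf m D \<Longrightarrow> e \<in> set (concat D) \<Longrightarrow> count_list (concat D) e = 1"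
  using wf_distinct[of m D] by (simp add: distinct_count_atmost_1 flip: count_mset)

lemma list_update_parts: "c < length D \<Longrightarrow> D[c := r] = take c D @ r # drop (Suc c) D"
  by (rule upd_conv_take_nth_drop)

lemma row_split: "c < length D \<Longrightarrow> D = take c D @ D ! c # drop (Suc c) D"
  by (rule id_take_nth_drop)

lemma concat_update: "c < length D \<Longrightarrow> concat (D[c := r]) = concat (take c D) @ r @ concat (drop (Suc c) D)"
  by (simp add: list_update_parts)

lemma concat_row: "c < length D \<Longrightarrow> concat D = concat (take c D) @ D ! c @ concat (drop (Suc c) D)"
  using arg_cong[OF row_split, of c D concat] by simp

definition slide_sub :: "nat \<Rightarrow> bool \<Rightarrow> nat \<Rightarrow> bool \<Rightarrow> nat \<Rightarrow> nat \<Rightarrow> ep \<Rightarrow> ep list" where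
  "slide_sub x sx z sz p q e =
    (if e = EP x True sx then [EP x True sx, EP p True (\<not> sx), EP q True sx]
     else if e = EP z False sz then [EP p False (\<not> sx), EP z False sz, EP q False sx] else [e])"

text \<open>The partners of the two adjacent endpoints, the tail of x and the head of z, may lie
  anywhere; \<phi> turns them into holes 0 and 2. The condition that x and z differ keeps them away
  from hole 1.\<close>

lemma slide:
  assumes wf: "gd_wf m D" and c: "c < m" and row: "D ! c = xs @ [EP x False sx, EP z True sz] @ ys" and xz: "x \<noteq> z"
    and fresh: "p \<notin> labs D" "q \<notin> labs D" "p \<noteq> q"
  shows "DE n m D (map (\<lambda>r. concat (map (slide_sub x sx z sz p q) r)) (D[c := xs @ [EP z True sz, EP x False sx] @ ys]))"
proof -
  have len: "length D = m" using wf by (simp add: gd_wf_def)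
  have cl: "c < length D" using c len by simp
  define \<phi> where "\<phi> e = (if e = EP x True sx then Hole 0 else if e = EP z False sz then Hole 2 else Lit e)" for e
  define C where "C = (map (map \<phi>) D)[c := map \<phi> xs @ [Hole 1] @ map \<phi> ys]"
  define f where "f k = (if k = 0 then [EP x True sx] else if k = 1 then [EP x False sx, EP z True sz] else [EP z False sz])" for k :: nat
  define f' where "f' k = (if k = 0 then [EP x True sx, EP p True (\<not> sx), EP q True sx] else if k = 1 then [EP z True sz, EP x False sx]
     else [EP p False (\<not> sx), EP z False sz, EP q False sx])" for k :: nat
  define A where "A = concat (take c D)"
  define B where "B = concat (drop (Suc c) D)"
  have cD: "concat D = A @ (xs @ [EP x False sx, EP z True sz] @ ys) @ B"
    using concat_row[OF cl] row by (simp add: A_def B_def)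
  have cC: "concat C = map \<phi> A @ (map \<phi> xs @ [Hole 1] @ map \<phi> ys) @ map \<phi> B"
    unfolding C_def using concat_update[of c "map (map \<phi>) D"] cl
    by (simp add: A_def B_def take_map drop_map map_concat)
  have cnt0: "count_list (map \<phi> es) (Hole 0) = count_list es (EP x True sx)"
    and cnt2: "count_list (map \<phi> es) (Hole 2) = count_list es (EP z False sz)"
    and cnt1: "count_list (map \<phi> es) (Hole 1) = 0" for es
    by (induction es) (auto simp: \<phi>_def)
  have mem: "EP x False sx \<in> set (concat D)" "EP z True sz \<in> set (concat D)" unfolding cD by auto
  have "count_list (concat D) (EP x True sx) = 1" "count_list (concat D) (EP z False sz) = 1"
    using wf_count[OF wf wf_partner(1)[OF wf mem(1)]] wf_count[OF wf wf_partner(1)[OF wf mem(2)]] by simp_all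
  then have "count_list (concat C) (Hole 0) = 1" "count_list (concat C) (Hole 1) = 1" "count_list (concat C) (Hole 2) = 1"
    unfolding cD cC using xz by (simp_all add: cnt0 cnt1[unfolded One_nat_def] cnt2)
  moreover have "k < 3" if "Hole k \<in> set (concat C)" for k
    using that unfolding cC by (auto simp: \<phi>_def split: if_splits)
  ultimately have ctx: "ctx 3 C" unfolding ctx_def
    by (metis One_nat_def Suc_1 less_Suc_eq less_one numeral_3_eq_3)
  have fe: "slotf f (\<phi> e) = [e]" for e by (simp add: \<phi>_def f_def)
  have fe': "slotf f' (\<phi> e) = slide_sub x sx z sz p q e" for e by (simp add: \<phi>_def f'_def slide_sub_def)
  have F: "fill f C = D"
  proof (rule nth_equalityI)
    fix r assume "r < length (fill f C)"
    then have r: "r < length D" by (simp add: C_def)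
    show "fill f C ! r = D ! r"
    proof (cases "r = c")
      case True
      have "C ! r = map \<phi> xs @ [Hole 1] @ map \<phi> ys" using True r by (simp add: C_def)
      then have "fillrow f (C ! r) = xs @ f 1 @ ys" by (simp add: fillrow_map fe concat_singletons)
      then show ?thesis using True r row by (simp add: C_def f_def)
    next
      case False
      then have "fillrow f (C ! r) = D ! r" using r by (simp add: C_def fillrow_map fe concat_singletons)
      then show ?thesis using r by (simp add: C_def)
    qed
  qed (simp add: C_def)
  have F': "fill f' C = map (\<lambda>r. concat (map (slide_sub x sx z sz p q) r)) (D[c := xs @ [EP z True sz, EP x False sx] @ ys])"
  proof (rule nth_equalityI)
    fix r assume "r < length (fill f' C)"
    then have r: "r < length D" by (simp add: C_def)
    show "fill f' C ! r = map (\<lambda>r. concat (map (slide_sub x sx z sz p q) r)) (D[c := xs @ [EP z True sz, EP x False sx] @ ys]) ! r"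
    proof (cases "r = c")
      case True
      have "C ! r = map \<phi> xs @ [Hole 1] @ map \<phi> ys" using True r by (simp add: C_def)
      then have "fillrow f' (C ! r) = concat (map (slide_sub x sx z sz p q) (xs @ [EP z True sz, EP x False sx] @ ys))"
        using xz by (simp add: fillrow_map fe') (simp add: f'_def slide_sub_def)
      then show ?thesis using True r by (simp add: C_def)
    next
      case False
      then have "fillrow f' (C ! r) = concat (map (slide_sub x sx z sz p q) (D ! r))"
        using r by (simp add: C_def fillrow_map fe')
      then show ?thesis using r False by (simp add: C_def)
    qed
  qed (simp add: C_def)
  have "DE n m (fill f C) (fill f' C)"
    by (rule slide_ctx[OF ctx, where x = x and sx = sx and z = z and sz = sz and p = p and q = q])
      (use wf fresh in \<open>simp_all add: F, simp_all add: f_def f'_def\<close>)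
  then show ?thesis unfolding F F' .
qed

lemma sv_remove:
  assumes wf: "gd_wf m D" and c: "c < m" "EP p True s \<in> set (D ! c)" "EP p False s \<in> set (D ! c)"
  shows "DE n m D (map (filter (\<lambda>e. lab e \<noteq> p)) D)"
proof -
  have len: "length D = m" using wf by (simp add: gd_wf_def)
  define \<phi> where "\<phi> e = (if e = EP p True s then Hole 0 else if e = EP p False s then Hole 1 else Lit e)" for e
  define C where "C = map (map \<phi>) D"
  define f where "f k = (if k = 0 then [EP p True s] else [EP p False s])" for k :: nat
  have cC: "concat C = map \<phi> (concat D)" by (simp add: C_def map_concat)
  have cnt: "count_list (map \<phi> es) (Hole 0) = count_list es (EP p True s)"
    "count_list (map \<phi> es) (Hole 1) = count_list es (EP p False s)" for es
    by (induction es) (auto simp: \<phi>_def)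
  have mem: "EP p True s \<in> set (concat D)" "EP p False s \<in> set (concat D)"
    using row_subset[of c D] c len by auto
  have "k < 2" if "Hole k \<in> set (concat C)" for k
    using that unfolding cC by (auto simp: \<phi>_def split: if_splits)
  moreover have "count_list (concat C) (Hole 0) = 1" "count_list (concat C) (Hole 1) = 1"
    unfolding cC cnt using wf_count[OF wf] mem by auto
  ultimately have ctx: "ctx 2 C" unfolding ctx_def by (auto simp: less_2_cases_iff)
  have fe: "slotf f (\<phi> e) = [e]" for e by (simp add: \<phi>_def f_def)
  have F: "fill f C = D"
    unfolding fill_eq C_def by (simp add: fillrow_map fe concat_singletons map_idI)
  have only: "e = EP p True s \<or> e = EP p False s" if "e \<in> set (concat D)" "lab e = p" for e
  proof (cases e)
    case (EP a b t)
    then show ?thesis using that wf_partner(2)[OF wf mem(1), of b t] by (cases b) auto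
  qed
  have fr: "concat (map (\<lambda>e. slotf (\<lambda>_. []) (\<phi> e)) r) = filter (\<lambda>e. lab e \<noteq> p) r" if "set r \<subseteq> set (concat D)" for r
    using that
  proof (induction r)
    case (Cons e r)
    then show ?case using only[of e] by (auto simp: \<phi>_def)
  qed simp
  have F0: "fill (\<lambda>_. []) C = map (filter (\<lambda>e. lab e \<noteq> p)) D"
    unfolding fill_eq C_def by (auto simp: fillrow_map intro!: fr)
  have "sv_move (fill (\<lambda>_. []) C) (fill f C)"
  proof -
    have "Hole 0 \<in> set (C ! c)" "Hole 1 \<in> set (C ! c)" "c < length C"
      using c len by (force simp: C_def \<phi>_def)+
    then show ?thesis unfolding sv_move_def f_def using ctx by blast
  qed
  moreover have "gd_wf m (map (filter (\<lambda>e. lab e \<noteq> p)) D)"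
  proof -
    have cf: "concat (map (filter (\<lambda>e. lab e \<noteq> p)) D) = filter (\<lambda>e. lab e \<noteq> p) (concat D)"
      by (simp add: filter_concat)
    have "wfm (filter_mset (\<lambda>e. lab e \<noteq> p) (mset (concat D)))"
      unfolding wfm_def
    proof (intro allI impI)
      fix a assume "\<exists>e. e \<in># filter_mset (\<lambda>e. lab e \<noteq> p) (mset (concat D)) \<and> lab e = a"
      then have a: "\<exists>e. e \<in># mset (concat D) \<and> lab e = a" "a \<noteq> p" by auto
      then obtain t where "filter_mset (\<lambda>e. lab e = a) (mset (concat D)) = {#EP a True t, EP a False t#}"
        using wf unfolding gd_wf_iff wfm_def by blast
      moreover have "filter_mset (\<lambda>e. lab e = a) (filter_mset (\<lambda>e. lab e \<noteq> p) (mset (concat D)))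
          = filter_mset (\<lambda>e. lab e = a) (mset (concat D))"
        using a(2) by (simp add: filter_filter_mset) (metis (mono_tags, lifting))
      ultimately show "\<exists>t. filter_mset (\<lambda>e. lab e = a) (filter_mset (\<lambda>e. lab e \<noteq> p) (mset (concat D))) = {#EP a True t, EP a False t#}"
        by metis
    qed
    then show ?thesis unfolding gd_wf_iff cf using len by simp
  qed
  ultimately show ?thesis using wf unfolding F F0 by (intro DE_sym[OF DE_step]) auto
qed

lemma slide_sub_filter:
  assumes "p \<notin> lab ` set r" "q \<notin> lab ` set r"
  shows "filter (\<lambda>e. lab e \<noteq> q) (filter (\<lambda>e. lab e \<noteq> p) (concat (map (slide_sub x sx z sz p q) r))) = r"
  using assms
proof (induction r)
  case (Cons e r)
  have "lab e \<noteq> p" "lab e \<noteq> q" using Cons.prems by auto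
  then have "filter (\<lambda>e. lab e \<noteq> q) (filter (\<lambda>e. lab e \<noteq> p) (slide_sub x sx z sz p q e)) = [e]"
    unfolding slide_sub_def by (cases "e = EP x True sx"; cases "e = EP z False sz") simp_all
  then show ?case using Cons by (simp only: list.map concat.simps filter_append) simp
qed simp

text \<open>When the tail of x and the head of z lie on a common strand, the two arrows created by
  the slide are self-arrows and can be deleted, so the exchange costs nothing.\<close>

lemma free_swap:
  assumes wf: "gd_wf m D" and c: "c < m" and row: "D ! c = xs @ [EP x False sx, EP z True sz] @ ys" and xz: "x \<noteq> z"
    and r: "r < m" "EP x True sx \<in> set (D ! r)" "EP z False sz \<in> set (D ! r)"
  shows "DE n m D (D[c := xs @ [EP z True sz, EP x False sx] @ ys])"
proof -
  have len: "length D = m" using wf by (simp add: gd_wf_def)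
  obtain p q where pq: "p \<notin> labs D" "q \<notin> labs D" "p \<noteq> q" by (rule fresh2)
  let ?D0 = "D[c := xs @ [EP z True sz, EP x False sx] @ ys]"
  let ?g = "slide_sub x sx z sz p q"
  let ?D2 = "map (\<lambda>r. concat (map ?g r)) ?D0"
  have 1: "DE n m D ?D2" by (rule slide[OF wf c row xz pq])
  have r0: "EP x True sx \<in> set (?D0 ! r)" "EP z False sz \<in> set (?D0 ! r)"
    using r row len by (cases "r = c"; auto)+
  have rows: "set (?D0 ! i) = set (D ! i)" if "i < m" for i
    using row that len by (cases "i = c") auto
  have in2: "e' \<in> set (?D2 ! r)" if "e \<in> set (?D0 ! r)" "e' \<in> set (?g e)" for e e'
    using that r(1) len by auto
  have p2: "EP p True (\<not> sx) \<in> set (?D2 ! r)" "EP p False (\<not> sx) \<in> set (?D2 ! r)"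
    "EP q True sx \<in> set (?D2 ! r)" "EP q False sx \<in> set (?D2 ! r)"
    using in2[OF r0(1)] in2[OF r0(2)] by (auto simp: slide_sub_def)
  have wf2: "gd_wf m ?D2" using DE_wf[OF 1] by simp
  let ?D3 = "map (filter (\<lambda>e. lab e \<noteq> p)) ?D2"
  have 2: "DE n m ?D2 ?D3" by (rule sv_remove[OF wf2 r(1) p2(1,2)])
  have q3: "EP q True sx \<in> set (?D3 ! r)" "EP q False sx \<in> set (?D3 ! r)"
    using p2(3,4) pq(3) r(1) len by auto
  have 3: "DE n m ?D3 (map (filter (\<lambda>e. lab e \<noteq> q)) ?D3)"
    using DE_wf[OF 2] by (intro sv_remove[OF _ r(1) q3]) simp
  have "map (filter (\<lambda>e. lab e \<noteq> q)) ?D3 = ?D0"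
  proof (rule nth_equalityI)
    fix i assume "i < length (map (filter (\<lambda>e. lab e \<noteq> q)) ?D3)"
    then have i: "i < m" "i < length D" using len by auto
    have "lab ` set (?D0 ! i) \<subseteq> labs D" unfolding rows[OF i(1)] using row_subset[OF i(2)] by blast
    then have "filter (\<lambda>e. lab e \<noteq> q) (filter (\<lambda>e. lab e \<noteq> p) (concat (map ?g (?D0 ! i)))) = ?D0 ! i"
      using pq by (intro slide_sub_filter) auto
    then show "map (filter (\<lambda>e. lab e \<noteq> q)) ?D3 ! i = ?D0 ! i" using i by simp
  qed simp
  then show ?thesis using DE_trans[OF 1 DE_trans[OF 2 3]] by simp
qed

section \<open>Sorting: tails before heads\<close>

definition selffree :: "gdiag \<Rightarrow> bool" where
  "selffree D \<longleftrightarrow> (\<forall>c<length D. \<forall>a s s'. \<not> (EP a True s \<in> set (D ! c) \<and> EP a False s' \<in> set (D ! c)))"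

definition rsorted :: "ep list \<Rightarrow> bool" where
  "rsorted r \<longleftrightarrow> r = filter is_tail r @ heads r"

text \<open>The result is given as a filter, because filtering keeps rows sorted and never increases
  the number of inversions.\<close>

lemma remove_self:
  "gd_wf m D \<Longrightarrow> \<exists>P. DE n m D (map (filter P) D) \<and> selffree (map (filter P) D)"
proof (induction "length (concat D)" arbitrary: D rule: less_induct)
  case less
  have len: "length D = m" using less.prems by (simp add: gd_wf_def)
  show ?case
  proof (cases "selffree D")
    case True
    have "map (filter (\<lambda>_. True)) D = D" by (simp add: map_idI)
    then show ?thesis using True DE_refl[OF less.prems] by (intro exI[of _ "\<lambda>_. True"]) simp
  next
    case False
    then obtain c a s s' where c: "c < length D" "EP a True s \<in> set (D ! c)" "EP a False s' \<in> set (D ! c)"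
      unfolding selffree_def by blast
    have "s' = s" using wf_partner(2)[OF less.prems row_subset[OF c(1,2)]] row_subset[OF c(1,3)] by blast
    let ?D1 = "map (filter (\<lambda>e. lab e \<noteq> a)) D"
    have 1: "DE n m D ?D1" by (rule sv_remove[OF less.prems]) (use c len \<open>s' = s\<close> in auto)
    have "length (concat ?D1) = length (filter (\<lambda>e. lab e \<noteq> a) (concat D))" by (simp add: filter_concat)
    also have "\<dots> < length (concat D)"
      using row_subset[OF c(1,2)] by (intro length_filter_less[of "EP a True s"]) simp_all
    finally obtain P where P: "DE n m ?D1 (map (filter P) ?D1)" "selffree (map (filter P) ?D1)"
      using less.hyps[of ?D1] DE_wf[OF 1] by blast
    have "map (filter P) ?D1 = map (filter (\<lambda>e. lab e \<noteq> a \<and> P e)) D" by (simp add: conj_commute)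
    then show ?thesis using DE_trans[OF 1 P(1)] P(2) by metis
  qed
qed

fun inversions :: "ep list \<Rightarrow> nat" where
  "inversions [] = 0"
| "inversions (e # es) = (if is_tail e then 0 else length (filter is_tail es)) + inversions es"

lemma inversions_swap:
  "\<not> is_tail h \<Longrightarrow> is_tail t \<Longrightarrow> inversions (xs @ [h, t] @ ys) = Suc (inversions (xs @ [t, h] @ ys))"
  by (induction xs) auto

lemma length_filter_filter: "length (filter Q (filter P es)) \<le> length (filter Q es)"
  by (induction es) auto

lemma inversions_filter: "inversions (filter P es) \<le> inversions es"
proof (induction es)
  case (Cons e es)
  then show ?case using length_filter_filter[of is_tail P es] by auto
qed simp

lemma unsorted_pair:
  "\<not> rsorted r \<Longrightarrow> \<exists>xs h t ys. r = xs @ [h, t] @ ys \<and> \<not> is_tail h \<and> is_tail t"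
proof (induction r)
  case Nil
  then show ?case by (simp add: rsorted_def)
next
  case (Cons e r)
  show ?case
  proof (cases "rsorted r")
    case False
    then obtain xs h t ys where "r = xs @ [h, t] @ ys" "\<not> is_tail h" "is_tail t" using Cons by blast
    then show ?thesis by (intro exI[of _ "e # xs"]) auto
  next
    case True
    then have e: "\<not> is_tail e" using Cons.prems by (cases "is_tail e") (auto simp: rsorted_def)
    then have "filter is_tail r \<noteq> []" using Cons.prems True by (auto simp: rsorted_def)
    then obtain t ts where "filter is_tail r = t # ts" by (cases "filter is_tail r") auto
    moreover from this have "is_tail t" by (metis Cons_eq_filterD)
    ultimately show ?thesis using True e
      by (intro exI[of _ "[]"] exI[of _ e] exI[of _ t] exI[of _ "ts @ heads r"]) (simp add: rsorted_def)
  qed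
qed

lemma rsortedI: "(\<And>e. e \<in> set ts \<Longrightarrow> is_tail e) \<Longrightarrow> (\<And>e. e \<in> set hs \<Longrightarrow> \<not> is_tail e) \<Longrightarrow> rsorted (ts @ hs)"
  by (simp add: rsorted_def filter_id_conv filter_empty_conv)

lemma rsortedE:
  assumes "rsorted r"
  obtains ts hs where "r = ts @ hs" "\<And>e. e \<in> set ts \<Longrightarrow> is_tail e" "\<And>e. e \<in> set hs \<Longrightarrow> \<not> is_tail e"
proof (rule that)
  show "r = filter is_tail r @ heads r" using assms unfolding rsorted_def .
qed simp_all

lemma rsorted_filter: "rsorted r \<Longrightarrow> rsorted (filter P r)"
proof (erule rsortedE)
  fix ts hs assume r: "r = ts @ hs" "\<And>e. e \<in> set ts \<Longrightarrow> is_tail e" "\<And>e. e \<in> set hs \<Longrightarrow> \<not> is_tail e"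
  show ?thesis unfolding r(1) filter_append
  proof (rule rsortedI)
    show "is_tail e" if "e \<in> set (filter P ts)" for e using r(2) that by simp
    show "\<not> is_tail e" if "e \<in> set (filter P hs)" for e using r(3) that by simp
  qed
qed

lemma slide_sub_is_tail: "d \<in> set (slide_sub x sx z sz p q e) \<Longrightarrow> is_tail d = is_tail e"
  by (auto simp: slide_sub_def split: if_splits)

lemma rsorted_slide_sub: "rsorted r \<Longrightarrow> rsorted (concat (map (slide_sub x sx z sz p q) r))"
proof (erule rsortedE)
  fix ts hs assume r: "r = ts @ hs" "\<And>e. e \<in> set ts \<Longrightarrow> is_tail e" "\<And>e. e \<in> set hs \<Longrightarrow> \<not> is_tail e"
  show ?thesis unfolding r(1) map_append concat_append
  proof (rule rsortedI)
    show "is_tail d" if "d \<in> set (concat (map (slide_sub x sx z sz p q) ts))" for d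
    proof -
      from that obtain e where "e \<in> set ts" "d \<in> set (slide_sub x sx z sz p q e)" by auto
      then show ?thesis using r(2)[of e] slide_sub_is_tail[of d] by blast
    qed
    show "\<not> is_tail d" if "d \<in> set (concat (map (slide_sub x sx z sz p q) hs))" for d
    proof -
      from that obtain e where "e \<in> set hs" "d \<in> set (slide_sub x sx z sz p q e)" by auto
      then show ?thesis using r(3)[of e] slide_sub_is_tail[of d] by blast
    qed
  qed
qed

text \<open>The measure is the number of inversions of row c alone. Other rows may grow, but a slide
  adds tails only beside tails and heads only beside heads, so rows already sorted stay
  sorted.\<close>

lemma sort_row:
  assumes "gd_wf m D" "selffree D" "c < m"
  shows "\<exists>D'. DE n m D D' \<and> selffree D' \<and> rsorted (D' ! c) \<and> (\<forall>r<m. rsorted (D ! r) \<longrightarrow> rsorted (D' ! r))"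
  using assms
proof (induction "inversions (D ! c)" arbitrary: D rule: less_induct)
  case less
  have len: "length D = m" using less.prems by (simp add: gd_wf_def)
  show ?case
  proof (cases "rsorted (D ! c)")
    case True
    then show ?thesis using DE_refl less.prems by blast
  next
    case False
    then obtain xs h t ys where row: "D ! c = xs @ [h, t] @ ys" and ht: "\<not> is_tail h" "is_tail t"
      using unsorted_pair by blast
    obtain x sx z sz where e: "h = EP x False sx" "t = EP z True sz" using ht by (cases h; cases t) auto
    have sf: "\<not> (EP a True s \<in> set (D ! c) \<and> EP a False s' \<in> set (D ! c))" for a s s'
      using less.prems(2,3) len unfolding selffree_def by blast
    have xz: "x \<noteq> z" using sf[of x sz sx] row e by auto
    obtain p q where pq: "p \<notin> labs D" "q \<notin> labs D" "p \<noteq> q" by (rule fresh2)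
    let ?D0 = "D[c := xs @ [EP z True sz, EP x False sx] @ ys]"
    let ?g = "slide_sub x sx z sz p q"
    let ?D2 = "map (\<lambda>r. concat (map ?g r)) ?D0"
    have 1: "DE n m D ?D2" by (rule slide[OF less.prems(1,3) _ xz pq]) (use row e in simp)
    obtain P where P: "DE n m ?D2 (map (filter P) ?D2)" "selffree (map (filter P) ?D2)"
      using remove_self[of m ?D2 n] DE_wf[OF 1] by blast
    let ?D3 = "map (filter P) ?D2"
    \<comment> \<open>Neither the tail of x nor the head of z lies in row c, since there are no
      self-arrows; in row c the slide is a bare exchange.\<close>
    have "concat (map ?g (xs @ [EP z True sz, EP x False sx] @ ys)) = xs @ [EP z True sz, EP x False sx] @ ys"
    proof (rule concat_singletons)
      fix e' assume "e' \<in> set (xs @ [EP z True sz, EP x False sx] @ ys)"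
      then have "e' \<in> set (D ! c)" using row e by auto
      moreover have "EP x False sx \<in> set (D ! c)" "EP z True sz \<in> set (D ! c)" using row e by auto
      ultimately show "?g e' = [e']" using sf[of x sx sx] sf[of z sz sz] by (auto simp: slide_sub_def)
    qed
    then have r3: "?D3 ! c = filter P (xs @ [EP z True sz, EP x False sx] @ ys)" using less.prems(3) len by simp
    have "inversions (?D3 ! c) < inversions (D ! c)"
      using inversions_filter[of P "xs @ [EP z True sz, EP x False sx] @ ys"]
        inversions_swap[of "EP x False sx" "EP z True sz" xs ys] unfolding r3 row e by simp
    then obtain D' where D': "DE n m ?D3 D'" "selffree D'" "rsorted (D' ! c)"
      "\<forall>r<m. rsorted (?D3 ! r) \<longrightarrow> rsorted (D' ! r)"
      using less.hyps[of ?D3] DE_wf[OF P(1)] P(2) less.prems(3) by blast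
    have "rsorted (?D3 ! r)" if "r < m" "rsorted (D ! r)" for r
    proof -
      have "r \<noteq> c" using that False by auto
      then have "?D3 ! r = filter P (concat (map ?g (D ! r)))" using that len by simp
      then show ?thesis using that rsorted_filter rsorted_slide_sub by simp
    qed
    then show ?thesis using D' DE_trans[OF 1 DE_trans[OF P(1) D'(1)]] by blast
  qed
qed

lemma sort_diagram:
  assumes "gd_wf m D"
  obtains D' where "DE n m D D'" "selffree D'" "\<And>c. c < m \<Longrightarrow> rsorted (D' ! c)"
proof -
  have "\<exists>D'. DE n m D D' \<and> selffree D' \<and> (\<forall>c<k. rsorted (D' ! c))" if "k \<le> m" for k
    using that
  proof (induction k)
    case 0
    then show ?case using remove_self[OF assms] by blast
  next
    case (Suc k)
    then obtain D1 where D1: "DE n m D D1" "selffree D1" "\<forall>c<k. rsorted (D1 ! c)" by auto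
    obtain D2 where "DE n m D1 D2" "selffree D2" "rsorted (D2 ! k)" "\<forall>r<m. rsorted (D1 ! r) \<longrightarrow> rsorted (D2 ! r)"
      using sort_row[of m D1 k n] DE_wf[OF D1(1)] D1(2) Suc.prems by auto
    then show ?case using D1 DE_trans[OF D1(1)] Suc.prems by (intro exI[of _ D2]) (auto simp: less_Suc_eq)
  qed
  from this[of m] show ?thesis using that by auto
qed

section \<open>Sorted diagrams as tuples of words\<close>

definition trow :: "gdiag \<Rightarrow> nat \<Rightarrow> nat" where
  "trow D a = (THE c. c < length D \<and> (\<exists>s. EP a True s \<in> set (D ! c)))"

definition ltr :: "gdiag \<Rightarrow> ep \<Rightarrow> nat \<times> bool" where
  "ltr D e = (trow D (lab e), psgn e)"

definition hw :: "gdiag \<Rightarrow> nat \<Rightarrow> gword" where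
  "hw D c = map (ltr D) (heads (D ! c))"

text \<open>In a sorted diagram every arrow starts on an initial arc, so the word of a strand is its
  longitude (before the framing correction), written in initial arcs.\<close>

definition srep :: "nat \<Rightarrow> gdiag \<Rightarrow> (nat \<Rightarrow> gword) \<Rightarrow> bool" where
  "srep m D W \<longleftrightarrow> gd_wf m D \<and> (\<forall>c<m. rsorted (D ! c)) \<and> (\<forall>c<m. hw D c = W c)"

lemma srepD: "srep m D W \<Longrightarrow> gd_wf m D" "srep m D W \<Longrightarrow> length D = m"
  "srep m D W \<Longrightarrow> c < m \<Longrightarrow> rsorted (D ! c)" "srep m D W \<Longrightarrow> c < m \<Longrightarrow> hw D c = W c"
  by (auto simp: srep_def gd_wf_def)

lemma tail_row_unique:
  assumes wf: "gd_wf m D" and "c < length D" "EP a b s \<in> set (D ! c)" "c' < length D" "EP a b s' \<in> set (D ! c')"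
  shows "c = c'"
proof -
  have "s' = s" using wf_partner(2)[OF wf row_subset[OF assms(2,3)]] row_subset[OF assms(4,5)] by blast
  then show ?thesis using distinct_rows[OF wf_distinct[OF wf] assms(2,4,3)] assms(5) by blast
qed

lemma trow_eq:
  assumes wf: "gd_wf m D" and "c < length D" "EP a True s \<in> set (D ! c)"
  shows "trow D a = c"
  unfolding trow_def
proof (rule the_equality)
  show "c < length D \<and> (\<exists>s. EP a True s \<in> set (D ! c))" using assms by blast
  show "c' = c" if "c' < length D \<and> (\<exists>s. EP a True s \<in> set (D ! c'))" for c'
    using that tail_row_unique[OF wf assms(2,3)] by blast
qed

lemma trow_in:
  assumes wf: "gd_wf m D" and e: "e \<in> set (concat D)"
  shows "trow D (lab e) < length D" "EP (lab e) True (psgn e) \<in> set (D ! trow D (lab e))"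
proof -
  obtain c xs ys where c: "c < length D" "D ! c = xs @ EP (lab e) True (psgn e) # ys" using tail_occurs[OF wf e] .
  then have "EP (lab e) True (psgn e) \<in> set (D ! c)" by simp
  with trow_eq[OF wf c(1) this] c show "trow D (lab e) < length D" "EP (lab e) True (psgn e) \<in> set (D ! trow D (lab e))"
    by simp_all
qed

lemma trow_same:
  assumes wf: "gd_wf m D" "gd_wf m D'" and a: "a \<in> labs D"
    and h: "\<And>r s. r < m \<Longrightarrow> EP a True s \<in> set (D ! r) \<Longrightarrow> EP a True s \<in> set (D' ! r)"
  shows "trow D' a = trow D a"
proof -
  have l: "length D = m" "length D' = m" using wf by (auto simp: gd_wf_def)
  obtain e where e: "e \<in> set (concat D)" "lab e = a" using a by blast
  have "EP a True (psgn e) \<in> set (D' ! trow D a)" "trow D a < m"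
    using trow_in[OF wf(1) e(1)] e(2) l h by auto
  then show ?thesis using trow_eq[OF wf(2), of "trow D a" a "psgn e"] l by simp
qed

text \<open>In a sorted row all tails precede the first undercrossing, so each of them has the
  unconjugated colour 1 + X r. The strand product is therefore the Magnus expansion of the
  word.\<close>

lemma sorted_hol:
  assumes sr: "srep m D W" and s: "sol 0 D T" and c: "c < m"
  shows "hol T (D ! c) = magnus (W c)"
proof -
  note wf = srepD(1)[OF sr]
  have len: "length D = m" using srepD(2)[OF sr] .
  have T: "T (lab e) = X (trow D (lab e))" if e: "e \<in> set (concat D)" for e
  proof -
    define r where "r = trow D (lab e)"
    have r: "r < m" "EP (lab e) True (psgn e) \<in> set (D ! r)" using trow_in[OF wf e] len by (auto simp: r_def)
    obtain ts hs where th: "D ! r = ts @ hs" "\<And>e. e \<in> set ts \<Longrightarrow> is_tail e" "\<And>e. e \<in> set hs \<Longrightarrow> \<not> is_tail e"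
      using rsortedE[OF srepD(3)[OF sr r(1)]] by metis
    have "EP (lab e) True (psgn e) \<in> set ts" using r(2) th(1) th(3)[of "EP (lab e) True (psgn e)"] by auto
    then obtain us vs where ts: "ts = us @ EP (lab e) True (psgn e) # vs" by (meson split_list)
    have "T (lab e) = col T r us" by (rule sol_0_D[OF s, of r us _ "psgn e" "vs @ hs"]) (use r len th ts in auto)
    also have "\<dots> = X r" using hol_tails[of us T] th(2) ts by (simp add: col_def)
    finally show ?thesis by (simp add: r_def)
  qed
  have "hol T es = magnus (map (ltr D) (heads es))" if "set es \<subseteq> set (concat D)" for es
    using that
  proof (induction es)
    case (Cons e es)
    then show ?case using T[of e] by (auto simp: hfac_def sgz_def lval_def ltr_def)
  qed simp
  moreover have "set (D ! c) \<subseteq> set (concat D)" using row_subset[of c D] c len by blast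
  ultimately show ?thesis using srepD(4)[OF sr c] by (simp add: hw_def)
qed

lemma mset_update:
  "c < length C \<Longrightarrow> mset (concat (C[c := r])) + mset (C ! c) = mset (concat C) + mset r"
  using arg_cong[OF concat_row, of c C mset] by (simp add: concat_update)

lemma count_list_map_Hole: "count_list (map Hole [0..<K]) (Hole k) = (if k < K then 1 else 0)"
  by (induction K) auto

lemma ctx_msetI:
  fixes C :: "'a slot list list"
  assumes "mset (concat C) = image_mset Lit M + mset (map Hole [0..<K])"
  shows "ctx K C"
proof -
  have L: "count (image_mset Lit M) (Hole k) = 0" for k
    by (auto simp: count_eq_zero_iff)
  have c: "count_list (concat C) (Hole k) = (if k < K then 1 else 0)" for k
  proof -
    have "count (mset (concat C)) (Hole k) = count (mset (map Hole [0..<K])) (Hole k :: 'a slot)" unfolding assms using L by simp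
    then show ?thesis by (simp only: count_mset count_list_map_Hole)
  qed
  then show ?thesis unfolding ctx_def by (metis count_list_0_iff zero_neq_one)
qed

lemma fill_update: "c < length C \<Longrightarrow> fill f (C[c := r]) = (fill f C)[c := fillrow f r]"
  by (simp add: fill_eq map_update)

lemma fill_Lit: "fill f (map (map Lit) D) = D"
  by (simp add: fill_eq o_def map_idI)

lemma concat_Lit: "concat (map (map Lit) D) = map Lit (concat D)"
  by (simp add: map_concat)

lemma perm_tails:
  assumes wf: "gd_wf m D" and c: "c < m" and row: "D ! c = xs @ ts @ ys" and t: "\<And>e. e \<in> set ts \<Longrightarrow> is_tail e"
    and p: "mset ts' = mset ts"
  shows "DE n m D (D[c := xs @ ts' @ ys])"
proof -
  have cl: "c < length D" using wf c by (simp add: gd_wf_def)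
  let ?C = "(map (map Lit) D)[c := map Lit xs @ [Hole 0] @ map Lit ys]"
  have "mset (concat ?C) + mset (map Lit (D ! c)) = mset (map Lit (concat D)) + mset (map Lit xs @ [Hole 0] @ map Lit ys)"
    using mset_update[of c "map (map Lit) D" "map Lit xs @ [Hole 0] @ map Lit ys"] cl by (simp add: concat_Lit)
  moreover have "mset (concat D) = mset (concat (take c D)) + mset (D ! c) + mset (concat (drop (Suc c) D))"
    using arg_cong[OF concat_row[OF cl], of mset] by simp
  ultimately have "mset (concat ?C) = image_mset Lit (mset (concat (take c D)) + mset xs + mset ys + mset (concat (drop (Suc c) D))) + mset (map Hole [0..<1])"
    by (simp add: row ac_simps)
  then have C: "ctx 1 ?C" by (rule ctx_msetI)
  have F: "fill f ?C = D[c := xs @ f 0 @ ys]" for f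
    using cl by (simp add: fill_update fill_Lit)
  have 1: "fill (\<lambda>_. ts) ?C = D" unfolding F row[symmetric] by simp
  have w: "gd_wf m (fill (\<lambda>_. ts) ?C)" unfolding 1 by (rule wf)
  have "DE n m (fill (\<lambda>_. ts) ?C) (fill ((\<lambda>_. ts)(0 := [] @ ts' @ [])) ?C)"
    by (rule oc_perm[OF C _ t w _ p]) simp_all
  then show ?thesis unfolding 1 unfolding F by simp
qed

text \<open>A relabelling must be injective on all natural numbers, not only on the labels
  present.\<close>

lemma inj_extend:
  fixes xs ys :: "nat list"
  assumes "distinct xs" "distinct ys" "length xs = length ys"
  obtains \<pi> :: "nat \<Rightarrow> nat" where "inj \<pi>" "map \<pi> xs = ys"
proof -
  define g where "g = the \<circ> map_of (zip xs ys)"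
  have g: "g (xs ! i) = ys ! i" if "i < length xs" for i
    using that assms by (simp add: g_def map_of_zip_nth)
  \<comment> \<open>A strict bound for all new labels; the remaining numbers are shifted beyond
    it.\<close>
  define M where "M = Suc (sum_list ys)"
  have M: "y < M" if "y \<in> set ys" for y using member_le_sum_list[OF that] by (simp add: M_def)
  define \<pi> where "\<pi> a = (if a \<in> set xs then g a else a + M)" for a
  have gs: "g a \<in> set ys" if a: "a \<in> set xs" for a
  proof -
    obtain i where "i < length xs" "xs ! i = a" using a unfolding in_set_conv_nth by blast
    then show ?thesis using g[of i] assms(3) nth_mem[of i ys] by simp
  qed
  have "inj \<pi>"
  proof (rule injI)
    fix a b assume eq: "\<pi> a = \<pi> b"
    have lt: "\<pi> d < M" if "d \<in> set xs" for d using M[OF gs[OF that]] that by (simp add: \<pi>_def)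
    have ge: "M \<le> \<pi> d" if "d \<notin> set xs" for d using that by (simp add: \<pi>_def)
    have "a \<in> set xs \<longleftrightarrow> b \<in> set xs" using eq lt[of a] lt[of b] ge[of a] ge[of b] by linarith
    moreover have "a = b" if ab: "a \<in> set xs" "b \<in> set xs"
    proof -
      obtain i j where ij: "i < length xs" "xs ! i = a" "j < length xs" "xs ! j = b" using ab unfolding in_set_conv_nth by blast
      moreover from this have "ys ! i = ys ! j" using eq g[OF ij(1)] g[OF ij(3)] ab by (simp add: \<pi>_def)
      ultimately show ?thesis using assms nth_eq_iff_index_eq[of ys i j] by simp
    qed
    moreover have "a = b" if "a \<notin> set xs" "b \<notin> set xs" using eq that by (simp add: \<pi>_def)
    ultimately show "a = b" by blast
  qed
  moreover have "map \<pi> xs = ys"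
  proof (rule nth_equalityI)
    fix i assume "i < length (map \<pi> xs)"
    then show "map \<pi> xs ! i = ys ! i" using g[of i] by (simp add: \<pi>_def)
  qed (use assms in simp)
  ultimately show ?thesis by (rule that)
qed

definition rl :: "(nat \<Rightarrow> nat) \<Rightarrow> ep \<Rightarrow> ep" where
  "rl \<pi> e = EP (\<pi> (lab e)) (is_tail e) (psgn e)"

lemma rl_simps [simp]: "lab (rl \<pi> e) = \<pi> (lab e)" "is_tail (rl \<pi> e) = is_tail e" "psgn (rl \<pi> e) = psgn e"
  by (simp_all add: rl_def)

lemma rl_EP: "rl \<pi> (EP a b s) = EP (\<pi> a) b s"
  by (simp add: rl_def)

lemma relabel_wf:
  assumes "inj \<pi>" "gd_wf m D"
  shows "gd_wf m (map (map (rl \<pi>)) D)"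
proof -
  have c: "mset (concat (map (map (rl \<pi>)) D)) = image_mset (rl \<pi>) (mset (concat D))"
    by (simp add: map_concat[symmetric])
  have "wfm (image_mset (rl \<pi>) M)" if M: "wfm M" for M
    unfolding wfm_def
  proof (intro allI impI)
    fix b assume "\<exists>e. e \<in># image_mset (rl \<pi>) M \<and> lab e = b"
    then obtain e where e: "e \<in># M" "b = \<pi> (lab e)" by auto
    then obtain s where s: "filter_mset (\<lambda>e'. lab e' = lab e) M = {#EP (lab e) True s, EP (lab e) False s#}"
      using M unfolding wfm_def by blast
    have "filter_mset (\<lambda>e'. lab e' = b) (image_mset (rl \<pi>) M) = image_mset (rl \<pi>) (filter_mset (\<lambda>e'. lab (rl \<pi> e') = b) M)"
      by (simp add: filter_mset_image_mset)
    also have "(\<lambda>e'. lab (rl \<pi> e') = b) = (\<lambda>e'. lab e' = lab e)"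
      using e(2) assms(1) by (auto simp: inj_eq)
    finally show "\<exists>s. filter_mset (\<lambda>e'. lab e' = b) (image_mset (rl \<pi>) M) = {#EP b True s, EP b False s#}"
      unfolding s by (intro exI[of _ s]) (simp add: e(2) rl_EP)
  qed
  then show ?thesis using assms(2) unfolding gd_wf_iff c by simp
qed

lemma row_by_row:
  assumes wf: "gd_wf m D" and len: "length D' = m"
    and step: "\<And>E c. gd_wf m E \<Longrightarrow> c < m \<Longrightarrow> E ! c = D ! c \<Longrightarrow> DE n m E (E[c := D' ! c])"
  shows "DE n m D D'"
proof -
  have lD: "length D = m" using wf by (simp add: gd_wf_def)
  have "DE n m D (take k D' @ drop k D)" if "k \<le> m" for k
    using that
  proof (induction k)
    case 0
    then show ?case using DE_refl[OF wf] by simp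
  next
    case (Suc k)
    let ?E = "take k D' @ drop k D"
    have k: "k < m" using Suc by simp
    have IH: "DE n m D ?E" using Suc by simp
    have "DE n m ?E (?E[k := D' ! k])"
      by (rule step) (use DE_wf[OF IH] k len lD in \<open>auto simp: nth_append\<close>)
    moreover have "?E[k := D' ! k] = take (Suc k) D' @ drop (Suc k) D"
      using k len lD by (simp add: list_update_append take_Suc_conv_app_nth Cons_nth_drop_Suc[symmetric, of k D])
    ultimately show ?case using DE_trans[OF IH] by simp
  qed
  from this[of m] show ?thesis using len lD by simp
qed

lemma concat_heads: "concat (map heads D) = heads (concat D)"
  by (simp add: filter_concat)

lemma heads_labels_distinct:
  assumes "gd_wf m D"
  shows "distinct (map lab (concat (map heads D)))"
  unfolding distinct_map
proof
  show "distinct (concat (map heads D))" unfolding concat_heads using wf_distinct[OF assms] by simp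
  show "inj_on lab (set (concat (map heads D)))"
  proof (rule inj_onI)
    fix e e' assume e: "e \<in> set (concat (map heads D))" "e' \<in> set (concat (map heads D))" "lab e = lab e'"
    then have h: "e \<in> set (concat D)" "\<not> is_tail e" "e' \<in> set (concat D)" "\<not> is_tail e'" unfolding concat_heads by auto
    have "psgn e = psgn e'" using wf_partner(2)[OF assms, of "lab e'" "is_tail e'" "psgn e'" "is_tail e" "psgn e"] h e(3)
      by (cases e; cases e') simp
    then show "e = e'" using h e(3) by (cases e; cases e') simp
  qed
qed

text \<open>The words determine strand and sign of every arrow, head by head. What remains is the
  choice of labels, matched by a relabelling, and the order of the tails in each row, matched by
  commuting tails.\<close>

lemma srep_unique:
  assumes s: "srep m D W" "srep m D' W"
  shows "DE n m D D'"
proof -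
  note wf = srepD(1)[OF s(1)] and wf' = srepD(1)[OF s(2)]
  have len: "length D = m" "length D' = m" using srepD(2) s by auto
  let ?H = "concat (map heads D)" and ?H' = "concat (map heads D')"
  have hweq: "map (ltr D) (heads (D ! c)) = map (ltr D') (heads (D' ! c))" if "c < m" for c
    using srepD(4)[OF s(1) that] srepD(4)[OF s(2) that] by (simp add: hw_def)
  have rowlen: "length (heads (D ! c)) = length (heads (D' ! c))" if "c < m" for c
    using arg_cong[OF hweq[OF that], of length] by simp
  have "map (map (ltr D)) (map heads D) = map (map (ltr D')) (map heads D')"
    by (rule nth_equalityI) (use hweq len in auto)
  then have H: "map (ltr D) ?H = map (ltr D') ?H'" by (simp only: map_concat)
  then have Hl: "length ?H = length ?H'" by (metis length_map)
  obtain \<pi> where \<pi>: "inj \<pi>" "map \<pi> (map lab ?H) = map lab ?H'"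
    using inj_extend[OF heads_labels_distinct[OF wf] heads_labels_distinct[OF wf']] Hl by auto
  define D1 where "D1 = map (map (rl \<pi>)) D"
  have wf1: "gd_wf m D1" unfolding D1_def by (rule relabel_wf[OF \<pi>(1) wf])
  have l1: "length D1 = m" using len by (simp add: D1_def)
  have "relabel D D1" unfolding relabel_def D1_def rl_def using \<pi>(1) by blast
  then have step1: "DE n m D D1" using wf wf1 by (intro DE_step) (auto intro: welded_rl)
  have HH: "map (rl \<pi>) ?H = ?H'"
  proof (rule nth_equalityI)
    fix i assume "i < length (map (rl \<pi>) ?H)"
    then have i: "i < length ?H" "i < length ?H'" using Hl by auto
    have "\<pi> (lab (?H ! i)) = lab (?H' ! i)" using arg_cong[OF \<pi>(2), of "\<lambda>l. l ! i"] i by simp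
    moreover have "psgn (?H ! i) = psgn (?H' ! i)" using arg_cong[OF H, of "\<lambda>l. snd (l ! i)"] i by (simp add: ltr_def)
    moreover have "\<not> is_tail (?H ! i)" "\<not> is_tail (?H' ! i)" using nth_mem[OF i(1)] nth_mem[OF i(2)] by auto
    ultimately show "map (rl \<pi>) ?H ! i = ?H' ! i" using i by (cases "?H ! i"; cases "?H' ! i") (simp add: rl_def)
  qed (use Hl in simp)
  have "map heads D1 = map (map (rl \<pi>)) (map heads D)"
    by (simp add: D1_def filter_map o_def)
  also have "\<dots> = map heads D'"
  proof (rule concat_eq_concat_iff[THEN iffD1])
    show "concat (map (map (rl \<pi>)) (map heads D)) = concat (map heads D')" using HH by (simp only: map_concat)
    show "\<forall>(x, y)\<in>set (zip (map (map (rl \<pi>)) (map heads D)) (map heads D')). length x = length y"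
      using rowlen len by (auto simp: set_zip)
  qed (use len in simp)
  finally have hd: "heads (D1 ! c) = heads (D' ! c)" if "c < m" for c
    using that len l1 by (metis nth_map)
  have tr1: "trow D1 (\<pi> a) = trow D a" if al: "a \<in> labs D" for a
  proof -
    obtain e where e: "e \<in> set (concat D)" "lab e = a" using al by blast
    have t: "trow D a < m" "EP a True (psgn e) \<in> set (D ! trow D a)" using trow_in[OF wf e(1)] e(2) len by auto
    then have "rl \<pi> (EP a True (psgn e)) \<in> set (D1 ! trow D a)" using len by (simp add: D1_def)
    then show ?thesis using trow_eq[OF wf1, of "trow D a" "\<pi> a" "psgn e"] t l1 by (simp add: rl_def)
  qed
  have tr: "trow D1 (lab e) = trow D' (lab e)" if eH: "e \<in> set ?H'" for e
  proof -
    obtain i where i: "i < length ?H'" "e = ?H' ! i" using eH unfolding in_set_conv_nth by blast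
    then have i': "i < length ?H" using Hl by simp
    have "lab e = \<pi> (lab (?H ! i))" using arg_cong[OF HH, of "\<lambda>l. lab (l ! i)"] i i' by simp
    moreover have "?H ! i \<in> set (concat D)" using nth_mem[OF i'] unfolding concat_heads by simp
    moreover have "trow D (lab (?H ! i)) = trow D' (lab e)" using arg_cong[OF H, of "\<lambda>l. fst (l ! i)"] i i' by (simp add: ltr_def)
    ultimately show ?thesis using tr1 by simp
  qed
  have sH: "set (concat (map heads D1)) = set ?H'" using \<open>map heads D1 = _\<close> HH by (metis map_concat)
  have chr: "e \<in> set (filter is_tail (E ! c)) \<longleftrightarrow> is_tail e \<and> EP (lab e) False (psgn e) \<in> set ?H' \<and> trow E (lab e) = c"
    if E: "gd_wf m E" "set (concat (map heads E)) = set ?H'" "c < m" for E c e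
  proof -
    have lE: "length E = m" using E by (simp add: gd_wf_def)
    show ?thesis
    proof
      assume a: "e \<in> set (filter is_tail (E ! c))"
      then have "is_tail e" by simp
      then obtain x s where e: "e = EP x True s" by (cases e) simp
      have ec: "EP x True s \<in> set (E ! c)" using a e by simp
      have cE: "c < length E" using E(3) lE by simp
      have "EP x (\<not> True) s \<in> set (concat E)" by (rule wf_partner(1)[OF E(1) row_subset[OF cE ec]])
      then have "EP x False s \<in> set (concat (map heads E))" unfolding concat_heads by simp
      moreover have "trow E x = c" by (rule trow_eq[OF E(1) cE ec])
      ultimately show "is_tail e \<and> EP (lab e) False (psgn e) \<in> set ?H' \<and> trow E (lab e) = c" unfolding e E(2) by simp
    next
      assume a: "is_tail e \<and> EP (lab e) False (psgn e) \<in> set ?H' \<and> trow E (lab e) = c"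
      then have "EP (lab e) False (psgn e) \<in> set (concat (map heads E))" using E(2) by simp
      then have "EP (lab e) False (psgn e) \<in> set (concat E)" unfolding concat_heads by simp
      from trow_in(2)[OF E(1) this] a show "e \<in> set (filter is_tail (E ! c))" by (cases e) auto
    qed
  qed
  \<comment> \<open>The tails of a row are determined by the heads and by the strand assigned to
    each label, and both data agree; as the rows are distinct, equal sets are equal
    multisets.\<close>
  have ts: "mset (filter is_tail (D' ! c)) = mset (filter is_tail (D1 ! c))" if "c < m" for c
  proof (rule set_eq_iff_mset_eq_distinct[THEN iffD1])
    show "distinct (filter is_tail (D' ! c))" "distinct (filter is_tail (D1 ! c))"
      using distinct_row[OF wf_distinct[OF wf'], of c] distinct_row[OF wf_distinct[OF wf1], of c] that len l1 by auto
    show "set (filter is_tail (D' ! c)) = set (filter is_tail (D1 ! c))"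
    proof (rule set_eqI)
      fix e
      show "e \<in> set (filter is_tail (D' ! c)) \<longleftrightarrow> e \<in> set (filter is_tail (D1 ! c))"
        unfolding chr[OF wf' refl that] chr[OF wf1 sH that]
        using tr[of "EP (lab e) False (psgn e)"] unfolding ep.sel by metis
    qed
  qed
  have sr1: "rsorted (D1 ! c)" if "c < m" for c
  proof -
    have "D ! c = filter is_tail (D ! c) @ heads (D ! c)" using srepD(3)[OF s(1) that] by (simp add: rsorted_def)
    from arg_cong[OF this, of "map (rl \<pi>)"] show ?thesis using that len
      by (simp add: D1_def rsorted_def filter_map o_def)
  qed
  have "DE n m D1 D'"
  proof (rule row_by_row[OF wf1 len(2)])
    fix E c assume E: "gd_wf m E" and c: "c < m" and eq: "E ! c = D1 ! c"
    have r1: "E ! c = [] @ filter is_tail (D1 ! c) @ heads (D1 ! c)" using sr1[OF c] eq by (simp add: rsorted_def)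
    have r': "D' ! c = [] @ filter is_tail (D' ! c) @ heads (D1 ! c)" using srepD(3)[OF s(2) c] hd[OF c] by (simp add: rsorted_def)
    show "DE n m E (E[c := D' ! c])"
      by (subst r', rule perm_tails[OF E c r1]) (use ts[OF c] in auto)
  qed
  then show ?thesis using step1 DE_trans by blast
qed

lemma update_same: "D ! k = r \<Longrightarrow> D[k := r] = D"
  by (metis list_update_id)

lemma update_twice: "k \<noteq> i \<Longrightarrow> D[k := a, i := b, k := c, i := d] = D[k := c, i := d]"
  by (metis list_update_overwrite list_update_swap)

definition tls :: "(nat \<times> bool) list \<Rightarrow> ep list" where
  "tls xs = map (\<lambda>x. EP (fst x) True (snd x)) xs"

definition hds :: "(nat \<times> bool) list \<Rightarrow> ep list" where
  "hds xs = map (\<lambda>x. EP (fst x) False (snd x)) xs"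

lemma tls_hds_simps [simp]: "tls [] = []" "tls (x # xs) = EP (fst x) True (snd x) # tls xs"
  "hds [] = []" "hds (x # xs) = EP (fst x) False (snd x) # hds xs"
  by (simp_all add: tls_def hds_def)

lemma tls_tail: "e \<in> set (tls xs) \<Longrightarrow> is_tail e" and hds_head: "e \<in> set (hds xs) \<Longrightarrow> \<not> is_tail e"
  by (auto simp: tls_def hds_def)

lemma wfm_add_list:
  "wfm M \<Longrightarrow> distinct (map fst xs) \<Longrightarrow> (\<And>e. e \<in># M \<Longrightarrow> lab e \<notin> fst ` set xs) \<Longrightarrow> wfm (M + mset (tls xs) + mset (hds xs))"
proof (induction xs arbitrary: M)
  case (Cons x xs)
  let ?M = "M + {#EP (fst x) True (snd x), EP (fst x) False (snd x)#}"
  have "wfm ?M" using Cons.prems(1,3) by (intro wfm_add) auto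
  moreover have "lab e \<notin> fst ` set xs" if e: "e \<in># ?M" for e
  proof -
    have nx: "fst x \<notin> fst ` set xs" using Cons.prems(2) by simp
    have "e \<in># M \<or> lab e = fst x" using e by auto
    then show ?thesis
    proof
      assume "e \<in># M"
      then show ?thesis using Cons.prems(3)[of e] by simp
    next
      assume "lab e = fst x"
      then show ?thesis using nx by (simp only: not_False_eq_True)
    qed
  qed
  ultimately have "wfm (?M + mset (tls xs) + mset (hds xs))" using Cons.prems(2) by (intro Cons.IH) simp_all
  then show ?case by (simp add: ac_simps)
qed simp

lemma gd_wf_add_list:
  assumes "gd_wf m D" "length D' = length D" "distinct (map fst xs)" "fst ` set xs \<inter> labs D = {}"
    and "mset (concat D') = mset (concat D) + mset (tls xs) + mset (hds xs)"
  shows "gd_wf m D'"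
proof -
  have "wfm (mset (concat D) + mset (tls xs) + mset (hds xs))"
  proof (rule wfm_add_list)
    show "wfm (mset (concat D))" using assms(1) by (simp add: gd_wf_iff)
    show "lab e \<notin> fst ` set xs" if "e \<in># mset (concat D)" for e
    proof -
      have "e \<in> set (concat D)" using that by (simp only: set_mset_mset)
      then show ?thesis using assms(4) by blast
    qed
  qed (rule assms(3))
  then show ?thesis using assms(1,2,5) by (simp add: gd_wf_iff)
qed

lemma srep_row:
  assumes "srep m D W" "c < m" "W c = u @ v"
  obtains ts h1 h2 where "D ! c = ts @ h1 @ h2" "\<And>e. e \<in> set ts \<Longrightarrow> is_tail e"
    "\<And>e. e \<in> set h1 \<Longrightarrow> \<not> is_tail e" "\<And>e. e \<in> set h2 \<Longrightarrow> \<not> is_tail e" "map (ltr D) h1 = u" "map (ltr D) h2 = v"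
proof -
  have hw: "map (ltr D) (heads (D ! c)) = u @ v" using srepD(4)[OF assms(1,2)] assms(3) by (simp add: hw_def)
  define h1 where "h1 = take (length u) (heads (D ! c))"
  define h2 where "h2 = drop (length u) (heads (D ! c))"
  have h: "heads (D ! c) = h1 @ h2" by (simp add: h1_def h2_def)
  have "length h1 = length u" using arg_cong[OF hw, of length] by (simp add: h1_def)
  moreover have "map (ltr D) h1 @ map (ltr D) h2 = u @ v" using hw unfolding h by (simp only: map_append)
  ultimately have w: "map (ltr D) h1 = u" "map (ltr D) h2 = v" by (simp_all add: append_eq_append_conv)
  have "D ! c = filter is_tail (D ! c) @ heads (D ! c)" using srepD(3)[OF assms(1,2)] unfolding rsorted_def .
  then have "D ! c = filter is_tail (D ! c) @ h1 @ h2" unfolding h .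
  moreover have "e \<in> set h1 \<Longrightarrow> \<not> is_tail e" "e \<in> set h2 \<Longrightarrow> \<not> is_tail e" for e
  proof -
    have s: "set h1 \<union> set h2 = set (heads (D ! c))" unfolding h by simp
    show "e \<in> set h1 \<Longrightarrow> \<not> is_tail e" "e \<in> set h2 \<Longrightarrow> \<not> is_tail e" using s by auto
  qed
  ultimately show ?thesis by (intro that[of "filter is_tail (D ! c)" h1 h2] w) (simp_all only: set_filter mem_Collect_eq not_False_eq_True)
qed

lemma heads_tails: "(\<And>e. e \<in> set ts \<Longrightarrow> is_tail e) \<Longrightarrow> heads ts = []"
  and heads_heads: "(\<And>e. e \<in> set hs \<Longrightarrow> \<not> is_tail e) \<Longrightarrow> heads hs = hs"
  by (simp_all add: filter_empty_conv filter_id_conv)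

lemma map_ltr_cong:
  assumes "\<And>a. a \<in> labs D \<Longrightarrow> trow D' a = trow D a" "set es \<subseteq> set (concat D)"
  shows "map (ltr D') es = map (ltr D) es"
  using assms by (intro map_cong) (auto simp: ltr_def simp del: set_concat)

text \<open>The insertion is returned as a two-hole context, so that it can be recognised as an
  instance of a move. The tails are put at the front of row i, where they keep the row
  sorted.\<close>

lemma insert_arrows:
  assumes sr: "srep m D W" and il: "i < m" "l < m" and W: "W l = u @ v"
    and xs: "distinct (map fst xs)" "fst ` set xs \<inter> labs D = {}"
  obtains C where "ctx 2 C" "length C = m" "fill (\<lambda>_. []) C = D" "Hole 0 \<in> set (C ! i)" "Hole 1 \<in> set (C ! l)"
    "srep m (fill (\<lambda>k. if k = 0 then tls xs else hds xs) C) (W(l := u @ map (\<lambda>x. (i, snd x)) xs @ v))"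
proof -
  note wf = srepD(1)[OF sr]
  have len: "length D = m" using srepD(2)[OF sr] .
  obtain ts h1 h2 where row: "D ! l = ts @ h1 @ h2" and t: "\<And>e. e \<in> set ts \<Longrightarrow> is_tail e"
    and h: "\<And>e. e \<in> set h1 \<Longrightarrow> \<not> is_tail e" "\<And>e. e \<in> set h2 \<Longrightarrow> \<not> is_tail e"
    and uv: "map (ltr D) h1 = u" "map (ltr D) h2 = v"
    using srep_row[OF sr il(2) W] by metis
  define C1 where "C1 = (map (map Lit) D)[l := map Lit (ts @ h1) @ [Hole 1] @ map Lit h2]"
  define C where "C = C1[i := Hole 0 # C1 ! i]"
  have l1: "length C1 = m" "length C = m" using len by (simp_all add: C1_def C_def)
  have "mset (concat C1) + mset (map Lit (D ! l)) = mset (map Lit (concat D)) + mset (map Lit (ts @ h1) @ [Hole 1] @ map Lit h2)"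
    unfolding C1_def using mset_update[of l "map (map Lit) D"] il len by (simp add: concat_Lit)
  then have m1: "mset (concat C1) = mset (map Lit (concat D)) + {#Hole 1#}" by (simp add: row)
  have "mset (concat C) + mset (C1 ! i) = mset (concat C1) + mset (Hole 0 # C1 ! i)"
    unfolding C_def using mset_update[of i C1] il l1 by simp
  then have "mset (concat C) = image_mset Lit (mset (concat D)) + mset (map Hole [0..<2])"
    using m1 by (simp add: numeral_2_eq_2)
  then have ctx: "ctx 2 C" by (rule ctx_msetI)
  have F1: "fill f C1 = D[l := ts @ h1 @ f 1 @ h2]" for f
    using il len by (simp add: C1_def fill_update fill_Lit)
  have F: "fill f C = (D[l := ts @ h1 @ f 1 @ h2])[i := f 0 @ (D[l := ts @ h1 @ f 1 @ h2]) ! i]" for f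
    using il l1 len unfolding C_def by (simp add: fill_update F1 fill_nth[symmetric] del: fill_nth)
  let ?f = "\<lambda>k::nat. if k = 0 then tls xs else hds xs"
  let ?D = "fill ?f C"
  let ?W = "W(l := u @ map (\<lambda>x. (i, snd x)) xs @ v)"
  have E: "fill (\<lambda>_. []) C = D" unfolding F using update_same[OF row] by simp
  have mD: "mset (concat ?D) = mset (concat D) + mset (tls xs) + mset (hds xs)"
    using mset_fill[OF ctx, of ?f] mset_fill[OF ctx, of "\<lambda>_. []"] unfolding E by (simp add: numeral_2_eq_2)
  have wfD: "gd_wf m ?D" by (rule gd_wf_add_list[OF wf _ xs mD]) (simp add: l1 len)
  have rowD: "?D ! r = (if r = i then tls xs else []) @ (if r = l then ts @ h1 @ hds xs @ h2 else D ! r)" if "r < m" for r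
    using that il len unfolding F by (auto simp: nth_list_update)
  have lenD: "length ?D = m" using l1 by simp
  have tr: "trow ?D a = trow D a" if "a \<in> labs D" for a
  proof (rule trow_same[OF wf wfD that])
    fix r s assume r: "r < m" "EP a True s \<in> set (D ! r)"
    then show "EP a True s \<in> set (?D ! r)" using row by (auto simp: rowD)
  qed
  have trn: "trow ?D (fst x) = i" if x: "x \<in> set xs" for x
  proof (rule trow_eq[OF wfD])
    show "EP (fst x) True (snd x) \<in> set (?D ! i)" using x il by (simp add: rowD tls_def)
  qed (use lenD il in simp)
  have sub: "set h1 \<subseteq> set (concat D)" "set h2 \<subseteq> set (concat D)"
    using row_subset[of l D] row il len by auto
  have "srep m ?D ?W" unfolding srep_def
  proof (intro conjI allI impI wfD)
    fix c assume c: "c < m"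
    obtain ts' hs' where th: "D ! c = ts' @ hs'" "\<And>e. e \<in> set ts' \<Longrightarrow> is_tail e" "\<And>e. e \<in> set hs' \<Longrightarrow> \<not> is_tail e"
      using rsortedE[OF srepD(3)[OF sr c]] by metis
    let ?T = "(if c = i then tls xs else []) @ (if c = l then ts else ts')"
      and ?H = "if c = l then h1 @ hds xs @ h2 else hs'"
    have "?D ! c = ?T @ ?H"
      using th(1) by (simp add: rowD[OF c])
    moreover have "rsorted (?T @ ?H)"
    proof (rule rsortedI)
      show "is_tail e" if "e \<in> set ?T" for e using that t[of e] th(2)[of e] tls_tail[of e xs] by (auto split: if_splits)
      show "\<not> is_tail e" if "e \<in> set ?H" for e using that h[of e] th(3)[of e] hds_head[of e xs] by (auto split: if_splits)
    qed
    ultimately show "rsorted (?D ! c)" by (simp only:)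
    have hl: "heads (?D ! c) = (if c = l then h1 @ hds xs @ h2 else heads (D ! c))"
      unfolding rowD[OF c] using heads_tails[OF t] heads_tails[OF tls_tail[of _ xs]] heads_heads[OF h(1)] heads_heads[OF h(2)] heads_heads[OF hds_head[of _ xs]]
      by auto
    have new: "map (ltr ?D) (hds xs) = map (\<lambda>x. (i, snd x)) xs"
      using trn by (auto simp: hds_def ltr_def)
    have old: "map (ltr ?D) es = map (ltr D) es" if "set es \<subseteq> set (concat D)" for es
      by (rule map_ltr_cong[OF tr that])
    show "hw ?D c = ?W c"
    proof (cases "c = l")
      case True
      then show ?thesis unfolding hw_def hl using old[OF sub(1)] old[OF sub(2)] uv new by simp
    next
      case False
      have "set (heads (D ! c)) \<subseteq> set (concat D)" using row_subset[of c D] c len by auto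
      from old[OF this] show ?thesis unfolding hw_def hl using False srepD(4)[OF sr c, unfolded hw_def] by simp
    qed
  qed
  moreover have "Hole 0 \<in> set (C ! i)" using il l1 by (simp add: C_def)
  moreover have "Hole 1 \<in> set (C ! l)"
    using il l1 len by (cases "l = i") (simp_all add: C_def C1_def)
  ultimately show ?thesis using that ctx l1(2) E by blast
qed

lemma srep_cong: "srep m D W \<Longrightarrow> (\<And>c. c < m \<Longrightarrow> W c = W' c) \<Longrightarrow> srep m D W'"
  by (simp add: srep_def)

lemma srep_exists:
  assumes "\<And>c x. c < m \<Longrightarrow> x \<in> set (W c) \<Longrightarrow> fst x < m"
  shows "\<exists>D. srep m D W"
  using assms
proof (induction "\<Sum>c<m. length (W c)" arbitrary: W)
  case 0
  then have "W c = []" if "c < m" for c using that by simp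
  moreover have "gd_wf m (replicate m [])" by (simp add: gd_wf_def)
  ultimately show ?case
    by (intro exI[of _ "replicate m []"]) (simp add: srep_def rsorted_def hw_def)
next
  case (Suc N)
  have "\<exists>l<m. W l \<noteq> []"
  proof (rule ccontr)
    assume "\<not> (\<exists>l<m. W l \<noteq> [])"
    then have "(\<Sum>c<m. length (W c)) = 0" by simp
    then show False using Suc.hyps(2) by simp
  qed
  then obtain l y w where l: "l < m" "W l = y # w" by (metis neq_Nil_conv)
  let ?W = "W(l := w)"
  have "(\<Sum>c<m. length (W c)) = length (W l) + (\<Sum>c\<in>{..<m} - {l}. length (W c))" using l by (simp add: sum.remove)
  moreover have "(\<Sum>c<m. length (?W c)) = length w + (\<Sum>c\<in>{..<m} - {l}. length (W c))"
    using l by (subst sum.remove[of _ l]) auto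
  ultimately have "N = (\<Sum>c<m. length (?W c))" using Suc.hyps(2) l by simp
  moreover have "fst x < m" if "c < m" "x \<in> set (?W c)" for c x
    using Suc.prems[of c x] that l by (cases "c = l") auto
  ultimately obtain D where D: "srep m D ?W" using Suc.hyps(1)[of ?W] by blast
  obtain a where a: "a \<notin> labs D" using fresh_nat[of "labs D"] by auto
  have "fst y < m" using Suc.prems[of l y] l by simp
  then obtain C where "srep m (fill (\<lambda>k. if k = 0 then tls [(a, snd y)] else hds [(a, snd y)]) C)
      (?W(l := [] @ map (\<lambda>x. (fst y, snd x)) [(a, snd y)] @ w))"
    using insert_arrows[OF D _ l(1), of "fst y" "[]" w "[(a, snd y)]"] a by auto
  then have "srep m (fill (\<lambda>k. if k = 0 then tls [(a, snd y)] else hds [(a, snd y)]) C) W"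
    by (rule srep_cong) (use l in auto)
  then show ?case by blast
qed

text \<open>By \<open>srep_unique\<close> one pair of representatives decides the relation
  (\<open>RWI\<close>). It is vacuous for tuples without a representative, so transitivity asks for
  a valid middle tuple.\<close>

definition RW :: "nat \<Rightarrow> nat \<Rightarrow> (nat \<Rightarrow> gword) \<Rightarrow> (nat \<Rightarrow> gword) \<Rightarrow> bool" where
  "RW n m W W' \<longleftrightarrow> (\<forall>D D'. srep m D W \<longrightarrow> srep m D' W' \<longrightarrow> DE n m D D')"

lemma RWI: "srep m D W \<Longrightarrow> srep m D' W' \<Longrightarrow> DE n m D D' \<Longrightarrow> RW n m W W'"
  unfolding RW_def by (meson DE_trans srep_unique)

text \<open>An R2 move whose two arrows run from strand i to strand l.\<close>

lemma RW_cancel: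
  assumes sr: "srep m D W" and il: "i < m" "l < m" and W: "W l = u @ v"
  shows "\<exists>D'. DE n m D D' \<and> srep m D' (W(l := u @ [(i, s), (i, \<not> s)] @ v))"
proof -
  obtain p q where pq: "p \<notin> labs D" "q \<notin> labs D" "p \<noteq> q" by (rule fresh2)
  let ?xs = "[(p, s), (q, \<not> s)]"
  obtain C where C: "ctx 2 C" "fill (\<lambda>_. []) C = D"
    "srep m (fill (\<lambda>k. if k = 0 then tls ?xs else hds ?xs) C) (W(l := u @ map (\<lambda>x. (i, snd x)) ?xs @ v))"
    using insert_arrows[OF sr il W, of ?xs] pq by (auto simp del: set_concat)
  let ?D = "fill (\<lambda>k. if k = 0 then tls ?xs else hds ?xs) C"
  have "?D = fill (\<lambda>k. if k = 0 then [EP p True s, EP q True (\<not> s)]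
                       else ord2 True (EP p False s) (EP q False (\<not> s))) C"
    by (rule arg_cong[where f = "\<lambda>f. fill f C"]) (auto simp: ord2_def)
  then have "r2_move D ?D" unfolding r2_move_def using C(1,2) by blast
  then have "DE n m D ?D" using srepD(1)[OF sr] srepD(1)[OF C(3)] by (intro DE_step) (auto intro: welded_r2)
  then show ?thesis using C(3) by auto
qed

section \<open>The twist move on sorted diagrams\<close>

lemma free_move:
  assumes wf: "gd_wf m D" and k: "k < m" "r < m" "r \<noteq> k" and row: "D ! k = P @ hs @ [t] @ Q"
    and t: "is_tail t" "EP (lab t) False (psgn t) \<in> set (D ! r)"
    and hs: "\<And>e. e \<in> set hs \<Longrightarrow> \<not> is_tail e \<and> EP (lab e) True (psgn e) \<in> set (D ! r)"
  shows "DE n m D (D[k := P @ [t] @ hs @ Q])"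
  using wf row t(2) hs
proof (induction hs arbitrary: D Q rule: rev_induct)
  case Nil
  have "D[k := P @ [t] @ [] @ Q] = D" using Nil(2) update_same[of D k "P @ t # Q"] by simp
  then show ?case using DE_refl[OF Nil(1)] by simp
next
  case (snoc e hs)
  have len: "length D = m" using snoc.prems(1) by (simp add: gd_wf_def)
  have "\<not> is_tail e" using snoc.prems(4)[of e] by simp
  then obtain x sx where e: "e = EP x False sx" by (cases e) auto
  obtain z sz where tz: "t = EP z True sz" using t(1) by (cases t) auto
  have xr: "EP x True sx \<in> set (D ! r)" using snoc.prems(4)[of e] e by simp
  have xz: "x \<noteq> z"
  proof
    assume "x = z"
    then have "r = k" using tail_row_unique[OF snoc.prems(1), of r x True sx k sz] xr snoc.prems(2) tz k len by auto
    then show False using k by simp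
  qed
  let ?D1 = "D[k := (P @ hs) @ [EP z True sz, EP x False sx] @ Q]"
  have 1: "DE n m D ?D1"
    by (rule free_swap[OF snoc.prems(1) k(1) _ xz k(2) xr]) (use snoc.prems(2,3) e tz in auto)
  have "DE n m ?D1 (?D1[k := P @ [t] @ hs @ ([e] @ Q)])"
  proof (rule snoc.IH)
    show "gd_wf m ?D1" using DE_wf[OF 1] by blast
    show "?D1 ! k = P @ hs @ [t] @ [e] @ Q" using k len e tz by simp
    show "EP (lab t) False (psgn t) \<in> set (?D1 ! r)" using snoc.prems(3) k(3) by simp
    show "\<not> is_tail e' \<and> EP (lab e') True (psgn e') \<in> set (?D1 ! r)" if "e' \<in> set hs" for e'
      using snoc.prems(4)[of e'] that k(3) by simp
  qed
  from DE_trans[OF 1 this] show ?case by simp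
qed

text \<open>All arrows of the block join rows k and r, so every exchange of a head with a later tail
  is free; the block is sorted without creating arrows.\<close>

lemma free_block:
  assumes wf: "gd_wf m D" and k: "k < m" "r < m" "r \<noteq> k" and row: "D ! k = P @ es @ Q"
    and es: "\<And>e. e \<in> set es \<Longrightarrow> EP (lab e) (\<not> is_tail e) (psgn e) \<in> set (D ! r)"
  shows "DE n m D (D[k := P @ filter is_tail es @ heads es @ Q])"
  using row es
proof (induction es arbitrary: Q rule: rev_induct)
  case Nil
  have "D[k := P @ filter is_tail [] @ heads [] @ Q] = D" using Nil(1) update_same[of D k "P @ Q"] by simp
  then show ?case using DE_refl[OF wf] by simp
next
  case (snoc e es)
  have len: "length D = m" using wf by (simp add: gd_wf_def)
  let ?D1 = "D[k := P @ filter is_tail es @ heads es @ [e] @ Q]"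
  have 1: "DE n m D ?D1"
    by (rule snoc.IH) (use snoc.prems in auto)
  show ?case
  proof (cases "is_tail e")
    case False
    then show ?thesis using 1 by simp
  next
    case True
    have "DE n m ?D1 (?D1[k := (P @ filter is_tail es) @ [e] @ heads es @ Q])"
    proof (rule free_move[OF _ k])
      show "gd_wf m ?D1" using DE_wf[OF 1] by blast
      show "?D1 ! k = (P @ filter is_tail es) @ heads es @ [e] @ Q" using k len by simp
      show "EP (lab e) False (psgn e) \<in> set (?D1 ! r)" using snoc.prems(2)[of e] True k(3) by simp
      show "\<not> is_tail e' \<and> EP (lab e') True (psgn e') \<in> set (?D1 ! r)" if "e' \<in> set (heads es)" for e'
        using snoc.prems(2)[of e'] that k(3) by auto
    qed (rule True)
    from DE_trans[OF 1 this] show ?thesis using True by simp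
  qed
qed

text \<open>In each strand of the twist region tails and heads alternate, and
  \<open>free_block\<close> separates them. What is left are n heads from the other strand on either
  strand, all with sign \<sigma>.\<close>

lemma twist_rows:
  assumes wf: "gd_wf m D" and ki: "k < m" "i < m" "k \<noteq> i" and rows: "D ! k = P @ Q" "D ! i = P' @ Q'"
  obtains tA hA tB hB where
    "DE n m D (D[k := P @ tA @ hA @ Q, i := P' @ tB @ hB @ Q'])"
    "\<And>e. e \<in> set tA \<Longrightarrow> is_tail e" "\<And>e. e \<in> set tB \<Longrightarrow> is_tail e"
    "\<And>e. e \<in> set hA \<Longrightarrow> \<not> is_tail e \<and> psgn e = \<sigma> \<and> EP (lab e) True \<sigma> \<in> set tB"
    "\<And>e. e \<in> set hB \<Longrightarrow> \<not> is_tail e \<and> psgn e = \<sigma> \<and> EP (lab e) True \<sigma> \<in> set tA"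
    "length hA = n" "length hB = n"
proof -
  have len: "length D = m" using wf by (simp add: gd_wf_def)
  have kl: "k < length D" "i < length D" using ki len by auto
  define N where "N = Suc (Max (insert 0 (labs D)))"
  define a where "a j = j + N" for j :: nat
  have fr: "a j \<notin> labs D" for j
  proof
    assume "a j \<in> labs D"
    then have "a j \<le> Max (insert 0 (labs D))" by (intro Max_ge) (auto simp del: set_concat)
    then show False by (simp add: a_def N_def)
  qed
  let ?f = "twist_fill n a \<sigma> True True"
  define C1 where "C1 = (map (map Lit) D)[k := map Lit P @ [Hole 0] @ map Lit Q]"
  define C where "C = C1[i := map Lit P' @ [Hole 1] @ map Lit Q']"
  have l1: "length C1 = m" "length C = m" using len by (simp_all add: C1_def C_def)
  have "mset (concat C1) + mset (map Lit (D ! k)) = mset (map Lit (concat D)) + mset (map Lit P @ [Hole 0] @ map Lit Q)"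
    unfolding C1_def using mset_update[of k "map (map Lit) D"] kl by (simp add: concat_Lit)
  then have m1: "mset (concat C1) = mset (map Lit (concat D)) + {#Hole 0#}" by (simp add: rows)
  have "C1 ! i = map Lit (D ! i)" using ki kl by (simp add: C1_def)
  then have "mset (concat C) + mset (map Lit (D ! i)) = mset (concat C1) + mset (map Lit P' @ [Hole 1] @ map Lit Q')"
    unfolding C_def using mset_update[of i C1] ki l1 by simp
  then have "mset (concat C) = image_mset Lit (mset (concat D)) + mset (map Hole [0..<2])"
    using m1 by (simp add: rows numeral_2_eq_2)
  then have ctx: "ctx 2 C" by (rule ctx_msetI)
  have F: "fill f C = D[k := P @ f 0 @ Q, i := P' @ f 1 @ Q']" for f
    using ki kl l1 by (simp add: C_def C1_def fill_update fill_Lit)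
  have E: "fill (\<lambda>_. []) C = D" unfolding F using update_same[OF rows(1)] update_same[OF rows(2)] by simp
  let ?xs = "map (\<lambda>j. (a j, \<sigma>)) [0..<2*n]"
  have "mset (map (\<lambda>j. EP (a j) (True = even j) \<sigma>) js) + mset (map (\<lambda>j. EP (a j) (True \<noteq> even j) \<sigma>) js)
      = mset (tls (map (\<lambda>j. (a j, \<sigma>)) js)) + mset (hds (map (\<lambda>j. (a j, \<sigma>)) js))" for js
  proof (induction js)
    case (Cons j js)
    then show ?case by (cases "even j") simp_all
  qed simp
  moreover have "?f 0 = map (\<lambda>j. EP (a j) (True = even j) \<sigma>) [0..<2*n]" "?f 1 = map (\<lambda>j. EP (a j) (True \<noteq> even j) \<sigma>) [0..<2*n]"
    by (simp_all only: twist_fill_def if_True if_False simp_thms zero_neq_one id_apply one_neq_zero)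
  ultimately have "mset (?f 0) + mset (?f 1) = mset (tls ?xs) + mset (hds ?xs)"
    by (simp only:)
  then have mD: "mset (concat (fill ?f C)) = mset (concat D) + mset (tls ?xs) + mset (hds ?xs)"
    using mset_fill[OF ctx, of ?f] mset_fill[OF ctx, of "\<lambda>_. []"] unfolding E by (simp add: numeral_2_eq_2)
  have wf1: "gd_wf m (fill ?f C)"
  proof (rule gd_wf_add_list[OF wf _ _ _ mD])
    show "distinct (map fst ?xs)" by (simp add: distinct_map inj_on_def a_def o_def)
    show "fst ` set ?xs \<inter> labs D = {}"
    proof (rule equals0I)
      fix y assume y: "y \<in> fst ` set ?xs \<inter> labs D"
      obtain j where "y = a j" using IntD1[OF y] by auto
      then show False using IntD2[OF y] fr[of j] by (simp only:)
    qed
  qed (simp add: l1 len)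
  have "twist_move n D (fill ?f C)" unfolding twist_move_iff using ctx E by metis
  then have 1: "DE n m D (fill ?f C)" using wf wf1 by (intro DE_step) auto
  let ?D1 = "D[k := P @ ?f 0 @ Q, i := P' @ ?f 1 @ Q']"
  let ?D2 = "?D1[k := P @ filter is_tail (?f 0) @ heads (?f 0) @ Q]"
  let ?D3 = "?D2[i := P' @ filter is_tail (?f 1) @ heads (?f 1) @ Q']"
  have p0: "EP (lab e) (\<not> is_tail e) (psgn e) \<in> set (?f 1)" if "e \<in> set (?f 0)" for e
  proof -
    from \<open>e \<in> _\<close> obtain j where "e = EP (a j) (True = even j) \<sigma>" "j < 2 * n" by (auto simp: twist_fill_set)
    then show ?thesis by (auto simp: twist_fill_set)
  qed
  have p1: "EP (lab e) (\<not> is_tail e) (psgn e) \<in> set (?f 0)" if "e \<in> set (?f 1)" for e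
  proof -
    from \<open>e \<in> _\<close> obtain j where "e = EP (a j) (True \<noteq> even j) \<sigma>" "j < 2 * n" by (auto simp: twist_fill_set)
    then show ?thesis by (auto simp: twist_fill_set)
  qed
  have w1: "gd_wf m ?D1" using wf1 unfolding F .
  have 2: "DE n m ?D1 ?D2"
  proof (rule free_block[OF w1 ki(1,2)])
    show "i \<noteq> k" using ki(3) by simp
    show "?D1 ! k = P @ ?f 0 @ Q" using ki(3) kl by simp
    show "EP (lab e) (\<not> is_tail e) (psgn e) \<in> set (?D1 ! i)" if "e \<in> set (?f 0)" for e
      using p0[OF that] kl by simp
  qed
  have 3: "DE n m ?D2 ?D3"
  proof (rule free_block[OF conjunct2[OF DE_wf[OF 2]] ki(2,1,3)])
    show "?D2 ! i = P' @ ?f 1 @ Q'" using ki(3) kl by simp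
    show "EP (lab e) (\<not> is_tail e) (psgn e) \<in> set (?D2 ! k)" if "e \<in> set (?f 1)" for e
    proof -
      have "EP (lab e) (\<not> is_tail e) (psgn e) \<in> set (filter is_tail (?f 0)) \<union> set (heads (?f 0))"
        using p1[OF that] by simp
      then show ?thesis using kl by auto
    qed
  qed
  have "?D3 = D[k := P @ filter is_tail (?f 0) @ heads (?f 0) @ Q, i := P' @ filter is_tail (?f 1) @ heads (?f 1) @ Q']"
    by (rule update_twice[OF ki(3)])
  then have dd: "DE n m D (D[k := P @ filter is_tail (?f 0) @ heads (?f 0) @ Q, i := P' @ filter is_tail (?f 1) @ heads (?f 1) @ Q'])"
    using DE_trans[OF 1[unfolded F] DE_trans[OF 2 3]] by (simp only:)
  have pa: "\<not> is_tail e \<and> psgn e = \<sigma> \<and> EP (lab e) True \<sigma> \<in> set (filter is_tail (?f 1))" if "e \<in> set (heads (?f 0))" for e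
    using that twist_fill_partner[of e n a \<sigma> True True 0] by auto
  have pb: "\<not> is_tail e \<and> psgn e = \<sigma> \<and> EP (lab e) True \<sigma> \<in> set (filter is_tail (?f 0))" if "e \<in> set (heads (?f 1))" for e
    using that twist_fill_partner[of e n a \<sigma> True True 1] by auto
  show ?thesis
    by (rule that[OF dd _ _ pa pb]) (simp_all only: twist_fill_heads set_filter mem_Collect_eq not_False_eq_True simp_thms)
qed

lemma map_ltr_cong':
  "(\<And>e. e \<in> set es \<Longrightarrow> trow D' (lab e) = trow D (lab e)) \<Longrightarrow> map (ltr D') es = map (ltr D) es"
  by (simp add: ltr_def)

lemma slide_sub_self: "e \<in> set (slide_sub x sx z sz p q e)"
  by (simp add: slide_sub_def)

lemma slide_sub_id:
  "EP x True sx \<notin> set r \<Longrightarrow> EP z False sz \<notin> set r \<Longrightarrow> concat (map (slide_sub x sx z sz p q) r) = r"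
  by (rule concat_singletons) (auto simp: slide_sub_def)

lemma heads_slide_sub:
  "EP z False sz \<notin> set r \<Longrightarrow> heads (concat (map (slide_sub x sx z sz p q) r)) = heads r"
  by (induction r) (auto simp: slide_sub_def)

text \<open>Each head of G passed by the tail of p conjugates p, so the head of p in row l ends up
  between the inverse of the word of G and that word. The arrows of G start on strands other than i
  and l, hence the new tails fall into third rows, next to existing tails, and leave rows i and l
  under control.\<close>

lemma sweep:
  assumes "gd_wf m D" "i < m" "l < m" "i \<noteq> l"
    and "D ! i = ts @ G @ [EP p True s] @ H" "D ! l = ls1 @ [EP p False s] @ ls2"
    and "\<forall>e\<in>set G. \<not> is_tail e \<and> trow D (lab e) \<noteq> i \<and> trow D (lab e) \<noteq> l"
  shows "\<exists>D' A A'. DE n m D D' \<and> D' ! i = ts @ [EP p True s] @ G @ H \<and> D' ! l = ls1 @ A @ [EP p False s] @ A' @ ls2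
    \<and> (\<forall>e\<in>set A \<union> set A'. \<not> is_tail e) \<and> map (ltr D') A = winv (map (ltr D) G) \<and> map (ltr D') A' = map (ltr D) G
    \<and> (\<forall>c<m. c \<noteq> i \<longrightarrow> c \<noteq> l \<longrightarrow> heads (D' ! c) = heads (D ! c) \<and> (rsorted (D ! c) \<longrightarrow> rsorted (D' ! c)))
    \<and> (\<forall>a\<in>labs D. a \<in> labs D' \<and> trow D' a = trow D a)"
  using assms
proof (induction G arbitrary: D H ls1 ls2 rule: rev_induct)
  case Nil
  show ?case
  proof (intro exI[of _ D] exI[of _ "[]"] conjI)
    show "DE n m D D" by (rule DE_refl[OF Nil(1)])
  qed (use Nil in auto)
next
  case (snoc g G)
  note wf = snoc.prems(1)
  have len: "length D = m" using wf by (simp add: gd_wf_def)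
  have il: "i < length D" "l < length D" using snoc.prems(2,3) len by auto
  have gG: "\<not> is_tail g" "trow D (lab g) \<noteq> i" "trow D (lab g) \<noteq> l" using snoc.prems(7) by auto
  obtain x sx where g: "g = EP x False sx" using gG(1) by (cases g) auto
  have gi: "g \<in> set (D ! i)" using snoc.prems(5) by simp
  have pl: "EP p False s \<in> set (D ! l)" using snoc.prems(6) by simp
  have xp: "x \<noteq> p"
  proof
    assume "x = p"
    then have "i = l" using tail_row_unique[OF wf il(1), of p False sx l s] gi g pl il(2) by simp
    then show False using snoc.prems(4) by simp
  qed
  define R where "R = trow D x"
  have R: "R < m" "EP x True sx \<in> set (D ! R)" "R \<noteq> i" "R \<noteq> l"
    using trow_in[OF wf row_subset[OF il(1) gi]] gG g len by (auto simp: R_def)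
  have xnot: "EP x True t \<notin> set (D ! c)" if "c < m" "c \<noteq> R" for c t
    using tail_row_unique[OF wf, of R x True sx c t] R that len by auto
  have pnot: "EP p False t \<notin> set (D ! c)" if "c < m" "c \<noteq> l" for c t
    using tail_row_unique[OF wf, of l p False s c t] pl that il len by auto
  obtain P Q where PQ: "P \<notin> labs D" "Q \<notin> labs D" "P \<noteq> Q" by (rule fresh2)
  define D0 where "D0 = D[i := (ts @ G) @ [EP p True s, EP x False sx] @ H]"
  let ?sb = "slide_sub x sx p s P Q"
  define D2 where "D2 = map (\<lambda>r. concat (map ?sb r)) D0"
  have 1: "DE n m D D2" unfolding D2_def D0_def
    by (rule slide[OF wf snoc.prems(2) _ xp PQ]) (use snoc.prems(5) g in simp)
  have wf2: "gd_wf m D2" using DE_wf[OF 1] by blast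
  have len2: "length D2 = m" using len by (simp add: D2_def D0_def)
  have rD2: "D2 ! c = concat (map ?sb (D ! c))" if "c < m" "c \<noteq> i" for c
    using that len by (simp add: D2_def D0_def)
  have D2i: "D2 ! i = (ts @ G) @ [EP p True s, EP x False sx] @ H"
  proof -
    have sub: "set ((ts @ G) @ [EP p True s, EP x False sx] @ H) \<subseteq> set (D ! i)" using snoc.prems(5) g by auto
    have "D2 ! i = concat (map ?sb ((ts @ G) @ [EP p True s, EP x False sx] @ H))"
      using il(1) by (simp add: D2_def D0_def)
    also have "\<dots> = (ts @ G) @ [EP p True s, EP x False sx] @ H"
      by (rule slide_sub_id) (use subsetD[OF sub] xnot[OF snoc.prems(2) not_sym[OF R(3)], of sx] pnot[OF snoc.prems(2,4), of s] in blast)+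
    finally show ?thesis .
  qed
  have D2l: "D2 ! l = (ls1 @ [EP P False (\<not> sx)]) @ [EP p False s] @ ([EP Q False sx] @ ls2)"
  proof -
    have "distinct (D ! l)" using distinct_row[OF wf_distinct[OF wf] il(2)] .
    then have n: "EP p False s \<notin> set ls1" "EP p False s \<notin> set ls2" unfolding snoc.prems(6) by auto
    have x: "EP x True sx \<notin> set ls1" "EP x True sx \<notin> set ls2" using xnot[of l sx] R snoc.prems(3,6) by auto
    have "D2 ! l = concat (map ?sb ls1) @ ?sb (EP p False s) @ concat (map ?sb ls2)"
      using rD2[of l] snoc.prems(3,4,6) by simp
    then show ?thesis using slide_sub_id[OF x(1) n(1)] slide_sub_id[OF x(2) n(2)] by (simp add: slide_sub_def)
  qed
  have mem2: "e \<in> set (D2 ! c)" if e: "c < m" "e \<in> set (D ! c)" for c e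
  proof (cases "c = i")
    case True
    then show ?thesis using e snoc.prems(5) g unfolding True D2i by auto
  next
    case False
    have "e \<in> set (?sb e)" by (rule slide_sub_self)
    then show ?thesis unfolding rD2[OF e(1) False] using e(2) by auto
  qed
  have tr2: "trow D2 a = trow D a" if "a \<in> labs D" for a
    by (rule trow_same[OF wf wf2 that]) (rule mem2)
  have lab2: "a \<in> labs D2" if a: "a \<in> labs D" for a
  proof -
    obtain e where e: "e \<in> set (concat D)" "lab e = a" using a by blast
    then obtain c where "c < length D" "e \<in> set (D ! c)" unfolding in_concat_nth by blast
    then have "e \<in> set (D2 ! c)" "c < length D2" using mem2 len len2 by auto
    then have "e \<in> set (concat D2)" by (metis row_subset)
    then show ?thesis using e(2) by blast
  qed
  have PQ2: "EP P True (\<not> sx) \<in> set (D2 ! R)" "EP Q True sx \<in> set (D2 ! R)"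
  proof -
    have "EP P True (\<not> sx) \<in> set (?sb (EP x True sx))" "EP Q True sx \<in> set (?sb (EP x True sx))"
      by (simp_all add: slide_sub_def)
    then show "EP P True (\<not> sx) \<in> set (D2 ! R)" "EP Q True sx \<in> set (D2 ! R)"
      unfolding rD2[OF R(1,3)] using R(2) by auto
  qed
  have trP: "trow D2 P = R" "trow D2 Q = R"
    using trow_eq[OF wf2 _ PQ2(1)] trow_eq[OF wf2 _ PQ2(2)] R(1) len2 by auto
  have Glab: "lab e \<in> labs D" if e: "e \<in> set G" for e
    using row_subset[OF il(1), of e] e snoc.prems(5) by (intro imageI) simp
  have ex: "\<exists>D' A A'. DE n m D2 D' \<and> D' ! i = ts @ [EP p True s] @ G @ (EP x False sx # H)
    \<and> D' ! l = (ls1 @ [EP P False (\<not> sx)]) @ A @ [EP p False s] @ A' @ ([EP Q False sx] @ ls2)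
    \<and> (\<forall>e\<in>set A \<union> set A'. \<not> is_tail e) \<and> map (ltr D') A = winv (map (ltr D2) G) \<and> map (ltr D') A' = map (ltr D2) G
    \<and> (\<forall>c<m. c \<noteq> i \<longrightarrow> c \<noteq> l \<longrightarrow> heads (D' ! c) = heads (D2 ! c) \<and> (rsorted (D2 ! c) \<longrightarrow> rsorted (D' ! c)))
    \<and> (\<forall>a\<in>labs D2. a \<in> labs D' \<and> trow D' a = trow D2 a)"
  proof (rule snoc.IH[OF wf2 snoc.prems(2-4) _ D2l])
    show "D2 ! i = ts @ G @ [EP p True s] @ EP x False sx # H" using D2i by simp
    show "\<forall>e\<in>set G. \<not> is_tail e \<and> trow D2 (lab e) \<noteq> i \<and> trow D2 (lab e) \<noteq> l"
    proof
      fix e assume e: "e \<in> set G"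
      then show "\<not> is_tail e \<and> trow D2 (lab e) \<noteq> i \<and> trow D2 (lab e) \<noteq> l"
        using snoc.prems(7) tr2[OF Glab[OF e]] by simp
    qed
  qed
  obtain D' A A' where D': "DE n m D2 D'" "D' ! i = ts @ [EP p True s] @ G @ (EP x False sx # H)"
    "D' ! l = (ls1 @ [EP P False (\<not> sx)]) @ A @ [EP p False s] @ A' @ ([EP Q False sx] @ ls2)"
    "\<forall>e\<in>set A \<union> set A'. \<not> is_tail e" "map (ltr D') A = winv (map (ltr D2) G)" "map (ltr D') A' = map (ltr D2) G"
    "\<forall>c<m. c \<noteq> i \<longrightarrow> c \<noteq> l \<longrightarrow> heads (D' ! c) = heads (D2 ! c) \<and> (rsorted (D2 ! c) \<longrightarrow> rsorted (D' ! c))"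
    "\<forall>a\<in>labs D2. a \<in> labs D' \<and> trow D' a = trow D2 a"
    using ex by (elim exE conjE) (rule that)
  have G2: "map (ltr D2) G = map (ltr D) G" by (rule map_ltr_cong') (use tr2 Glab in blast)
  have PQlab: "P \<in> labs D2" "Q \<in> labs D2"
    using imageI[OF row_subset[OF _ PQ2(1)], of lab] imageI[OF row_subset[OF _ PQ2(2)], of lab] R(1) len2
    by (simp_all del: set_concat)
  have trP': "trow D' P = R" "trow D' Q = R" using bspec[OF D'(8) PQlab(1)] bspec[OF D'(8) PQlab(2)] trP by simp_all
  have lg: "ltr D g = (R, sx)" by (simp add: ltr_def g R_def)
  show ?case
  proof (rule exI[of _ D'], rule exI[of _ "EP P False (\<not> sx) # A"], rule exI[of _ "A' @ [EP Q False sx]"], intro conjI)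
    show "DE n m D D'" by (rule DE_trans[OF 1 D'(1)])
    show "D' ! i = ts @ [EP p True s] @ (G @ [g]) @ H" using D'(2) g by simp
    show "D' ! l = ls1 @ (EP P False (\<not> sx) # A) @ [EP p False s] @ (A' @ [EP Q False sx]) @ ls2" using D'(3) by simp
    show "\<forall>e\<in>set (EP P False (\<not> sx) # A) \<union> set (A' @ [EP Q False sx]). \<not> is_tail e" using D'(4) by auto
    show "map (ltr D') (EP P False (\<not> sx) # A) = winv (map (ltr D) (G @ [g]))"
      using D'(5) G2 trP' lg by (simp add: ltr_def[of D' "EP P False (\<not> sx)"])
    show "map (ltr D') (A' @ [EP Q False sx]) = map (ltr D) (G @ [g])"
      using D'(6) G2 trP' lg by (simp add: ltr_def[of D' "EP Q False sx"])
    show "\<forall>c<m. c \<noteq> i \<longrightarrow> c \<noteq> l \<longrightarrow> heads (D' ! c) = heads (D ! c) \<and> (rsorted (D ! c) \<longrightarrow> rsorted (D' ! c))"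
    proof (intro allI impI)
      fix c assume c: "c < m" "c \<noteq> i" "c \<noteq> l"
      have "heads (D2 ! c) = heads (D ! c)" unfolding rD2[OF c(1,2)] by (rule heads_slide_sub[OF pnot[OF c(1,3)]])
      moreover have "rsorted (D ! c) \<longrightarrow> rsorted (D2 ! c)" unfolding rD2[OF c(1,2)] using rsorted_slide_sub by blast
      ultimately show "heads (D' ! c) = heads (D ! c) \<and> (rsorted (D ! c) \<longrightarrow> rsorted (D' ! c))" using D'(7) c by simp
    qed
    show "\<forall>a\<in>labs D. a \<in> labs D' \<and> trow D' a = trow D a"
    proof
      fix a assume a: "a \<in> labs D"
      show "a \<in> labs D' \<and> trow D' a = trow D a" using bspec[OF D'(8) lab2[OF a]] tr2[OF a] by simp
    qed
  qed
qed

lemma srep_labels: "srep m D W \<Longrightarrow> c < m \<Longrightarrow> x \<in> set (W c) \<Longrightarrow> fst x < m"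
proof -
  assume s: "srep m D W" and c: "c < m" and x: "x \<in> set (W c)"
  have "x \<in> set (hw D c)" using srepD(4)[OF s c] x by simp
  then obtain e where e: "e \<in> set (D ! c)" "x = ltr D e" by (auto simp: hw_def)
  have "e \<in> set (concat D)" using row_subset[of c D e] e c srepD(2)[OF s] by simp
  from trow_in(1)[OF srepD(1)[OF s] this] show ?thesis using e srepD(2)[OF s] by (simp add: ltr_def)
qed

text \<open>Both blocks of heads are placed directly after the tails, so on the level of words the
  2n-move puts an n-th power at the front of two words simultaneously.\<close>

lemma twist_srep:
  assumes sr: "srep m D W" and ki: "k < m" "i < m" "k \<noteq> i"
  shows "\<exists>D'. DE n m D D' \<and> srep m D' (W(k := replicate n (i, \<sigma>) @ W k, i := replicate n (k, \<sigma>) @ W i))"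
proof -
  note wf = srepD(1)[OF sr]
  have len: "length D = m" using srepD(2)[OF sr] .
  have rows: "D ! k = filter is_tail (D ! k) @ heads (D ! k)" "D ! i = filter is_tail (D ! i) @ heads (D ! i)"
    using srepD(3)[OF sr] ki unfolding rsorted_def by blast+
  obtain tA hA tB hB where DE: "DE n m D (D[k := filter is_tail (D ! k) @ tA @ hA @ heads (D ! k), i := filter is_tail (D ! i) @ tB @ hB @ heads (D ! i)])"
    and t: "\<And>e. e \<in> set tA \<Longrightarrow> is_tail e" "\<And>e. e \<in> set tB \<Longrightarrow> is_tail e"
    and h: "\<And>e. e \<in> set hA \<Longrightarrow> \<not> is_tail e \<and> psgn e = \<sigma> \<and> EP (lab e) True \<sigma> \<in> set tB"
      "\<And>e. e \<in> set hB \<Longrightarrow> \<not> is_tail e \<and> psgn e = \<sigma> \<and> EP (lab e) True \<sigma> \<in> set tA"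
    and n: "length hA = n" "length hB = n"
    by (rule twist_rows[OF wf ki rows, where n = n and \<sigma> = \<sigma>]) (rule that)
  let ?D = "D[k := filter is_tail (D ! k) @ tA @ hA @ heads (D ! k), i := filter is_tail (D ! i) @ tB @ hB @ heads (D ! i)]"
  have wf': "gd_wf m ?D" using DE_wf[OF DE] by blast
  have len': "length ?D = m" using len by simp
  have r: "?D ! c = (filter is_tail (D ! c) @ (if c = i then tB else if c = k then tA else [])) @ ((if c = i then hB else if c = k then hA else []) @ heads (D ! c))"
    if "c < m" for c
  proof -
    have "D ! c = filter is_tail (D ! c) @ heads (D ! c)" using srepD(3)[OF sr that] unfolding rsorted_def .
    then show ?thesis using that len ki by (auto simp: nth_list_update)
  qed
  have tr: "trow ?D a = trow D a" if al: "a \<in> labs D" for a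
  proof (rule trow_same[OF wf wf' al])
    fix c s assume c: "c < m" "EP a True s \<in> set (D ! c)"
    then show "EP a True s \<in> set (?D ! c)" by (simp add: r)
  qed
  have hA: "map (ltr ?D) hA = replicate n (i, \<sigma>)"
  proof (rule nth_equalityI)
    fix j assume "j < length (map (ltr ?D) hA)"
    then have j: "j < length hA" by simp
    have "EP (lab (hA ! j)) True \<sigma> \<in> set (?D ! i)" using h(1)[OF nth_mem[OF j]] ki by (simp add: r)
    then have "trow ?D (lab (hA ! j)) = i" using trow_eq[OF wf'] ki len' by metis
    then show "map (ltr ?D) hA ! j = replicate n (i, \<sigma>) ! j" using j n h(1)[OF nth_mem[OF j]] by (simp add: ltr_def)
  qed (use n in simp)
  have rk: "?D ! k = (filter is_tail (D ! k) @ tA) @ (hA @ heads (D ! k))" using r[OF ki(1)] ki(3) by simp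
  have hB: "map (ltr ?D) hB = replicate n (k, \<sigma>)"
  proof (rule nth_equalityI)
    fix j assume "j < length (map (ltr ?D) hB)"
    then have j: "j < length hB" by simp
    have "EP (lab (hB ! j)) True \<sigma> \<in> set (?D ! k)" unfolding rk using h(2)[OF nth_mem[OF j]] by simp
    then have "trow ?D (lab (hB ! j)) = k" using trow_eq[OF wf'] ki len' by metis
    then show "map (ltr ?D) hB ! j = replicate n (k, \<sigma>) ! j" using j n h(2)[OF nth_mem[OF j]] by (simp add: ltr_def)
  qed (use n in simp)
  have "srep m ?D (W(k := replicate n (i, \<sigma>) @ W k, i := replicate n (k, \<sigma>) @ W i))"
    unfolding srep_def
  proof (intro conjI allI impI wf')
    fix c assume c: "c < m"
    show "rsorted (?D ! c)" unfolding r[OF c] using t h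
      by (intro rsortedI) (auto split: if_splits)
    have hh: "heads (?D ! c) = (if c = i then hB else if c = k then hA else []) @ heads (D ! c)"
      unfolding r[OF c] using heads_tails[OF t(1)] heads_tails[OF t(2)] heads_heads[of hA] heads_heads[of hB] h
      by (auto simp: filter_empty_conv)
    have "map (ltr ?D) (heads (D ! c)) = W c"
    proof -
      have "map (ltr ?D) (heads (D ! c)) = map (ltr D) (heads (D ! c))"
        by (rule map_ltr_cong[OF tr]) (use row_subset[of c D] c len in auto)
      also have "\<dots> = W c" using srepD(4)[OF sr c] unfolding hw_def .
      finally show ?thesis .
    qed
    then show "hw ?D c = (W(k := replicate n (i, \<sigma>) @ W k, i := replicate n (k, \<sigma>) @ W i)) c"
      unfolding hw_def hh using hA hB by auto
  qed
  then show ?thesis using DE by blast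
qed

section \<open>The relations among the words on one strand\<close>

lemma in_row_lab: "c < length D \<Longrightarrow> e \<in> set (D ! c) \<Longrightarrow> lab e \<in> labs D"
  using row_subset[of c D e] by (intro imageI)

lemma trow_row:
  assumes "gd_wf m D" "c < m" "EP a True s \<in> set (D ! c)"
  shows "trow D a = c"
  using trow_eq[OF assms(1) _ assms(3)] assms(1,2) by (simp add: gd_wf_def)

lemma winv_replicate: "winv (replicate n (i, b)) = replicate n (i, \<not> b)"
  by (simp add: winv_def)

lemma map_ltr_trow:
  assumes "\<And>e. e \<in> set es \<Longrightarrow> lab e \<in> L" "\<And>a. a \<in> L \<Longrightarrow> trow D' a = trow D a"
  shows "map (ltr D') es = map (ltr D) es"
  by (rule map_ltr_cong') (rule assms(2)[OF assms(1)])

lemma srep_letter: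
  assumes sr: "srep m D W" and l: "l < m" and W: "W l = u @ [(k, s)] @ v"
  obtains ts h1 z h2 where "D ! l = (ts @ h1) @ [EP z False s] @ h2" "\<And>e. e \<in> set ts \<Longrightarrow> is_tail e"
    "\<And>e. e \<in> set h1 \<Longrightarrow> \<not> is_tail e" "\<And>e. e \<in> set h2 \<Longrightarrow> \<not> is_tail e" "map (ltr D) h1 = u" "map (ltr D) h2 = v"
    "trow D z = k" "k < m" "EP z True s \<in> set (D ! k)"
proof -
  have len: "length D = m" using srepD(2)[OF sr] .
  obtain ts h1 h' where r: "D ! l = ts @ h1 @ h'" "\<And>e. e \<in> set ts \<Longrightarrow> is_tail e"
    "\<And>e. e \<in> set h1 \<Longrightarrow> \<not> is_tail e" "\<And>e. e \<in> set h' \<Longrightarrow> \<not> is_tail e" "map (ltr D) h1 = u" "map (ltr D) h' = [(k, s)] @ v"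
    by (rule srep_row[OF sr l W]) (rule that)
  obtain e h2 where h': "h' = e # h2" "ltr D e = (k, s)" "map (ltr D) h2 = v" using r(6) by (cases h') auto
  have ne: "\<not> is_tail e" using r(4)[of e] h' by simp
  obtain z where e: "e = EP z False s" using h'(2) ne by (cases e) (simp add: ltr_def)
  have ein: "e \<in> set (concat D)" using row_subset[of l D e] r(1) h'(1) l len by simp
  have tz: "trow D z = k" using h'(2) e by (simp add: ltr_def)
  have t: "k < m" "EP z True s \<in> set (D ! k)" using trow_in[OF srepD(1)[OF sr] ein] tz e len by simp_all
  show ?thesis
    by (rule that[of ts h1 z h2, OF _ r(2,3) _ r(5) h'(3) tz t]) (use r(1,4) h'(1) e in simp_all)
qed

lemma move_tail_last:
  assumes sr: "srep m D W" and k: "k < m" and z: "EP z True s \<in> set (D ! k)"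
  obtains tt where "D ! k = filter is_tail (D ! k) @ heads (D ! k)" "\<And>e. e \<in> set tt \<Longrightarrow> is_tail e"
    "set (filter is_tail (D ! k)) = insert (EP z True s) (set tt)"
    "DE n m D (D[k := (tt @ [EP z True s]) @ heads (D ! k)])"
proof -
  have r: "D ! k = filter is_tail (D ! k) @ heads (D ! k)" using srepD(3)[OF sr k] unfolding rsorted_def .
  have "EP z True s \<in> set (filter is_tail (D ! k))" using z by simp
  then obtain t1 t2 where t: "filter is_tail (D ! k) = t1 @ EP z True s # t2" by (meson split_list)
  have tails: "is_tail e" if "e \<in> set (t1 @ EP z True s # t2)" for e using that unfolding t[symmetric] by simp
  have r': "D ! k = [] @ (t1 @ EP z True s # t2) @ heads (D ! k)" using r unfolding t by simp
  have "DE n m D (D[k := [] @ (t1 @ t2 @ [EP z True s]) @ heads (D ! k)])"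
    by (rule perm_tails[OF srepD(1)[OF sr] k r' tails]) simp_all
  then have d: "DE n m D (D[k := ((t1 @ t2) @ [EP z True s]) @ heads (D ! k)])" by simp
  show ?thesis
    by (rule that[OF r _ _ d]) (use tails t in auto)
qed

text \<open>This is the source of the relation that a generator commutes with its conjugates: an
  arrow leaving strand i may be conjugated by any later arc of strand i, here the one reached after
  passing the heads G.\<close>

lemma self_conj:
  assumes wf: "gd_wf m D" and il: "i < m" "l < m" "i \<noteq> l"
    and ri: "D ! i = tt @ [EP z True s] @ G @ H" and rl: "D ! l = ls1 @ [EP z False s] @ ls2"
  obtains P Q where "P \<notin> labs D" "Q \<notin> labs D" "P \<noteq> Q"
    "DE n m D (D[i := tt @ [EP z True s] @ G @ [EP P True (\<not> t), EP Q True t] @ H,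
       l := ls1 @ [EP P False (\<not> t), EP z False s, EP Q False t] @ ls2])"
proof -
  have len: "length D = m" using wf by (simp add: gd_wf_def)
  obtain y where y: "y \<notin> labs D" using fresh_nat[of "labs D"] by auto
  \<comment> \<open>An auxiliary self-arrow y with its head just before the tail of z and its tail
    after G. Sliding the tail of z over that head conjugates z by the arc on which y starts; then y
    is deleted.\<close>
  define D2 where "D2 = D[i := tt @ [EP y False t, EP z True s] @ (G @ [EP y True t] @ H)]"
  have len2: "length D2 = m" using len by (simp add: D2_def)
  let ?C = "(map (map Lit) D)[i := map Lit tt @ [Hole 1] @ map Lit (EP z True s # G) @ [Hole 0] @ map Lit H]"
  have "mset (concat ?C) + mset (map Lit (D ! i)) = mset (map Lit (concat D)) + mset (map Lit tt @ [Hole 1] @ map Lit (EP z True s # G) @ [Hole 0] @ map Lit H)"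
    using mset_update[of i "map (map Lit) D"] il len by (simp add: concat_Lit)
  then have "mset (concat ?C) = image_mset Lit (mset (concat D)) + mset (map Hole [0..<2])"
    by (simp add: ri numeral_2_eq_2)
  then have C: "ctx 2 ?C" by (rule ctx_msetI)
  have F: "fill f ?C = D[i := tt @ f 1 @ (EP z True s # G) @ f 0 @ H]" for f
    using il len by (simp add: fill_update fill_Lit)
  let ?f = "\<lambda>k::nat. if k = 0 then [EP y True t] else [EP y False t]"
  have E: "fill (\<lambda>_. []) ?C = D" unfolding F using update_same[OF ri] by simp
  have F2: "fill ?f ?C = D2" unfolding F D2_def by simp
  have m2: "mset (concat D2) = mset (concat D) + {#EP y True t, EP y False t#}"
    using mset_fill[OF C, of ?f] mset_fill[OF C, of "\<lambda>_. []"] unfolding E F2 by (simp add: numeral_2_eq_2)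
  have wf2: "gd_wf m D2" by (rule gd_wf_add[OF wf _ y m2]) (simp add: D2_def)
  have "sv_move D D2" unfolding sv_move_def
  proof (intro exI conjI)
    show "ctx 2 ?C" by (rule C)
    show "i < length ?C" using il len by simp
    show "Hole 0 \<in> set (?C ! i)" "Hole 1 \<in> set (?C ! i)" using il len by simp_all
    show "D = fill (\<lambda>_. []) ?C" using E by (rule sym)
    show "D2 = fill ?f ?C" using F2 by (rule sym)
  qed
  then have 1: "DE n m D D2" using wf wf2 by (intro DE_step) auto
  have zi: "EP z True s \<in> set (D ! i)" and zl: "EP z False s \<in> set (D ! l)" using ri rl by auto
  have yz: "y \<noteq> z" using in_row_lab[of i D "EP z True s"] zi y il len by auto
  obtain P Q where PQ: "P \<notin> labs D2" "Q \<notin> labs D2" "P \<noteq> Q" by (rule fresh2)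
  have sub: "labs D \<subseteq> labs D2"
  proof
    fix a assume "a \<in> labs D"
    then obtain e where e: "e \<in># mset (concat D)" "lab e = a" by (auto simp del: set_concat simp flip: set_mset_mset)
    then have "e \<in># mset (concat D2)" unfolding m2 by simp
    then have "e \<in> set (concat D2)" by (simp only: set_mset_mset)
    then show "a \<in> labs D2" using e(2) by (intro image_eqI) simp_all
  qed
  have yi: "EP y True t \<in> set (D2 ! i)" "EP y False t \<in> set (D2 ! i)" using il len by (simp_all add: D2_def)
  have yP: "y \<noteq> P" "y \<noteq> Q" using in_row_lab[of i D2 "EP y True t"] yi PQ il len2 by auto
  let ?sb = "slide_sub y t z s P Q"
  let ?D0 = "D2[i := tt @ [EP z True s, EP y False t] @ (G @ [EP y True t] @ H)]"
  let ?D3 = "map (\<lambda>r. concat (map ?sb r)) ?D0"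
  have 2: "DE n m D2 ?D3"
    by (rule slide[OF wf2 il(1) _ yz PQ]) (use il len in \<open>simp add: D2_def\<close>)
  have wf3: "gd_wf m ?D3" using DE_wf[OF 2] by blast
  have rl2: "D2 ! c = D ! c" if "c \<noteq> i" for c using that by (simp add: D2_def)
  have ny: "EP y b t' \<notin> set (D ! c)" if "c < m" for c b t'
    using in_row_lab[of c D "EP y b t'"] y that len by auto
  have nz: "EP z False t' \<notin> set (D ! c)" if "c < m" "c \<noteq> l" for c t'
    using tail_row_unique[OF wf, of l z False s c t'] zl il that len by auto
  have dl: "distinct (D ! l)" using distinct_row[OF wf_distinct[OF wf]] il len by simp
  have parts: "set tt \<subseteq> set (D ! i)" "set G \<subseteq> set (D ! i)" "set H \<subseteq> set (D ! i)" "set ls1 \<subseteq> set (D ! l)" "set ls2 \<subseteq> set (D ! l)"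
    unfolding ri rl by auto
  have sid: "concat (map ?sb r) = r" if "set r \<subseteq> set (D ! i)" for r
    by (rule slide_sub_id) (use subsetD[OF that] ny[OF il(1)] nz[OF il(1,3)] in blast)+
  have zn: "EP z False s \<notin> set ls1" "EP z False s \<notin> set ls2" using dl unfolding rl by auto
  have sid1: "concat (map ?sb ls1) = ls1" by (rule slide_sub_id) (use subsetD[OF parts(4)] ny[OF il(2)] zn in blast)+
  have sid2: "concat (map ?sb ls2) = ls2" by (rule slide_sub_id) (use subsetD[OF parts(5)] ny[OF il(2)] zn in blast)+
  have D3i: "?D3 ! i = tt @ [EP z True s, EP y False t] @ G @ [EP y True t, EP P True (\<not> t), EP Q True t] @ H"
  proof -
    have "?D3 ! i = concat (map ?sb tt) @ ?sb (EP z True s) @ ?sb (EP y False t) @ concat (map ?sb G) @ ?sb (EP y True t) @ concat (map ?sb H)"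
      using il len2 by simp
    then show ?thesis using sid[OF parts(1)] sid[OF parts(2)] sid[OF parts(3)] yz by (simp add: slide_sub_def)
  qed
  have D3l: "?D3 ! l = ls1 @ [EP P False (\<not> t), EP z False s, EP Q False t] @ ls2"
  proof -
    have "?D3 ! l = concat (map ?sb ls1) @ ?sb (EP z False s) @ concat (map ?sb ls2)"
      using il len2 rl2[of l] rl by simp
    then show ?thesis using sid1 sid2 by (simp add: slide_sub_def)
  qed
  have D3c: "?D3 ! c = D ! c" if c: "c < m" "c \<noteq> i" "c \<noteq> l" for c
  proof -
    have "?D3 ! c = concat (map ?sb (D ! c))" using c len2 rl2[of c] by simp
    also have "\<dots> = D ! c" by (rule slide_sub_id[OF ny[OF c(1)] nz[OF c(1,3)]])
    finally show ?thesis .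
  qed
  have y3: "EP y True t \<in> set (?D3 ! i)" "EP y False t \<in> set (?D3 ! i)" unfolding D3i by auto
  let ?D4 = "map (filter (\<lambda>e. lab e \<noteq> y)) ?D3"
  have 3: "DE n m ?D3 ?D4" by (rule sv_remove[OF wf3 il(1) y3])
  have fy: "filter (\<lambda>e. lab e \<noteq> y) r = r" if "set r \<subseteq> set (D ! c)" "c < m" for r c
  proof (rule filter_True, rule ballI)
    fix e assume "e \<in> set r"
    then have "lab e \<in> labs D" using that len by (intro in_row_lab[of c]) auto
    then show "lab e \<noteq> y" using y by blast
  qed
  have "?D4 = D[i := tt @ [EP z True s] @ G @ [EP P True (\<not> t), EP Q True t] @ H,
       l := ls1 @ [EP P False (\<not> t), EP z False s, EP Q False t] @ ls2]" (is "_ = ?R")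
  proof (rule nth_equalityI)
    fix c assume "c < length ?D4"
    then have c: "c < m" using len2 by simp
    have d4: "?D4 ! c = filter (\<lambda>e. lab e \<noteq> y) (?D3 ! c)" using c len2 by simp
    show "?D4 ! c = ?R ! c"
    proof (cases "c = i")
      case True
      show ?thesis unfolding d4 unfolding True D3i using fy[OF parts(1) il(1)] fy[OF parts(2) il(1)] fy[OF parts(3) il(1)] yz yP il len
        by simp
    next
      case ci: False
      show ?thesis
      proof (cases "c = l")
        case True
        show ?thesis unfolding d4 unfolding True D3l using fy[OF parts(4) il(2)] fy[OF parts(5) il(2)] yz yP il len by simp
      next
        case False
        show ?thesis unfolding d4 unfolding D3c[OF c ci False] using False fy[OF subset_refl c] ci by simp
      qed
    qed
  qed (simp add: len len2)
  then have d: "DE n m D ?R" using DE_trans[OF 1 DE_trans[OF 2 3]] by (simp only:)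
  show ?thesis by (rule that[OF _ _ PQ(3) d]) (use PQ sub in blast)+
qed

text \<open>After \<open>self_conj\<close> the two new arrows start behind the heads G of row i.
  Sweeping their tails back to the front sorts the row and replaces each of the two letters by its
  conjugate under the word g.\<close>

lemma RW_selfcomm:
  assumes sr: "srep m D W" and il: "i < m" "l < m" "i \<noteq> l"
    and Wl: "W l = u @ [(i, s)] @ v" and Wi: "W i = g @ w" and g: "\<And>x. x \<in> set g \<Longrightarrow> fst x \<noteq> i \<and> fst x \<noteq> l"
  shows "\<exists>D'. DE n m D D' \<and> srep m D' (W(l := u @ winv g @ [(i, \<not> t)] @ g @ [(i, s)] @ winv g @ [(i, t)] @ g @ v))"
proof -
  note wf = srepD(1)[OF sr]
  have len: "length D = m" using srepD(2)[OF sr] .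
  obtain tl h1 z h2 where rl: "D ! l = (tl @ h1) @ [EP z False s] @ h2" and tl: "\<And>e. e \<in> set tl \<Longrightarrow> is_tail e"
    and h12: "\<And>e. e \<in> set h1 \<Longrightarrow> \<not> is_tail e" "\<And>e. e \<in> set h2 \<Longrightarrow> \<not> is_tail e" and uv: "map (ltr D) h1 = u" "map (ltr D) h2 = v"
    and z: "trow D z = i" "i < m" "EP z True s \<in> set (D ! i)"
    by (rule srep_letter[OF sr il(2) Wl]) (rule that)
  obtain tt where ri: "D ! i = filter is_tail (D ! i) @ heads (D ! i)" and tt: "\<And>e. e \<in> set tt \<Longrightarrow> is_tail e"
    and stt: "set (filter is_tail (D ! i)) = insert (EP z True s) (set tt)"
    and d1: "DE n m D (D[i := (tt @ [EP z True s]) @ heads (D ! i)])"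
    by (rule move_tail_last[OF sr il(1) z(3), where n = n]) (rule that)
  define G where "G = take (length g) (heads (D ! i))"
  define H where "H = drop (length g) (heads (D ! i))"
  have GH: "heads (D ! i) = G @ H" by (simp add: G_def H_def)
  have hi: "map (ltr D) (heads (D ! i)) = g @ w" using srepD(4)[OF sr il(1)] Wi by (simp add: hw_def)
  have Gg: "map (ltr D) G = g" unfolding G_def take_map[symmetric] hi by simp
  have Gh: "\<not> is_tail e" "\<not> is_tail e'" if "e \<in> set G" "e' \<in> set H" for e e'
    using that set_take_subset[of "length g" "heads (D ! i)"] set_drop_subset[of "length g" "heads (D ! i)"]
    unfolding G_def H_def by auto
  have Gh1: "\<not> is_tail e" if "e \<in> set G" for e
    using that set_take_subset[of "length g" "heads (D ! i)"] unfolding G_def by auto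
  have Hh1: "\<not> is_tail e" if "e \<in> set H" for e
    using that set_drop_subset[of "length g" "heads (D ! i)"] unfolding H_def by auto
  define D1 where "D1 = D[i := tt @ [EP z True s] @ G @ H]"
  have d1': "DE n m D D1" using d1 unfolding GH D1_def by simp
  have wf1: "gd_wf m D1" using DE_wf[OF d1'] by blast
  have D1i: "D1 ! i = tt @ [EP z True s] @ G @ H" using il len by (simp add: D1_def)
  have D1l: "D1 ! l = (tl @ h1) @ [EP z False s] @ h2" using il rl by (simp add: D1_def)
  obtain P Q where PQ: "P \<notin> labs D1" "Q \<notin> labs D1" "P \<noteq> Q"
    and d2: "DE n m D1 (D1[i := tt @ [EP z True s] @ G @ [EP P True (\<not> t), EP Q True t] @ H,
       l := (tl @ h1) @ [EP P False (\<not> t), EP z False s, EP Q False t] @ h2])"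
    by (rule self_conj[OF wf1 il D1i D1l, where n = n and t = t]) (rule that)
  define D4 where "D4 = D1[i := tt @ [EP z True s] @ G @ [EP P True (\<not> t), EP Q True t] @ H,
       l := (tl @ h1) @ [EP P False (\<not> t), EP z False s, EP Q False t] @ h2]"
  have d4: "DE n m D1 D4" using d2 unfolding D4_def .
  have wf4: "gd_wf m D4" using DE_wf[OF d4] by blast
  have len4: "length D4 = m" using len by (simp add: D4_def D1_def)
  have D4i: "D4 ! i = (tt @ [EP z True s]) @ G @ [EP P True (\<not> t)] @ ([EP Q True t] @ H)"
    using il len by (simp add: D4_def D1_def)
  have D4l: "D4 ! l = (tl @ h1) @ [EP P False (\<not> t)] @ ([EP z False s, EP Q False t] @ h2)"
    using il len by (simp add: D4_def D1_def)
  have D4c: "D4 ! c = D ! c" if "c \<noteq> i" "c \<noteq> l" for c using that by (simp add: D4_def D1_def)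
  have sDi: "set (D ! i) = insert (EP z True s) (set tt) \<union> set G \<union> set H"
    using arg_cong[OF ri, of set] unfolding set_append stt GH by (simp only: set_append Un_assoc)
  have mem4: "e \<in> set (D4 ! c)" if e: "e \<in> set (D ! c)" for c e
  proof (cases "c = i")
    case True
    then show ?thesis using e sDi unfolding True D4i by auto
  next
    case ci: False
    show ?thesis
    proof (cases "c = l")
      case True
      then show ?thesis using e rl unfolding True D4l by auto
    qed (use e D4c ci in simp)
  qed
  have tr4: "trow D4 a = trow D a" if "a \<in> labs D" for a
    by (rule trow_same[OF wf wf4 that]) (rule mem4)
  have lab4: "a \<in> labs D4" if a: "a \<in> labs D" for a
  proof -
    obtain e where e: "e \<in> set (concat D)" "lab e = a" using a by blast
    then obtain c where "c < length D" "e \<in> set (D ! c)" unfolding in_concat_nth by blast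
    then show ?thesis using in_row_lab[of c D4 e] mem4[of e c] e(2) len len4 by simp
  qed
  have li: "i < length D" "l < length D" using il len by auto
  have GlD: "lab e \<in> labs D" if "e \<in> set G" for e using in_row_lab[OF li(1)] sDi that by blast
  have HlD: "lab e \<in> labs D" if "e \<in> set H" for e using in_row_lab[OF li(1)] sDi that by blast
  have h1D: "lab e \<in> labs D" if "e \<in> set h1" for e using in_row_lab[OF li(2), of e] rl that by simp
  have h2D: "lab e \<in> labs D" if "e \<in> set h2" for e using in_row_lab[OF li(2), of e] rl that by simp
  have zD: "z \<in> labs D" using in_row_lab[OF li(1) z(3)] by simp
  have Gtr: "\<not> is_tail e \<and> trow D (lab e) \<noteq> i \<and> trow D (lab e) \<noteq> l" if e: "e \<in> set G" for e
  proof -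
    have "ltr D e \<in> set g" using e unfolding Gg[symmetric] by simp
    then show ?thesis using g[of "ltr D e"] Gh1[OF e] by (simp add: ltr_def)
  qed
  have Gtr4: "\<not> is_tail e \<and> trow D4 (lab e) \<noteq> i \<and> trow D4 (lab e) \<noteq> l" if e: "e \<in> set G" for e
    using Gtr[OF e] tr4[OF GlD[OF e]] by simp
  have g4: "map (ltr D4) G = g" using map_ltr_trow[of G "labs D" D4 D, OF GlD tr4] Gg by simp
  have Gb4: "\<forall>e\<in>set G. \<not> is_tail e \<and> trow D4 (lab e) \<noteq> i \<and> trow D4 (lab e) \<noteq> l" using Gtr4 by (intro ballI)
  \<comment> \<open>First P is swept across G, then Q, so that both tails stand before all heads of
    row i.\<close>
  obtain D5 A A' where D5: "DE n m D4 D5" "D5 ! i = (tt @ [EP z True s]) @ [EP P True (\<not> t)] @ G @ ([EP Q True t] @ H)"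
    "D5 ! l = (tl @ h1) @ A @ [EP P False (\<not> t)] @ A' @ ([EP z False s, EP Q False t] @ h2)"
    "\<forall>e\<in>set A \<union> set A'. \<not> is_tail e" "map (ltr D5) A = winv (map (ltr D4) G)" "map (ltr D5) A' = map (ltr D4) G"
    "\<forall>c<m. c \<noteq> i \<longrightarrow> c \<noteq> l \<longrightarrow> heads (D5 ! c) = heads (D4 ! c) \<and> (rsorted (D4 ! c) \<longrightarrow> rsorted (D5 ! c))"
    "\<forall>a\<in>labs D4. a \<in> labs D5 \<and> trow D5 a = trow D4 a"
    using sweep[OF wf4 il D4i D4l Gb4, where n = n] by (elim exE conjE) (rule that)
  have wf5: "gd_wf m D5" using DE_wf[OF D5(1)] by blast
  have len5: "length D5 = m" using wf5 by (simp add: gd_wf_def)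
  have Gtr5: "\<not> is_tail e \<and> trow D5 (lab e) \<noteq> i \<and> trow D5 (lab e) \<noteq> l" if e: "e \<in> set G" for e
    using Gtr4[OF e] bspec[OF D5(8) lab4[OF GlD[OF e]]] by simp
  have D5i: "D5 ! i = (tt @ [EP z True s, EP P True (\<not> t)]) @ G @ [EP Q True t] @ H" using D5(2) by simp
  have D5l: "D5 ! l = ((tl @ h1) @ A @ [EP P False (\<not> t)] @ A' @ [EP z False s]) @ [EP Q False t] @ h2" using D5(3) by simp
  have Gb5: "\<forall>e\<in>set G. \<not> is_tail e \<and> trow D5 (lab e) \<noteq> i \<and> trow D5 (lab e) \<noteq> l" using Gtr5 by (intro ballI)
  obtain D6 B B' where D6: "DE n m D5 D6" "D6 ! i = (tt @ [EP z True s, EP P True (\<not> t)]) @ [EP Q True t] @ G @ H"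
    "D6 ! l = ((tl @ h1) @ A @ [EP P False (\<not> t)] @ A' @ [EP z False s]) @ B @ [EP Q False t] @ B' @ h2"
    "\<forall>e\<in>set B \<union> set B'. \<not> is_tail e" "map (ltr D6) B = winv (map (ltr D5) G)" "map (ltr D6) B' = map (ltr D5) G"
    "\<forall>c<m. c \<noteq> i \<longrightarrow> c \<noteq> l \<longrightarrow> heads (D6 ! c) = heads (D5 ! c) \<and> (rsorted (D5 ! c) \<longrightarrow> rsorted (D6 ! c))"
    "\<forall>a\<in>labs D5. a \<in> labs D6 \<and> trow D6 a = trow D5 a"
    using sweep[OF wf5 il D5i D5l Gb5, where n = n] by (elim exE conjE) (rule that)
  have wf6: "gd_wf m D6" using DE_wf[OF D6(1)] by blast
  have lab5: "a \<in> labs D5" if a: "a \<in> labs D" for a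
    by (rule conjunct1[OF bspec[OF D5(8) lab4[OF a]]])
  have tr6: "trow D6 a = trow D a" if a: "a \<in> labs D" for a
  proof -
    have "trow D6 a = trow D5 a" by (rule conjunct2[OF bspec[OF D6(8) lab5[OF a]]])
    also have "\<dots> = trow D4 a" by (rule conjunct2[OF bspec[OF D5(8) lab4[OF a]]])
    also have "\<dots> = trow D a" by (rule tr4[OF a])
    finally show ?thesis .
  qed
  have tP: "trow D6 P = i" "trow D6 Q = i"
    by (rule trow_row[OF wf6 il(1), of _ "\<not> t"], simp add: D6(2)) (rule trow_row[OF wf6 il(1), of _ t], simp add: D6(2))
  have l5: "l < length D5" using il len5 by simp
  have A5: "lab e \<in> labs D5" if "e \<in> set A" for e using in_row_lab[OF l5, of e] that D5(3) by simp
  have A5': "lab e \<in> labs D5" if "e \<in> set A'" for e using in_row_lab[OF l5, of e] that D5(3) by simp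
  have tr65: "trow D6 a = trow D5 a" if "a \<in> labs D5" for a by (rule conjunct2[OF bspec[OF D6(8) that]])
  have g5: "map (ltr D5) G = g"
    using map_ltr_trow[of G "labs D4" D5 D4, OF lab4[OF GlD] conjunct2[OF bspec[OF D5(8)]]] g4 by simp
  have A6: "map (ltr D6) A = winv g" using map_ltr_trow[of A "labs D5" D6 D5, OF A5 tr65] D5(5) g4 by simp
  have A6': "map (ltr D6) A' = g" using map_ltr_trow[of A' "labs D5" D6 D5, OF A5' tr65] D5(6) g4 by simp
  have old: "map (ltr D6) es = map (ltr D) es" if "\<And>e. e \<in> set es \<Longrightarrow> lab e \<in> labs D" for es
    by (rule map_ltr_trow[of es "labs D", OF that tr6])
  have lz: "ltr D6 (EP z False s) = (i, s)" using tr6[OF zD] z(1) by (simp add: ltr_def)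
  let ?W = "W(l := u @ winv g @ [(i, \<not> t)] @ g @ [(i, s)] @ winv g @ [(i, t)] @ g @ v)"
  have "srep m D6 ?W" unfolding srep_def
  proof (intro conjI allI impI wf6)
    fix c assume c: "c < m"
    let ?T = "tt @ [EP z True s, EP P True (\<not> t), EP Q True t]"
    let ?K = "h1 @ A @ [EP P False (\<not> t)] @ A' @ [EP z False s] @ B @ [EP Q False t] @ B' @ h2"
    have i6: "D6 ! i = ?T @ (G @ H)" and l6: "D6 ! l = tl @ ?K" using D6(2,3) by simp_all
    have Tt: "is_tail e" if "e \<in> set ?T" for e using that tt by auto
    have GHh: "\<not> is_tail e" if "e \<in> set (G @ H)" for e using that Gh1 Hh1 by auto
    have Kh: "\<not> is_tail e" if "e \<in> set ?K" for e using that h12[of e] D5(4) D6(4) by auto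
    have hT: "heads ?T = []" by (rule heads_tails) (rule Tt)
    have hG: "heads (G @ H) = G @ H" by (rule heads_heads) (rule GHh)
    have ht: "heads tl = []" by (rule heads_tails) (rule tl)
    have hK: "heads ?K = ?K" by (rule heads_heads) (rule Kh)
    have "rsorted (D6 ! c) \<and> hw D6 c = ?W c"
    proof (cases "c = i")
      case True
      have "heads (D6 ! i) = G @ H" unfolding i6 filter_append[of _ ?T "G @ H"] hT hG by simp
      moreover have "map (ltr D6) G = map (ltr D) G" by (rule old) (rule GlD)
      moreover have "map (ltr D6) H = map (ltr D) H" by (rule old) (rule HlD)
      ultimately have "hw D6 i = map (ltr D) (heads (D ! i))" unfolding hw_def GH by (simp only: map_append)
      then have "hw D6 i = W i" using hi Wi by simp
      moreover have "rsorted (D6 ! i)" unfolding i6 by (rule rsortedI[OF Tt GHh])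
      ultimately show ?thesis using True il by simp
    next
      case ci: False
      show ?thesis
      proof (cases "c = l")
        case True
        have "heads (D6 ! l) = ?K" unfolding l6 filter_append[of _ tl ?K] ht hK by simp
        moreover have "map (ltr D6) h1 = map (ltr D) h1" by (rule old) (rule h1D)
        moreover have "map (ltr D6) h2 = map (ltr D) h2" by (rule old) (rule h2D)
        moreover have "ltr D6 (EP P False (\<not> t)) = (i, \<not> t)" "ltr D6 (EP Q False t) = (i, t)" using tP by (simp_all add: ltr_def)
        ultimately have "hw D6 l = u @ winv g @ [(i, \<not> t)] @ g @ [(i, s)] @ winv g @ [(i, t)] @ g @ v"
          unfolding hw_def using uv A6 A6' D6(5,6) g5 lz by (simp only: map_append list.map)
        moreover have "rsorted (D6 ! l)" unfolding l6 by (rule rsortedI[OF tl Kh])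
        ultimately show ?thesis using True by simp
      next
        case cl: False
        have rs: "rsorted (D6 ! c)" using D5(7) D6(7) c ci cl srepD(3)[OF sr c] D4c[OF ci cl] by simp
        have "heads (D6 ! c) = heads (D ! c)" using D5(7) D6(7) c ci cl D4c[OF ci cl] by simp
        moreover have "map (ltr D6) (heads (D ! c)) = map (ltr D) (heads (D ! c))"
          by (rule old) (use in_row_lab[of c D] c len in auto)
        ultimately have "hw D6 c = W c" using srepD(4)[OF sr c] unfolding hw_def by (simp only:)
        then show ?thesis using rs cl by simp
      qed
    qed
    then show "rsorted (D6 ! c)" "hw D6 c = ?W c" by auto
  qed
  then show ?thesis using DE_trans[OF d1' DE_trans[OF d4 DE_trans[OF D5(1) D6(1)]]] by blast
qed

text \<open>A 2n-move on rows k and i supplies n heads to sweep the tail of z across, which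
  conjugates the letter k on row l by the n-th power of i. The n-th powers left on rows k and i are
  then removed by the inverse 2n-move.\<close>

lemma RW_central:
  assumes sr: "srep m D W" and il: "k < m" "i < m" "l < m" "k \<noteq> i" "k \<noteq> l" "i \<noteq> l"
    and Wl: "W l = u @ [(k, s)] @ v"
  shows "\<exists>D'. DE n m D D' \<and> srep m D' (W(l := u @ replicate n (i, False) @ [(k, s)] @ replicate n (i, True) @ v))"
proof -
  note wf = srepD(1)[OF sr]
  have len: "length D = m" using srepD(2)[OF sr] .
  let ?W4 = "W(l := u @ replicate n (i, False) @ [(k, s)] @ replicate n (i, True) @ v)"
  obtain tl h1 z h2 where rl: "D ! l = (tl @ h1) @ [EP z False s] @ h2" and tl: "\<And>e. e \<in> set tl \<Longrightarrow> is_tail e"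
    and h12: "\<And>e. e \<in> set h1 \<Longrightarrow> \<not> is_tail e" "\<And>e. e \<in> set h2 \<Longrightarrow> \<not> is_tail e" and uv: "map (ltr D) h1 = u" "map (ltr D) h2 = v"
    and z: "trow D z = k" "k < m" "EP z True s \<in> set (D ! k)"
    by (rule srep_letter[OF sr il(3) Wl]) (rule that)
  obtain tt where rk: "D ! k = filter is_tail (D ! k) @ heads (D ! k)" and tt: "\<And>e. e \<in> set tt \<Longrightarrow> is_tail e"
    and stt: "set (filter is_tail (D ! k)) = insert (EP z True s) (set tt)"
    and d1: "DE n m D (D[k := (tt @ [EP z True s]) @ heads (D ! k)])"
    by (rule move_tail_last[OF sr il(1) z(3), where n = n]) (rule that)
  define D1 where "D1 = D[k := (tt @ [EP z True s]) @ heads (D ! k)]"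
  have d1': "DE n m D D1" using d1 unfolding D1_def .
  have wf1: "gd_wf m D1" using DE_wf[OF d1'] by blast
  have ri: "D ! i = filter is_tail (D ! i) @ heads (D ! i)" using srepD(3)[OF sr il(2)] unfolding rsorted_def .
  have D1k: "D1 ! k = tt @ ([EP z True s] @ heads (D ! k))" using il len by (simp add: D1_def)
  have D1i: "D1 ! i = filter is_tail (D ! i) @ heads (D ! i)" using il ri by (simp add: D1_def)
  \<comment> \<open>The block goes between the other tails of row k and the tail of z, so that
    exactly the n heads from strand i stand before that tail.\<close>
  obtain tA hA tB hB where d2: "DE n m D1 (D1[k := tt @ tA @ hA @ ([EP z True s] @ heads (D ! k)), i := filter is_tail (D ! i) @ tB @ hB @ heads (D ! i)])"
    and t: "\<And>e. e \<in> set tA \<Longrightarrow> is_tail e" "\<And>e. e \<in> set tB \<Longrightarrow> is_tail e"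
    and h: "\<And>e. e \<in> set hA \<Longrightarrow> \<not> is_tail e \<and> psgn e = True \<and> EP (lab e) True True \<in> set tB"
      "\<And>e. e \<in> set hB \<Longrightarrow> \<not> is_tail e \<and> psgn e = True \<and> EP (lab e) True True \<in> set tA"
    and nn: "length hA = n" "length hB = n"
    by (rule twist_rows[OF wf1 il(1,2,4) D1k D1i, where n = n and \<sigma> = True]) (rule that)
  define D2 where "D2 = D1[k := tt @ tA @ hA @ ([EP z True s] @ heads (D ! k)), i := filter is_tail (D ! i) @ tB @ hB @ heads (D ! i)]"
  have d2': "DE n m D1 D2" using d2 unfolding D2_def .
  have wf2: "gd_wf m D2" using DE_wf[OF d2'] by blast
  have len2: "length D2 = m" using len by (simp add: D2_def D1_def)
  have D2k: "D2 ! k = (tt @ tA) @ hA @ [EP z True s] @ heads (D ! k)" using il len by (simp add: D2_def D1_def)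
  have D2i: "D2 ! i = (filter is_tail (D ! i) @ tB) @ (hB @ heads (D ! i))" using il len by (simp add: D2_def D1_def)
  have D2c: "D2 ! c = D ! c" if "c \<noteq> k" "c \<noteq> i" for c using that by (simp add: D2_def D1_def)
  have D2l: "D2 ! l = (tl @ h1) @ [EP z False s] @ h2" using D2c[of l] il rl by simp
  have sDk: "set (D ! k) = insert (EP z True s) (set tt) \<union> set (heads (D ! k))"
    using arg_cong[OF rk, of set] unfolding set_append stt .
  have sDi: "set (D ! i) = set (filter is_tail (D ! i)) \<union> set (heads (D ! i))"
    using arg_cong[OF ri, of set] unfolding set_append .
  have mem2: "e \<in> set (D2 ! c)" if e: "e \<in> set (D ! c)" for c e
  proof (cases "c = k")
    case True
    have "e \<in> insert (EP z True s) (set tt) \<union> set (heads (D ! k))" using e unfolding True sDk .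
    then show ?thesis unfolding True D2k set_append by auto
  next
    case ck: False
    show ?thesis
    proof (cases "c = i")
      case True
      have "e \<in> set (filter is_tail (D ! i)) \<union> set (heads (D ! i))" using e unfolding True sDi .
      then show ?thesis unfolding True D2i set_append by blast
    qed (use e D2c ck in simp)
  qed
  have tr2: "trow D2 a = trow D a" if "a \<in> labs D" for a
    by (rule trow_same[OF wf wf2 that]) (rule mem2)
  have lab2: "a \<in> labs D2" if a: "a \<in> labs D" for a
  proof -
    obtain e where e: "e \<in> set (concat D)" "lab e = a" using a by blast
    then obtain c where "c < length D" "e \<in> set (D ! c)" unfolding in_concat_nth by blast
    then show ?thesis using in_row_lab[of c D2 e] mem2[of e c] e(2) len len2 by simp
  qed
  have hAtr: "trow D2 (lab e) = i" if e: "e \<in> set hA" for e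
    by (rule trow_row[OF wf2 il(2), of _ True]) (use h(1)[OF e] D2i in simp)
  have hBtr: "trow D2 (lab e) = k" if e: "e \<in> set hB" for e
    by (rule trow_row[OF wf2 il(1), of _ True]) (use h(2)[OF e] D2k in simp)
  have hA2: "map (ltr D2) hA = replicate n (i, True)"
  proof (rule nth_equalityI)
    fix j assume "j < length (map (ltr D2) hA)"
    then have j: "j < length hA" by simp
    have "ltr D2 (hA ! j) = (i, True)" using hAtr[OF nth_mem[OF j]] h(1)[OF nth_mem[OF j]] by (simp add: ltr_def)
    then show "map (ltr D2) hA ! j = replicate n (i, True) ! j" using j nn by simp
  qed (simp add: nn)
  have hB2: "map (ltr D2) hB = replicate n (k, True)"
  proof (rule nth_equalityI)
    fix j assume "j < length (map (ltr D2) hB)"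
    then have j: "j < length hB" by simp
    have "ltr D2 (hB ! j) = (k, True)" using hBtr[OF nth_mem[OF j]] h(2)[OF nth_mem[OF j]] by (simp add: ltr_def)
    then show "map (ltr D2) hB ! j = replicate n (k, True) ! j" using j nn by simp
  qed (simp add: nn)
  have Gtr: "\<not> is_tail e \<and> trow D2 (lab e) \<noteq> k \<and> trow D2 (lab e) \<noteq> l" if e: "e \<in> set hA" for e
    using h(1)[OF e] hAtr[OF e] il by simp
  have Gb: "\<forall>e\<in>set hA. \<not> is_tail e \<and> trow D2 (lab e) \<noteq> k \<and> trow D2 (lab e) \<noteq> l" using Gtr by (intro ballI)
  obtain D3 A A' where D3: "DE n m D2 D3" "D3 ! k = (tt @ tA) @ [EP z True s] @ hA @ heads (D ! k)"
    "D3 ! l = (tl @ h1) @ A @ [EP z False s] @ A' @ h2"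
    "\<forall>e\<in>set A \<union> set A'. \<not> is_tail e" "map (ltr D3) A = winv (map (ltr D2) hA)" "map (ltr D3) A' = map (ltr D2) hA"
    "\<forall>c<m. c \<noteq> k \<longrightarrow> c \<noteq> l \<longrightarrow> heads (D3 ! c) = heads (D2 ! c) \<and> (rsorted (D2 ! c) \<longrightarrow> rsorted (D3 ! c))"
    "\<forall>a\<in>labs D2. a \<in> labs D3 \<and> trow D3 a = trow D2 a"
    using sweep[OF wf2 il(1,3,5) D2k D2l Gb, where n = n] by (elim exE conjE) (rule that)
  have wf3: "gd_wf m D3" using DE_wf[OF D3(1)] by blast
  have tr32: "trow D3 a = trow D2 a" if "a \<in> labs D2" for a by (rule conjunct2[OF bspec[OF D3(8) that]])
  have tr3: "trow D3 a = trow D a" if a: "a \<in> labs D" for a using tr32[OF lab2[OF a]] tr2[OF a] by simp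
  have old: "map (ltr D3) es = map (ltr D) es" if "\<And>e. e \<in> set es \<Longrightarrow> lab e \<in> labs D" for es
    by (rule map_ltr_trow[of es "labs D", OF that tr3])
  have rowD: "lab e \<in> labs D" if "c < m" "e \<in> set (D ! c)" for c e using in_row_lab[of c D e] that len by simp
  have hrow: "map (ltr D3) (heads (D ! c)) = W c" if c: "c < m" for c
  proof -
    have "map (ltr D3) (heads (D ! c)) = map (ltr D) (heads (D ! c))" by (rule old) (use rowD[OF c] in simp)
    also have "\<dots> = W c" using srepD(4)[OF sr c] unfolding hw_def .
    finally show ?thesis .
  qed
  have kl2: "k < length D2" "i < length D2" using il len2 by auto
  have hA3: "map (ltr D3) hA = replicate n (i, True)"
  proof -
    have "lab e \<in> labs D2" if "e \<in> set hA" for e using in_row_lab[OF kl2(1), of e] that D2k by simp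
    from map_ltr_trow[of hA "labs D2" D3 D2, OF this tr32] show ?thesis using hA2 by simp
  qed
  have hB3: "map (ltr D3) hB = replicate n (k, True)"
  proof -
    have "lab e \<in> labs D2" if "e \<in> set hB" for e using in_row_lab[OF kl2(2), of e] that D2i by simp
    from map_ltr_trow[of hB "labs D2" D3 D2, OF this tr32] show ?thesis using hB2 by simp
  qed
  have sl: "set h1 \<subseteq> set (D ! l)" "set h2 \<subseteq> set (D ! l)" unfolding rl by auto
  have "map (ltr D3) h1 = map (ltr D) h1" by (rule old) (use rowD[OF il(3)] sl in blast)
  then have h13: "map (ltr D3) h1 = u" using uv by (simp only:)
  have "map (ltr D3) h2 = map (ltr D) h2" by (rule old) (use rowD[OF il(3)] sl in blast)
  then have h23: "map (ltr D3) h2 = v" using uv by (simp only:)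
  have "z \<in> labs D" using rowD[OF il(1) z(3)] unfolding ep.sel .
  then have lz: "ltr D3 (EP z False s) = (k, s)" using tr3[of z] z(1) unfolding ltr_def ep.sel by (simp only:)
  \<comment> \<open>The tuple reached is ?W4 after a 2n-move on k and i. Hence the move is undone by
    twisting a diagram for ?W4 and comparing the two through \<open>srep_unique\<close>.\<close>
  let ?W3 = "?W4(k := replicate n (i, True) @ ?W4 k, i := replicate n (k, True) @ ?W4 i)"
  have sr3: "srep m D3 ?W3" unfolding srep_def
  proof (intro conjI allI impI wf3)
    fix c assume c: "c < m"
    let ?T = "tt @ tA @ [EP z True s]" and ?K = "h1 @ A @ [EP z False s] @ A' @ h2"
    have k3: "D3 ! k = ?T @ (hA @ heads (D ! k))" and l3: "D3 ! l = tl @ ?K" using D3(2,3) by simp_all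
    have Tt: "is_tail e" if "e \<in> set ?T" for e using that tt[of e] t(1)[of e] by auto
    have Hh: "\<not> is_tail e" if "e \<in> set (hA @ heads (D ! k))" for e using that h(1)[of e] by auto
    have Kh: "\<not> is_tail e" if e: "e \<in> set ?K" for e
    proof -
      have "e \<in> set h1 \<or> e \<in> set A \<union> set A' \<or> e = EP z False s \<or> e \<in> set h2" using e by auto
      then show ?thesis using h12[of e] bspec[OF D3(4), of e] by (elim disjE) simp_all
    qed
    have Ti: "is_tail e" if "e \<in> set (filter is_tail (D ! i) @ tB)" for e using that t(2)[of e] by auto
    have Hi: "\<not> is_tail e" if "e \<in> set (hB @ heads (D ! i))" for e using that h(2)[of e] by auto
    have hT: "heads ?T = []" by (rule heads_tails) (rule Tt)
    have hH: "heads (hA @ heads (D ! k)) = hA @ heads (D ! k)" by (rule heads_heads) (rule Hh)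
    have ht: "heads tl = []" by (rule heads_tails) (rule tl)
    have hK: "heads ?K = ?K" by (rule heads_heads) (rule Kh)
    have hTi: "heads (filter is_tail (D ! i) @ tB) = []" by (rule heads_tails) (rule Ti)
    have hHi: "heads (hB @ heads (D ! i)) = hB @ heads (D ! i)" by (rule heads_heads) (rule Hi)
    have "rsorted (D3 ! c) \<and> hw D3 c = ?W3 c"
    proof (cases "c = k")
      case True
      have "heads (D3 ! k) = hA @ heads (D ! k)" unfolding k3 filter_append[of _ ?T "hA @ heads (D ! k)"] hT hH by simp
      then have "hw D3 k = replicate n (i, True) @ W k" unfolding hw_def using hA3 hrow[OF il(1)] by (simp only: map_append)
      moreover have "rsorted (D3 ! k)" unfolding k3 by (rule rsortedI[OF Tt Hh])
      ultimately show ?thesis using True il by simp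
    next
      case ck: False
      show ?thesis
      proof (cases "c = l")
        case True
        have "heads (D3 ! l) = ?K" unfolding l3 filter_append[of _ tl ?K] ht hK by simp
        then have "hw D3 l = ?W4 l"
          unfolding hw_def using h13 h23 D3(5,6) hA2 lz
          by (simp only: map_append list.map winv_replicate fun_upd_same not_True_eq_False)
        moreover have "rsorted (D3 ! l)" unfolding l3 by (rule rsortedI[OF tl Kh])
        ultimately show ?thesis using True il by simp
      next
        case cl: False
        note hd0 = mp[OF mp[OF mp[OF spec[OF D3(7), of c] c] ck] cl]
        note hd = conjunct1[OF hd0] conjunct2[OF hd0]
        show ?thesis
        proof (cases "c = i")
          case True
          have "rsorted (D2 ! i)" unfolding D2i by (rule rsortedI[OF Ti Hi])
          moreover have "heads (D2 ! i) = hB @ heads (D ! i)"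
            unfolding D2i filter_append[of _ "filter is_tail (D ! i) @ tB" "hB @ heads (D ! i)"] hTi hHi by simp
          ultimately have "rsorted (D3 ! i)" "hw D3 i = replicate n (k, True) @ W i"
            using hd hB3 hrow[OF il(2)] unfolding True hw_def by (simp_all only: map_append simp_thms)
          then show ?thesis using True il by simp
        next
          case ci: False
          have "D2 ! c = D ! c" by (rule D2c[OF ck ci])
          then have "rsorted (D3 ! c)" "hw D3 c = W c" using hd hrow[OF c] srepD(3)[OF sr c] unfolding hw_def by (simp_all only: simp_thms)
          then show ?thesis using ck ci cl by simp
        qed
      qed
    qed
    then show "rsorted (D3 ! c)" "hw D3 c = ?W3 c" by auto
  qed
  have "\<exists>D4. srep m D4 ?W4"
  proof (rule srep_exists)
    fix c x assume c: "c < m" and x: "x \<in> set (?W4 c)"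
    show "fst x < m"
    proof (cases "c = l")
      case True
      have "x \<in> set (u @ replicate n (i, False) @ [(k, s)] @ replicate n (i, True) @ v)" using x True by simp
      then have "x \<in> set (W l) \<or> fst x = i" unfolding Wl by (auto split: if_splits)
      then show ?thesis
      proof
        assume "x \<in> set (W l)"
        then show ?thesis by (rule srep_labels[OF sr il(3)])
      qed (use il in simp)
    next
      case False
      then have "x \<in> set (W c)" using x by simp
      then show ?thesis by (rule srep_labels[OF sr c])
    qed
  qed
  then obtain D4 where D4: "srep m D4 ?W4" by (elim exE) (rule that)
  obtain D5 where D5: "DE n m D4 D5" "srep m D5 ?W3" using twist_srep[OF D4 il(1,2,4), where \<sigma> = True and n = n] by (elim exE conjE) (rule that)
  have "DE n m D3 D5" by (rule srep_unique[OF sr3 D5(2)])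
  from DE_trans[OF DE_trans[OF d1' DE_trans[OF d2' D3(1)]] DE_trans[OF this DE_sym[OF D5(1)]]]
  have "DE n m D D4" .
  then show ?thesis using D4 by (intro exI conjI)
qed

section \<open>The group of words on one strand\<close>

text \<open>Words modulo the relation weq form a group only after a choice of n, m and l, so they cannot be given
a group type directly; they act faithfully on their own classes, inside the full symmetric group.\<close>

typedef 'a sym = "{f :: 'a \<Rightarrow> 'a. bij f}"
  morphisms ap Abs_sym
  by (rule exI[of _ id]) simp

lemma bij_ap [simp]: "bij (ap f)"
  using ap[of f] by simp

lemma ap_Abs: "bij f \<Longrightarrow> ap (Abs_sym f) = f"
  by (simp add: Abs_sym_inverse)

instantiation sym :: (type) group_add
begin

definition "0 = Abs_sym id"
definition "f + g = Abs_sym (ap f \<circ> ap g)"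
definition "- f = Abs_sym (inv (ap f))"
definition "f - g = f + - (g :: 'a sym)"

instance
proof
  fix f g h :: "'a sym"
  have ap_add: "ap (f + g) = ap f \<circ> ap g" for f g :: "'a sym"
    unfolding plus_sym_def by (rule ap_Abs) (simp add: bij_comp)
  have ap_0: "ap (0 :: 'a sym) = id" unfolding zero_sym_def by (rule ap_Abs) simp
  have ap_u: "ap (- f) = inv (ap f)" for f :: "'a sym"
    unfolding uminus_sym_def by (rule ap_Abs) (simp add: bij_imp_bij_inv)
  show "f + g + h = f + (g + h)" by (simp add: ap_inject[symmetric] ap_add comp_assoc)
  show "0 + f = f" "f + 0 = f" by (simp_all add: ap_inject[symmetric] ap_add ap_0)
  show "- f + f = 0" using bij_is_inj[OF bij_ap[of f]] by (simp add: ap_inject[symmetric] ap_add ap_0 ap_u)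
  show "f + - g = f - g" by (simp add: minus_sym_def)
qed

end

definition VL :: "nat \<Rightarrow> nat \<Rightarrow> nat \<times> bool \<Rightarrow> bool" where
  "VL m l x \<longleftrightarrow> fst x < m \<and> fst x \<noteq> l"

definition validW :: "nat \<Rightarrow> (nat \<Rightarrow> gword) \<Rightarrow> bool" where
  "validW m W \<longleftrightarrow> (\<forall>c<m. \<forall>x\<in>set (W c). fst x < m)"

lemma validW_srep: "validW m W \<Longrightarrow> \<exists>D. srep m D W"
  by (rule srep_exists) (auto simp: validW_def)

lemma RW_refl: "RW n m W W"
  unfolding RW_def using srep_unique by blast

lemma RW_sym: "RW n m W W' \<Longrightarrow> RW n m W' W"
  unfolding RW_def using DE_sym by blast

lemma RW_trans:
  assumes "validW m W2" "RW n m W1 W2" "RW n m W2 W3"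
  shows "RW n m W1 W3"
proof -
  obtain D2 where D2: "srep m D2 W2" using validW_srep[OF assms(1)] by blast
  show ?thesis unfolding RW_def
  proof (intro allI impI)
    fix D D' assume "srep m D W1" "srep m D' W3"
    then have "DE n m D D2" "DE n m D2 D'" using assms(2,3) D2 unfolding RW_def by blast+
    then show "DE n m D D'" by (rule DE_trans)
  qed
qed

text \<open>Interchangeability on strand l, in every context and for all words on the other strands.
  The filters delete letters that are not allowed on strand l, so that this is a congruence on all
  words instead of a partial one.\<close>

definition weq :: "nat \<Rightarrow> nat \<Rightarrow> nat \<Rightarrow> gword \<Rightarrow> gword \<Rightarrow> bool" where
  "weq n m l w w' \<longleftrightarrow> (\<forall>W u v. validW m W \<longrightarrow>
     RW n m (W(l := filter (VL m l) u @ filter (VL m l) w @ filter (VL m l) v))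
            (W(l := filter (VL m l) u @ filter (VL m l) w' @ filter (VL m l) v)))"

lemma weqI:
  assumes "\<And>W u v. validW m W \<Longrightarrow>
     RW n m (W(l := filter (VL m l) u @ filter (VL m l) w @ filter (VL m l) v))
            (W(l := filter (VL m l) u @ filter (VL m l) w' @ filter (VL m l) v))"
  shows "weq n m l w w'"
  unfolding weq_def using assms by blast

lemma weqD:
  "weq n m l w w' \<Longrightarrow> validW m W \<Longrightarrow>
     RW n m (W(l := filter (VL m l) u @ filter (VL m l) w @ filter (VL m l) v))
            (W(l := filter (VL m l) u @ filter (VL m l) w' @ filter (VL m l) v))"
  unfolding weq_def by blast

lemma validW_upd: "validW m W \<Longrightarrow> validW m (W(l := filter (VL m l) u))"
  by (auto simp: validW_def VL_def)

lemma weq_refl: "weq n m l w w"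
  by (rule weqI) (rule RW_refl)

lemma weq_sym: "weq n m l w w' \<Longrightarrow> weq n m l w' w"
  by (rule weqI) (rule RW_sym[OF weqD])

lemma weq_trans:
  assumes "weq n m l w1 w2" "weq n m l w2 w3"
  shows "weq n m l w1 w3"
proof (rule weqI)
  fix W u v assume W: "validW m W"
  have "validW m (W(l := filter (VL m l) (u @ w2 @ v)))" by (rule validW_upd[OF W])
  then have "validW m (W(l := filter (VL m l) u @ filter (VL m l) w2 @ filter (VL m l) v))" by simp
  then show "RW n m (W(l := filter (VL m l) u @ filter (VL m l) w1 @ filter (VL m l) v))
            (W(l := filter (VL m l) u @ filter (VL m l) w3 @ filter (VL m l) v))"
    by (rule RW_trans[OF _ weqD[OF assms(1) W] weqD[OF assms(2) W]])
qed

lemma weq_ctx: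
  assumes "weq n m l w w'"
  shows "weq n m l (a @ w @ b) (a @ w' @ b)"
proof (rule weqI)
  fix W u v assume W: "validW m W"
  from weqD[OF assms W, of "u @ a" "b @ v"]
  show "RW n m (W(l := filter (VL m l) u @ filter (VL m l) (a @ w @ b) @ filter (VL m l) v))
            (W(l := filter (VL m l) u @ filter (VL m l) (a @ w' @ b) @ filter (VL m l) v))" by simp
qed

lemma RW_from:
  assumes "validW m W" "\<And>D. srep m D W \<Longrightarrow> \<exists>D'. DE n m D D' \<and> srep m D' W'"
  shows "RW n m W W'"
proof -
  obtain D where D: "srep m D W" using validW_srep[OF assms(1)] by blast
  then obtain D' where "DE n m D D'" "srep m D' W'" using assms(2) by blast
  then show ?thesis using RWI[OF D] by blast
qed

lemma weq_cancel:
  assumes l: "l < m"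
  shows "weq n m l [(j, s), (j, \<not> s)] []"
proof (rule weqI)
  fix W u v assume W: "validW m W"
  let ?u = "filter (VL m l) u" and ?v = "filter (VL m l) v"
  show "RW n m (W(l := ?u @ filter (VL m l) [(j, s), (j, \<not> s)] @ ?v)) (W(l := ?u @ filter (VL m l) [] @ ?v))"
  proof (cases "j < m \<and> j \<noteq> l")
    case True
    have "RW n m (W(l := ?u @ ?v)) ((W(l := ?u @ ?v))(l := ?u @ [(j, s), (j, \<not> s)] @ ?v))"
    proof (rule RW_from)
      show "validW m (W(l := ?u @ ?v))" using validW_upd[OF W, of l "u @ v"] by simp
      fix D assume "srep m D (W(l := ?u @ ?v))"
      then show "\<exists>D'. DE n m D D' \<and> srep m D' ((W(l := ?u @ ?v))(l := ?u @ [(j, s), (j, \<not> s)] @ ?v))"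
        by (rule RW_cancel) (use True l in simp_all)
    qed
    moreover have "filter (VL m l) [(j, s), (j, \<not> s)] = [(j, s), (j, \<not> s)]" using True by (simp add: VL_def)
    ultimately show ?thesis by (simp only: RW_sym fun_upd_upd filter.simps(1) append_Nil)
  next
    case False
    then have "filter (VL m l) [(j, s), (j, \<not> s)] = []" by (simp add: VL_def)
    then show ?thesis using RW_refl by (simp only: filter.simps(1))
  qed
qed

lemma weq_winv: "l < m \<Longrightarrow> weq n m l (w @ winv w) []"
proof (induction w)
  case Nil
  then show ?case by (simp add: weq_refl)
next
  case (Cons x w)
  have "weq n m l ([x] @ (w @ winv w) @ [(fst x, \<not> snd x)]) ([x] @ [] @ [(fst x, \<not> snd x)])"
    by (rule weq_ctx[OF Cons.IH[OF Cons.prems]])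
  moreover have "weq n m l ([x] @ [] @ [(fst x, \<not> snd x)]) []"
    using weq_cancel[OF Cons.prems, of n "fst x" "snd x"] by simp
  ultimately have "weq n m l ([x] @ (w @ winv w) @ [(fst x, \<not> snd x)]) []" by (rule weq_trans)
  then show ?case by simp
qed

text \<open>Lets an arbitrary word g stand at the front of the word of strand i, where
  \<open>RW_selfcomm\<close> expects it.\<close>

lemma RW_pad:
  assumes g: "\<And>x. x \<in> set g \<Longrightarrow> fst x < m" and i: "i < m"
  shows "validW m W \<Longrightarrow> RW n m W (W(i := g @ winv g @ W i))"
  using g
proof (induction g arbitrary: W rule: rev_induct)
  case Nil
  then show ?case using RW_refl by simp
next
  case (snoc x g)
  have x: "fst x < m" using snoc.prems(2)[of x] by simp
  have g: "fst y < m" if "y \<in> set g" for y using snoc.prems(2)[of y] that by simp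
  let ?W1 = "W(i := g @ winv g @ W i)"
  have v1: "validW m ?W1"
    using snoc.prems(1) g unfolding validW_def winv_def by auto
  have 1: "RW n m W ?W1" using snoc.IH[OF snoc.prems(1)] g by blast
  have "RW n m ?W1 (?W1(i := g @ [(fst x, snd x), (fst x, \<not> snd x)] @ (winv g @ W i)))"
  proof (rule RW_from[OF v1])
    fix D assume "srep m D ?W1"
    then show "\<exists>D'. DE n m D D' \<and> srep m D' (?W1(i := g @ [(fst x, snd x), (fst x, \<not> snd x)] @ (winv g @ W i)))"
      by (rule RW_cancel) (use x i in simp_all)
  qed
  then have "RW n m W (?W1(i := g @ [(fst x, snd x), (fst x, \<not> snd x)] @ (winv g @ W i)))"
    by (rule RW_trans[OF v1 1])
  moreover have "(g @ [x]) @ winv (g @ [x]) @ W i = g @ [(fst x, snd x), (fst x, \<not> snd x)] @ (winv g @ W i)"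
    by (simp add: winv_def)
  ultimately show ?case by (simp only: fun_upd_upd)
qed

lemma filter_VL: "(\<And>x. x \<in> set w \<Longrightarrow> fst x < m \<and> fst x \<noteq> l) \<Longrightarrow> filter (VL m l) w = w"
  by (rule filter_True) (simp add: VL_def)

text \<open>The word of strand i is padded by g and its inverse, the relation is applied, and the
  padding is taken away again. The result says that x i is unchanged under conjugation by its
  conjugate under g.\<close>

lemma weq_selfcomm:
  assumes il: "i < m" "l < m" "i \<noteq> l" and g: "\<And>x. x \<in> set g \<Longrightarrow> fst x < m \<and> fst x \<noteq> i \<and> fst x \<noteq> l"
  shows "weq n m l [(i, True)] (winv g @ [(i, False)] @ g @ [(i, True)] @ winv g @ [(i, True)] @ g)"
proof (rule weqI)
  fix W u v assume W: "validW m W"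
  let ?u = "filter (VL m l) u" and ?v = "filter (VL m l) v"
  let ?c = "winv g @ [(i, False)] @ g @ [(i, True)] @ winv g @ [(i, True)] @ g"
  have gi: "fst x < m \<and> fst x \<noteq> i \<and> fst x \<noteq> l" if x: "x \<in> set (winv g)" for x
  proof -
    have "fst x \<in> fst ` set (winv g)" using x by (rule imageI)
    then have "fst x \<in> fst ` set g" by (simp only: fst_set_winv)
    then obtain y where "y \<in> set g" "fst x = fst y" by (rule imageE) blast
    then show ?thesis using g[of y] by simp
  qed
  have fg: "filter (VL m l) g = g" by (rule filter_VL) (use g in blast)
  have fg': "filter (VL m l) (winv g) = winv g" by (rule filter_VL) (use gi in blast)
  have fi: "filter (VL m l) [(i, b)] = [(i, b)]" for b using il by (simp add: VL_def)
  have fc: "filter (VL m l) ?c = ?c" by (simp only: filter_append fg fg' fi)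
  let ?W0 = "W(l := ?u @ [(i, True)] @ ?v)" and ?W3 = "W(l := ?u @ ?c @ ?v)"
  have v0: "validW m ?W0" using validW_upd[OF W, of l "u @ [(i, True)] @ v"] by (simp only: filter_append fi)
  have v3: "validW m ?W3" using validW_upd[OF W, of l "u @ ?c @ v"] by (simp only: filter_append fg fg' fi append_assoc)
  have gm: "fst x < m" if "x \<in> set g" for x using g[OF that] by blast
  \<comment> \<open>Both tuples are padded in row i, so the second padding serves, reversed, to
    return from the padded result.\<close>
  have p0: "RW n m ?W0 (?W0(i := g @ winv g @ ?W0 i))" by (rule RW_pad[OF _ il(1) v0]) (rule gm)
  have p3: "RW n m ?W3 (?W3(i := g @ winv g @ ?W3 i))" by (rule RW_pad[OF _ il(1) v3]) (rule gm)
  let ?W1 = "?W0(i := g @ winv g @ ?W0 i)"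
  have pad: "validW m (V(i := g @ winv g @ V i))" if V: "validW m V" for V
    using V gm gi unfolding validW_def by auto
  have v1: "validW m ?W1" by (rule pad[OF v0])
  have "RW n m ?W1 (?W1(l := ?u @ winv g @ [(i, \<not> True)] @ g @ [(i, True)] @ winv g @ [(i, True)] @ g @ ?v))"
  proof (rule RW_from[OF v1])
    fix D assume D: "srep m D ?W1"
    show "\<exists>D'. DE n m D D' \<and> srep m D' (?W1(l := ?u @ winv g @ [(i, \<not> True)] @ g @ [(i, True)] @ winv g @ [(i, True)] @ g @ ?v))"
    proof (rule RW_selfcomm[OF D il])
      show "?W1 l = ?u @ [(i, True)] @ ?v" using il by simp
      show "?W1 i = g @ (winv g @ ?W0 i)" by simp
      show "fst x \<noteq> i \<and> fst x \<noteq> l" if "x \<in> set g" for x using g[OF that] by blast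
    qed
  qed
  moreover have "?W1(l := ?u @ winv g @ [(i, \<not> True)] @ g @ [(i, True)] @ winv g @ [(i, True)] @ g @ ?v) = ?W3(i := g @ winv g @ ?W3 i)"
    using il by (auto simp: fun_upd_def)
  ultimately have "RW n m ?W1 (?W3(i := g @ winv g @ ?W3 i))" by (simp only:)
  then have "RW n m ?W1 ?W3" by (rule RW_trans[OF pad[OF v3] _ RW_sym[OF p3]])
  then have "RW n m ?W0 ?W3" by (rule RW_trans[OF v1 p0])
  then show "RW n m (W(l := ?u @ filter (VL m l) [(i, True)] @ ?v)) (W(l := ?u @ filter (VL m l) ?c @ ?v))"
    by (simp only: fi fc)
qed

lemma weq_central:
  assumes il: "k < m" "i < m" "l < m" "k \<noteq> i" "k \<noteq> l" "i \<noteq> l"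
  shows "weq n m l [(k, True)] (replicate n (i, False) @ [(k, True)] @ replicate n (i, True))"
proof (rule weqI)
  fix W u v assume W: "validW m W"
  let ?u = "filter (VL m l) u" and ?v = "filter (VL m l) v"
  let ?c = "replicate n (i, False) @ [(k, True)] @ replicate n (i, True)"
  have f: "filter (VL m l) [(k, True)] = [(k, True)]" "filter (VL m l) ?c = ?c" using il by (simp_all add: VL_def)
  let ?W0 = "W(l := ?u @ [(k, True)] @ ?v)"
  have v0: "validW m ?W0" using validW_upd[OF W, of l "u @ [(k, True)] @ v"] f by (simp only: filter_append)
  have "RW n m ?W0 (?W0(l := ?u @ replicate n (i, False) @ [(k, True)] @ replicate n (i, True) @ ?v))"
  proof (rule RW_from[OF v0])
    fix D assume D: "srep m D ?W0"
    show "\<exists>D'. DE n m D D' \<and> srep m D' (?W0(l := ?u @ replicate n (i, False) @ [(k, True)] @ replicate n (i, True) @ ?v))"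
      by (rule RW_central[OF D il]) simp
  qed
  then show "RW n m (W(l := ?u @ filter (VL m l) [(k, True)] @ ?v)) (W(l := ?u @ filter (VL m l) ?c @ ?v))"
    unfolding f by simp
qed

section \<open>Words as permutations of their classes\<close>

definition cls :: "nat \<Rightarrow> nat \<Rightarrow> nat \<Rightarrow> gword \<Rightarrow> gword set" where
  "cls n m l w = {v. weq n m l w v}"

lemma cls_eq_iff: "cls n m l w = cls n m l w' \<longleftrightarrow> weq n m l w w'"
proof
  assume "cls n m l w = cls n m l w'"
  then have "w' \<in> cls n m l w" using weq_refl[of n m l w'] by (simp add: cls_def)
  then show "weq n m l w w'" by (simp add: cls_def)
next
  assume a: "weq n m l w w'"
  show "cls n m l w = cls n m l w'"
    unfolding cls_def using weq_trans[OF weq_sym[OF a]] weq_trans[OF a] by blast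
qed

text \<open>Left multiplication on classes, extended by the identity to sets of words that are not
  classes; this makes it a permutation of the whole type.\<close>

definition act :: "nat \<Rightarrow> nat \<Rightarrow> nat \<Rightarrow> gword \<Rightarrow> gword set \<Rightarrow> gword set" where
  "act n m l w A = (if A \<in> range (cls n m l) then cls n m l (w @ (SOME v. A = cls n m l v)) else A)"

lemma act_cls: "act n m l w (cls n m l v) = cls n m l (w @ v)"
proof -
  have "cls n m l v = cls n m l (SOME u. cls n m l v = cls n m l u)" by (rule someI[of "\<lambda>u. cls n m l v = cls n m l u" v]) simp
  then have "weq n m l v (SOME u. cls n m l v = cls n m l u)" by (simp only: cls_eq_iff)
  from weq_ctx[OF this, of w "[]"]
  have "cls n m l (w @ (SOME u. cls n m l v = cls n m l u)) = cls n m l (w @ v)"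
    unfolding cls_eq_iff[of n m l "w @ _"] append_Nil2 by (rule weq_sym)
  then show ?thesis unfolding act_def if_P[OF rangeI] .
qed

lemma act_append: "act n m l u (act n m l w A) = act n m l (u @ w) A"
proof (cases "A \<in> range (cls n m l)")
  case True
  then obtain v where "A = cls n m l v" by blast
  then show ?thesis by (simp add: act_cls)
qed (simp add: act_def)

lemma act_cong: "weq n m l w w' \<Longrightarrow> act n m l w = act n m l w'"
proof (rule ext)
  fix A assume a: "weq n m l w w'"
  show "act n m l w A = act n m l w' A"
  proof (cases "A \<in> range (cls n m l)")
    case True
    then obtain v where v: "A = cls n m l v" by blast
    have "weq n m l (w @ v) (w' @ v)" using weq_ctx[OF a, of "[]" v] by simp
    then show ?thesis unfolding v act_cls by (simp only: cls_eq_iff)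
  qed (simp add: act_def)
qed

lemma act_Nil: "act n m l [] = id"
proof (rule ext)
  fix A show "act n m l [] A = id A"
  proof (cases "A \<in> range (cls n m l)")
    case True
    then obtain v where "A = cls n m l v" by blast
    then show ?thesis by (simp add: act_cls)
  qed (simp add: act_def)
qed

lemma act_winv: "l < m \<Longrightarrow> act n m l w (act n m l (winv w) A) = A"
  unfolding act_append using act_cong[OF weq_winv[of l m n w]] act_Nil[of n m l] by simp

lemma bij_act: "l < m \<Longrightarrow> bij (act n m l w)"
proof (rule bijI')
  fix A B assume l: "l < m"
  have w: "act n m l (winv w) (act n m l w C) = C" for C using act_winv[OF l, of n "winv w"] by simp
  show "(act n m l w A = act n m l w B) = (A = B)" using w by metis
next
  fix B assume l: "l < m"
  show "\<exists>A. B = act n m l w A" using act_winv[OF l, of n w B] by metis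
qed

definition gen :: "nat \<Rightarrow> nat \<Rightarrow> nat \<Rightarrow> nat \<Rightarrow> gword set sym" where
  "gen n m l j = Abs_sym (act n m l [(j, True)])"

lemma ap_plus: "ap (f + g) = ap f \<circ> ap g"
  unfolding plus_sym_def by (rule ap_Abs) (simp add: bij_comp)

lemma ap_zero: "ap 0 = id"
  unfolding zero_sym_def by (rule ap_Abs) simp

lemma ap_ev:
  assumes l: "l < m"
  shows "ap (ev (gen n m l) w) = act n m l w"
proof (induction w)
  case Nil
  then show ?case by (simp add: ap_zero act_Nil)
next
  case (Cons x w)
  have pos: "ap (gen n m l j) = act n m l [(j, True)]" for j unfolding gen_def by (rule ap_Abs[OF bij_act[OF l]])
  have neg: "- gen n m l j = Abs_sym (act n m l [(j, False)])" for j
  proof (rule minus_unique)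
    have "ap (gen n m l j + Abs_sym (act n m l [(j, False)])) = ap 0"
      unfolding ap_plus pos ap_Abs[OF bij_act[OF l]] ap_zero
      using act_winv[OF l, of n "[(j, True)]"] by (simp add: fun_eq_iff)
    then show "gen n m l j + Abs_sym (act n m l [(j, False)]) = 0" by (simp only: ap_inject)
  qed
  have "ap (gval (gen n m l) x) = act n m l [x]"
  proof (cases x)
    case (Pair j b)
    then show ?thesis by (cases b) (simp_all add: gval_def pos neg ap_Abs[OF bij_act[OF l]])
  qed
  then show ?case using Cons by (simp add: ap_plus fun_eq_iff act_append)
qed

text \<open>The action is faithful: the class of the empty word is sent to the class of the acting
  word.\<close>

lemma ev_eq_iff:
  assumes "l < m"
  shows "ev (gen n m l) w = ev (gen n m l) w' \<longleftrightarrow> weq n m l w w'"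
proof
  assume "ev (gen n m l) w = ev (gen n m l) w'"
  then have "act n m l w = act n m l w'" using ap_ev[OF assms] by metis
  then have "act n m l w (cls n m l []) = act n m l w' (cls n m l [])" by simp
  then show "weq n m l w w'" by (simp add: act_cls cls_eq_iff)
next
  assume "weq n m l w w'"
  then have "act n m l w = act n m l w'" by (rule act_cong)
  then have "ap (ev (gen n m l) w) = ap (ev (gen n m l) w')" by (simp only: ap_ev[OF assms])
  then show "ev (gen n m l) w = ev (gen n m l) w'" by (simp only: ap_inject)
qed

lemma ev_replicate: "ev x (replicate k (i, True)) = nmul k (x i)"
  by (induction k) (simp_all add: gval_def)

lemma ev_replicate': "ev x (replicate k (i, False)) = - nmul k (x i)"
  using ev_winv[of x "replicate k (i, True)"] by (simp add: winv_replicate ev_replicate)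

text \<open>The two axioms are \<open>weq_selfcomm\<close> and \<open>weq_central\<close>, read as
  fixed points of conjugation. Strand l is excluded because letters l are ignored in words on strand
  l.\<close>

lemma reduced_group_gen:
  assumes l: "l < m"
  shows "reduced_group (gen n m l) ({..<m} - {l}) n"
proof
  fix i :: nat and g :: gword assume i: "i \<in> {..<m} - {l}" and g: "fst ` set g \<subseteq> {..<m} - {l} - {i}"
  let ?x = "gen n m l" and ?c = "winv g @ [(i, True)] @ g"
  have "weq n m l [(i, True)] (winv g @ [(i, False)] @ g @ [(i, True)] @ winv g @ [(i, True)] @ g)"
  proof (rule weq_selfcomm)
    fix x assume "x \<in> set g"
    then have "fst x \<in> {..<m} - {l} - {i}" using g by blast
    then show "fst x < m \<and> fst x \<noteq> i \<and> fst x \<noteq> l" by simp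
  qed (use i l in auto)
  then have "ev ?x [(i, True)] = ev ?x (winv ?c @ [(i, True)] @ ?c)"
    unfolding ev_eq_iff[OF l] by simp
  then have "?x i = - ev ?x ?c + (?x i + ev ?x ?c)"
    by (simp only: ev_simps(3) ev_winv) (simp add: gval_def)
  then have "conjg (?x i) (ev ?x ?c) = ?x i" by (simp only: conjg_def)
  then have "cm (?x i) (ev ?x ?c)" by (simp only: conjg_eq_self_iff)
  moreover have "ev ?x ?c = conjg (?x i) (ev ?x g)"
    by (simp add: conjg_def ev_winv gval_def)
  ultimately show "cm (?x i) (conjg (?x i) (ev ?x g))" by simp
next
  fix i k assume i: "i \<in> {..<m} - {l}" and k: "k \<in> {..<m} - {l}"
  let ?x = "gen n m l"
  show "cm (nmul n (?x i)) (?x k)"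
  proof (cases "i = k")
    case True
    then show ?thesis using cm_nmul[OF cm_refl] by blast
  next
    case False
    have "weq n m l [(k, True)] (replicate n (i, False) @ [(k, True)] @ replicate n (i, True))"
      by (rule weq_central) (use i k l False in auto)
    then have "ev ?x [(k, True)] = ev ?x (replicate n (i, False) @ [(k, True)] @ replicate n (i, True))"
      unfolding ev_eq_iff[OF l] .
    then have "?x k = - nmul n (?x i) + (?x k + nmul n (?x i))"
      by (simp only: ev_simps(3) ev_replicate ev_replicate') (simp add: gval_def)
    then have "conjg (?x k) (nmul n (?x i)) = ?x k" by (simp only: conjg_def)
    then show ?thesis unfolding conjg_eq_self_iff by (rule cm_sym)
  qed
qed

lemma weq_of_magnus:
  assumes l: "l < m" and w: "\<And>x. x \<in> set w \<Longrightarrow> fst x < m \<and> fst x \<noteq> l" "\<And>x. x \<in> set w' \<Longrightarrow> fst x < m \<and> fst x \<noteq> l"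
    and single: "\<And>i. coef (magnus w) [i] = coef (magnus w') [i]"
    and all: "\<And>p. distinct p \<Longrightarrow> int n dvd coef (magnus w) p - coef (magnus w') p"
  shows "weq n m l w w'"
proof -
  interpret reduced_group "gen n m l" "{..<m} - {l}" n by (rule reduced_group_gen[OF l])
  have "ev (gen n m l) w = ev (gen n m l) w'"
  proof (rule ev_eqI[of "{..<m} - {l}"])
    show "fst ` set w \<subseteq> {..<m} - {l}" using w(1) by (auto simp: image_subset_iff)
    show "fst ` set w' \<subseteq> {..<m} - {l}" using w(2) by (auto simp: image_subset_iff)
  qed (use single all in simp_all)
  then show ?thesis by (simp only: ev_eq_iff[OF l])
qed

section \<open>Classification\<close>

definition selfless :: "nat \<Rightarrow> (nat \<Rightarrow> gword) \<Rightarrow> bool" where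
  "selfless m W \<longleftrightarrow> (\<forall>c<m. \<forall>x\<in>set (W c). fst x < m \<and> fst x \<noteq> c)"

text \<open>Strands are treated one at a time; \<open>weq\<close> permits any words on the others,
  in particular the partly replaced tuples ?V k.\<close>

lemma RW_rows:
  assumes W: "selfless m W" "selfless m W'" and e: "\<And>c. c < m \<Longrightarrow> weq n m c (W c) (W' c)"
  shows "RW n m W (\<lambda>c. if c < m then W' c else W c)"
proof -
  let ?V = "\<lambda>k c. if c < k then W' c else W c"
  have v: "validW m (?V k)" for k using W unfolding selfless_def validW_def by auto
  have "RW n m W (?V k)" if "k \<le> m" for k
    using that
  proof (induction k)
    case 0
    then show ?case using RW_refl by simp
  next
    case (Suc k)
    have k: "k < m" using Suc.prems by simp
    have f: "filter (VL m k) (W k) = W k" by (rule filter_VL) (use W(1) k in \<open>simp add: selfless_def\<close>)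
    have f': "filter (VL m k) (W' k) = W' k" by (rule filter_VL) (use W(2) k in \<open>simp add: selfless_def\<close>)
    from weqD[OF e[OF k] v[of k], of "[]" "[]"]
    have "RW n m ((?V k)(k := W k)) ((?V k)(k := W' k))" by (simp add: f f')
    moreover have "(?V k)(k := W k) = ?V k" "(?V k)(k := W' k) = ?V (Suc k)" by (auto simp: fun_eq_iff less_Suc_eq)
    ultimately have "RW n m (?V k) (?V (Suc k))" by (simp only:)
    then show ?case using RW_trans[OF v[of k] Suc.IH] Suc.prems by simp
  qed
  from this[of m] show ?thesis by simp
qed

lemma magnus_twist:
  "magnus (replicate k (j, \<sigma>) @ w) = (1 + of_nat k * sgz \<sigma> (X j)) * magnus w"
proof -
  have sq: "sgz \<sigma> (X j) * (of_nat k * sgz \<sigma> (X j)) = 0" for k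
  proof -
    have "X j * (of_nat k * X j) = 0" by (rule X_mult_X)
    then show ?thesis by (simp add: sgz_def)
  qed
  have "magnus (replicate k (j, \<sigma>)) = 1 + of_nat k * sgz \<sigma> (X j)"
  proof (induction k)
    case (Suc k)
    have "magnus (replicate (Suc k) (j, \<sigma>)) = (1 + sgz \<sigma> (X j)) * (1 + of_nat k * sgz \<sigma> (X j))"
      using Suc by (simp add: lval_def sgz_def)
    also have "\<dots> = 1 + of_nat k * sgz \<sigma> (X j) + sgz \<sigma> (X j)" using sq[of k] by (simp add: distrib_left distrib_right)
    also have "\<dots> = 1 + of_nat (Suc k) * sgz \<sigma> (X j)" by (simp add: distrib_right)
    finally show ?case .
  qed simp
  then show ?thesis by simp
qed

lemma magnus_twist_single:
  "coef (magnus (replicate k (j, \<sigma>) @ w)) [q] = coef (magnus w) [q] + (if q = j then (if \<sigma> then int k else - int k) else 0)"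
  unfolding magnus_twist
  by (simp add: coef_mult coef_of_nat_mult coef_one sgz_def coef_X)

text \<open>The n-th power put in front by a 2n-move expands to 1 + n X up to sign, so a twist keeps
  all coefficients modulo n and can be used freely to adjust the linear ones.\<close>

lemma magnus_twist_mod: "cg (int k) (\<lambda>p. True) (magnus (replicate k (j, \<sigma>) @ w)) (magnus w)"
proof -
  have "cg (int k) (\<lambda>p. True) (1 + of_nat k * sgz \<sigma> (X j)) 1" by (simp add: cg_def coef_of_nat_mult)
  from cg_mult[OF infixcl_True this cg_refl[of _ _ "magnus w"]] show ?thesis unfolding magnus_twist by simp
qed

text \<open>Conditions (i) and (ii) for words. The second is rearranged so that it compares defects:
  on a pair of strands both linking numbers are off by the same amount, hence one 2n-move corrects
  both.\<close>

definition good :: "nat \<Rightarrow> nat \<Rightarrow> (nat \<Rightarrow> gword) \<Rightarrow> (nat \<Rightarrow> gword) \<Rightarrow> bool" where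
  "good n m W W' \<longleftrightarrow> (\<forall>c<m. \<forall>p. distinct p \<longrightarrow> c \<notin> set p \<longrightarrow> int n dvd coef (magnus (W c)) p - coef (magnus (W' c)) p) \<and>
     (\<forall>c<m. \<forall>j<m. c \<noteq> j \<longrightarrow> coef (magnus (W c)) [j] - coef (magnus (W' c)) [j] = coef (magnus (W j)) [c] - coef (magnus (W' j)) [c])"

lemma selfless_coef0:
  assumes "selfless m W" "c < m" "distinct p" "c \<in> set p \<or> \<not> set p \<subseteq> {..<m}"
  shows "coef (magnus (W c)) p = 0"
proof (rule coef_magnus_support[OF assms(3)])
  have "fst ` set (W c) \<subseteq> {..<m} - {c}" using assms(1,2) unfolding selfless_def by auto
  then show "\<not> set p \<subseteq> fst ` set (W c)" using assms(4) by blast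
qed

text \<open>The measure is the total defect of the linear coefficients. As long as it is positive, a
  2n-move on a pair with nonzero defect lowers it; once it is zero, the words are equal in the group
  of each strand by \<open>weq_of_magnus\<close>.\<close>

lemma classify:
  assumes n: "0 < n" and W': "srep m D' W'" "selfless m W'"
  shows "srep m D W \<Longrightarrow> selfless m W \<Longrightarrow> good n m W W' \<Longrightarrow> DE n m D D'"
proof (induction "\<Sum>(i, j)\<in>{..<m} \<times> {..<m}. nat \<bar>coef (magnus (W i)) [j] - coef (magnus (W' i)) [j]\<bar>" arbitrary: W D rule: less_induct)
  case less
  let ?d = "\<lambda>W i j. coef (magnus (W i)) [j] - coef (magnus (W' i)) [j]"
  show ?case
  proof (cases "\<forall>i<m. \<forall>j<m. ?d W i j = 0")
    case True
    have "weq n m c (W c) (W' c)" if c: "c < m" for c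
    proof (rule weq_of_magnus[OF c])
      show "fst x < m \<and> fst x \<noteq> c" if "x \<in> set (W c)" for x using less.prems(2) c that unfolding selfless_def by blast
      show "fst x < m \<and> fst x \<noteq> c" if "x \<in> set (W' c)" for x using W'(2) c that unfolding selfless_def by blast
      show "coef (magnus (W c)) [i] = coef (magnus (W' c)) [i]" for i
      proof (cases "i < m")
        case i: True
        then have "?d W c i = 0" using True c by blast
        then show ?thesis by simp
      next
        case False
        then show ?thesis using selfless_coef0[OF less.prems(2) c, of "[i]"] selfless_coef0[OF W'(2) c, of "[i]"] by simp
      qed
      show "int n dvd coef (magnus (W c)) p - coef (magnus (W' c)) p" if p: "distinct p" for p
      proof (cases "c \<in> set p")
        case True
        then show ?thesis using selfless_coef0[OF less.prems(2) c p] selfless_coef0[OF W'(2) c p] by simp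
      next
        case False
        then show ?thesis using less.prems(3) c p unfolding good_def by blast
      qed
    qed
    then have r: "RW n m W (\<lambda>c. if c < m then W' c else W c)" by (intro RW_rows less.prems W')
    have "srep m D' (\<lambda>c. if c < m then W' c else W c)" by (rule srep_cong[OF W'(1)]) simp
    then show ?thesis using r less.prems(1) unfolding RW_def by blast
  next
    case False
    then obtain i j where ij: "i < m" "j < m" "?d W i j \<noteq> 0" by blast
    have inej: "i \<noteq> j"
    proof
      assume "i = j"
      then have "?d W i j = 0" using selfless_coef0[OF less.prems(2) ij(1), of "[j]"] selfless_coef0[OF W'(2) ij(1), of "[j]"] by simp
      then show False using ij by simp
    qed
    define d where "d = ?d W i j"
    have dj: "?d W j i = d" using less.prems(3) ij inej unfolding good_def d_def by metis
    \<comment> \<open>The defect is a multiple of n by the congruence for the one-letter monomial;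
      being nonzero it has absolute value at least n.\<close>
    have nd: "int n dvd d" using less.prems(3) ij inej unfolding good_def d_def by (metis distinct_singleton empty_iff insert_iff list.set(1) list.set(2))
    have dn: "int n \<le> \<bar>d\<bar>" using dvd_imp_le_int[OF _ nd] ij(3) unfolding d_def by simp
    \<comment> \<open>The twist adds n to both coefficients for a positive sign and subtracts n
      otherwise; the sign is chosen against the defect.\<close>
    define \<sigma> where "\<sigma> = (d < 0)"
    define W2 where "W2 = W(i := replicate n (j, \<sigma>) @ W i, j := replicate n (i, \<sigma>) @ W j)"
    obtain D2 where D2: "DE n m D D2" "srep m D2 W2"
      using twist_srep[OF less.prems(1) ij(1,2) inej, of n \<sigma>] unfolding W2_def by blast
    have s2: "selfless m W2" using less.prems(2) ij inej unfolding selfless_def W2_def by auto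
    let ?\<delta> = "if \<sigma> then int n else - int n"
    have W2s: "coef (magnus (W2 a)) [b] = coef (magnus (W a)) [b] + (if (a = i \<and> b = j) \<or> (a = j \<and> b = i) then ?\<delta> else 0)" for a b
      using inej unfolding W2_def by (auto simp: magnus_twist_single simp del: magnus_simps)
    have W2m: "cg (int n) (\<lambda>p. True) (magnus (W2 a)) (magnus (W a))" for a
      using inej magnus_twist_mod[of n j \<sigma> "W i"] magnus_twist_mod[of n i \<sigma> "W j"] unfolding W2_def by (auto simp del: magnus_simps)
    have g2: "good n m W2 W'" unfolding good_def
    proof (intro conjI allI impI)
      fix c p assume c: "c < m" and p: "distinct p" "c \<notin> set p"
      have "int n dvd coef (magnus (W2 c)) p - coef (magnus (W c)) p" using W2m[of c] p unfolding cg_def by blast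
      moreover have "int n dvd coef (magnus (W c)) p - coef (magnus (W' c)) p" using less.prems(3) c p unfolding good_def by blast
      ultimately have "int n dvd (coef (magnus (W2 c)) p - coef (magnus (W c)) p) + (coef (magnus (W c)) p - coef (magnus (W' c)) p)" by (rule dvd_add)
      then show "int n dvd coef (magnus (W2 c)) p - coef (magnus (W' c)) p" by simp
    next
      fix a b assume ab: "a < m" "b < m" "a \<noteq> b"
      have "?d W a b = ?d W b a" using less.prems(3) ab unfolding good_def by blast
      moreover have "((a = i \<and> b = j) \<or> (a = j \<and> b = i)) = ((b = i \<and> a = j) \<or> (b = j \<and> a = i))" by blast
      ultimately show "?d W2 a b = ?d W2 b a" unfolding W2s by (simp only:)
    qed
    have small: "\<bar>d + ?\<delta>\<bar> < \<bar>d\<bar>" using dn n ij(3) unfolding \<sigma>_def d_def by (auto split: if_splits)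
    have "(\<Sum>(i, j)\<in>{..<m} \<times> {..<m}. nat \<bar>?d W2 i j\<bar>) < (\<Sum>(i, j)\<in>{..<m} \<times> {..<m}. nat \<bar>?d W i j\<bar>)"
    proof (rule sum_strict_mono_ex1)
      show "\<forall>x\<in>{..<m} \<times> {..<m}. (case x of (i, j) \<Rightarrow> nat \<bar>?d W2 i j\<bar>) \<le> (case x of (i, j) \<Rightarrow> nat \<bar>?d W i j\<bar>)"
      proof
        fix x :: "nat \<times> nat"
        obtain a b where x: "x = (a, b)" by (cases x)
        have "\<bar>?d W2 a b\<bar> \<le> \<bar>?d W a b\<bar>"
        proof (cases "(a = i \<and> b = j) \<or> (a = j \<and> b = i)")
          case True
          then have "?d W a b = d" using dj d_def by auto
          then show ?thesis unfolding W2s if_P[OF True] using small by linarith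
        next
          case False
          show ?thesis unfolding W2s if_not_P[OF False] by simp
        qed
        then show "(case x of (i, j) \<Rightarrow> nat \<bar>?d W2 i j\<bar>) \<le> (case x of (i, j) \<Rightarrow> nat \<bar>?d W i j\<bar>)" unfolding x by simp
      qed
      have "?d W2 i j = d + ?\<delta>" unfolding W2s d_def by simp
      then have "\<bar>?d W2 i j\<bar> < \<bar>?d W i j\<bar>" using small unfolding d_def by (simp only:)
      then have "nat \<bar>?d W2 i j\<bar> < nat \<bar>?d W i j\<bar>" by (simp only: nat_less_eq_zless abs_ge_zero)
      then show "\<exists>x\<in>{..<m} \<times> {..<m}. (case x of (i, j) \<Rightarrow> nat \<bar>?d W2 i j\<bar>) < (case x of (i, j) \<Rightarrow> nat \<bar>?d W i j\<bar>)"
        using ij by (intro bexI[of _ "(i, j)"]) auto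
    qed simp
    then have "DE n m D2 D'" by (rule less.hyps[OF _ D2(2) s2 g2])
    then show ?thesis by (rule DE_trans[OF D2(1)])
  qed
qed

text \<open>Absence of self-arrows becomes the absence of the letter c in the word of strand c, as
  the group of words on a strand requires.\<close>

lemma sorted_form:
  assumes "gd_wf m D"
  obtains D1 where "DE n m D D1" "srep m D1 (hw D1)" "selfless m (hw D1)"
proof -
  obtain D1 where D1: "DE n m D D1" "selffree D1" "\<And>c. c < m \<Longrightarrow> rsorted (D1 ! c)" by (rule sort_diagram[OF assms, of n]) (rule that)
  have wf: "gd_wf m D1" using DE_wf[OF D1(1)] by blast
  have len: "length D1 = m" using wf by (simp add: gd_wf_def)
  have sr: "srep m D1 (hw D1)" unfolding srep_def using wf D1(3) by simp
  have "selfless m (hw D1)" unfolding selfless_def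
  proof (intro allI impI ballI)
    fix c x assume c: "c < m" and x: "x \<in> set (hw D1 c)"
    obtain e where e: "e \<in> set (D1 ! c)" "\<not> is_tail e" "x = ltr D1 e" using x by (auto simp: hw_def)
    have ein: "e \<in> set (concat D1)" using row_subset[of c D1 e] e c len by simp
    have "fst x \<noteq> c"
    proof
      assume "fst x = c"
      then have "EP (lab e) True (psgn e) \<in> set (D1 ! c)" using trow_in(2)[OF wf ein] e(3) by (simp add: ltr_def)
      moreover have "EP (lab e) False (psgn e) = e" using e(2) by (cases e) simp
      then have "EP (lab e) False (psgn e) \<in> set (D1 ! c)" using e(1) by (simp only:)
      ultimately show False using D1(2) c len unfolding selffree_def by blast
    qed
    then show "fst x < m \<and> fst x \<noteq> c" using srep_labels[OF sr c x] by simp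
  qed
  then show ?thesis using that D1(1) sr by blast
qed

theorem theorem1p2:
  fixes n m :: nat and D D' :: gdiag
  assumes "0 < n" and "gd_wf m D" and "gd_wf m D'"
  shows "twon_sv_equiv n m D D' \<longleftrightarrow>
           ((\<forall>I. I \<noteq> [] \<and> set I \<subseteq> {1..m} \<and> distinct I \<longrightarrow>
                  mu D I mod int n = mu D' I mod int n) \<and>
            (\<forall>i j. 1 \<le> i \<and> i < j \<and> j \<le> m \<longrightarrow>
                  mu D [i, j] - mu D [j, i] = mu D' [i, j] - mu D' [j, i]))"
proof -
  note wf = assms(2) and wf' = assms(3)
  have len: "length D = m" "length D' = m" using wf wf' by (auto simp: gd_wf_def)
  obtain T where T: "sol 0 D T" using sol_exists[OF wf] .
  obtain T' where T': "sol 0 D' T'" using sol_exists[OF wf'] .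
  have mu: "mu D (map Suc (p @ [c])) = coef (hol T (D ! c)) p" "mu D' (map Suc (p @ [c])) = coef (hol T' (D' ! c)) p"
    if "distinct p" "set p \<subseteq> {..<m}" "c < m" "c \<notin> set p" for p c
    using mu_eq_coef[OF wf T, of "p @ [c]"] mu_eq_coef[OF wf' T', of "p @ [c]"] that by simp_all
  have mu2: "mu D [Suc i, Suc j] = coef (hol T (D ! j)) [i]" "mu D' [Suc i, Suc j] = coef (hol T' (D' ! j)) [i]"
    if "i < m" "j < m" "i \<noteq> j" for i j
    using mu[of "[i]" j] that by simp_all
  \<comment> \<open>\<open>mu D [i, j]\<close> is read along strand j, hence the exchanged indices
    in \<open>lkd\<close>.\<close>
  have lkm: "mu D [Suc i, Suc j] - mu D [Suc j, Suc i] = lkd T D j i" "mu D' [Suc i, Suc j] - mu D' [Suc j, Suc i] = lkd T' D' j i"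
    if "i < m" "j < m" "i \<noteq> j" for i j
    using mu2[OF that] mu2[of j i] that by (simp_all add: lkd_def)
  show ?thesis
  proof
    assume "twon_sv_equiv n m D D'"
    from equiv_inv[OF this wf] have iv: "inv_eq (int n) D D'" and lk: "lk_eq D D'" by auto
    show "(\<forall>I. I \<noteq> [] \<and> set I \<subseteq> {1..m} \<and> distinct I \<longrightarrow> mu D I mod int n = mu D' I mod int n) \<and>
            (\<forall>i j. 1 \<le> i \<and> i < j \<and> j \<le> m \<longrightarrow> mu D [i, j] - mu D [j, i] = mu D' [i, j] - mu D' [j, i])"
    proof (intro conjI allI impI)
      fix I :: "nat list" assume I: "I \<noteq> [] \<and> set I \<subseteq> {1..m} \<and> distinct I"
      define J where "J = map (\<lambda>i. i - 1) I"
      have "map Suc J = map id I" unfolding J_def map_map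
      proof (rule map_cong[OF refl])
        fix x assume "x \<in> set I"
        then have "1 \<le> x" using I by auto
        then show "(Suc \<circ> (\<lambda>i. i - 1)) x = id x" by simp
      qed
      then have IJ: "I = map Suc J" by simp
      have J: "J \<noteq> []" "distinct J" "set J \<subseteq> {..<m}" using I unfolding IJ by (auto simp: distinct_map subset_iff)
      obtain p c where pc: "J = p @ [c]" using J(1) by (cases J rule: rev_cases) auto
      have h: "distinct p" "set p \<subseteq> {..<m}" "c < m" "c \<notin> set p" using J pc by auto
      have "int n dvd coef (hol T (D ! c)) p - coef (hol T' (D' ! c)) p"
        using inv_eqD[OF iv T T', of c] h len unfolding cg_def by simp
      then show "mu D I mod int n = mu D' I mod int n"
        unfolding IJ pc mu[OF h] by (simp only: mod_eq_dvd_iff)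
    next
      fix i j assume ij: "1 \<le> i \<and> i < j \<and> j \<le> m"
      obtain i' j' where e: "i = Suc i'" "j = Suc j'" "i' < m" "j' < m" "i' \<noteq> j'" using ij by (cases i; cases j) auto
      have "lkd T D j' i' = lkd T' D' j' i'" using lk T T' e len unfolding lk_eq_def by metis
      then show "mu D [i, j] - mu D [j, i] = mu D' [i, j] - mu D' [j, i]" unfolding e(1,2) lkm[OF e(3-5)] .
    qed
  next
    assume R: "(\<forall>I. I \<noteq> [] \<and> set I \<subseteq> {1..m} \<and> distinct I \<longrightarrow> mu D I mod int n = mu D' I mod int n) \<and>
            (\<forall>i j. 1 \<le> i \<and> i < j \<and> j \<le> m \<longrightarrow> mu D [i, j] - mu D [j, i] = mu D' [i, j] - mu D' [j, i])"
    obtain D1 where D1: "DE n m D D1" "srep m D1 (hw D1)" "selfless m (hw D1)" by (rule sorted_form[OF wf, of n])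
    obtain D2 where D2: "DE n m D' D2" "srep m D2 (hw D2)" "selfless m (hw D2)" by (rule sorted_form[OF wf', of n])
    let ?W = "hw D1" and ?W' = "hw D2"
    obtain T1 where T1: "sol 0 D1 T1" using sol_exists[OF srepD(1)[OF D1(2)]] .
    obtain T2 where T2: "sol 0 D2 T2" using sol_exists[OF srepD(1)[OF D2(2)]] .
    have h1: "hol T1 (D1 ! c) = magnus (?W c)" if "c < m" for c by (rule sorted_hol[OF D1(2) T1 that])
    have h2: "hol T2 (D2 ! c) = magnus (?W' c)" if "c < m" for c by (rule sorted_hol[OF D2(2) T2 that])
    have i1: "inv_eq (int n) D D1" "lk_eq D D1" using equiv_inv[OF _ wf, of n D1] D1(1) by (auto simp: DE_def)
    have i2: "inv_eq (int n) D' D2" "lk_eq D' D2" using equiv_inv[OF _ wf', of n D2] D2(1) by (auto simp: DE_def)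
    have "good n m ?W ?W'" unfolding good_def
    proof (intro conjI allI impI)
      fix c p assume c: "c < m" and p: "distinct p" "c \<notin> set p"
      show "int n dvd coef (magnus (?W c)) p - coef (magnus (?W' c)) p"
      proof (cases "set p \<subseteq> {..<m}")
        \<comment> \<open>A monomial with a variable that is no strand occurs in neither expansion,
          and the hypothesis (i) does not speak about it.\<close>
        case False
        then show ?thesis using selfless_coef0[OF D1(3) c p(1)] selfless_coef0[OF D2(3) c p(1)] by simp
      next
        case True
        have a: "int n dvd coef (hol T (D ! c)) p - coef (magnus (?W c)) p"
          using inv_eqD[OF i1(1) T T1, of c] c len p h1[OF c] unfolding cg_def by simp
        have b: "int n dvd coef (hol T' (D' ! c)) p - coef (magnus (?W' c)) p"
          using inv_eqD[OF i2(1) T' T2, of c] c len p h2[OF c] unfolding cg_def by simp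
        let ?I = "map Suc (p @ [c])"
        have "?I \<noteq> []" "set ?I \<subseteq> {1..m}" "distinct ?I" using True c p by (auto simp: distinct_map)
        then have "mu D ?I mod int n = mu D' ?I mod int n" using R by blast
        then have m: "int n dvd coef (hol T (D ! c)) p - coef (hol T' (D' ! c)) p"
          unfolding mu[OF p(1) True c p(2)] by (simp only: mod_eq_dvd_iff)
        \<comment> \<open>Telescoping through the two original diagrams: sorting preserves each
          coefficient modulo n, and the hypothesis compares the originals.\<close>
        have "coef (magnus (?W c)) p - coef (magnus (?W' c)) p = (coef (hol T (D ! c)) p - coef (hol T' (D' ! c)) p)
            - (coef (hol T (D ! c)) p - coef (magnus (?W c)) p) + (coef (hol T' (D' ! c)) p - coef (magnus (?W' c)) p)" by simp
        moreover have "int n dvd (coef (hol T (D ! c)) p - coef (hol T' (D' ! c)) p)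
            - (coef (hol T (D ! c)) p - coef (magnus (?W c)) p) + (coef (hol T' (D' ! c)) p - coef (magnus (?W' c)) p)"
          by (rule dvd_add[OF dvd_diff[OF m a] b])
        ultimately show ?thesis by (simp only:)
      qed
    next
      fix c j assume cj: "c < m" "j < m" "c \<noteq> j"
      \<comment> \<open>The hypothesis covers ordered pairs only; \<open>lkd\<close> is
        antisymmetric in c and j.\<close>
      have e: "lkd T D c j = lkd T' D' c j"
      proof (cases "j < c")
        case True
        have "mu D [Suc j, Suc c] - mu D [Suc c, Suc j] = mu D' [Suc j, Suc c] - mu D' [Suc c, Suc j]"
          using R cj True by simp
        then show ?thesis unfolding lkm[OF cj(2,1) not_sym[OF cj(3)]] .
      next
        case False
        have "mu D [Suc c, Suc j] - mu D [Suc j, Suc c] = mu D' [Suc c, Suc j] - mu D' [Suc j, Suc c]"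
          using R cj False by simp
        then have "lkd T D j c = lkd T' D' j c" unfolding lkm[OF cj] .
        then show ?thesis by (simp add: lkd_def)
      qed
      have l1: "lkd T D c j = lkd T1 D1 c j" using i1(2) T T1 cj len unfolding lk_eq_def by metis
      have l2: "lkd T' D' c j = lkd T2 D2 c j" using i2(2) T' T2 cj len unfolding lk_eq_def by metis
      have "lkd T1 D1 c j = lkd T2 D2 c j" using e l1 l2 by simp
      then show "coef (magnus (?W c)) [j] - coef (magnus (?W' c)) [j] = coef (magnus (?W j)) [c] - coef (magnus (?W' j)) [c]"
        unfolding lkd_def h1[OF cj(1)] h1[OF cj(2)] h2[OF cj(1)] h2[OF cj(2)] by simp
    qed
    then have "DE n m D1 D2" by (rule classify[OF assms(1) D2(2,3) D1(2,3)])
    then have "DE n m D D'" using DE_trans[OF D1(1) DE_trans[OF _ DE_sym[OF D2(1)]]] by blast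
    then show "twon_sv_equiv n m D D'" by (simp add: DE_def)
  qed
qed

end
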